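(* Let $(\lambda,\mu)\in\mathcal G$ be a correlated flow of the class $\mathcal G$ (defined in the context), corresponding to some $\delta\in\mathbb H^2(\mathcal F_0)$ independent of $\xi$ and $W$. Let $\phi,\psi,\theta$ be the solutions of the ODEs in the context (with $\theta$ associated with $t\mapsto\mathbb E[\mu_t]$), and set $$\Phi_t=R_t^{-1}(B_t^\top\phi_t+S_t),\quad \Psi_t=R_t^{-1}B_t^\top\psi_t,\quad \Theta_t=R_t^{-1}(B_t^\top\theta_t+r_t),$$ $$M_t=Q_t+\Phi_t^\top R_t\Phi_t-2\Phi_t^\top S_t,\quad N_t=\tilde Q_t+\Psi_t^\top R_t\Phi_t-\Psi_t^\top S_t,\quad G_t=\Psi_t^\top R_t\Psi_t .$$ Let $f(\mu)=(f_t(\mu))_{t\in[0,T]}$ be given by $$\dot f_t(\mu)=(A_t-B_t\Phi_t)f_t(\mu)+B_t\big(\Psi_t(\mu_t-\mathbb E[\mu_t])+R_t^{-1}\delta_t-\Theta_t\big),\qquad f_0(\mu)=0 .$$ Then $(\lambda,\mu)$ is a mean field CCE if and only if $$\begin{aligned} &\int_0^T\Big(\mathbb E[\langle N_t(\mu_t-\mathbb E[\mu_t]),\mu_t-\mathbb E[\mu_t]\rangle]+\tfrac12\big(\mathbb E[\langle G_t\mu_t,\mu_t\rangle]-\langle G_t\mathbb E[\mu_t],\mathbb E[\mu_t]\rangle\big)\\ &\qquad+\tfrac12\mathbb E[\langle R_t^{-1}\delta_t,\delta_t\rangle]-\tfrac12\langle R_t\Theta_t,\Theta_t\rangle\Big)dt+\mathbb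 E[\langle\tilde H(\mu_T-\mathbb E[\mu_T]),\mu_T-\mathbb E[\mu_T]\rangle]\\ \le{}&\int_0^T\Big(\tfrac12\big(\mathbb E[\langle M_t(\mu_t+f_t(\mu)),\mu_t+f_t(\mu)\rangle]-\mathbb E[\langle M_t\mu_t,\mu_t\rangle]\big)+\mathbb E[\langle N_tf_t(\mu),\mathbb E[\mu_t]\rangle]\\ &\qquad+\langle q_t-\Phi_t^\top r_t,\mathbb E[f_t(\mu)]\rangle+\langle B_t^\top(\phi_t+\psi_t)\mathbb E[\mu_t],\Theta_t\rangle-\mathbb E[\langle B_t^\top(\phi_t+\psi_t)\mu_t,R_t^{-1}\delta_t\rangle]\\ &\qquad+\mathbb E[\langle B_t^\top\phi_tf_t(\mu),\Theta_t\rangle]-\mathbb E[\langle r_t,\Theta_t-R_t^{-1}\delta_t\rangle]\Big)dt\\ &+\tfrac12\big(\mathbb E[\langle H(\mu_T+f_T(\mu)),\mu_T+f_T(\mu)\rangle]-\mathbb E[\langle H\mu_T,\mu_T\rangle]\big)+\langle\tilde H\,\mathbb E[f_T(\mu)],\mathbb E[\mu_T]\rangle . \end{aligned}$$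
   Context: Data. Fix $T>0$, $d,k\in\mathbb N$. $\mathcal S^n$ is the set of real symmetric $n\times n$ matrices, ordered by $\ge$ in the positive semidefinite sense; $I_n$ is the identity. Given: $A,\sigma\in L^\infty([0,T];\mathbb R^{d\times d})$, $B\in L^\infty([0,T];\mathbb R^{d\times k})$, $Q,\bar Q,\tilde Q\in L^\infty([0,T];\mathcal S^d)$, $R\in\mathcal C([0,T];\mathcal S^k)$, $H,\bar H,\tilde H\in\mathcal S^d$, $S\in L^\infty([0,T];\mathbb R^{k\times d})$, $L,q\in L^\infty([0,T];\mathbb R^d)$, $r\in L^\infty([0,T];\mathbb R^k)$, with $H,\bar H,\tilde H\ge0$; $Q_t\ge d_1I_d$ and $R_t\ge d_2I_k$ for all $t$, where $d_1\ge0$, $d_2>0$; $\sup_t|S_t|^2<d_1d_2$ if $d_1>0$, and $S\equiv0$ if $d_1=0$. ODEs with bounded measurable coefficients are understood in the integrated (a.e.) sense. Probability. $(\Omega,\mathcal F,\mathbb F=(\mathcal F_t)_{t\in[0,T]},\mathbb P)$ is a complete filtered probability space satisfying the usual conditions, $W$ a $d$-dimensional $\mathbb F$-Brownian motion, $\xi$ an $\mathbb R^d$-valued $\mathcal F_0$-measurable random variable independent of $W$, with law $\nu$ having finite second moment; $\nu_1=\mathbb E[\xi]$. $\mathcal F_0$ supports a uniform random variable independent of $(\xi,W)$. $\mathbb F^1$ is the filtration generated by $\xi$ and $W$ (satisfying the usual conditions). For a filtration $\mathbb G$, $\mathbb H^2(\mathbb G)$ is the set of $\mathbb G$-progressively measurable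 $\mathbb R^k$-valued processes $\alpha$ with $\mathbb E\int_0^T|\alpha_t|^2dt<\infty$; $\mathbb H^2(\mathcal F_0)$ is this set for the constant filtration $\mathcal F_0$. "Independent of $\xi$ and $W$" means independent of the pair $(\xi,W)$. State and payoff. For $\lambda\in\mathbb H^2(\mathbb F)$, $X=X^\lambda$ solves $dX_t=(A_tX_t+B_t\lambda_t)dt+\sigma_tdW_t$, $X_0=\xi$, and $$\begin{aligned}\mathfrak J(\lambda,\mu)=\mathbb E\Big[&\int_0^T\big(\langle L_t,\mu_t\rangle-\tfrac12\langle\bar Q_t\mu_t,\mu_t\rangle-\tfrac12\langle Q_tX_t,X_t\rangle-\langle\tilde Q_tX_t,\mu_t\rangle-\langle q_t,X_t\rangle-\tfrac12\langle R_t\lambda_t,\lambda_t\rangle-\langle S_tX_t,\lambda_t\rangle-\langle r_t,\lambda_t\rangle\big)dt\\&-\tfrac12\langle\bar H\mu_T,\mu_T\rangle-\tfrac12\langle HX_T,X_T\rangle-\langle\tilde HX_T,\mu_T\rangle\Big].\end{aligned}$$ Correlated flow: a pair $(\lambda,\mu)$ with $\lambda\in\mathbb H^2(\mathbb F)$ and $\mu$ an $\mathcal F_0$-measurable $\mathcal C([0,T];\mathbb R^d)$-valued random variable independent of $\xi$ and $W$. Mean field coarse correlated equilibrium (CCE): a correlated flow $(\lambda,\mu)$ such that (i) $\mathfrak J(\lambda,\mu)\ge\mathfrak J(\beta,\mu)$ for every $\beta\in\mathbb H^2(\mathbb F^1)$; (ii) (consistency) $\mu_t=\mathbb E[X^\lambda_t\mid\mu]$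 $\mathbb P$-a.s. for all $t\in[0,T]$. ODEs. $\phi,\psi$ ($d\times d$-matrix valued) and $\theta$ ($\mathbb R^d$-valued) solve $$\dot\phi_t+\phi_tA_t+A_t^\top\phi_t+Q_t-(\phi_tB_t+S_t^\top)R_t^{-1}(B_t^\top\phi_t+S_t)=0,\ \phi_T=H,$$ $$\dot\psi_t+A_t^\top\psi_t+\tilde Q_t-(\phi_tB_t+S_t^\top)R_t^{-1}B_t^\top\psi_t=0,\ \psi_T=\tilde H,$$ $$\dot\theta_t+\psi_t\tfrac{d\mathbb E[\mu_t]}{dt}+A_t^\top\theta_t+q_t-(\phi_tB_t+S_t^\top)R_t^{-1}(B_t^\top\theta_t+r_t)=0,\ \theta_T=0.$$ Class $\mathcal G$: all correlated flows $(\lambda,\mu)$ of the form $$\lambda_t=-R_t^{-1}\big((B_t^\top\phi_t+S_t)X_t+B_t^\top\psi_t\mu_t+\delta_t\big),\qquad \dot\mu_t=\big(A_t-B_tR_t^{-1}(B_t^\top\phi_t+S_t+B_t^\top\psi_t)\big)\mu_t-B_tR_t^{-1}\delta_t,\ \ \mu_0=\nu_1,$$ where $X=X^\lambda$ and $\delta\in\mathbb H^2(\mathcal F_0)$ is independent of $\xi$ and $W$. *)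

theory Defs
  imports "HOL-Probability.Probability"
begin

section \<open>Symmetric matrices and coefficient spaces\<close>

definition psd :: "real^'n^'n \<Rightarrow> bool" where
  "psd P \<longleftrightarrow> transpose P = P \<and> (\<forall>x. 0 \<le> inner (P *v x) x)"

text \<open>Elements of \<open>L\<^sup>\<infinity>([0,T])\<close> are given by an arbitrary Lebesgue measurable representative, so
  every pointwise condition on them is imposed almost everywhere.\<close>

definition Linf :: "real \<Rightarrow> (real \<Rightarrow> 'b::euclidean_space) \<Rightarrow> bool" where
  "Linf T f \<longleftrightarrow> f \<in> borel_measurable (lebesgue_on {0..T}) \<and>
     (\<exists>C. AE t in lebesgue_on {0..T}. norm (f t) \<le> C)"

text \<open>The equation \<open>y' = g\<close> on \<open>[0,T]\<close>, understood in the integrated (a.e.) sense.\<close>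

definition ode_on :: "real \<Rightarrow> (real \<Rightarrow> 'b::euclidean_space) \<Rightarrow> (real \<Rightarrow> 'b) \<Rightarrow> bool" where
  "ode_on T y g \<longleftrightarrow> set_integrable lebesgue {0..T} g \<and>
     (\<forall>t\<in>{0..T}. y t = y 0 + (LINT s:{0..t}|lebesgue. g s))"

section \<open>Path spaces and independence\<close>

text \<open>A process is a function of time and scenario; only its values for times in \<open>[0,T]\<close> matter.\<close>

definition traj :: "real \<Rightarrow> (real \<Rightarrow> 'w \<Rightarrow> 'b) \<Rightarrow> 'w \<Rightarrow> real \<Rightarrow> 'b" where
  "traj T X \<omega> = (\<lambda>t\<in>{0..T}. X t \<omega>)"

text \<open>The Borel \<open>\<sigma>\<close>-algebra of \<open>C([0,T])\<close> with the supremum metric.\<close>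

definition C_borel :: "real \<Rightarrow> (real \<Rightarrow> 'b::euclidean_space) measure" where
  "C_borel T = (let C = cfunspace (top_of_set {0..T}) (euclidean_metric :: 'b metric)
     in sigma (mspace C) {U. openin (mtopology_of C) U})"

abbreviation path_algebra :: "real \<Rightarrow> (real \<Rightarrow> 'b::euclidean_space) measure" where
  "path_algebra T \<equiv> PiM {0..T} (\<lambda>_. borel)"

text \<open>Unlike \<^const>\<open>prob_space.indep_var\<close>, the two random variables may have different types.\<close>

definition indep_rv ::
  "'w measure \<Rightarrow> 'a measure \<Rightarrow> ('w \<Rightarrow> 'a) \<Rightarrow> 'b measure \<Rightarrow> ('w \<Rightarrow> 'b) \<Rightarrow> bool" where
  "indep_rv P M X N Y \<longleftrightarrow> X \<in> measurable P M \<and> Y \<in> measurable P N \<and>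
     prob_space.indep_set P (sets (vimage_algebra (space P) X M))
       (sets (vimage_algebra (space P) Y N))"

definition indep_of_noise ::
  "real \<Rightarrow> 'w measure \<Rightarrow> (real \<Rightarrow> 'w \<Rightarrow> real^'d) \<Rightarrow> ('w \<Rightarrow> real^'d) \<Rightarrow> 'a measure \<Rightarrow> ('w \<Rightarrow> 'a) \<Rightarrow> bool"
  where
  "indep_of_noise T P W \<xi> M X \<longleftrightarrow>
     indep_rv P M X (borel \<Otimes>\<^sub>M path_algebra T) (\<lambda>\<omega>. (\<xi> \<omega>, traj T W \<omega>))"

section \<open>The filtered probability space\<close>

text \<open>Filtrations on \<open>[0,T]\<close> are indexed by all reals (for instance extended by constants), but
  only the \<open>\<sigma>\<close>-algebras with index in \<open>[0,T]\<close> are used.\<close>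

definition usual_conditions :: "real \<Rightarrow> 'w measure \<Rightarrow> (real \<Rightarrow> 'w measure) \<Rightarrow> bool" where
  "usual_conditions T P F \<longleftrightarrow> prob_space P \<and> complete_measure P \<and> filtration (space P) F \<and>
     (\<forall>t\<in>{0..T}. subalgebra P (F t)) \<and> null_sets P \<subseteq> sets (F 0) \<and>
     (\<forall>t\<in>{0..<T}. sets (F t) = (\<Inter>s\<in>{t<..T}. sets (F s)))"

definition brownian_motion ::
  "real \<Rightarrow> 'w measure \<Rightarrow> (real \<Rightarrow> 'w measure) \<Rightarrow> (real \<Rightarrow> 'w \<Rightarrow> real^'d) \<Rightarrow> bool" where
  "brownian_motion T P F W \<longleftrightarrow>
     (\<forall>t\<in>{0..T}. W t \<in> borel_measurable (F t)) \<and>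
     (AE \<omega> in P. W 0 \<omega> = 0) \<and>
     (AE \<omega> in P. continuous_on {0..T} (\<lambda>t. W t \<omega>)) \<and>
     (\<forall>s t. 0 \<le> s \<longrightarrow> s < t \<longrightarrow> t \<le> T \<longrightarrow>
        prob_space.indep_set P (sets (F s))
          (sets (vimage_algebra (space P) (\<lambda>\<omega>. W t \<omega> - W s \<omega>) borel)) \<and>
        distributed P lborel (\<lambda>\<omega>. W t \<omega> - W s \<omega>)
          (\<lambda>x. ennreal (\<Prod>i\<in>UNIV. normal_density 0 (sqrt (t - s)) (x $ i))))"

text \<open>The filtration generated by \<open>\<xi>\<close> and \<open>W\<close>, completed by all null sets and made right-continuous.
  For \<open>t \<ge> T\<close> the intersection is just the completed \<open>\<sigma>\<close>-algebra generated by \<open>\<xi>\<close> and all of \<open>W\<close>.\<close>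

definition gen_filtration ::
  "real \<Rightarrow> 'w measure \<Rightarrow> (real \<Rightarrow> 'w \<Rightarrow> real^'d) \<Rightarrow> ('w \<Rightarrow> real^'d) \<Rightarrow> real \<Rightarrow> 'w measure" where
  "gen_filtration T P W \<xi> t = sigma (space P)
     (\<Inter>s\<in>{t<..}. sigma_sets (space P)
        ({\<xi> -` E \<inter> space P | E. E \<in> sets borel} \<union>
         {W u -` E \<inter> space P | u E. 0 \<le> u \<and> u \<le> T \<and> u \<le> s \<and> E \<in> sets borel} \<union>
         null_sets P))"

definition prog_measurable ::
  "real \<Rightarrow> (real \<Rightarrow> 'w measure) \<Rightarrow> (real \<Rightarrow> 'w \<Rightarrow> 'b::euclidean_space) \<Rightarrow> bool" where
  "prog_measurable T G \<alpha> \<longleftrightarrow> (\<forall>t\<in>{0..T}.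
     (\<lambda>(s, \<omega>). \<alpha> s \<omega>) \<in> borel_measurable (restrict_space borel {0..t} \<Otimes>\<^sub>M G t))"

definition H2 ::
  "real \<Rightarrow> 'w measure \<Rightarrow> (real \<Rightarrow> 'w measure) \<Rightarrow> (real \<Rightarrow> 'w \<Rightarrow> 'b::euclidean_space) set" where
  "H2 T P G = {\<alpha>. prog_measurable T G \<alpha> \<and>
     (\<integral>\<^sup>+\<omega>. (\<integral>\<^sup>+t\<in>{0..T}. ennreal ((norm (\<alpha> t \<omega>))\<^sup>2) \<partial>lebesgue) \<partial>P) < \<infinity>}"

section \<open>Stochastic integral of a deterministic integrand\<close>

text \<open>Step functions with jump times \<open>p 0 \<le> \<dots> \<le> p n\<close> and values \<open>c 0, \<dots>, c (n - 1)\<close>.\<close>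

definition step_fun ::
  "nat \<Rightarrow> (nat \<Rightarrow> real) \<Rightarrow> (nat \<Rightarrow> real^'d^'d) \<Rightarrow> real \<Rightarrow> real^'d^'d" where
  "step_fun n p c s = (\<Sum>i<n. indicator {p i<..p (Suc i)} s *\<^sub>R c i)"

definition step_integral ::
  "(real \<Rightarrow> 'w \<Rightarrow> real^'d) \<Rightarrow> nat \<Rightarrow> (nat \<Rightarrow> real) \<Rightarrow> (nat \<Rightarrow> real^'d^'d) \<Rightarrow> real \<Rightarrow> 'w \<Rightarrow> real^'d"
  where
  "step_integral W n p c t \<omega> =
     (\<Sum>i<n. c i *v (W (min t (p (Suc i))) \<omega> - W (min t (p i)) \<omega>))"

text \<open>\<open>I\<close> is a continuous adapted version of \<open>t \<mapsto> \<integral>\<^bsub>0\<^esub>\<^bsup>t\<^esup> \<sigma> dW\<close>: the \<open>L\<^sup>2(P)\<close>-limit of the integrals of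
  step functions that converge to \<open>\<sigma>\<close> in \<open>L\<^sup>2([0,T])\<close>.\<close>

definition stoch_integral ::
  "real \<Rightarrow> 'w measure \<Rightarrow> (real \<Rightarrow> 'w measure) \<Rightarrow> (real \<Rightarrow> 'w \<Rightarrow> real^'d) \<Rightarrow>
   (real \<Rightarrow> real^'d^'d) \<Rightarrow> (real \<Rightarrow> 'w \<Rightarrow> real^'d) \<Rightarrow> bool" where
  "stoch_integral T P F W \<sigma> I \<longleftrightarrow>
     (\<forall>t\<in>{0..T}. I t \<in> borel_measurable (F t)) \<and>
     (AE \<omega> in P. continuous_on {0..T} (\<lambda>t. I t \<omega>)) \<and>
     (\<exists>n p c. (\<forall>j. 0 \<le> p j 0 \<and> p j (n j) \<le> T \<and> (\<forall>i<n j. p j i \<le> p j (Suc i))) \<and>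
        ((\<lambda>j. \<integral>\<^sup>+s\<in>{0..T}. ennreal ((norm (\<sigma> s - step_fun (n j) (p j) (c j) s))\<^sup>2) \<partial>lebesgue)
           \<longlonglongrightarrow> 0) \<and>
        (\<forall>t\<in>{0..T}.
          (\<lambda>j. \<integral>\<^sup>+\<omega>. ennreal ((norm (I t \<omega> - step_integral W (n j) (p j) (c j) t \<omega>))\<^sup>2) \<partial>P)
           \<longlonglongrightarrow> 0))"

section \<open>State, payoff and equilibria\<close>

definition state_process ::
  "real \<Rightarrow> 'w measure \<Rightarrow> (real \<Rightarrow> 'w measure) \<Rightarrow> (real \<Rightarrow> 'w \<Rightarrow> real^'d) \<Rightarrow> ('w \<Rightarrow> real^'d) \<Rightarrow>
   (real \<Rightarrow> real^'d^'d) \<Rightarrow> (real \<Rightarrow> real^'k^'d) \<Rightarrow> (real \<Rightarrow> real^'d^'d) \<Rightarrow>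
   (real \<Rightarrow> 'w \<Rightarrow> real^'k) \<Rightarrow> (real \<Rightarrow> 'w \<Rightarrow> real^'d) \<Rightarrow> bool" where
  "state_process T P F W \<xi> A B \<sigma> lam X \<longleftrightarrow>
     prog_measurable T F X \<and>
     (AE \<omega> in P. continuous_on {0..T} (\<lambda>t. X t \<omega>)) \<and>
     (\<exists>I. stoch_integral T P F W \<sigma> I \<and>
        (AE \<omega> in P. \<forall>t\<in>{0..T}. X t \<omega> = \<xi> \<omega> +
           (LINT s:{0..t}|lebesgue. A s *v X s \<omega> + B s *v lam s \<omega>) + I t \<omega>))"

text \<open>For \<open>lam\<close> in \<open>H2 T P F\<close> the state equation is linear with bounded coefficients, so it has a
  solution, unique up to indistinguishability, and the choice is immaterial.\<close>

definition state ::
  "real \<Rightarrow> 'w measure \<Rightarrow> (real \<Rightarrow> 'w measure) \<Rightarrow> (real \<Rightarrow> 'w \<Rightarrow> real^'d) \<Rightarrow> ('w \<Rightarrow> real^'d) \<Rightarrow>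
   (real \<Rightarrow> real^'d^'d) \<Rightarrow> (real \<Rightarrow> real^'k^'d) \<Rightarrow> (real \<Rightarrow> real^'d^'d) \<Rightarrow>
   (real \<Rightarrow> 'w \<Rightarrow> real^'k) \<Rightarrow> real \<Rightarrow> 'w \<Rightarrow> real^'d" where
  "state T P F W \<xi> A B \<sigma> lam = (SOME X. state_process T P F W \<xi> A B \<sigma> lam X)"

definition payoff ::
  "real \<Rightarrow> 'w measure \<Rightarrow> (real \<Rightarrow> 'w measure) \<Rightarrow> (real \<Rightarrow> 'w \<Rightarrow> real^'d) \<Rightarrow> ('w \<Rightarrow> real^'d) \<Rightarrow>
   (real \<Rightarrow> real^'d^'d) \<Rightarrow> (real \<Rightarrow> real^'k^'d) \<Rightarrow> (real \<Rightarrow> real^'d^'d) \<Rightarrow>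
   (real \<Rightarrow> real^'d) \<Rightarrow> (real \<Rightarrow> real^'d^'d) \<Rightarrow> (real \<Rightarrow> real^'d^'d) \<Rightarrow> (real \<Rightarrow> real^'d^'d) \<Rightarrow>
   (real \<Rightarrow> real^'d) \<Rightarrow> (real \<Rightarrow> real^'k^'k) \<Rightarrow> (real \<Rightarrow> real^'d^'k) \<Rightarrow> (real \<Rightarrow> real^'k) \<Rightarrow>
   real^'d^'d \<Rightarrow> real^'d^'d \<Rightarrow> real^'d^'d \<Rightarrow>
   (real \<Rightarrow> 'w \<Rightarrow> real^'k) \<Rightarrow> (real \<Rightarrow> 'w \<Rightarrow> real^'d) \<Rightarrow> real" where
  "payoff T P F W \<xi> A B \<sigma> L Qbar Q Qtil q R S r Hbar H Htil lam \<mu> =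
     (let X = state T P F W \<xi> A B \<sigma> lam in
      \<integral>\<omega>. ((LINT t:{0..T}|lebesgue.
               inner (L t) (\<mu> t \<omega>)
               - 1/2 * inner (Qbar t *v \<mu> t \<omega>) (\<mu> t \<omega>)
               - 1/2 * inner (Q t *v X t \<omega>) (X t \<omega>)
               - inner (Qtil t *v X t \<omega>) (\<mu> t \<omega>)
               - inner (q t) (X t \<omega>)
               - 1/2 * inner (R t *v lam t \<omega>) (lam t \<omega>)
               - inner (S t *v X t \<omega>) (lam t \<omega>)
               - inner (r t) (lam t \<omega>))
            - 1/2 * inner (Hbar *v \<mu> T \<omega>) (\<mu> T \<omega>)
            - 1/2 * inner (H *v X T \<omega>) (X T \<omega>)
            - inner (Htil *v X T \<omega>) (\<mu> T \<omega>)) \<partial>P)"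

definition correlated_flow ::
  "real \<Rightarrow> 'w measure \<Rightarrow> (real \<Rightarrow> 'w measure) \<Rightarrow> (real \<Rightarrow> 'w \<Rightarrow> real^'d) \<Rightarrow> ('w \<Rightarrow> real^'d) \<Rightarrow>
   (real \<Rightarrow> 'w \<Rightarrow> real^'k) \<Rightarrow> (real \<Rightarrow> 'w \<Rightarrow> real^'d) \<Rightarrow> bool" where
  "correlated_flow T P F W \<xi> lam \<mu> \<longleftrightarrow>
     lam \<in> H2 T P F \<and>
     traj T \<mu> \<in> measurable (F 0) (C_borel T) \<and>
     indep_of_noise T P W \<xi> (C_borel T) (traj T \<mu>)"

definition mean_field_cce ::
  "real \<Rightarrow> 'w measure \<Rightarrow> (real \<Rightarrow> 'w measure) \<Rightarrow> (real \<Rightarrow> 'w \<Rightarrow> real^'d) \<Rightarrow> ('w \<Rightarrow> real^'d) \<Rightarrow>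
   (real \<Rightarrow> real^'d^'d) \<Rightarrow> (real \<Rightarrow> real^'k^'d) \<Rightarrow> (real \<Rightarrow> real^'d^'d) \<Rightarrow>
   (real \<Rightarrow> real^'d) \<Rightarrow> (real \<Rightarrow> real^'d^'d) \<Rightarrow> (real \<Rightarrow> real^'d^'d) \<Rightarrow> (real \<Rightarrow> real^'d^'d) \<Rightarrow>
   (real \<Rightarrow> real^'d) \<Rightarrow> (real \<Rightarrow> real^'k^'k) \<Rightarrow> (real \<Rightarrow> real^'d^'k) \<Rightarrow> (real \<Rightarrow> real^'k) \<Rightarrow>
   real^'d^'d \<Rightarrow> real^'d^'d \<Rightarrow> real^'d^'d \<Rightarrow>
   (real \<Rightarrow> 'w \<Rightarrow> real^'k) \<Rightarrow> (real \<Rightarrow> 'w \<Rightarrow> real^'d) \<Rightarrow> bool" where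
  "mean_field_cce T P F W \<xi> A B \<sigma> L Qbar Q Qtil q R S r Hbar H Htil lam \<mu> \<longleftrightarrow>
     correlated_flow T P F W \<xi> lam \<mu> \<and>
     (\<forall>\<beta>\<in>H2 T P (gen_filtration T P W \<xi>).
        payoff T P F W \<xi> A B \<sigma> L Qbar Q Qtil q R S r Hbar H Htil lam \<mu> \<ge>
        payoff T P F W \<xi> A B \<sigma> L Qbar Q Qtil q R S r Hbar H Htil \<beta> \<mu>) \<and>
     (\<forall>t\<in>{0..T}. \<forall>i. AE \<omega> in P. \<mu> t \<omega> $ i =
        real_cond_exp P (vimage_algebra (space P) (traj T \<mu>) (C_borel T))
          (\<lambda>\<omega>. state T P F W \<xi> A B \<sigma> lam t \<omega> $ i) \<omega>)"

section \<open>The backward equations and the class of linear feedback flows\<close>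

definition solves_phi ::
  "real \<Rightarrow> (real \<Rightarrow> real^'d^'d) \<Rightarrow> (real \<Rightarrow> real^'k^'d) \<Rightarrow> (real \<Rightarrow> real^'d^'d) \<Rightarrow>
   (real \<Rightarrow> real^'k^'k) \<Rightarrow> (real \<Rightarrow> real^'d^'k) \<Rightarrow> real^'d^'d \<Rightarrow> (real \<Rightarrow> real^'d^'d) \<Rightarrow> bool" where
  "solves_phi T A B Q R S H \<phi> \<longleftrightarrow> \<phi> T = H \<and>
     ode_on T \<phi> (\<lambda>t. - (\<phi> t ** A t + transpose (A t) ** \<phi> t + Q t
       - (\<phi> t ** B t + transpose (S t)) ** matrix_inv (R t) ** (transpose (B t) ** \<phi> t + S t)))"

definition solves_psi ::
  "real \<Rightarrow> (real \<Rightarrow> real^'d^'d) \<Rightarrow> (real \<Rightarrow> real^'k^'d) \<Rightarrow> (real \<Rightarrow> real^'d^'d) \<Rightarrow>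
   (real \<Rightarrow> real^'k^'k) \<Rightarrow> (real \<Rightarrow> real^'d^'k) \<Rightarrow> real^'d^'d \<Rightarrow> (real \<Rightarrow> real^'d^'d) \<Rightarrow>
   (real \<Rightarrow> real^'d^'d) \<Rightarrow> bool" where
  "solves_psi T A B Qtil R S Htil \<phi> \<psi> \<longleftrightarrow> \<psi> T = Htil \<and>
     ode_on T \<psi> (\<lambda>t. - (transpose (A t) ** \<psi> t + Qtil t
       - (\<phi> t ** B t + transpose (S t)) ** matrix_inv (R t) ** transpose (B t) ** \<psi> t))"

text \<open>\<open>m\<close> is the mean flow; it is differentiable almost everywhere.\<close>

definition solves_theta ::
  "real \<Rightarrow> (real \<Rightarrow> real^'d^'d) \<Rightarrow> (real \<Rightarrow> real^'k^'d) \<Rightarrow> (real \<Rightarrow> real^'d) \<Rightarrow>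
   (real \<Rightarrow> real^'k^'k) \<Rightarrow> (real \<Rightarrow> real^'d^'k) \<Rightarrow> (real \<Rightarrow> real^'k) \<Rightarrow>
   (real \<Rightarrow> real^'d^'d) \<Rightarrow> (real \<Rightarrow> real^'d^'d) \<Rightarrow> (real \<Rightarrow> real^'d) \<Rightarrow> (real \<Rightarrow> real^'d) \<Rightarrow> bool" where
  "solves_theta T A B q R S r \<phi> \<psi> m \<theta> \<longleftrightarrow> \<theta> T = 0 \<and>
     ode_on T \<theta> (\<lambda>t. - (\<psi> t *v vector_derivative m (at t within {0..T})
       + transpose (A t) *v \<theta> t + q t
       - ((\<phi> t ** B t + transpose (S t)) ** matrix_inv (R t)) *v (transpose (B t) *v \<theta> t + r t)))"

text \<open>The pair \<open>(lam, \<mu>)\<close> is the member of the class \<open>\<G>\<close> that corresponds to \<open>\<delta>\<close>. Controls are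
  identified up to \<open>dt \<otimes> dP\<close>-null sets.\<close>

definition class_G ::
  "real \<Rightarrow> 'w measure \<Rightarrow> (real \<Rightarrow> 'w measure) \<Rightarrow> (real \<Rightarrow> 'w \<Rightarrow> real^'d) \<Rightarrow> ('w \<Rightarrow> real^'d) \<Rightarrow>
   (real \<Rightarrow> real^'d^'d) \<Rightarrow> (real \<Rightarrow> real^'k^'d) \<Rightarrow> (real \<Rightarrow> real^'d^'d) \<Rightarrow>
   (real \<Rightarrow> real^'k^'k) \<Rightarrow> (real \<Rightarrow> real^'d^'k) \<Rightarrow>
   (real \<Rightarrow> real^'d^'d) \<Rightarrow> (real \<Rightarrow> real^'d^'d) \<Rightarrow>
   (real \<Rightarrow> 'w \<Rightarrow> real^'k) \<Rightarrow> (real \<Rightarrow> 'w \<Rightarrow> real^'k) \<Rightarrow> (real \<Rightarrow> 'w \<Rightarrow> real^'d) \<Rightarrow> bool" where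
  "class_G T P F W \<xi> A B \<sigma> R S \<phi> \<psi> \<delta> lam \<mu> \<longleftrightarrow>
     correlated_flow T P F W \<xi> lam \<mu> \<and>
     \<delta> \<in> H2 T P (\<lambda>_. F 0) \<and>
     indep_of_noise T P W \<xi> (path_algebra T) (traj T \<delta>) \<and>
     (\<exists>X. state_process T P F W \<xi> A B \<sigma> lam X \<and>
        (AE (t, \<omega>) in lebesgue_on {0..T} \<Otimes>\<^sub>M P. lam t \<omega> =
           - (matrix_inv (R t) *v ((transpose (B t) ** \<phi> t + S t) *v X t \<omega>
                + (transpose (B t) ** \<psi> t) *v \<mu> t \<omega> + \<delta> t \<omega>)))) \<and>
     (AE \<omega> in P. \<mu> 0 \<omega> = (\<integral>\<omega>. \<xi> \<omega> \<partial>P) \<and>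
        ode_on T (\<lambda>t. \<mu> t \<omega>) (\<lambda>t.
          (A t - B t ** matrix_inv (R t) ** (transpose (B t) ** \<phi> t + S t + transpose (B t) ** \<psi> t))
             *v \<mu> t \<omega> - (B t ** matrix_inv (R t)) *v \<delta> t \<omega>))"

end

theory Submission
  imports Defs
begin

text \<open>Write \<open>X = \<mu> + Z\<close>. For a flow of the class the fluctuation \<open>Z\<close> solves a linear equation driven by the
  noise only, so it is centred and uncorrelated with \<open>\<mu>\<close> and \<open>\<delta>\<close>; this already gives the consistency
  condition. Given \<open>\<mu>\<close>, a deviating player who observes only the noise faces a linear-quadratic problem in
  which \<open>\<mu>\<close> enters through its mean \<open>m\<close>; by convexity and the adjoint process
  \<open>p = \<phi> X\<^sup>* + \<psi> m + \<theta>\<close> its solution is the feedback \<open>- \<Phi> X\<^sup>* - \<Psi> m - \<Theta>\<close>. The optimal state is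
  \<open>X\<^sup>* = (\<mu> + f) + Z\<close>, where \<open>\<mu> + f\<close> is deterministic. Hence \<open>(lam, \<mu>)\<close> is an equilibrium iff its payoff is at
  least that of this single deviation, and since \<open>X\<close> and \<open>X\<^sup>*\<close> have the same fluctuation \<open>Z\<close>, all terms in \<open>Z\<close>
  cancel in the difference of the two payoffs.\<close>

section \<open>Integral equations in the almost everywhere sense\<close>

text \<open>The coefficients are only Lebesgue measurable in time, so every equation is an integral
  equation and integrands are compared almost everywhere; as the equation of \<open>\<theta>\<close>
  contains the pointwise derivative of \<open>m\<close>, a.e. differentiability of indefinite
  integrals is needed as well. The integrand \<open>\<sigma>\<close> is deterministic, and its
  stochastic integral enters mainly through uniqueness and through orthogonality of its increments.
  The rest is pathwise: a state minus its stochastic integral is absolutely continuous, and the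
  difference of two states contains no noise at all. The delicate point is admissibility of the best
  deviation: it must be progressive for the filtration of \<open>\<xi>\<close> and \<open>W\<close>,
  whereas \<open>X - \<mu>\<close> is only known to be adapted to \<open>F\<close>; an L2 projection
  argument closes this gap. The source terms of \<open>f\<close> are those that cancel
  \<open>\<delta>\<close> and \<open>\<Psi> \<mu>\<close> in the sum \<open>\<mu> + f\<close>. That
  \<open>\<mu>\<close> acts only through \<open>m\<close> holds under expectations: the centred
  \<open>\<mu>\<close> is uncorrelated with the response to any deviation.\<close>

lemma AE_has_vector_derivative_indefinite_integral:
  fixes g :: "real \<Rightarrow> 'b::euclidean_space"
  assumes g: "g integrable_on {a..b}"
  shows "negligible {x \<in> {a..b}. \<not> ((\<lambda>u. integral {a..u} g) has_vector_derivative g x) (at x within {a..b})}"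
proof -
  define G where "G u = integral {a..u} g" for u
  \<comment> \<open>Near a point of \<open>bad e\<close>, arbitrarily short intervals have a
    difference quotient that misses \<open>g x\<close> by more than \<open>e\<close>. A Vitali
    subfamily of such intervals is disjoint and its fivefold enlargements cover
    \<open>bad e\<close>, while Henstock's lemma bounds its total error, which is at least
    \<open>e\<close> times its total length.\<close>
  define bad where "bad e = {x \<in> {a..b}. \<forall>d>0. \<exists>y\<in>{a..b}. y \<noteq> x \<and> \<bar>y - x\<bar> < d \<and>
      norm (G y - G x - (y - x) *\<^sub>R g x) > e * \<bar>y - x\<bar>}" for e
  have neg: "negligible (bad e)" if "e > 0" for e
    unfolding negligible_outer_le
  proof (intro allI impI)
    fix \<eta> :: real assume "\<eta> > 0"
    \<comment> \<open>The 5 is the enlargement factor of the Vitali lemma: a total error below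
      \<open>\<eta> * e / 5\<close> forces a total length below \<open>\<eta> / 5\<close>.\<close>
    then have "\<eta> * e / 5 > 0" using \<open>e > 0\<close> by simp
    from Henstock_lemma[OF g[folded cbox_interval] this] obtain \<gamma> where \<gamma>: "gauge \<gamma>"
      and fine: "\<And>p. \<lbrakk>p tagged_partial_division_of (cbox a b); \<gamma> fine p\<rbrakk> \<Longrightarrow>
        (\<Sum>(x,k)\<in>p. norm (measure lborel k *\<^sub>R g x - integral k g)) < \<eta> * e / 5" by blast
    have "\<exists>y. x \<in> bad e \<longrightarrow> y \<in> {a..b} \<and> y \<noteq> x \<and> norm (G y - G x - (y - x) *\<^sub>R g x) > e * \<bar>y - x\<bar>
        \<and> {min x y..max x y} \<subseteq> \<gamma> x" for x
    proof (cases "x \<in> bad e")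
      case True
      have "open (\<gamma> x)" "x \<in> \<gamma> x" using \<gamma> by (auto simp: gauge_def)
      then obtain d where d: "d > 0" "ball x d \<subseteq> \<gamma> x" using open_contains_ball by blast
      with True obtain y where y: "y \<in> {a..b}" "y \<noteq> x" "\<bar>y - x\<bar> < d" "norm (G y - G x - (y - x) *\<^sub>R g x) > e * \<bar>y - x\<bar>"
        unfolding bad_def by blast
      have "{min x y..max x y} \<subseteq> ball x d" using y(3) by (auto simp: dist_real_def min_def max_def split: if_splits)
      then show ?thesis using y d by blast
    qed auto
    then obtain Y where Y: "\<And>x. x \<in> bad e \<Longrightarrow> Y x \<in> {a..b} \<and> Y x \<noteq> x \<and>
        norm (G (Y x) - G x - (Y x - x) *\<^sub>R g x) > e * \<bar>Y x - x\<bar> \<and> {min x (Y x)..max x (Y x)} \<subseteq> \<gamma> x" by metis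
    \<comment> \<open>The interval between \<open>x\<close> and its witness \<open>Y x\<close>,
      written as a ball for the covering lemma; the tag \<open>x\<close> is an endpoint of it, not
      the centre.\<close>
    define c where "c x = (x + Y x) / 2" for x
    define r where "r x = \<bar>Y x - x\<bar> / 2" for x
    have cball: "cball (c x) (r x) = {min x (Y x)..max x (Y x)}" for x
      unfolding c_def r_def cball_eq_atLeastAtMost by (auto simp: min_def max_def field_simps)
    have "bad e \<subseteq> (\<Union>x\<in>bad e. cball (c x) (r x))" unfolding cball by force
    moreover have "0 < r x \<and> r x \<le> b - a" if "x \<in> bad e" for x
      using Y[OF that] that by (auto simp: r_def bad_def)
    ultimately obtain C where C: "countable C" "C \<subseteq> bad e"
      "pairwise (\<lambda>i j. disjnt (cball (c i) (r i)) (cball (c j) (r j))) C"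
      "bad e \<subseteq> (\<Union>i\<in>C. cball (c i) (5 * r i))"
      by (rule Vitali_covering_lemma_cballs)
    define K where "K x = {min x (Y x)..max x (Y x)}" for x
    \<comment> \<open>A finite subfamily is a tagged partial division, so Henstock's lemma applies
      to it; the bound passes to the countable union afterwards.\<close>
    have bound: "measure lebesgue (\<Union>i\<in>D. cball (c i) (5 * r i)) \<le> \<eta>" if D: "D \<subseteq> C" "finite D" for D
    proof -
      have inj: "inj_on (\<lambda>x. (x, K x)) D" by (auto simp: inj_on_def)
      have p: "(\<lambda>x. (x, K x)) ` D tagged_partial_division_of cbox a b"
        unfolding tagged_partial_division_of_def
      proof (intro conjI allI impI)
        show "finite ((\<lambda>x. (x, K x)) ` D)" using D by simp
        fix x k assume "(x, k) \<in> (\<lambda>x. (x, K x)) ` D"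
        then have x: "x \<in> D" "k = K x" by auto
        then have "x \<in> bad e" using D C by auto
        then show "x \<in> k" "k \<subseteq> cbox a b" "\<exists>a b. k = cbox a b"
          using Y[of x] x by (auto simp: K_def bad_def)
      next
        fix x k x' k' assume "(x, k) \<in> (\<lambda>x. (x, K x)) ` D \<and> (x', k') \<in> (\<lambda>x. (x, K x)) ` D \<and> (x, k) \<noteq> (x', k')"
        then have x: "x \<in> D" "k = K x" and "x' \<in> D" "k' = K x'" "x \<noteq> x'" by auto
        then have "disjnt (K x) (K x')" using C(3) D x unfolding pairwise_def K_def cball by blast
        then have "K x \<inter> K x' = {}" by (simp add: disjnt_def)
        then show "interior k \<inter> interior k' = {}"
          using x \<open>k' = K x'\<close> by (metis interior_Int interior_empty)
      qed
      have "\<gamma> fine ((\<lambda>x. (x, K x)) ` D)"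
        using Y C D unfolding fine_def K_def by auto
      from fine[OF p this] have "(\<Sum>x\<in>D. norm (measure lborel (K x) *\<^sub>R g x - integral (K x) g)) < \<eta> * e / 5"
        by (simp add: sum.reindex[OF inj])
      moreover have "norm (measure lborel (K x) *\<^sub>R g x - integral (K x) g) \<ge> e * (2 * r x)" if "x \<in> D" for x
      proof -
        have b: "x \<in> bad e" using that C D by auto
        then have x: "x \<in> {a..b}" by (auto simp: bad_def)
        note Y = Y[OF b]
        have diff: "integral {u..v} g = G v - G u" if "a \<le> u" "u \<le> v" "v \<le> b" for u v
        proof -
          have "integral {a..u} g + integral {u..v} g = integral {a..v} g"
            using that by (intro Henstock_Kurzweil_Integration.integral_combine
                integrable_on_subinterval[OF g]) auto
          then show ?thesis by (simp add: G_def algebra_simps)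
        qed
        have "norm (measure lborel (K x) *\<^sub>R g x - integral (K x) g) = norm (G (Y x) - G x - (Y x - x) *\<^sub>R g x)"
        proof (cases "x \<le> Y x")
          case True
          have "measure lborel (K x) *\<^sub>R g x - integral (K x) g = - (G (Y x) - G x - (Y x - x) *\<^sub>R g x)"
            using True x Y unfolding K_def by (simp add: diff)
          then show ?thesis by (simp only: norm_minus_cancel)
        next
          case False
          have "measure lborel (K x) *\<^sub>R g x - integral (K x) g = G (Y x) - G x - (Y x - x) *\<^sub>R g x"
            using False x Y unfolding K_def by (simp add: diff algebra_simps)
          then show ?thesis by simp
        qed
        then show ?thesis using Y by (simp add: r_def)
      qed
      ultimately have "(\<Sum>x\<in>D. e * (2 * r x)) < \<eta> * e / 5"
        by (rule le_less_trans[OF sum_mono, rotated])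
      moreover have "e * (\<Sum>x\<in>D. 2 * (5 * r x)) = 5 * (\<Sum>x\<in>D. e * (2 * r x))"
        by (simp add: sum_distrib_left mult_ac)
      ultimately have "e * (\<Sum>x\<in>D. 2 * (5 * r x)) < e * \<eta>"
        by (simp add: field_simps)
      then have "(\<Sum>x\<in>D. 2 * (5 * r x)) \<le> \<eta>" using \<open>e > 0\<close> by simp
      moreover have "measure lebesgue (\<Union>i\<in>D. cball (c i) (5 * r i)) \<le> (\<Sum>i\<in>D. measure lebesgue (cball (c i) (5 * r i)))"
        using D by (intro measure_UNION_le) auto
      moreover have "measure lebesgue (cball (c i) (5 * r i)) = 2 * (5 * r i)" for i
        by (simp add: cball_eq_atLeastAtMost r_def)
      ultimately show ?thesis by simp
    qed
    show "\<exists>T. bad e \<subseteq> T \<and> T \<in> lmeasurable \<and> measure lebesgue T \<le> \<eta>"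
    proof (intro exI conjI)
      show "bad e \<subseteq> (\<Union>i\<in>C. cball (c i) (5 * r i))" by (rule C(4))
      show "(\<Union>i\<in>C. cball (c i) (5 * r i)) \<in> lmeasurable"
        by (rule fmeasurable_UN_bound[OF C(1) _ bound]) auto
      show "measure lebesgue (\<Union>i\<in>C. cball (c i) (5 * r i)) \<le> \<eta>"
        by (rule measure_UN_bound[OF C(1) _ bound]) auto
    qed
  qed
  have "{x \<in> {a..b}. \<not> (G has_vector_derivative g x) (at x within {a..b})} \<subseteq> (\<Union>n. bad (1 / real (Suc n)))"
  proof (clarify)
    fix x assume x: "x \<in> {a..b}" and nd: "\<not> (G has_vector_derivative g x) (at x within {a..b})"
    have "\<exists>n. x \<in> bad (1 / real (Suc n))"
    proof (rule ccontr)
      assume "\<nexists>n. x \<in> bad (1 / real (Suc n))"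
      then have good: "\<exists>d>0. \<forall>y\<in>{a..b}. \<bar>y - x\<bar> < d \<longrightarrow> norm (G y - G x - (y - x) *\<^sub>R g x) \<le> 1 / real (Suc n) * \<bar>y - x\<bar>" for n
      proof -
        have "x \<notin> bad (1 / real (Suc n))" using \<open>\<nexists>n. _ n\<close> by blast
        then obtain d where d: "d > 0" "\<not> (\<exists>y\<in>{a..b}. y \<noteq> x \<and> \<bar>y - x\<bar> < d \<and>
            norm (G y - G x - (y - x) *\<^sub>R g x) > 1 / real (Suc n) * \<bar>y - x\<bar>)"
          using x unfolding bad_def by blast
        have "norm (G y - G x - (y - x) *\<^sub>R g x) \<le> 1 / real (Suc n) * \<bar>y - x\<bar>" if "y \<in> {a..b}" "\<bar>y - x\<bar> < d" for y
          using d(2) that by (cases "y = x") (auto simp del: of_nat_Suc simp: not_less)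
        with d(1) show ?thesis by blast
      qed
      have "(G has_vector_derivative g x) (at x within {a..b})"
        unfolding has_vector_derivative_def has_derivative_within_alt
      proof (intro conjI allI impI)
        show "bounded_linear (\<lambda>h. h *\<^sub>R g x)" by (rule bounded_linear_scaleR_left)
        fix e :: real assume "e > 0"
        then obtain n where n: "1 / real (Suc n) < e" using nat_approx_posE by metis
        from good[of n] obtain d where d: "d > 0"
          "\<And>y. y \<in> {a..b} \<Longrightarrow> \<bar>y - x\<bar> < d \<Longrightarrow> norm (G y - G x - (y - x) *\<^sub>R g x) \<le> 1 / real (Suc n) * \<bar>y - x\<bar>" by blast
        have "norm (G y - G x - (y - x) *\<^sub>R g x) \<le> e * \<bar>y - x\<bar>" if "y \<in> {a..b}" "\<bar>y - x\<bar> < d" for y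
          using d(2)[OF that] mult_right_mono[OF less_imp_le[OF n], of "\<bar>y - x\<bar>"] by linarith
        then show "\<exists>d>0. \<forall>y\<in>{a..b}. norm (y - x) < d \<longrightarrow> norm (G y - G x - (y - x) *\<^sub>R g x) \<le> e * norm (y - x)"
          using d(1) by auto
      qed
      then show False using nd by simp
    qed
    then show "x \<in> (\<Union>n. bad (1 / real (Suc n)))" by blast
  qed
  moreover have "negligible (\<Union>n. bad (1 / real (Suc n)))"
    by (intro negligible_countable_Union) (auto intro: neg)
  ultimately show ?thesis unfolding G_def using negligible_subset by blast
qed

text \<open>The bound for \<open>u t\<close>, multiplied by \<open>exp (- (C * t))\<close>, is
  nonincreasing: its derivative has the sign of \<open>u\<close> minus that bound. At time 0 it
  equals \<open>a\<close>.\<close>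

lemma gronwall:
  fixes u :: "real \<Rightarrow> real"
  assumes cont: "continuous_on {0..T} u" and C: "C \<ge> 0"
    and le: "\<And>t. t \<in> {0..T} \<Longrightarrow> u t \<le> a + C * integral {0..t} u"
    and t: "t \<in> {0..T}"
  shows "u t \<le> a * exp (C * t)"
proof -
  define v where "v s = (a + C * integral {0..s} u) * exp (- (C * s))" for s
  have "v t \<le> v 0"
  proof (rule DERIV_nonpos_imp_decreasing_open[of 0 t v])
    show "0 \<le> t" using t by simp
    show "continuous_on {0..t} v"
      unfolding v_def using cont t
      by (intro continuous_intros indefinite_integral_continuous_1 integrable_continuous_real)
        (auto elim: continuous_on_subset)
    fix x assume x: "0 < x" "x < t"
    have "((\<lambda>s. integral {0..s} u) has_real_derivative u x) (at x within {0..T})"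
      using integral_has_real_derivative[OF cont, of x] x t by auto
    then have "((\<lambda>s. integral {0..s} u) has_real_derivative u x) (at x within {0<..<T})"
      by (rule DERIV_subset) auto
    then have *: "((\<lambda>s. integral {0..s} u) has_real_derivative u x) (at x)"
      using x t by (subst (asm) at_within_open) auto
    have "(v has_real_derivative C * (u x - (a + C * integral {0..x} u)) * exp (- (C * x))) (at x)"
      unfolding v_def by (auto intro!: derivative_eq_intros * simp: algebra_simps)
    moreover have "C * (u x - (a + C * integral {0..x} u)) * exp (- (C * x)) \<le> 0"
      using le[of x] x t C by (intro mult_nonpos_nonneg mult_nonneg_nonpos) auto
    ultimately show "\<exists>y. (v has_real_derivative y) (at x) \<and> y \<le> 0" by blast
  qed
  then have "a + C * integral {0..t} u \<le> a * exp (C * t)"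
    by (simp add: v_def exp_minus field_simps)
  then show ?thesis using le[OF t] by simp
qed

section \<open>Lebesgue integration over a time interval and its initial segments\<close>

lemma borel_measurable_id_lebesgue_on:
  "(\<lambda>x. x) \<in> borel_measurable (lebesgue_on S)"
  by (intro measurable_restrict_space1 measurable_completion) simp

lemma finite_measure_lebesgue_on_Icc: "finite_measure (lebesgue_on {a..b::real})"
  by (rule finite_measure_lebesgue_on) simp

lemma set_integrable_iff_lebesgue_on:
  fixes g :: "real \<Rightarrow> 'b::euclidean_space"
  shows "set_integrable lebesgue {a..b} g \<longleftrightarrow> integrable (lebesgue_on {a..b}) g"
  by (simp add: set_integrable_def integrable_restrict_space)

lemma set_integral_eq_lebesgue_on:
  fixes g :: "real \<Rightarrow> 'b::euclidean_space"
  shows "(LINT s:{a..b}|lebesgue. g s) = integral\<^sup>L (lebesgue_on {a..b}) g"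
  by (simp add: set_lebesgue_integral_def integral_restrict_space)

lemma set_integral_eq_indicator_lebesgue_on:
  fixes g :: "real \<Rightarrow> 'b::euclidean_space"
  assumes "t \<le> b"
  shows "(LINT s:{a..t}|lebesgue. g s) = (\<integral>s. indicator {a..t} s *\<^sub>R g s \<partial>lebesgue_on {a..b})"
proof -
  have *: "indicator {a..b} s *\<^sub>R indicator {a..t} s *\<^sub>R g s = indicator {a..t} s *\<^sub>R g s" for s
    using assms by (auto split: split_indicator)
  show ?thesis by (simp add: set_lebesgue_integral_def integral_restrict_space * del: scaleR_scaleR)
qed

lemma integrable_lebesgue_on_mono:
  fixes g :: "real \<Rightarrow> 'b::euclidean_space"
  assumes "integrable (lebesgue_on {a..b}) g" "t \<le> b"
  shows "integrable (lebesgue_on {a..t}) g"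
  using assms(1) unfolding set_integrable_iff_lebesgue_on[symmetric]
  by (rule set_integrable_subset) (use assms(2) in auto)

lemma AE_lebesgue_on_mono:
  assumes "AE s in lebesgue_on {a..b::real}. Q s" "t \<le> b"
  shows "AE s in lebesgue_on {a..t}. Q s"
  using assms by (auto simp: AE_restrict_space_iff elim!: eventually_mono)

lemma measurable_lebesgue_on_mono:
  assumes "g \<in> borel_measurable (lebesgue_on {a..b::real})" "t \<le> b"
  shows "g \<in> borel_measurable (lebesgue_on {a..t})"
proof -
  have "lebesgue_on {a..t} = restrict_space (lebesgue_on {a..b}) {a..t}"
    using assms(2) by (simp add: restrict_restrict_space Int_absorb1)
  then show ?thesis using measurable_restrict_space1[OF assms(1), of "{a..t}"] by simp
qed

lemma integral_lebesgue_on_HK: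
  fixes g :: "real \<Rightarrow> 'b::euclidean_space"
  assumes "integrable (lebesgue_on {a..b}) g"
  shows "g integrable_on {a..b}" "integral\<^sup>L (lebesgue_on {a..b}) g = integral {a..b} g"
  using set_lebesgue_integral_eq_integral[of "{a..b}" g] assms
  by (auto simp: set_integrable_iff_lebesgue_on set_integral_eq_lebesgue_on)

lemma continuous_on_integrable_lebesgue_on:
  fixes g :: "real \<Rightarrow> 'b::euclidean_space"
  assumes "continuous_on {a..b} g"
  shows "integrable (lebesgue_on {a..b}) g"
  unfolding set_integrable_iff_lebesgue_on[symmetric]
  by (rule absolutely_integrable_continuous_real[OF assms])

lemma continuous_on_measurable_lebesgue_on:
  fixes g :: "real \<Rightarrow> 'b::euclidean_space"
  assumes "continuous_on {a..b} g"
  shows "g \<in> borel_measurable (lebesgue_on {a..b})"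
  using continuous_on_integrable_lebesgue_on[OF assms] by simp

section \<open>Calculus of integrated equations: linearity, Gronwall bounds, product rule\<close>

lemma ode_onI:
  assumes "integrable (lebesgue_on {0..T}) g"
    "\<And>t. t \<in> {0..T} \<Longrightarrow> y t = y 0 + integral\<^sup>L (lebesgue_on {0..t}) g"
  shows "ode_on T y g"
  unfolding ode_on_def set_integrable_iff_lebesgue_on set_integral_eq_lebesgue_on using assms by blast

lemma ode_onD:
  assumes "ode_on T y g"
  shows "integrable (lebesgue_on {0..T}) g"
    "\<And>t. t \<in> {0..T} \<Longrightarrow> y t = y 0 + integral\<^sup>L (lebesgue_on {0..t}) g"
    "\<And>t. t \<in> {0..T} \<Longrightarrow> integrable (lebesgue_on {0..t}) g"
proof -
  show i: "integrable (lebesgue_on {0..T}) g"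
    using assms by (simp add: ode_on_def set_integrable_iff_lebesgue_on)
  show "y t = y 0 + integral\<^sup>L (lebesgue_on {0..t}) g" if "t \<in> {0..T}" for t
    using assms that unfolding ode_on_def set_integral_eq_lebesgue_on by blast
  show "integrable (lebesgue_on {0..t}) g" if "t \<in> {0..T}" for t
    using integrable_lebesgue_on_mono[OF i] that by simp
qed

lemma ode_on_HK:
  assumes "ode_on T y g"
  shows "g integrable_on {0..T}" "\<And>t. t \<in> {0..T} \<Longrightarrow> y t = y 0 + integral {0..t} g"
  using ode_onD[OF assms] integral_lebesgue_on_HK by metis+

lemma ode_on_continuous:
  assumes "ode_on T y g"
  shows "continuous_on {0..T} y"
proof -
  have "continuous_on {0..T} (\<lambda>t. y 0 + integral {0..t} g)"
    by (intro continuous_intros indefinite_integral_continuous_1 ode_on_HK[OF assms])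
  then show ?thesis by (rule continuous_on_eq) (simp add: ode_on_HK(2)[OF assms, symmetric])
qed

text \<open>Serves to exchange an integrand for a simpler one that agrees with it for almost every
  time, for instance after the feedback form of a control has been inserted.\<close>

lemma ode_on_cong:
  assumes "ode_on T y g" "AE s in lebesgue_on {0..T}. g s = h s" "h \<in> borel_measurable (lebesgue_on {0..T})"
    "\<And>t. t \<in> {0..T} \<Longrightarrow> y t = z t" "T \<ge> 0"
  shows "ode_on T z h"
proof (rule ode_onI)
  note * = ode_onD[OF assms(1)]
  show i: "integrable (lebesgue_on {0..T}) h"
    by (rule integrable_cong_AE_imp[OF *(1) assms(3,2)])
  fix t assume t: "t \<in> {0..T}"
  have "integral\<^sup>L (lebesgue_on {0..t}) g = integral\<^sup>L (lebesgue_on {0..t}) h"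
    using *(3)[OF t] integrable_lebesgue_on_mono[OF i] t AE_lebesgue_on_mono[OF assms(2)]
    by (intro integral_cong_AE) auto
  then show "z t = z 0 + integral\<^sup>L (lebesgue_on {0..t}) h"
    using *(2)[OF t] assms(4)[OF t] assms(4)[of 0] \<open>T \<ge> 0\<close> by simp
qed

lemma ode_on_linear:
  assumes "ode_on T y g" "bounded_linear f"
  shows "ode_on T (\<lambda>t. f (y t)) (\<lambda>t. f (g t))"
proof (rule ode_onI)
  note * = ode_onD[OF assms(1)]
  show "integrable (lebesgue_on {0..T}) (\<lambda>t. f (g t))"
    by (rule integrable_bounded_linear[OF assms(2) *(1)])
  fix t assume t: "t \<in> {0..T}"
  show "f (y t) = f (y 0) + integral\<^sup>L (lebesgue_on {0..t}) (\<lambda>t. f (g t))"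
    using *(2)[OF t] integral_bounded_linear[OF assms(2) *(3)[OF t]]
    by (metis assms(2) bounded_linear.linear linear_add)
qed

lemma ode_on_add:
  assumes "ode_on T y g" "ode_on T z h"
  shows "ode_on T (\<lambda>t. y t + z t) (\<lambda>t. g t + h t)"
proof (rule ode_onI)
  note * = ode_onD[OF assms(1)] ode_onD[OF assms(2)]
  show "integrable (lebesgue_on {0..T}) (\<lambda>t. g t + h t)" using * by simp
  fix t assume t: "t \<in> {0..T}"
  show "y t + z t = y 0 + z 0 + integral\<^sup>L (lebesgue_on {0..t}) (\<lambda>t. g t + h t)"
    using *(2,5)[OF t] *(3,6)[OF t] by simp
qed

lemma ode_on_diff:
  assumes "ode_on T y g" "ode_on T z h"
  shows "ode_on T (\<lambda>t. y t - z t) (\<lambda>t. g t - h t)"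
  using ode_on_add[OF assms(1) ode_on_linear[OF assms(2), of uminus]]
  by (simp add: bounded_linear_minus)

text \<open>Needed for \<open>\<theta>\<close>: its equation contains the pointwise derivative of
  \<open>m\<close>, whereas \<open>m\<close> is known through an integral equation.\<close>

lemma AE_vector_derivative_ode_on:
  assumes "ode_on T y g" "T > 0"
  shows "AE t in lebesgue_on {0..T}. vector_derivative y (at t within {0..T}) = g t"
proof -
  define N where "N = {x \<in> {0..T}. \<not> ((\<lambda>u. integral {0..u} g) has_vector_derivative g x) (at x within {0..T})}"
  have "N \<in> null_sets lebesgue"
    using AE_has_vector_derivative_indefinite_integral[OF ode_on_HK(1)[OF assms(1)]]
    by (simp add: negligible_iff_null_sets N_def)
  then have "AE t in lebesgue. t \<notin> N" by (rule AE_not_in)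
  moreover have "vector_derivative y (at t within {0..T}) = g t" if "t \<notin> N" "t \<in> {0..T}" for t
  proof -
    have "((\<lambda>u. integral {0..u} g) has_vector_derivative g t) (at t within {0..T})"
      using that by (simp add: N_def)
    then have "((\<lambda>u. y 0 + integral {0..u} g) has_vector_derivative g t) (at t within {0..T})"
      by (auto intro!: derivative_eq_intros)
    then have "(y has_vector_derivative g t) (at t within {0..T})"
      by (rule has_vector_derivative_transform[OF that(2), rotated]) (rule ode_on_HK(2)[OF assms(1)])
    then show ?thesis
      using that assms(2) by (intro vector_derivative_within_closed_interval) auto
  qed
  ultimately show ?thesis by (auto simp: AE_restrict_space_iff elim!: eventually_mono)
qed

text \<open>Gronwall's inequality with the forcing \<open>k\<close> integrated over the whole of
  \<open>{0..T}\<close>, which is possible because \<open>k\<close> is nonnegative. A random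
  \<open>k\<close> yields square integrable bounds for states and flows, and \<open>k = 0\<close>
  yields uniqueness.\<close>

lemma ode_on_bound:
  fixes y :: "real \<Rightarrow> 'b::euclidean_space"
  assumes y: "ode_on T y g" and C: "C \<ge> 0"
    and g: "AE s in lebesgue_on {0..T}. norm (g s) \<le> C * norm (y s) + k s"
    and k: "integrable (lebesgue_on {0..T}) k" "AE s in lebesgue_on {0..T}. k s \<ge> 0"
    and t: "t \<in> {0..T}"
  shows "norm (y t) \<le> (norm (y 0) + integral\<^sup>L (lebesgue_on {0..T}) k) * exp (C * T)"
proof -
  define a where "a = norm (y 0) + integral\<^sup>L (lebesgue_on {0..T}) k"
  note cont = ode_on_continuous[OF y]
  then have cn: "continuous_on {0..T} (\<lambda>s. norm (y s))" by (intro continuous_intros)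
  have "norm (y t) \<le> a * exp (C * t)"
  proof (rule gronwall[OF cn C _ t])
    fix t assume t: "t \<in> {0..T}"
    have ik: "integrable (lebesgue_on {0..t}) k" using integrable_lebesgue_on_mono[OF k(1)] t by simp
    have iy: "integrable (lebesgue_on {0..t}) (\<lambda>s. norm (y s))"
      by (rule continuous_on_integrable_lebesgue_on[OF continuous_on_subset[OF cn]]) (use t in auto)
    have "norm (y t) \<le> norm (y 0) + norm (integral\<^sup>L (lebesgue_on {0..t}) g)"
      using ode_onD(2)[OF y t] norm_triangle_ineq by metis
    also have "norm (integral\<^sup>L (lebesgue_on {0..t}) g) \<le> (\<integral>s. C * norm (y s) + k s \<partial>lebesgue_on {0..t})"
      by (rule order_trans[OF integral_norm_bound])
        (use ode_onD(3)[OF y t] AE_lebesgue_on_mono[OF g] t ik iy in \<open>intro integral_mono_AE\<close>, auto)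
    also have "\<dots> = C * integral {0..t} (\<lambda>s. norm (y s)) + integral\<^sup>L (lebesgue_on {0..t}) k"
      using ik iy by (simp add: integral_lebesgue_on_HK(2)[symmetric])
    also have "integral\<^sup>L (lebesgue_on {0..t}) k \<le> integral\<^sup>L (lebesgue_on {0..T}) k"
    proof -
      have "integral\<^sup>L (lebesgue_on {0..t}) k = (\<integral>s. indicator {0..t} s * k s \<partial>lebesgue_on {0..T})"
        using set_integral_eq_indicator_lebesgue_on[of t T 0 k] t by (simp add: set_integral_eq_lebesgue_on)
      also have "\<dots> \<le> integral\<^sup>L (lebesgue_on {0..T}) k"
      proof (rule integral_mono_AE[OF _ k(1)])
        show "integrable (lebesgue_on {0..T}) (\<lambda>s. indicator {0..t} s * k s)"
          using integrable_mult_indicator[OF _ k(1), of "{0..t}"] t by (simp add: sets_restrict_space_iff)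
        show "AE s in lebesgue_on {0..T}. indicator {0..t} s * k s \<le> k s"
          using k(2) by eventually_elim (auto split: split_indicator)
      qed
      finally show ?thesis .
    qed
    finally show "norm (y t) \<le> a + C * integral {0..t} (\<lambda>s. norm (y s))" by (simp add: a_def)
  qed
  also have "\<dots> \<le> a * exp (C * T)"
  proof -
    have "a \<ge> 0" unfolding a_def using integral_nonneg_AE[OF k(2)] by simp
    then show ?thesis using t C by (intro mult_left_mono) (auto intro: mult_left_mono)
  qed
  finally show ?thesis by (simp add: a_def)
qed

lemma continuous_on_Icc_bounded:
  fixes f :: "real \<Rightarrow> 'b::real_normed_vector"
  assumes "continuous_on {a..b} f"
  obtains B where "B \<ge> 0" "\<And>s. s \<in> {a..b} \<Longrightarrow> norm (f s) \<le> B"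
proof -
  obtain B where B: "\<forall>s\<in>{a..b}. norm (f s) \<le> B"
    using compact_imp_bounded[OF compact_continuous_image[OF assms compact_Icc]] by (auto simp: bounded_iff)
  then show ?thesis by (intro that[of "max B 0"]) (auto simp: le_max_iff_disj)
qed

lemma borel_measurable_bilinear:
  fixes b :: "'a::euclidean_space \<Rightarrow> 'b::euclidean_space \<Rightarrow> 'c::euclidean_space"
  assumes "bounded_bilinear b" "u \<in> borel_measurable M" "v \<in> borel_measurable M"
  shows "(\<lambda>x. b (u x) (v x)) \<in> borel_measurable M"
proof -
  have "continuous_on UNIV (\<lambda>p. b (fst p) (snd p))"
    by (intro bounded_bilinear.continuous_on[OF assms(1)] continuous_intros)
  from borel_measurable_continuous_on[OF this borel_measurable_Pair[OF assms(2,3)]] show ?thesis by simp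
qed

text \<open>Integration by parts without derivatives: \<open>b (y t - y 0) (z t - z 0)\<close> is a
  double integral over a square, and Fubini on the two triangles on either side of the diagonal
  gives the two terms.\<close>

lemma ode_on_bilinear:
  fixes y :: "real \<Rightarrow> 'a::euclidean_space" and z :: "real \<Rightarrow> 'b::euclidean_space"
    and b :: "'a \<Rightarrow> 'b \<Rightarrow> 'c::euclidean_space"
  assumes y: "ode_on T y g" and z: "ode_on T z h" and b: "bounded_bilinear b"
  shows "ode_on T (\<lambda>t. b (y t) (z t)) (\<lambda>t. b (g t) (z t) + b (y t) (h t))"
proof -
  interpret b: bounded_bilinear b by (rule b)
  obtain K where K: "\<And>x y. norm (b x y) \<le> norm x * norm y * K" "K \<ge> 0" using b.nonneg_bounded by blast
  note meas = borel_measurable_bilinear[OF b]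
  have int_bounded: "integrable (lebesgue_on {0..t}) (\<lambda>s. b (u s) (v s))"
    if "integrable (lebesgue_on {0..t}) u \<and> continuous_on {0..t} v \<or>
      continuous_on {0..t} u \<and> integrable (lebesgue_on {0..t}) v" for u v and t :: real
  proof -
    have m: "(\<lambda>s. b (u s) (v s)) \<in> borel_measurable (lebesgue_on {0..t})"
      using that by (intro meas) (auto intro: continuous_on_measurable_lebesgue_on)
    from that show ?thesis
    proof
      assume a: "integrable (lebesgue_on {0..t}) u \<and> continuous_on {0..t} v"
      then obtain B where B: "\<And>s. s \<in> {0..t} \<Longrightarrow> norm (v s) \<le> B" using continuous_on_Icc_bounded by blast
      show ?thesis
      proof (rule Bochner_Integration.integrable_bound[OF _ m])
        show "integrable (lebesgue_on {0..t}) (\<lambda>s. norm (u s) * (B * K))" using a by simp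
        show "AE s in lebesgue_on {0..t}. norm (b (u s) (v s)) \<le> norm (norm (u s) * (B * K))"
        proof (rule AE_I2)
          fix s assume "s \<in> space (lebesgue_on {0..t})"
          then have "norm (v s) \<le> B" using B by simp
          then have "norm (u s) * norm (v s) * K \<le> norm (u s) * (B * K)"
            using K(2) by (simp add: mult_left_mono mult_right_mono mult.assoc)
          then show "norm (b (u s) (v s)) \<le> norm (norm (u s) * (B * K))" using K(1)[of "u s" "v s"] by simp
        qed
      qed
    next
      assume a: "continuous_on {0..t} u \<and> integrable (lebesgue_on {0..t}) v"
      then obtain B where B: "\<And>s. s \<in> {0..t} \<Longrightarrow> norm (u s) \<le> B" using continuous_on_Icc_bounded by blast
      show ?thesis
      proof (rule Bochner_Integration.integrable_bound[OF _ m])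
        show "integrable (lebesgue_on {0..t}) (\<lambda>s. norm (v s) * (B * K))" using a by simp
        show "AE s in lebesgue_on {0..t}. norm (b (u s) (v s)) \<le> norm (norm (v s) * (B * K))"
        proof (rule AE_I2)
          fix s assume "s \<in> space (lebesgue_on {0..t})"
          then have "norm (u s) \<le> B" using B by simp
          then have "norm (u s) * norm (v s) * K \<le> norm (v s) * (B * K)"
            using K(2) mult_right_mono[of "norm (u s)" B "norm (v s) * K"] by (simp add: mult_ac)
          then show "norm (b (u s) (v s)) \<le> norm (norm (v s) * (B * K))" using K(1)[of "u s" "v s"] by simp
        qed
      qed
    qed
  qed
  note cy = ode_on_continuous[OF y] and cz = ode_on_continuous[OF z]
  show ?thesis
  proof (rule ode_onI)
    show "integrable (lebesgue_on {0..T}) (\<lambda>t. b (g t) (z t) + b (y t) (h t))"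
      using int_bounded[of T g z] int_bounded[of T y h] cy cz ode_onD(1)[OF y] ode_onD(1)[OF z] by simp
    fix t assume t: "t \<in> {0..T}"
    define M where "M = lebesgue_on {0..t}"
    interpret M: finite_measure M unfolding M_def by (rule finite_measure_lebesgue_on_Icc)
    interpret MM: pair_sigma_finite M M ..
    have idM[measurable]: "(\<lambda>x. x) \<in> borel_measurable M" unfolding M_def by (rule borel_measurable_id_lebesgue_on)
    have ig: "integrable M g" and ih: "integrable M h"
      using ode_onD(3)[OF y t] ode_onD(3)[OF z t] by (auto simp: M_def)
    note [measurable] = borel_measurable_integrable[OF ig] borel_measurable_integrable[OF ih]
    have yt: "y s - y 0 = (\<integral>u. indicator {0..s} u *\<^sub>R g u \<partial>M)" if "s \<in> {0..t}" for s
      using ode_onD(2)[OF y, of s] that t set_integral_eq_indicator_lebesgue_on[of s t 0 g]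
      by (simp add: M_def set_integral_eq_lebesgue_on)
    have zt: "z s - z 0 = (\<integral>u. indicator {0..s} u *\<^sub>R h u \<partial>M)" if "s \<in> {0..t}" for s
      using ode_onD(2)[OF z, of s] that t set_integral_eq_indicator_lebesgue_on[of s t 0 h]
      by (simp add: M_def set_integral_eq_lebesgue_on)
    have spM: "space M = {0..t}" by (simp add: M_def)
    have m2: "(\<lambda>p. b (g (fst p)) (h (snd p))) \<in> borel_measurable (M \<Otimes>\<^sub>M M)"
      by (rule meas) measurable
    have int2: "integrable (M \<Otimes>\<^sub>M M) (\<lambda>p. b (g (fst p)) (h (snd p)))"
    proof (rule MM.Fubini_integrable[OF m2])
      show "AE x in M. integrable M (\<lambda>y. b (g (fst (x, y))) (h (snd (x, y))))"
        using integrable_bounded_linear[OF b.bounded_linear_right ih] by simp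
      show "integrable M (\<lambda>x. \<integral>y. norm (b (g (fst (x, y))) (h (snd (x, y)))) \<partial>M)"
      proof (rule Bochner_Integration.integrable_bound)
        show "integrable M (\<lambda>x. norm (g x) * (K * (\<integral>y. norm (h y) \<partial>M)))" using ig by simp
        show "(\<lambda>x. \<integral>y. norm (b (g (fst (x, y))) (h (snd (x, y)))) \<partial>M) \<in> borel_measurable M"
          using m2 by (intro M.borel_measurable_lebesgue_integral) (simp add: case_prod_beta')
        show "AE x in M. norm (\<integral>y. norm (b (g (fst (x, y))) (h (snd (x, y)))) \<partial>M)
            \<le> norm (norm (g x) * (K * (\<integral>y. norm (h y) \<partial>M)))"
        proof (rule AE_I2)
          fix x
          have "(\<integral>y. norm (b (g x) (h y)) \<partial>M) \<le> (\<integral>y. norm (g x) * K * norm (h y) \<partial>M)"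
            using K(1) ih integrable_bounded_linear[OF b.bounded_linear_right ih]
            by (intro integral_mono) (auto simp: mult_ac)
          also have "\<dots> = norm (g x) * (K * (\<integral>y. norm (h y) \<partial>M))" by simp
          finally show "norm (\<integral>y. norm (b (g (fst (x, y))) (h (snd (x, y)))) \<partial>M)
            \<le> norm (norm (g x) * (K * (\<integral>y. norm (h y) \<partial>M)))" by simp
        qed
      qed
    qed
    \<comment> \<open>Indicator of the closed triangle \<open>snd p \<le> fst p\<close>. The
      diagonal belongs to it; for the complementary triangle it is a null set in every
      section.\<close>
    define L where "L p = (if snd p \<le> fst p then 1 else 0 :: real)" for p :: "real \<times> real"
    have Lm: "L \<in> borel_measurable (M \<Otimes>\<^sub>M M)" unfolding L_def by measurable
    have i1: "integrable (M \<Otimes>\<^sub>M M) (\<lambda>p. L p *\<^sub>R b (g (fst p)) (h (snd p)))"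
      by (rule Bochner_Integration.integrable_bound[OF int2]) (use Lm m2 in \<open>auto simp: L_def\<close>)
    have i2: "integrable (M \<Otimes>\<^sub>M M) (\<lambda>p. (1 - L p) *\<^sub>R b (g (fst p)) (h (snd p)))"
      by (rule Bochner_Integration.integrable_bound[OF int2]) (use Lm m2 in \<open>auto simp: L_def\<close>)
    have "b (y t - y 0) (z t - z 0) = b (\<integral>u. g u \<partial>M) (\<integral>u. h u \<partial>M)"
      using ode_onD(2)[OF y t] ode_onD(2)[OF z t] by (simp add: M_def)
    also have "\<dots> = (\<integral>s. b (g s) (\<integral>u. h u \<partial>M) \<partial>M)"
      by (rule integral_bounded_linear[OF b.bounded_linear_left ig, symmetric])
    also have "\<dots> = (\<integral>s. \<integral>u. b (g s) (h u) \<partial>M \<partial>M)"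
      by (simp add: integral_bounded_linear[OF b.bounded_linear_right ih])
    also have "\<dots> = (\<integral>p. b (g (fst p)) (h (snd p)) \<partial>(M \<Otimes>\<^sub>M M))"
      using MM.integral_fst'[OF int2] by simp
    also have "\<dots> = (\<integral>p. L p *\<^sub>R b (g (fst p)) (h (snd p)) + (1 - L p) *\<^sub>R b (g (fst p)) (h (snd p)) \<partial>(M \<Otimes>\<^sub>M M))"
      by (simp add: scaleR_left_diff_distrib)
    also have "\<dots> = (\<integral>p. L p *\<^sub>R b (g (fst p)) (h (snd p)) \<partial>(M \<Otimes>\<^sub>M M)) + (\<integral>p. (1 - L p) *\<^sub>R b (g (fst p)) (h (snd p)) \<partial>(M \<Otimes>\<^sub>M M))"
      using i1 i2 by (rule Bochner_Integration.integral_add)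
    also have "(\<integral>p. L p *\<^sub>R b (g (fst p)) (h (snd p)) \<partial>(M \<Otimes>\<^sub>M M)) = (\<integral>s. b (g s) (z s - z 0) \<partial>M)"
    proof -
      have "(\<integral>p. L p *\<^sub>R b (g (fst p)) (h (snd p)) \<partial>(M \<Otimes>\<^sub>M M)) = (\<integral>s. \<integral>u. L (s, u) *\<^sub>R b (g s) (h u) \<partial>M \<partial>M)"
        using MM.integral_fst'[OF i1] by simp
      also have "\<dots> = (\<integral>s. b (g s) (z s - z 0) \<partial>M)"
      proof (rule Bochner_Integration.integral_cong[OF refl])
        fix s assume s: "s \<in> space M"
        have "(\<integral>u. L (s, u) *\<^sub>R b (g s) (h u) \<partial>M) = (\<integral>u. b (g s) (indicator {0..s} u *\<^sub>R h u) \<partial>M)"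
          using s by (intro Bochner_Integration.integral_cong) (auto simp: L_def spM b.scaleR_right split: split_indicator)
        also have "\<dots> = b (g s) (z s - z 0)"
          using s by (subst zt) (auto simp: spM M_def sets_restrict_space_iff intro!: integral_bounded_linear[OF b.bounded_linear_right]
            integrable_mult_indicator ih[unfolded M_def])
        finally show "(\<integral>u. L (s, u) *\<^sub>R b (g s) (h u) \<partial>M) = b (g s) (z s - z 0)" .
      qed
      finally show ?thesis .
    qed
    also have "(\<integral>p. (1 - L p) *\<^sub>R b (g (fst p)) (h (snd p)) \<partial>(M \<Otimes>\<^sub>M M)) = (\<integral>u. b (y u - y 0) (h u) \<partial>M)"
    proof -
      have "(\<integral>p. (1 - L p) *\<^sub>R b (g (fst p)) (h (snd p)) \<partial>(M \<Otimes>\<^sub>M M)) = (\<integral>u. \<integral>s. (1 - L (s, u)) *\<^sub>R b (g s) (h u) \<partial>M \<partial>M)"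
        using MM.integral_snd[of "\<lambda>s u. (1 - L (s, u)) *\<^sub>R b (g s) (h u)"] i2 by (simp add: case_prod_beta')
      also have "\<dots> = (\<integral>u. b (y u - y 0) (h u) \<partial>M)"
      proof (rule Bochner_Integration.integral_cong[OF refl])
        fix u assume u: "u \<in> space M"
        have "AE s in M. s \<noteq> u"
          using AE_lborel_singleton[of u] unfolding M_def
          by (auto simp: AE_restrict_space_iff intro!: AE_completion elim: eventually_mono)
        then have "AE s in M. (1 - L (s, u)) *\<^sub>R b (g s) (h u) = b (indicator {0..u} s *\<^sub>R g s) (h u)"
          using AE_space by eventually_elim (use u in \<open>auto simp: L_def spM b.scaleR_left split: split_indicator\<close>)
        moreover have "(\<lambda>s. (1 - L (s, u)) *\<^sub>R b (g s) (h u)) \<in> borel_measurable M"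
          unfolding L_def by (simp, intro borel_measurable_scaleR meas) measurable
        moreover have "(\<lambda>s. b (indicator {0..u} s *\<^sub>R g s) (h u)) \<in> borel_measurable M"
          by (intro meas) measurable
        ultimately have "(\<integral>s. (1 - L (s, u)) *\<^sub>R b (g s) (h u) \<partial>M) = (\<integral>s. b (indicator {0..u} s *\<^sub>R g s) (h u) \<partial>M)"
          by (intro integral_cong_AE) auto
        also have "\<dots> = b (y u - y 0) (h u)"
          using u by (subst yt) (auto simp: spM M_def sets_restrict_space_iff intro!: integral_bounded_linear[OF b.bounded_linear_left]
            integrable_mult_indicator ig[unfolded M_def])
        finally show "(\<integral>s. (1 - L (s, u)) *\<^sub>R b (g s) (h u) \<partial>M) = b (y u - y 0) (h u)" .
      qed
      finally show ?thesis .
    qed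
    finally have main: "b (y t - y 0) (z t - z 0) = (\<integral>s. b (g s) (z s - z 0) \<partial>M) + (\<integral>s. b (y s - y 0) (h s) \<partial>M)" .
    have cyt: "continuous_on {0..t} y" and czt: "continuous_on {0..t} z"
      using cy cz t by (auto elim: continuous_on_subset)
    have j: "integrable M (\<lambda>s. b (g s) (z s))" "integrable M (\<lambda>s. b (y s) (h s))"
      "integrable M (\<lambda>s. b (g s) (z 0))" "integrable M (\<lambda>s. b (y 0) (h s))"
      using int_bounded[of t] ig ih cyt czt unfolding M_def by auto
    have "(\<integral>s. b (g s) (z 0) \<partial>M) = b (y t - y 0) (z 0)" "(\<integral>s. b (y 0) (h s) \<partial>M) = b (y 0) (z t - z 0)"
      using integral_bounded_linear[OF b.bounded_linear_left ig] integral_bounded_linear[OF b.bounded_linear_right ih]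
        ode_onD(2)[OF y t] ode_onD(2)[OF z t] by (auto simp: M_def)
    with main j have "b (y t - y 0) (z t - z 0) = (\<integral>s. b (g s) (z s) \<partial>M) - b (y t - y 0) (z 0) + ((\<integral>s. b (y s) (h s) \<partial>M) - b (y 0) (z t - z 0))"
      by (simp add: b.diff_left b.diff_right)
    then show "b (y t) (z t) = b (y 0) (z 0) + (\<integral>s. b (g s) (z s) + b (y s) (h s) \<partial>lebesgue_on {0..t})"
      using j by (simp add: M_def[symmetric] b.diff_left b.diff_right algebra_simps)
  qed
qed

section \<open>Essentially bounded coefficients and linear equations\<close>

text \<open>At time 0 the interval \<open>{0..0}\<close> is a single point, and the integral
  equation must reduce to the initial value.\<close>

lemma integral_lebesgue_on_singleton [simp]:
  fixes g :: "real \<Rightarrow> 'b::euclidean_space"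
  shows "integral\<^sup>L (lebesgue_on {a}) g = 0"
proof -
  have "AE s in lebesgue. s \<noteq> a" by (intro AE_completion AE_lborel_singleton)
  moreover have *: "{a} \<inter> space lebesgue \<in> sets lebesgue" by simp
  ultimately have "AE s in lebesgue_on {a}. g s = 0"
    unfolding AE_restrict_space_iff[OF *] by eventually_elim simp
  then show ?thesis by (rule integral_eq_zero_AE)
qed

lemma matrix_vector_mult_component_inner: "(A *v x) $ i = A $ i \<bullet> x" for A :: "real^'n^'m"
  by (simp add: matrix_vector_mult_def inner_vec_def)

text \<open>The norm of a matrix is here the Frobenius norm, so Cauchy-Schwarz applied row by row
  gives the bound with constant 1.\<close>

lemma norm_matrix_vector_mult_le: "norm (A *v x) \<le> norm A * norm x" for A :: "real^'n^'m"
proof -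
  have "norm (A *v x) \<le> L2_set (\<lambda>i. norm (A $ i) * norm x) UNIV"
    unfolding norm_vec_def[of "A *v x"]
    by (rule L2_set_mono) (auto simp: matrix_vector_mult_component_inner Cauchy_Schwarz_ineq2)
  also have "\<dots> = norm A * norm x"
    by (simp add: norm_vec_def[of A] L2_set_left_distrib)
  finally show ?thesis .
qed

lemma bounded_bilinear_matrix_vector_mult: "bounded_bilinear ((*v) :: real^'n^'m \<Rightarrow> real^'n \<Rightarrow> real^'m)"
  unfolding bilinear_conv_bounded_bilinear[symmetric] bilinear_def
  by (auto intro!: linearI simp: vec_eq_iff matrix_vector_mult_def sum.distrib algebra_simps sum_distrib_left)

lemma bounded_bilinear_matrix_matrix_mult: "bounded_bilinear ((**) :: real^'n^'m \<Rightarrow> real^'p^'n \<Rightarrow> real^'p^'m)"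
  unfolding bilinear_conv_bounded_bilinear[symmetric] bilinear_def
  by (auto intro!: linearI simp: vec_eq_iff matrix_matrix_mult_def sum.distrib algebra_simps sum_distrib_left)

lemma bounded_linear_transpose: "bounded_linear (transpose :: real^'n^'m \<Rightarrow> real^'m^'n)"
  unfolding linear_conv_bounded_linear[symmetric]
  by (auto intro!: linearI simp: vec_eq_iff transpose_def)

lemmas borel_measurable_matrix_vector_mult [measurable (raw)] =
  borel_measurable_bilinear[OF bounded_bilinear_matrix_vector_mult]
lemmas borel_measurable_matrix_matrix_mult [measurable (raw)] =
  borel_measurable_bilinear[OF bounded_bilinear_matrix_matrix_mult]

lemma borel_measurable_transpose [measurable (raw)]:
  fixes u :: "'e \<Rightarrow> real^'n^'m"
  assumes "u \<in> borel_measurable M"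
  shows "(\<lambda>x. transpose (u x)) \<in> borel_measurable M"
  using borel_measurable_continuous_on[OF bounded_linear.continuous_on[OF bounded_linear_transpose continuous_on_id] assms] .

lemma LinfI:
  assumes "f \<in> borel_measurable (lebesgue_on {0..T})" "AE t in lebesgue_on {0..T}. norm (f t) \<le> C"
  shows "Linf T f"
  using assms by (auto simp: Linf_def)

lemma LinfE:
  assumes "Linf T f"
  obtains C where "f \<in> borel_measurable (lebesgue_on {0..T})" "C > 0" "AE t in lebesgue_on {0..T}. norm (f t) \<le> C"
proof -
  obtain C where C: "AE t in lebesgue_on {0..T}. norm (f t) \<le> C" using assms by (auto simp: Linf_def)
  have "AE t in lebesgue_on {0..T}. norm (f t) \<le> max C 1" using C by eventually_elim auto
  then show ?thesis using assms by (intro that[of "max C 1"]) (auto simp: Linf_def)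
qed

lemma Linf_measurable: "Linf T f \<Longrightarrow> f \<in> borel_measurable (lebesgue_on {0..T})"
  by (simp add: Linf_def)

lemma Linf_bilinear:
  fixes b :: "'a::euclidean_space \<Rightarrow> 'b::euclidean_space \<Rightarrow> 'c::euclidean_space"
  assumes b: "bounded_bilinear b" and f: "Linf T f" and g: "Linf T g"
  shows "Linf T (\<lambda>t. b (f t) (g t))"
proof -
  obtain K where K: "\<And>x y. norm (b x y) \<le> norm x * norm y * K" "K \<ge> 0" using bounded_bilinear.nonneg_bounded[OF b] by blast
  obtain C where C: "f \<in> borel_measurable (lebesgue_on {0..T})" "C > 0" "AE t in lebesgue_on {0..T}. norm (f t) \<le> C"
    using LinfE[OF f] by blast
  obtain D where D: "g \<in> borel_measurable (lebesgue_on {0..T})" "D > 0" "AE t in lebesgue_on {0..T}. norm (g t) \<le> D"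
    using LinfE[OF g] by blast
  show ?thesis
  proof (rule LinfI[where C="C * D * K"])
    show "(\<lambda>t. b (f t) (g t)) \<in> borel_measurable (lebesgue_on {0..T})"
      by (rule borel_measurable_bilinear[OF b C(1) D(1)])
    show "AE t in lebesgue_on {0..T}. norm (b (f t) (g t)) \<le> C * D * K"
      using C(3) D(3)
    proof eventually_elim
      case (elim t)
      have "norm (f t) * norm (g t) * K \<le> C * D * K"
        using elim C(2) D(2) K(2) by (intro mult_right_mono mult_mono) auto
      then show ?case using K(1) order_trans by blast
    qed
  qed
qed

lemma Linf_linear:
  fixes f :: "real \<Rightarrow> 'a::euclidean_space" and h :: "'a \<Rightarrow> 'b::euclidean_space"
  assumes h: "bounded_linear h" and f: "Linf T f"
  shows "Linf T (\<lambda>t. h (f t))"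
proof -
  obtain K where K: "\<And>x. norm (h x) \<le> norm x * K" "K \<ge> 0" using bounded_linear.nonneg_bounded[OF h] by blast
  obtain C where C: "f \<in> borel_measurable (lebesgue_on {0..T})" "C > 0" "AE t in lebesgue_on {0..T}. norm (f t) \<le> C"
    using LinfE[OF f] by blast
  show ?thesis
  proof (rule LinfI[where C="C * K"])
    show "(\<lambda>t. h (f t)) \<in> borel_measurable (lebesgue_on {0..T})"
      using borel_measurable_continuous_on[OF bounded_linear.continuous_on[OF h continuous_on_id] C(1)] .
    show "AE t in lebesgue_on {0..T}. norm (h (f t)) \<le> C * K"
      using C(3) by eventually_elim (meson K order_trans mult_right_mono)
  qed
qed

lemma Linf_add:
  assumes f: "Linf T f" and g: "Linf T g"
  shows "Linf T (\<lambda>t. f t + g t)"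
proof -
  obtain C where C: "f \<in> borel_measurable (lebesgue_on {0..T})" "C > 0" "AE t in lebesgue_on {0..T}. norm (f t) \<le> C"
    using LinfE[OF f] by blast
  obtain D where D: "g \<in> borel_measurable (lebesgue_on {0..T})" "D > 0" "AE t in lebesgue_on {0..T}. norm (g t) \<le> D"
    using LinfE[OF g] by blast
  show ?thesis
  proof (rule LinfI[where C="C + D"])
    show "(\<lambda>t. f t + g t) \<in> borel_measurable (lebesgue_on {0..T})" using C(1) D(1) by simp
    show "AE t in lebesgue_on {0..T}. norm (f t + g t) \<le> C + D"
      using C(3) D(3) by eventually_elim (meson add_mono norm_triangle_ineq order_trans)
  qed
qed

lemma Linf_minus: "Linf T f \<Longrightarrow> Linf T (\<lambda>t. - f t)"
  by (simp add: Linf_def)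

lemma Linf_diff: "Linf T f \<Longrightarrow> Linf T g \<Longrightarrow> Linf T (\<lambda>t. f t - g t)"
  using Linf_add[OF _ Linf_minus] by fastforce

lemma Linf_continuous:
  assumes "continuous_on {0..T} f"
  shows "Linf T f"
proof -
  obtain B where "\<And>s. s \<in> {0..T} \<Longrightarrow> norm (f s) \<le> B"
    using continuous_on_Icc_bounded[OF assms] by blast
  then show ?thesis using continuous_on_measurable_lebesgue_on[OF assms] by (intro LinfI[where C=B] AE_I2) auto
qed

lemmas Linf_ode_on = Linf_continuous[OF ode_on_continuous]

lemma Linf_integrable:
  assumes "Linf T f"
  shows "integrable (lebesgue_on {0..T}) f"
proof -
  obtain C where C: "f \<in> borel_measurable (lebesgue_on {0..T})" "C > 0" "AE t in lebesgue_on {0..T}. norm (f t) \<le> C"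
    using LinfE[OF assms] by blast
  show ?thesis
    by (rule finite_measure.integrable_const_bound[OF finite_measure_lebesgue_on_Icc C(3,1)])
qed

lemmas Linf_matrix_intros = Linf_add Linf_diff Linf_minus
  Linf_bilinear[OF bounded_bilinear_matrix_vector_mult] Linf_bilinear[OF bounded_bilinear_matrix_matrix_mult]
  Linf_linear[OF bounded_linear_transpose] Linf_linear[OF bounded_linear_scaleR_right]

text \<open>Progressive measurability is formulated with Borel sets of times, so a Lebesgue
  measurable feedback coefficient must be replaced by a Borel one before it can define an admissible
  control. The replacement is made in each of the finitely many coordinates.\<close>

lemma lebesgue_on_ex_borel:
  fixes g :: "real \<Rightarrow> 'b::euclidean_space"
  assumes g: "g \<in> borel_measurable (lebesgue_on {a..b})"
  shows "\<exists>g'\<in>borel_measurable borel. AE t in lebesgue_on {a..b}. g t = g' t"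
proof -
  define h where "h t = indicator {a..b} t *\<^sub>R g t" for t
  have h: "h \<in> borel_measurable lebesgue"
    using borel_measurable_restrict_space_iff[of "{a..b}" lebesgue g] g by (simp add: h_def[abs_def])
  have "\<exists>u\<in>borel_measurable lborel. AE t in lborel. h t \<bullet> i = u t" for i
    using h by (intro completion_ex_borel_measurable_real) simp
  then obtain u where u: "\<And>i. u i \<in> borel_measurable lborel" "\<And>i. AE t in lborel. h t \<bullet> i = u i t" by metis
  have "AE t in lborel. \<forall>i\<in>Basis. h t \<bullet> i = u i t"
    using u(2) by (intro AE_finite_allI) auto
  then have "AE t in lebesgue. \<forall>i\<in>Basis. h t \<bullet> i = u i t" by (rule AE_completion)
  then have "AE t in lebesgue_on {a..b}. g t = (\<Sum>i\<in>Basis. u i t *\<^sub>R i)"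
  proof (subst AE_restrict_space_iff, simp, eventually_elim)
    case (elim t)
    have "h t = (\<Sum>i\<in>Basis. (h t \<bullet> i) *\<^sub>R i)" by (simp add: euclidean_representation)
    then show ?case using elim by (auto simp: h_def)
  qed
  moreover have "(\<lambda>t. \<Sum>i\<in>Basis. u i t *\<^sub>R i) \<in> borel_measurable borel" using u(1) by simp
  ultimately show ?thesis by (intro bexI conjI)
qed

section \<open>Coercive matrices and their inverses\<close>

lemma psd_ge:
  fixes R :: "real^'k^'k"
  assumes "psd (R - d *\<^sub>R mat 1)"
  shows "d * (norm x)\<^sup>2 \<le> (R *v x) \<bullet> x"
proof -
  have "0 \<le> ((R - d *\<^sub>R mat 1) *v x) \<bullet> x" using assms by (auto simp: psd_def)
  also have "(R - d *\<^sub>R mat 1) *v x = R *v x - d *\<^sub>R x"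
    by (simp add: matrix_vector_mult_diff_rdistrib scaleR_matrix_vector_assoc[symmetric])
  finally show ?thesis by (simp add: inner_diff_left power2_norm_eq_inner)
qed

text \<open>Coercivity makes the kernel trivial, hence \<open>R\<close> invertible; testing
  \<open>R *v y = x\<close> with \<open>y\<close> itself gives a bound on the inverse that depends
  on \<open>d\<close> only.\<close>

lemma psd_inverse:
  fixes R :: "real^'k^'k"
  assumes "psd (R - d *\<^sub>R mat 1)" "d > 0"
  shows "R ** matrix_inv R = mat 1" "matrix_inv R ** R = mat 1"
    "norm (matrix_inv R *v x) \<le> norm x / d"
proof -
  note ge = psd_ge[OF assms(1)]
  have "\<forall>x. R *v x = 0 \<longrightarrow> x = 0"
  proof (intro allI impI)
    fix x assume "R *v x = 0"
    then have "d * (norm x)\<^sup>2 \<le> 0" using ge[of x] by simp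
    then show "x = 0" using assms(2) by (simp add: mult_le_0_iff)
  qed
  then have inv: "invertible R"
    using invertible_left_inverse matrix_left_invertible_ker by blast
  show RI: "R ** matrix_inv R = mat 1" "matrix_inv R ** R = mat 1"
    using someI_ex[OF inv[unfolded invertible_def]] by (auto simp: matrix_inv_def)
  define y where "y = matrix_inv R *v x"
  have "R *v y = x" by (simp add: y_def matrix_vector_mul_assoc RI)
  then have "d * (norm y)\<^sup>2 \<le> norm x * norm y" using ge[of y] norm_cauchy_schwarz[of x y] by simp
  then have "d * norm y \<le> norm x"
    by (cases "y = 0") (auto simp: power2_eq_square mult.assoc[symmetric])
  then show "norm (matrix_inv R *v x) \<le> norm x / d"
    using assms(2) by (simp add: y_def field_simps)
qed

text \<open>Coercivity bounds the inverses uniformly, and the identity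
  \<open>?V s - ?V t = ?V s ** (R t - R s) ** ?V t\<close> then transfers continuity from
  \<open>R\<close> to its inverse.\<close>

lemma continuous_on_matrix_inv:
  fixes R :: "real \<Rightarrow> real^'k^'k"
  assumes R: "continuous_on S R" and psd: "\<forall>t\<in>S. psd (R t - d *\<^sub>R mat 1)" and d: "d > 0"
  shows "continuous_on S (\<lambda>t. matrix_inv (R t))"
proof -
  let ?V = "\<lambda>t. matrix_inv (R t)"
  have comp: "\<bar>?V t $ i $ j\<bar> \<le> 1 / d" if "t \<in> S" for t i j
  proof -
    have "norm (?V t *v axis j 1) \<le> 1 / d" using psd_inverse(3)[OF psd[rule_format, OF that] d, of "axis j 1"] by simp
    moreover have "?V t $ i $ j = (?V t *v axis j 1) $ i"
      by (simp add: matrix_vector_mult_basis column_def)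
    ultimately show ?thesis using component_le_norm_cart[of "?V t *v axis j 1" i] by simp
  qed
  have bd: "norm (?V t) \<le> real CARD('k) * real CARD('k) / d" if "t \<in> S" for t
  proof -
    have "norm (?V t) \<le> (\<Sum>i\<in>UNIV. norm (?V t $ i))" unfolding norm_vec_def by (rule L2_set_le_sum) simp
    also have "\<dots> \<le> (\<Sum>i\<in>(UNIV::'k set). \<Sum>j\<in>(UNIV::'k set). \<bar>?V t $ i $ j\<bar>)"
      by (intro sum_mono) (rule norm_le_l1_cart)
    also have "\<dots> \<le> (\<Sum>i\<in>(UNIV::'k set). \<Sum>j\<in>(UNIV::'k set). 1 / d)" by (intro sum_mono comp that)
    finally show ?thesis by simp
  qed
  define c where "c = real CARD('k) * real CARD('k) / d"
  interpret m: bounded_bilinear "(**) :: real^'k^'k \<Rightarrow> real^'k^'k \<Rightarrow> real^'k^'k"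
    by (rule bounded_bilinear_matrix_matrix_mult)
  obtain K where K: "K \<ge> 0" "\<And>(X::real^'k^'k) (Y::real^'k^'k). norm (X ** Y) \<le> norm X * norm Y * K" using m.nonneg_bounded by blast
  have diff: "norm (?V s - ?V t) \<le> norm (R t - R s) * (c * K * c * K)" if "s \<in> S" "t \<in> S" for s t
  proof -
    have "?V s - ?V t = ?V s ** (R t - R s) ** ?V t"
      using psd_inverse(1,2)[OF psd[rule_format, OF that(1)] d] psd_inverse(1,2)[OF psd[rule_format, OF that(2)] d]
      by (simp add: m.diff_left m.diff_right matrix_mul_assoc[symmetric])
    also have "norm \<dots> \<le> norm (?V s ** (R t - R s)) * norm (?V t) * K" by (rule K)
    also have "\<dots> \<le> (norm (?V s) * norm (R t - R s) * K) * norm (?V t) * K"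
      by (intro mult_right_mono K) auto
    also have "\<dots> \<le> (c * norm (R t - R s) * K) * c * K"
      using bd[OF that(1), folded c_def] bd[OF that(2), folded c_def] K(1)
      by (intro mult_mono) (use d in \<open>auto simp: c_def\<close>)
    finally show ?thesis by (simp add: mult_ac)
  qed
  show ?thesis
    unfolding continuous_on_def
  proof
    fix t assume t: "t \<in> S"
    have "((\<lambda>s. R t - R s) \<longlongrightarrow> R t - R t) (at t within S)"
      using R t by (intro tendsto_intros) (auto simp: continuous_on_def)
    then have "((\<lambda>s. norm (R t - R s) * (c * K * c * K)) \<longlongrightarrow> 0) (at t within S)"
      by (intro tendsto_mult_left_zero) (simp add: tendsto_norm_zero)
    then have "((\<lambda>s. ?V s - ?V t) \<longlongrightarrow> 0) (at t within S)"
      by (rule Lim_null_comparison[rotated]) (use diff t in \<open>auto simp: eventually_at_filter\<close>)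
    then show "(?V \<longlongrightarrow> ?V t) (at t within S)" by (simp add: LIM_zero_iff)
  qed
qed

section \<open>Linear equations: existence, fundamental matrix, variation of constants\<close>

lemma linear_ode_exists:
  fixes L :: "real \<Rightarrow> 'b::euclidean_space \<Rightarrow> 'b"
  assumes lin: "\<And>t. bounded_linear (L t)" and bd: "\<And>t x. norm (L t x) \<le> C * norm x" and C: "C > 0" and T: "T \<ge> 0"
    and meas: "\<And>y. y \<in> borel_measurable (lebesgue_on {0..T}) \<Longrightarrow> (\<lambda>t. L t (y t)) \<in> borel_measurable (lebesgue_on {0..T})"
  shows "\<exists>y. y 0 = c \<and> ode_on T y (\<lambda>t. L t (y t))"
proof -
  \<comment> \<open>The terms of the Picard series, not its partial sums: \<open>u 0\<close> is the
    constant initial value, and each further term integrates \<open>L\<close> applied to its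
    predecessor.\<close>
  define u where "u = rec_nat (\<lambda>t. c) (\<lambda>n v t. integral\<^sup>L (lebesgue_on {0..t}) (\<lambda>s. L s (v s)))"
  have u0: "u 0 t = c" and uS: "u (Suc n) t = integral\<^sup>L (lebesgue_on {0..t}) (\<lambda>s. L s (u n s))" for n t
    by (simp_all add: u_def)
  have int: "integrable (lebesgue_on {0..t}) (\<lambda>s. L s (v s))" if v: "continuous_on {0..T} v" and t: "t \<in> {0..T}" for v t
  proof -
    obtain B where B: "\<And>s. s \<in> {0..T} \<Longrightarrow> norm (v s) \<le> B"
      using continuous_on_Icc_bounded[OF v] by blast
    have "integrable (lebesgue_on {0..T}) (\<lambda>s. L s (v s))"
    proof (rule finite_measure.integrable_const_bound[OF finite_measure_lebesgue_on_Icc, where B="C * B"])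
      show "AE s in lebesgue_on {0..T}. norm (L s (v s)) \<le> C * B"
        using B C by (intro AE_I2 order_trans[OF bd]) auto
      show "(\<lambda>s. L s (v s)) \<in> borel_measurable (lebesgue_on {0..T})"
        by (intro meas continuous_on_measurable_lebesgue_on v)
    qed
    then show ?thesis using t by (auto intro: integrable_lebesgue_on_mono)
  qed
  have ode: "ode_on T (u (Suc n)) (\<lambda>s. L s (u n s))" if "continuous_on {0..T} (u n)" for n
  proof (rule ode_onI)
    show "integrable (lebesgue_on {0..T}) (\<lambda>s. L s (u n s))" using int[OF that, of T] T by simp
    fix t assume "t \<in> {0..T}"
    have "u (Suc n) 0 = 0" by (simp add: uS)
    then show "u (Suc n) t = u (Suc n) 0 + integral\<^sup>L (lebesgue_on {0..t}) (\<lambda>s. L s (u n s))" by (simp add: uS)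
  qed
  have cont: "continuous_on {0..T} (u n)" for n
    by (induction n) (auto intro: ode_on_continuous[OF ode] simp: u0[abs_def])
  \<comment> \<open>With the exponent \<open>2 * C\<close>, integrating \<open>C * E\<close> gains a
    factor 1/2, so the series converges geometrically on all of \<open>{0..T}\<close> at once and
    the interval need not be subdivided.\<close>
  define E where "E t = exp (2 * C * t)" for t
  have bound: "norm (u n t) \<le> norm c * (1/2)^n * E t" if "t \<in> {0..T}" for n t
    using that
  proof (induction n arbitrary: t)
    case 0
    then show ?case using C by (simp add: u0 E_def mult_left_le)
      (metis mult_left_mono mult.right_neutral norm_ge_zero one_le_exp_iff mult_nonneg_nonneg zero_le_mult_iff order_less_imp_le zero_le_numeral)
  next
    case (Suc n)
    have Eint: "((\<lambda>s. C * E s) has_integral (E t / 2 - E 0 / 2)) {0..t}"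
      using Suc.prems unfolding E_def
      by (intro fundamental_theorem_of_calculus)
        (auto intro!: derivative_eq_intros simp flip: has_real_derivative_iff_has_vector_derivative)
    have Ecint: "integrable (lebesgue_on {0..t}) (\<lambda>s. C * E s)"
      unfolding E_def by (intro continuous_on_integrable_lebesgue_on continuous_intros)
    have "norm (u (Suc n) t) \<le> (\<integral>s. norm c * (1/2)^n * (C * E s) \<partial>lebesgue_on {0..t})"
      unfolding uS
    proof (rule order_trans[OF integral_norm_bound], rule integral_mono)
      show "integrable (lebesgue_on {0..t}) (\<lambda>s. norm (L s (u n s)))"
        using int[OF cont Suc.prems] by simp
      show "integrable (lebesgue_on {0..t}) (\<lambda>s. norm c * (1/2)^n * (C * E s))" using Ecint by simp
      fix s assume "s \<in> space (lebesgue_on {0..t})"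
      then have "norm (u n s) \<le> norm c * (1/2)^n * E s" using Suc by simp
      then have "C * norm (u n s) \<le> C * (norm c * (1/2)^n * E s)" using C by (intro mult_left_mono) auto
      then show "norm (L s (u n s)) \<le> norm c * (1/2)^n * (C * E s)"
        using bd[of s "u n s"] by (simp add: mult_ac)
    qed
    also have "\<dots> = norm c * (1/2)^n * (E t / 2 - E 0 / 2)"
      using trans[OF integral_lebesgue_on_HK(2)[OF Ecint] integral_unique[OF Eint]]
      by (simp only: integral_mult_right_zero)
    also have "\<dots> \<le> norm c * (1/2)^n * (E t / 2)"
      by (intro mult_left_mono) (auto simp: E_def)
    finally show ?case by simp
  qed
  define y where "y t = (\<Sum>n. u n t)" for t
  define B where "B = norm c * E T"
  have boundB: "norm (u n t) \<le> B * (1/2)^n" if "t \<in> {0..T}" for n t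
  proof -
    have "E t \<le> E T" using that C by (simp add: E_def)
    then have "norm c * (1/2)^n * E t \<le> norm c * (1/2)^n * E T" by (intro mult_left_mono) auto
    then show ?thesis using bound[OF that, of n] by (simp add: B_def mult_ac)
  qed
  have B0: "B \<ge> 0" by (simp add: B_def E_def)
  have sB: "summable (\<lambda>n. B * (1/2)^n)" by (intro summable_mult summable_geometric) simp
  have ul: "uniform_limit {0..T} (\<lambda>n t. \<Sum>i<n. u i t) y sequentially"
    unfolding y_def by (rule Weierstrass_m_test[OF _ sB]) (use boundB in auto)
  have cy: "continuous_on {0..T} y"
    by (rule uniform_limit_theorem[OF always_eventually ul]) (auto intro!: continuous_intros cont)
  have sums: "(\<lambda>n. u n t) sums y t" if "t \<in> {0..T}" for t
    unfolding y_def using boundB[OF that] by (intro summable_sums summable_comparison_test'[OF sB]) auto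
  have psum: "norm (\<Sum>i<n. u i t) \<le> B * 2" if "t \<in> {0..T}" for n t
  proof -
    have "norm (\<Sum>i<n. u i t) \<le> (\<Sum>i<n. B * (1/2)^i)" by (rule sum_norm_le) (use boundB that in auto)
    also have "\<dots> \<le> (\<Sum>i. B * (1/2)^i)" using B0 by (intro sum_le_suminf sB) auto
    also have "\<dots> = B * 2" by (subst suminf_mult) (auto simp: suminf_geometric intro!: summable_geometric)
    finally show ?thesis .
  qed
  have "ode_on T y (\<lambda>t. L t (y t))" "y 0 = c"
  proof -
    have eq: "y t = c + integral\<^sup>L (lebesgue_on {0..t}) (\<lambda>s. L s (y s))" if t: "t \<in> {0..T}" for t
    proof -
      have "(\<lambda>n. \<integral>s. L s (\<Sum>i<n. u i s) \<partial>lebesgue_on {0..t}) \<longlonglongrightarrow> (\<integral>s. L s (y s) \<partial>lebesgue_on {0..t})"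
      proof (rule integral_dominated_convergence[where w="\<lambda>s. C * (B * 2)"])
        show "(\<lambda>s. L s (y s)) \<in> borel_measurable (lebesgue_on {0..t})" using int[OF cy t] by simp
        show "(\<lambda>s. L s (\<Sum>i<n. u i s)) \<in> borel_measurable (lebesgue_on {0..t})" for n
          using int[OF _ t, of "\<lambda>s. \<Sum>i<n. u i s"] cont by (auto intro!: borel_measurable_integrable continuous_on_sum)
        show "integrable (lebesgue_on {0..t}) (\<lambda>s. C * (B * 2))"
          by (intro continuous_on_integrable_lebesgue_on continuous_intros)
        show "AE s in lebesgue_on {0..t}. (\<lambda>n. L s (\<Sum>i<n. u i s)) \<longlonglongrightarrow> L s (y s)"
          using t sums by (intro AE_I2 bounded_linear.tendsto[OF lin]) (auto simp: sums_def)
        show "AE s in lebesgue_on {0..t}. norm (L s (\<Sum>i<n. u i s)) \<le> C * (B * 2)" for n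
          using t psum C by (intro AE_I2 order_trans[OF bd]) (auto intro!: mult_left_mono)
      qed
      moreover have "(\<integral>s. L s (\<Sum>i<n. u i s) \<partial>lebesgue_on {0..t}) = (\<Sum>i<n. u (Suc i) t)" for n
      proof -
        have "(\<integral>s. L s (\<Sum>i<n. u i s) \<partial>lebesgue_on {0..t}) = (\<integral>s. (\<Sum>i<n. L s (u i s)) \<partial>lebesgue_on {0..t})"
          by (simp add: linear_sum[OF bounded_linear.linear[OF lin]])
        also have "\<dots> = (\<Sum>i<n. u (Suc i) t)"
          unfolding uS by (rule Bochner_Integration.integral_sum) (rule int[OF cont t])
        finally show ?thesis .
      qed
      moreover have "(\<lambda>n. \<Sum>i<n. u (Suc i) t) \<longlonglongrightarrow> y t - c"
        using sums[OF t] sums_Suc_iff[of "\<lambda>n. u n t" "y t - c"] by (simp add: u0 sums_def[symmetric])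
      ultimately have "(\<integral>s. L s (y s) \<partial>lebesgue_on {0..t}) = y t - c"
        using LIMSEQ_unique by simp
      then show ?thesis by simp
    qed
    have "u (Suc n) 0 = 0" for n by (simp add: uS)
    then have "u n 0 = (if n = 0 then c else 0)" for n by (cases n) (auto simp: u0)
    then have "(\<lambda>n. u n 0) sums c" using sums_single[of 0 "\<lambda>_. c"] by simp
    then show y0: "y 0 = c" using sums[of 0] T sums_unique2 by auto
    show "ode_on T y (\<lambda>t. L t (y t))"
      by (rule ode_onI) (use int[OF cy, of T] T eq y0 in auto)
  qed
  then show ?thesis by blast
qed

text \<open>\<open>Y\<close> solves the equation that the inverse of \<open>X\<close> must satisfy.
  The product rule makes \<open>Y t ** X t\<close> constant; for square matrices a left inverse is a
  right inverse, and the latter is what variation of constants uses.\<close>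

lemma fundamental_matrix_exists:
  fixes A :: "real \<Rightarrow> real^'d^'d"
  assumes A: "Linf T A" and T: "T \<ge> 0"
  shows "\<exists>(X :: real \<Rightarrow> real^'d^'d) (Y :: real \<Rightarrow> real^'d^'d). ode_on T X (\<lambda>t. A t ** X t) \<and> ode_on T Y (\<lambda>t. - (Y t ** A t)) \<and>
    (\<forall>t\<in>{0..T}. X t ** Y t = mat 1)"
proof -
  obtain C where C: "A \<in> borel_measurable (lebesgue_on {0..T})" "C > 0" "AE t in lebesgue_on {0..T}. norm (A t) \<le> C"
    using LinfE[OF A] by blast
  \<comment> \<open>The Picard argument wants a bound at every time. Cutting \<open>A\<close> off at
    its essential bound changes it only on a null set, which \<open>ode_on_cong\<close> removes at
    the end.\<close>
  define A' where "A' t = (if norm (A t) \<le> C then A t else 0)" for t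
  have A'm[measurable]: "A' \<in> borel_measurable (lebesgue_on {0..T})"
    unfolding A'_def using C(1) by measurable
  have A': "norm (A' t) \<le> C" for t using C(2) by (simp add: A'_def)
  have ae: "AE t in lebesgue_on {0..T}. A' t = A t" using C(3) by eventually_elim (simp add: A'_def)
  note m = bounded_bilinear_matrix_matrix_mult[where 'n='d and 'm='d and 'p='d]
  interpret m: bounded_bilinear "(**) :: real^'d^'d \<Rightarrow> real^'d^'d \<Rightarrow> real^'d^'d" by (rule m)
  obtain K where K: "K > 0" "\<And>(X::real^'d^'d) (Y::real^'d^'d). norm (X ** Y) \<le> norm X * norm Y * K" using m.pos_bounded by blast
  have "\<exists>X. X 0 = mat 1 \<and> ode_on T X (\<lambda>t. A' t ** X t)"
  proof (rule linear_ode_exists[where C="C * K"])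
    show "norm (A' t ** X) \<le> C * K * norm X" for t and X :: "real^'d^'d"
    proof -
      have "norm (A' t) * norm X * K \<le> C * norm X * K" using A'[of t] K(1) by (intro mult_right_mono) auto
      then show ?thesis using K(2)[of "A' t" X] by (simp add: mult_ac)
    qed
    show "(\<lambda>t. A' t ** y t) \<in> borel_measurable (lebesgue_on {0..T})"
      if "y \<in> borel_measurable (lebesgue_on {0..T})" for y
      using that by measurable
  qed (use C(2) K(1) T m.bounded_linear_right in auto)
  then obtain X where X: "X 0 = mat 1" "ode_on T X (\<lambda>t. A' t ** X t)" by blast
  have "\<exists>Y. Y 0 = mat 1 \<and> ode_on T Y (\<lambda>t. - (Y t ** A' t))"
  proof (rule linear_ode_exists[where C="C * K"])
    show "norm (- (Y ** A' t)) \<le> C * K * norm Y" for t and Y :: "real^'d^'d"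
    proof -
      have "norm Y * norm (A' t) * K \<le> norm Y * C * K" using A'[of t] K(1) by (intro mult_right_mono mult_left_mono) auto
      then show ?thesis using K(2)[of Y "A' t"] by (simp add: mult_ac)
    qed
    show "(\<lambda>t. - (y t ** A' t)) \<in> borel_measurable (lebesgue_on {0..T})"
      if "y \<in> borel_measurable (lebesgue_on {0..T})" for y
      using that by measurable
    show "bounded_linear (\<lambda>Y :: real^'d^'d. - (Y ** A' t))" for t
      using bounded_linear_minus[OF m.bounded_linear_left] by simp
  qed (use C(2) K(1) T in auto)
  then obtain Y where Y: "Y 0 = mat 1" "ode_on T Y (\<lambda>t. - (Y t ** A' t))" by blast
  have "ode_on T (\<lambda>t. Y t ** X t) (\<lambda>t. - (Y t ** A' t) ** X t + Y t ** (A' t ** X t))"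
    by (rule ode_on_bilinear[OF Y(2) X(2) m])
  then have "ode_on T (\<lambda>t. Y t ** X t) (\<lambda>t. 0)"
    by (simp add: m.minus_left matrix_mul_assoc)
  then have "Y t ** X t = mat 1" if "t \<in> {0..T}" for t
    using ode_onD(2)[of T "\<lambda>t. Y t ** X t" "\<lambda>t. 0" t] that X(1) Y(1) by simp
  then have "\<forall>t\<in>{0..T}. X t ** Y t = mat 1" using matrix_left_right_inverse by blast
  moreover have [measurable]: "X \<in> borel_measurable (lebesgue_on {0..T})" "Y \<in> borel_measurable (lebesgue_on {0..T})"
    using X(2) Y(2) by (auto intro!: continuous_on_measurable_lebesgue_on ode_on_continuous)
  have "ode_on T X (\<lambda>t. A t ** X t)"
    by (rule ode_on_cong[OF X(2)]) (use ae C(1) T in \<open>auto elim: eventually_mono\<close>)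
  moreover have "ode_on T Y (\<lambda>t. - (Y t ** A t))"
    by (rule ode_on_cong[OF Y(2)]) (use ae C(1) T in \<open>auto elim: eventually_mono\<close>)
  ultimately show ?thesis by blast
qed

text \<open>Variation of constants. The explicit formula matters: for random \<open>g\<close> it
  presents \<open>D t\<close> as a matrix applied to an integral over the past, from which
  adaptedness can be read off.\<close>

lemma linear_ode_solution:
  fixes A X Y :: "real \<Rightarrow> real^'d^'d" and g :: "real \<Rightarrow> real^'d"
  assumes X: "ode_on T X (\<lambda>t. A t ** X t)" and Y: "ode_on T Y (\<lambda>t. - (Y t ** A t))"
    and XY: "\<forall>t\<in>{0..T}. X t ** Y t = mat 1"
    and A: "Linf T A" and T: "T \<ge> 0" and g: "integrable (lebesgue_on {0..T}) g"
    and D: "\<And>t. t \<in> {0..T} \<Longrightarrow> D t = X t *v integral\<^sup>L (lebesgue_on {0..t}) (\<lambda>s. Y s *v g s)"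
  shows "ode_on T D (\<lambda>t. A t *v D t + g t)" "D 0 = 0"
proof -
  note mv = bounded_bilinear_matrix_vector_mult[where 'n='d and 'm='d]
  interpret mv: bounded_bilinear "(*v) :: real^'d^'d \<Rightarrow> real^'d \<Rightarrow> real^'d" by (rule mv)
  have [measurable]: "X \<in> borel_measurable (lebesgue_on {0..T})" "Y \<in> borel_measurable (lebesgue_on {0..T})"
      "A \<in> borel_measurable (lebesgue_on {0..T})" "g \<in> borel_measurable (lebesgue_on {0..T})"
    using X Y A g by (auto intro!: continuous_on_measurable_lebesgue_on ode_on_continuous simp: Linf_def)
  have i: "integrable (lebesgue_on {0..T}) (\<lambda>s. Y s *v g s)"
  proof -
    obtain B where B: "\<And>s. s \<in> {0..T} \<Longrightarrow> norm (Y s) \<le> B"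
      using continuous_on_Icc_bounded[OF ode_on_continuous[OF Y]] by blast
    show ?thesis
    proof (rule Bochner_Integration.integrable_bound)
      show "integrable (lebesgue_on {0..T}) (\<lambda>s. B * norm (g s))" using g by simp
      show "AE s in lebesgue_on {0..T}. norm (Y s *v g s) \<le> norm (B * norm (g s))"
      proof (rule AE_I2)
        fix s assume "s \<in> space (lebesgue_on {0..T})"
        then have "norm (Y s) * norm (g s) \<le> B * norm (g s)" using B by (intro mult_right_mono) auto
        then show "norm (Y s *v g s) \<le> norm (B * norm (g s))" using norm_matrix_vector_mult_le[of "Y s" "g s"] by simp
      qed
    qed measurable
  qed
  define w where "w t = integral\<^sup>L (lebesgue_on {0..t}) (\<lambda>s. Y s *v g s)" for t
  have w0: "w 0 = 0" by (simp add: w_def)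
  have w: "ode_on T w (\<lambda>s. Y s *v g s)" by (rule ode_onI[OF i]) (simp add: w0, simp add: w_def)
  have wm[measurable]: "w \<in> borel_measurable (lebesgue_on {0..T})"
    by (intro continuous_on_measurable_lebesgue_on ode_on_continuous[OF w])
  show "ode_on T D (\<lambda>t. A t *v D t + g t)"
  proof (rule ode_on_cong[OF ode_on_bilinear[OF X w mv]])
    show "AE s in lebesgue_on {0..T}. (A s ** X s) *v w s + X s *v (Y s *v g s) = A s *v D s + g s"
      using XY D by (intro AE_I2) (auto simp: w_def matrix_vector_mul_assoc)
    show "X t *v w t = D t" if "t \<in> {0..T}" for t using D[OF that] by (simp add: w_def)
    have "(\<lambda>t. X t *v w t) \<in> borel_measurable (lebesgue_on {0..T})" by measurable
    then have [measurable]: "D \<in> borel_measurable (lebesgue_on {0..T})"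
      by (subst measurable_cong[where g="\<lambda>t. X t *v w t"]) (simp_all add: D w_def)
    show "(\<lambda>t. A t *v D t + g t) \<in> borel_measurable (lebesgue_on {0..T})" by measurable
  qed (rule T)
  show "D 0 = 0" using D[of 0] T w0 by (simp add: w_def)
qed

section \<open>Square integrability and independence\<close>

definition sq_integrable :: "'a measure \<Rightarrow> ('a \<Rightarrow> 'b::euclidean_space) \<Rightarrow> bool" where
  "sq_integrable M X \<longleftrightarrow> X \<in> borel_measurable M \<and> integrable M (\<lambda>\<omega>. (norm (X \<omega>))\<^sup>2)"

lemma sq_integrable_measurable [dest]: "sq_integrable M X \<Longrightarrow> X \<in> borel_measurable M"
  by (simp add: sq_integrable_def)

lemma sq_integrable_bound:
  assumes Y: "sq_integrable M Y" and X: "X \<in> borel_measurable M" and le: "AE \<omega> in M. norm (X \<omega>) \<le> C * norm (Y \<omega>)"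
  shows "sq_integrable M X"
  unfolding sq_integrable_def
proof
  show "integrable M (\<lambda>\<omega>. (norm (X \<omega>))\<^sup>2)"
  proof (rule Bochner_Integration.integrable_bound)
    show "integrable M (\<lambda>\<omega>. C\<^sup>2 * (norm (Y \<omega>))\<^sup>2)" using Y by (simp add: sq_integrable_def)
    show "AE \<omega> in M. norm ((norm (X \<omega>))\<^sup>2) \<le> norm (C\<^sup>2 * (norm (Y \<omega>))\<^sup>2)"
      using le
    proof eventually_elim
      case (elim \<omega>)
      then have "(norm (X \<omega>))\<^sup>2 \<le> (C * norm (Y \<omega>))\<^sup>2" by (rule power_mono) simp
      then show ?case by (simp add: power_mult_distrib)
    qed
  qed (use X in measurable)
qed (rule X)

lemma norm_add_sq_le: "(norm (x + y))\<^sup>2 \<le> 2 * (norm x)\<^sup>2 + 2 * (norm y)\<^sup>2" for x y :: "'a::real_normed_vector"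
proof -
  have "(norm (x + y))\<^sup>2 \<le> (norm x + norm y)\<^sup>2" by (intro power_mono norm_triangle_ineq) simp
  also have "\<dots> \<le> 2 * (norm x)\<^sup>2 + 2 * (norm y)\<^sup>2"
    using sum_squares_bound[of "norm x" "norm y"] by (simp add: power2_sum)
  finally show ?thesis .
qed

lemma sq_integrable_add:
  assumes X: "sq_integrable M X" and Y: "sq_integrable M Y"
  shows "sq_integrable M (\<lambda>\<omega>. X \<omega> + Y \<omega>)"
proof -
  note [measurable] = sq_integrable_measurable[OF X] sq_integrable_measurable[OF Y]
  show ?thesis
    unfolding sq_integrable_def
  proof
    show "integrable M (\<lambda>\<omega>. (norm (X \<omega> + Y \<omega>))\<^sup>2)"
    proof (rule Bochner_Integration.integrable_bound)
      show "integrable M (\<lambda>\<omega>. 2 * (norm (X \<omega>))\<^sup>2 + 2 * (norm (Y \<omega>))\<^sup>2)" using X Y by (simp add: sq_integrable_def)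
      show "AE \<omega> in M. norm ((norm (X \<omega> + Y \<omega>))\<^sup>2) \<le> norm (2 * (norm (X \<omega>))\<^sup>2 + 2 * (norm (Y \<omega>))\<^sup>2)"
        using norm_add_sq_le by (intro AE_I2) simp
    qed measurable
  qed measurable
qed

lemma sq_integrable_linear:
  fixes h :: "'b::euclidean_space \<Rightarrow> 'c::euclidean_space"
  assumes X: "sq_integrable M X" and h: "bounded_linear h"
  shows "sq_integrable M (\<lambda>\<omega>. h (X \<omega>))"
proof -
  obtain K where K: "\<And>x. norm (h x) \<le> norm x * K" using bounded_linear.bounded[OF h] by blast
  show ?thesis
  proof (rule sq_integrable_bound[OF X, where C=K])
    show "(\<lambda>\<omega>. h (X \<omega>)) \<in> borel_measurable M"
      using borel_measurable_continuous_on[OF bounded_linear.continuous_on[OF h continuous_on_id] sq_integrable_measurable[OF X]] .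
    show "AE \<omega> in M. norm (h (X \<omega>)) \<le> K * norm (X \<omega>)" using K by (intro AE_I2) (simp add: mult.commute)
  qed
qed

lemmas sq_integrable_minus = sq_integrable_linear[OF _ bounded_linear_minus[OF bounded_linear_ident]]
lemmas sq_integrable_mult = sq_integrable_linear[OF _ bounded_linear_mult_right]
lemmas sq_integrable_component = sq_integrable_linear[OF _ bounded_linear_vec_nth]
lemmas sq_integrable_matrix = sq_integrable_linear[OF _ bounded_bilinear.bounded_linear_right[OF bounded_bilinear_matrix_vector_mult]]

lemma sq_integrable_diff: "sq_integrable M X \<Longrightarrow> sq_integrable M Y \<Longrightarrow> sq_integrable M (\<lambda>\<omega>. X \<omega> - Y \<omega>)"
  using sq_integrable_add[OF _ sq_integrable_minus] by fastforce

lemma sq_integrable_sum: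
  assumes "\<And>i. i \<in> I \<Longrightarrow> sq_integrable M (X i)"
  shows "sq_integrable M (\<lambda>\<omega>. \<Sum>i\<in>I. X i \<omega>)"
  using assms
proof (induction I rule: infinite_finite_induct)
  case (insert x F)
  then show ?case using sq_integrable_add[of M "X x" "\<lambda>\<omega>. \<Sum>i\<in>F. X i \<omega>"] by simp
qed (auto simp: sq_integrable_def)

lemma sq_integrable_const: "finite_measure M \<Longrightarrow> sq_integrable M (\<lambda>\<omega>. c)"
  by (simp add: sq_integrable_def finite_measure.integrable_const)

lemma sq_integrable_bilinear:
  fixes b :: "'b::euclidean_space \<Rightarrow> 'c::euclidean_space \<Rightarrow> 'd::euclidean_space"
  assumes X: "sq_integrable M X" and Y: "sq_integrable M Y" and b: "bounded_bilinear b"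
  shows "integrable M (\<lambda>\<omega>. b (X \<omega>) (Y \<omega>))"
proof -
  obtain K where K: "\<And>x y. norm (b x y) \<le> norm x * norm y * K" "K \<ge> 0" using bounded_bilinear.nonneg_bounded[OF b] by blast
  show ?thesis
  proof (rule Bochner_Integration.integrable_bound)
    show "integrable M (\<lambda>\<omega>. ((norm (X \<omega>))\<^sup>2 + (norm (Y \<omega>))\<^sup>2) * K)" using X Y by (simp add: sq_integrable_def)
    show "(\<lambda>\<omega>. b (X \<omega>) (Y \<omega>)) \<in> borel_measurable M"
      using X Y by (intro borel_measurable_bilinear[OF b]) auto
    show "AE \<omega> in M. norm (b (X \<omega>) (Y \<omega>)) \<le> norm (((norm (X \<omega>))\<^sup>2 + (norm (Y \<omega>))\<^sup>2) * K)"
    proof (rule AE_I2)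
      fix \<omega>
      have "2 * (norm (X \<omega>) * norm (Y \<omega>)) \<le> (norm (X \<omega>))\<^sup>2 + (norm (Y \<omega>))\<^sup>2"
        using sum_squares_bound[of "norm (X \<omega>)" "norm (Y \<omega>)"] by simp
      moreover have "norm (X \<omega>) * norm (Y \<omega>) \<ge> 0" by simp
      ultimately have "norm (X \<omega>) * norm (Y \<omega>) \<le> (norm (X \<omega>))\<^sup>2 + (norm (Y \<omega>))\<^sup>2" by linarith
      then have "norm (X \<omega>) * norm (Y \<omega>) * K \<le> ((norm (X \<omega>))\<^sup>2 + (norm (Y \<omega>))\<^sup>2) * K"
        using K(2) by (rule mult_right_mono)
      then show "norm (b (X \<omega>) (Y \<omega>)) \<le> norm (((norm (X \<omega>))\<^sup>2 + (norm (Y \<omega>))\<^sup>2) * K)"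
        using order_trans[OF K(1)] K(2) by simp
    qed
  qed
qed

lemmas sq_integrable_imp_mult = sq_integrable_bilinear[OF _ _ bounded_bilinear_mult]
lemmas sq_integrable_imp_scaleR = sq_integrable_bilinear[OF _ _ bounded_bilinear_scaleR]
lemmas sq_integrable_imp_inner = sq_integrable_bilinear[OF _ _ bounded_bilinear_inner]

lemma sq_integrable_imp_integrable:
  fixes X :: "'a \<Rightarrow> 'b::euclidean_space"
  assumes "finite_measure M" "sq_integrable M X"
  shows "integrable M X"
  using sq_integrable_imp_scaleR[OF sq_integrable_const[OF assms(1), of "1::real"] assms(2)] by simp

lemma sq_integrable_nn:
  assumes "X \<in> borel_measurable M" "(\<integral>\<^sup>+\<omega>. ennreal ((norm (X \<omega>))\<^sup>2) \<partial>M) < \<infinity>"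
  shows "sq_integrable M X"
  using assms unfolding sq_integrable_def by (auto intro!: integrableI_bounded)

lemma sq_integrable_cong_AE:
  assumes "sq_integrable M X" "Y \<in> borel_measurable M" "AE \<omega> in M. X \<omega> = Y \<omega>"
  shows "sq_integrable M Y"
  by (rule sq_integrable_bound[OF assms(1,2), where C=1]) (use assms(3) in \<open>auto elim: eventually_mono\<close>)

text \<open>The weighted inequality \<open>2\<bar>xy\<bar> \<le> c x\<^sup>2 + y\<^sup>2 / c\<close> replaces Cauchy-Schwarz.\<close>

lemma sq_integrable_tendsto_mult:
  fixes X :: "nat \<Rightarrow> 'a \<Rightarrow> real"
  assumes X: "\<And>n. sq_integrable M (X n)" and Y: "sq_integrable M Y"
    and lim: "(\<lambda>n. \<integral>\<omega>. (X n \<omega>)\<^sup>2 \<partial>M) \<longlonglongrightarrow> 0"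
  shows "(\<lambda>n. \<integral>\<omega>. X n \<omega> * Y \<omega> \<partial>M) \<longlonglongrightarrow> 0"
proof (rule LIMSEQ_I)
  fix e :: real assume e: "e > 0"
  define y where "y = (\<integral>\<omega>. (Y \<omega>)\<^sup>2 \<partial>M)"
  have y0: "y \<ge> 0" unfolding y_def by (intro integral_nonneg_AE AE_I2) simp
  define c where "c = (y + 1) / e"
  have c: "c > 0" "y / c < e" using y0 e by (auto simp: c_def field_simps)
  have "eventually (\<lambda>n. norm ((\<integral>\<omega>. (X n \<omega>)\<^sup>2 \<partial>M) - 0) < e / c) sequentially"
    using tendstoD[OF lim, of "e / c"] c e by (simp add: dist_norm)
  then obtain n0 where n0: "\<And>n. n \<ge> n0 \<Longrightarrow> (\<integral>\<omega>. (X n \<omega>)\<^sup>2 \<partial>M) < e / c"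
    by (auto simp: eventually_sequentially)
  have "norm (\<integral>\<omega>. X n \<omega> * Y \<omega> \<partial>M) < e" if "n \<ge> n0" for n
  proof -
    have iX: "integrable M (\<lambda>\<omega>. (X n \<omega>)\<^sup>2)" and iY: "integrable M (\<lambda>\<omega>. (Y \<omega>)\<^sup>2)"
      using X[of n] Y by (auto simp: sq_integrable_def)
    have "norm (\<integral>\<omega>. X n \<omega> * Y \<omega> \<partial>M) \<le> (\<integral>\<omega>. (c * (X n \<omega>)\<^sup>2 + (Y \<omega>)\<^sup>2 / c) / 2 \<partial>M)"
    proof (rule order_trans[OF integral_norm_bound], rule integral_mono)
      show "integrable M (\<lambda>\<omega>. norm (X n \<omega> * Y \<omega>))" using sq_integrable_imp_mult[OF X Y] by simp
      show "integrable M (\<lambda>\<omega>. (c * (X n \<omega>)\<^sup>2 + (Y \<omega>)\<^sup>2 / c) / 2)" using iX iY by simp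
      fix \<omega>
      have "0 \<le> (c * \<bar>X n \<omega>\<bar> - \<bar>Y \<omega>\<bar>)\<^sup>2 / c" using c by simp
      also have "\<dots> = c * (X n \<omega>)\<^sup>2 + (Y \<omega>)\<^sup>2 / c - 2 * \<bar>X n \<omega> * Y \<omega>\<bar>"
        using c by (simp add: power2_diff field_simps power2_eq_square abs_mult)
      finally show "norm (X n \<omega> * Y \<omega>) \<le> (c * (X n \<omega>)\<^sup>2 + (Y \<omega>)\<^sup>2 / c) / 2" by simp
    qed
    also have "\<dots> = (c * (\<integral>\<omega>. (X n \<omega>)\<^sup>2 \<partial>M) + y / c) / 2" using iX iY by (simp add: y_def)
    also have "\<dots> < e"
    proof -
      have "c * (\<integral>\<omega>. (X n \<omega>)\<^sup>2 \<partial>M) < e" using n0[OF that] c by (simp add: field_simps)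
      then show ?thesis using c by simp
    qed
    finally show ?thesis .
  qed
  then show "\<exists>n0. \<forall>n\<ge>n0. norm ((\<integral>\<omega>. X n \<omega> * Y \<omega> \<partial>M) - 0) < e" by auto
qed

text \<open>Independence is given between whole \<sigma>-algebras; it restricts to those generated
  by \<open>X\<close> and \<open>Y\<close>, where the product formula for independent random
  variables applies.\<close>

lemma (in prob_space) expectation_mult_indep_set:
  fixes X Y :: "'a \<Rightarrow> real"
  assumes indep: "indep_set (sets M1) (sets M2)" and sp: "space M1 = space M" "space M2 = space M"
    and X: "X \<in> borel_measurable M1" and Y: "Y \<in> borel_measurable M2"
    and int: "integrable M X" "integrable M Y"
  shows "expectation (\<lambda>\<omega>. X \<omega> * Y \<omega>) = expectation X * expectation Y"
proof -
  have ev: "sets M1 \<subseteq> events" "sets M2 \<subseteq> events"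
    using indep by (auto simp: indep_set_def indep_sets_def split: bool.splits)
  have s1: "sigma_sets (space M) {X -` A \<inter> space M |A. A \<in> sets borel} \<subseteq> sets M1"
    using X unfolding measurable_iff_sets sp sets_vimage_algebra by simp
  have s2: "sigma_sets (space M) {Y -` A \<inter> space M |A. A \<in> sets borel} \<subseteq> sets M2"
    using Y unfolding measurable_iff_sets sp sets_vimage_algebra by simp
  have "indep_set (sigma_sets (space M) {X -` A \<inter> space M |A. A \<in> sets borel}) (sigma_sets (space M) {Y -` A \<inter> space M |A. A \<in> sets borel})"
    by (rule indep_setI) (use s1 s2 ev indep_setD[OF indep] in blast)+
  then have "indep_var borel X borel Y"
    using int by (auto simp: indep_var_eq)
  then show ?thesis by (rule indep_var_lebesgue_integral) (use int in auto)
qed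

section \<open>Moments of Gaussian vectors\<close>

lemma has_integral_prod_lborel_vec:
  fixes h :: "'d::finite \<Rightarrow> real \<Rightarrow> real"
  assumes "\<And>i. integrable lborel (h i)"
  shows "integrable lborel (\<lambda>x::real^'d. \<Prod>i\<in>UNIV. h i (x $ i))"
    and "(\<integral>x. (\<Prod>i\<in>UNIV. h i ((x::real^'d) $ i)) \<partial>lborel) = (\<Prod>i\<in>UNIV. integral\<^sup>L lborel (h i))"
proof -
  let ?P = "\<Pi>\<^sub>M b\<in>(Basis :: (real^'d) set). (lborel :: real measure)"
  let ?s = "\<lambda>f. \<Sum>b\<in>(Basis :: (real^'d) set). f b *\<^sub>R b"
  interpret product_sigma_finite "\<lambda>_. lborel :: real measure" ..
  have Basis: "(Basis :: (real^'d) set) = (\<lambda>i. axis i 1) ` UNIV" by (auto simp: Basis_vec_def)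
  have inj: "inj (\<lambda>i. axis i (1::real) :: real^'d)" by (auto simp: inj_on_def axis_eq_axis)
  \<comment> \<open>\<open>lborel\<close> on \<open>real^'d\<close> is the image of a product
    measure indexed by basis vectors, so the factors are reindexed along the bijection from
    \<open>i\<close> to \<open>axis i 1\<close>.\<close>
  define k where "k b = h (THE i. b = axis i (1::real))" for b
  have k: "k (axis i 1) = h i" for i by (simp add: k_def axis_eq_axis)
  have comp: "?s f $ i = f (axis i 1)" for f and i :: 'd
  proof -
    have "?s f $ i = (\<Sum>j\<in>UNIV. f (axis j 1) * (axis j 1 :: real^'d) $ i)"
      unfolding Basis by (simp add: sum.reindex[OF inj])
    also have "\<dots> = f (axis i 1)" by (simp add: axis_def if_distrib[of "(*) _"] cong: if_cong)
    finally show ?thesis .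
  qed
  have eq: "(\<Prod>i\<in>UNIV. h i (?s f $ i)) = (\<Prod>b\<in>(Basis :: (real^'d) set). k b (f b))" for f
    by (simp only: comp) (simp add: Basis prod.reindex[OF inj] k)
  have kint: "integrable lborel (k b)" if "b \<in> (Basis :: (real^'d) set)" for b
    using that assms by (auto simp: Basis k)
  have [measurable]: "h i \<in> borel_measurable borel" for i using borel_measurable_integrable[OF assms] by simp
  have m[measurable]: "(\<lambda>x::real^'d. \<Prod>i\<in>UNIV. h i (x $ i)) \<in> borel_measurable borel" by measurable
  have ms[measurable]: "?s \<in> measurable ?P borel" by measurable
  show "integrable lborel (\<lambda>x::real^'d. \<Prod>i\<in>UNIV. h i (x $ i))"
    unfolding lborel_eq[where 'a="real^'d"]
    using product_integrable_prod[of "Basis :: (real^'d) set" k] kint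
    by (subst integrable_distr_eq[OF ms m]) (simp add: eq del: sum_component)
  have "(\<integral>x. (\<Prod>i\<in>UNIV. h i ((x::real^'d) $ i)) \<partial>lborel) = (\<integral>f. (\<Prod>b\<in>(Basis :: (real^'d) set). k b (f b)) \<partial>?P)"
    unfolding lborel_eq[where 'a="real^'d"]
    by (subst integral_distr[OF ms m]) (simp add: eq del: sum_component)
  also have "\<dots> = (\<Prod>b\<in>(Basis :: (real^'d) set). integral\<^sup>L lborel (k b))"
    by (rule product_integral_prod) (use kint in auto)
  also have "\<dots> = (\<Prod>i\<in>UNIV. integral\<^sup>L lborel (h i))"
    unfolding Basis by (simp add: prod.reindex[OF inj] k)
  finally show "(\<integral>x. (\<Prod>i\<in>UNIV. h i ((x::real^'d) $ i)) \<partial>lborel) = (\<Prod>i\<in>UNIV. integral\<^sup>L lborel (h i))" .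
qed

lemma normal_density_second_moment:
  "\<sigma> > 0 \<Longrightarrow> has_bochner_integral lborel (\<lambda>x. normal_density 0 \<sigma> x * x\<^sup>2) (\<sigma>\<^sup>2)"
  using normal_moment_even[of \<sigma> 0 1] by (simp add: power2_eq_square mult_ac)

text \<open>All four claims come from one formula: the expectation of a product of functions of the
  separate coordinates is a product of one-dimensional Gaussian integrals.\<close>

lemma normal_vec_moments:
  fixes D :: "'w \<Rightarrow> real^'d"
  assumes D: "distributed P lborel D (\<lambda>x. ennreal (\<Prod>i\<in>UNIV. normal_density 0 \<sigma> (x $ i)))" and \<sigma>: "\<sigma> > 0"
  shows "integrable P (\<lambda>\<omega>. D \<omega> $ i)" "(\<integral>\<omega>. D \<omega> $ i \<partial>P) = 0"
    "integrable P (\<lambda>\<omega>. D \<omega> $ i * D \<omega> $ j)" "(\<integral>\<omega>. D \<omega> $ i * D \<omega> $ j \<partial>P) = (if i = j then \<sigma>\<^sup>2 else 0)"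
proof -
  have int: "integrable P (\<lambda>\<omega>. \<Prod>l\<in>UNIV. g l (D \<omega> $ l)) \<and>
      (\<integral>\<omega>. (\<Prod>l\<in>UNIV. g l (D \<omega> $ l)) \<partial>P) = (\<Prod>l\<in>UNIV. \<integral>x. normal_density 0 \<sigma> x * g l x \<partial>lborel)"
    if g: "\<And>l. g l \<in> borel_measurable borel" "\<And>l. integrable lborel (\<lambda>x. normal_density 0 \<sigma> x * g l x)" for g :: "'d \<Rightarrow> real \<Rightarrow> real"
  proof -
    have [measurable]: "(\<lambda>x::real^'d. \<Prod>l\<in>UNIV. g l (x $ l)) \<in> borel_measurable lborel" using g(1) by measurable
    have nn: "0 \<le> (\<Prod>i\<in>UNIV. normal_density 0 \<sigma> (x $ i))" for x :: "real^'d" by (intro prod_nonneg) simp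
    have eq: "(\<Prod>i\<in>UNIV. normal_density 0 \<sigma> (x $ i)) * (\<Prod>l\<in>UNIV. g l (x $ l)) =
        (\<Prod>l\<in>UNIV. normal_density 0 \<sigma> (x $ l) * g l (x $ l))" for x :: "real^'d" by (simp add: prod.distrib)
    show ?thesis
      using has_integral_prod_lborel_vec[of "\<lambda>l x. normal_density 0 \<sigma> x * g l x", OF g(2)]
        distributed_integrable[OF D, of "\<lambda>x. \<Prod>l\<in>UNIV. g l (x $ l)"]
        distributed_integral[OF D, of "\<lambda>x. \<Prod>l\<in>UNIV. g l (x $ l)"] nn
      by (simp add: eq)
  qed
  \<comment> \<open>With \<open>e i\<close> the product over all coordinates is just coordinate
    \<open>i\<close>; the pointwise product of \<open>e i\<close> and \<open>e j\<close> gives the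
    mixed second moment, a square arising in the factor \<open>l = i\<close> when
    \<open>i = j\<close>.\<close>
  define e where "e i l x = (if l = i then x else 1 :: real)" for i l :: 'd and x :: real
  have [measurable]: "e i l \<in> borel_measurable borel" for i l unfolding e_def by measurable
  have e: "(\<Prod>l\<in>UNIV. e i l (x $ l)) = x $ i" for i and x :: "real^'d"
    unfolding e_def by (simp add: prod.delta)
  have ie: "integrable lborel (\<lambda>x. normal_density 0 \<sigma> x * e i l x)" "(\<integral>x. normal_density 0 \<sigma> x * e i l x \<partial>lborel) = (if l = i then 0 else 1)" for i l
    using integrable_normal_moment_nz_1[OF \<sigma>, of 0] integral_normal_moment_nz_1[OF \<sigma>, of 0]
      integrable_normal_density[OF \<sigma>, of 0] integral_normal_density[OF \<sigma>, of 0]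
    by (cases "l = i"; simp add: e_def)+
  have "integrable P (\<lambda>\<omega>. \<Prod>l\<in>UNIV. e i l (D \<omega> $ l)) \<and>
      (\<integral>\<omega>. (\<Prod>l\<in>UNIV. e i l (D \<omega> $ l)) \<partial>P) = (\<Prod>l\<in>UNIV. \<integral>x. normal_density 0 \<sigma> x * e i l x \<partial>lborel)"
    by (rule int) (use ie in auto)
  then show "integrable P (\<lambda>\<omega>. D \<omega> $ i)" "(\<integral>\<omega>. D \<omega> $ i \<partial>P) = 0"
    by (simp_all add: e ie prod_zero_iff)
  have iee: "integrable lborel (\<lambda>x. normal_density 0 \<sigma> x * (e i l x * e j l x))"
    "(\<integral>x. normal_density 0 \<sigma> x * (e i l x * e j l x) \<partial>lborel) = (if l = i then if l = j then \<sigma>\<^sup>2 else 0 else if l = j then 0 else 1)" for i j l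
    using ie[of i l] ie[of j l] has_bochner_integral_integrable normal_density_second_moment[OF \<sigma>]
      integrable_normal_density[OF \<sigma>, of 0] integral_normal_density[OF \<sigma>, of 0]
    by (cases "l = i"; cases "l = j"; simp add: e_def has_bochner_integral_iff power2_eq_square)+
  have "integrable P (\<lambda>\<omega>. \<Prod>l\<in>UNIV. e i l (D \<omega> $ l) * e j l (D \<omega> $ l)) \<and>
      (\<integral>\<omega>. (\<Prod>l\<in>UNIV. e i l (D \<omega> $ l) * e j l (D \<omega> $ l)) \<partial>P) = (\<Prod>l\<in>UNIV. \<integral>x. normal_density 0 \<sigma> x * (e i l x * e j l x) \<partial>lborel)"
    by (rule int) (use iee in auto)
  then have *: "integrable P (\<lambda>\<omega>. D \<omega> $ i * D \<omega> $ j)"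
    "(\<integral>\<omega>. D \<omega> $ i * D \<omega> $ j \<partial>P) = (\<Prod>l\<in>UNIV. (if l = i then if l = j then \<sigma>\<^sup>2 else 0 else if l = j then 0 else 1))"
    by (simp_all add: e iee prod.distrib)
  show "integrable P (\<lambda>\<omega>. D \<omega> $ i * D \<omega> $ j)" by (rule *)
  show "(\<integral>\<omega>. D \<omega> $ i * D \<omega> $ j \<partial>P) = (if i = j then \<sigma>\<^sup>2 else 0)"
  proof (cases "i = j")
    case True
    have "(\<Prod>l\<in>UNIV. (if l = i then if l = j then \<sigma>\<^sup>2 else 0 else if l = j then 0 else 1)) = (\<Prod>l\<in>UNIV. if l = i then \<sigma>\<^sup>2 else 1)"
      using True by (intro prod.cong) auto
    then show ?thesis using * True by (simp add: prod.delta)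
  next
    case False
    have "(\<Prod>l\<in>UNIV. (if l = i then if l = j then \<sigma>\<^sup>2 else 0 else if l = j then 0 else (1::real))) = 0"
      using False by (intro prod_zero) auto
    then show ?thesis using * False by simp
  qed
qed

lemma sq_integrable_vecI:
  fixes D :: "'w \<Rightarrow> real^'d"
  assumes "D \<in> borel_measurable P" "\<And>i. integrable P (\<lambda>\<omega>. D \<omega> $ i * D \<omega> $ i)"
  shows "sq_integrable P D"
  using assms by (simp add: sq_integrable_def power2_norm_eq_inner inner_vec_def)

section \<open>Brownian increments and the stochastic integral\<close>

lemma borel_measurable_component:
  fixes X :: "'a \<Rightarrow> real^'n"
  shows "X \<in> borel_measurable M \<Longrightarrow> (\<lambda>\<omega>. X \<omega> $ i) \<in> borel_measurable M"
  using borel_measurable_continuous_on[OF bounded_linear.continuous_on[OF bounded_linear_vec_nth continuous_on_id]] .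

lemma integral_sum_sum:
  fixes f :: "'i \<Rightarrow> 'j \<Rightarrow> 'a \<Rightarrow> real"
  assumes "\<And>i j. i \<in> I \<Longrightarrow> j \<in> J \<Longrightarrow> integrable M (f i j)"
  shows "(\<integral>x. (\<Sum>i\<in>I. \<Sum>j\<in>J. f i j x) \<partial>M) = (\<Sum>i\<in>I. \<Sum>j\<in>J. integral\<^sup>L M (f i j))"
proof -
  have "(\<integral>x. (\<Sum>i\<in>I. \<Sum>j\<in>J. f i j x) \<partial>M) = (\<Sum>i\<in>I. \<integral>x. (\<Sum>j\<in>J. f i j x) \<partial>M)"
    by (intro Bochner_Integration.integral_sum Bochner_Integration.integrable_sum assms)
  also have "\<dots> = (\<Sum>i\<in>I. \<Sum>j\<in>J. integral\<^sup>L M (f i j))"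
    by (intro sum.cong refl Bochner_Integration.integral_sum assms)
  finally show ?thesis .
qed

locale noise = prob_space P for P :: "'w measure" +
  fixes T :: real and F :: "real \<Rightarrow> 'w measure" and W :: "real \<Rightarrow> 'w \<Rightarrow> real^'d" and \<xi> :: "'w \<Rightarrow> real^'d"
  assumes T: "T > 0" and usual: "usual_conditions T P F" and bm: "brownian_motion T P F W"
    and \<xi>_F0: "\<xi> \<in> borel_measurable (F 0)" and \<xi>_sq: "integrable P (\<lambda>\<omega>. (norm (\<xi> \<omega>))\<^sup>2)"
begin

lemma space_F [simp]: "space (F t) = space P"
  using usual filtration.space_F by (auto simp: usual_conditions_def)

lemma sets_F_mono: "s \<le> t \<Longrightarrow> sets (F s) \<subseteq> sets (F t)"
proof -
  have "filtration (space P) F" using usual by (simp add: usual_conditions_def)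
  then show "s \<le> t \<Longrightarrow> sets (F s) \<subseteq> sets (F t)" by (rule filtration.sets_F_mono)
qed

lemma sets_F_P: "t \<in> {0..T} \<Longrightarrow> sets (F t) \<subseteq> sets P"
  using usual by (auto simp: usual_conditions_def subalgebra_def)

lemma null_sets_F: "t \<ge> 0 \<Longrightarrow> null_sets P \<subseteq> sets (F t)"
  using usual sets_F_mono[of 0 t] by (auto simp: usual_conditions_def)

lemma measurable_F_mono: "X \<in> measurable (F s) N \<Longrightarrow> s \<le> t \<Longrightarrow> X \<in> measurable (F t) N"
  using sets_F_mono[of s t] by (auto simp: measurable_def)

lemma measurable_F_P: "X \<in> measurable (F s) N \<Longrightarrow> s \<in> {0..T} \<Longrightarrow> X \<in> measurable P N"
  using sets_F_P[of s] by (auto simp: measurable_def)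

lemma AE_in_null_sets:
  assumes "AE \<omega> in P. Q \<omega>"
  shows "{\<omega> \<in> space P. \<not> Q \<omega>} \<in> null_sets P"
proof -
  interpret complete_measure P using usual by (simp add: usual_conditions_def)
  from assms obtain N where "{\<omega> \<in> space P. \<not> Q \<omega>} \<subseteq> N" "N \<in> null_sets P" by (auto elim!: AE_E)
  then show ?thesis by (meson complete2)
qed

text \<open>By completeness every subset of the exceptional set belongs to \<open>G\<close>, so
  almost sure modifications preserve adaptedness. Paths that are continuous only almost surely are
  repaired in this way.\<close>

lemma measurable_AE_cong_null:
  fixes X Y :: "'w \<Rightarrow> 'b::euclidean_space"
  assumes X: "X \<in> borel_measurable G" and G: "space G = space P" "null_sets P \<subseteq> sets G"
    and eq: "AE \<omega> in P. X \<omega> = Y \<omega>"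
  shows "Y \<in> borel_measurable G"
proof (rule borel_measurableI)
  fix S :: "'b set" assume "open S"
  interpret complete_measure P using usual by (simp add: usual_conditions_def)
  define N where "N = {\<omega> \<in> space P. X \<omega> \<noteq> Y \<omega>}"
  have N: "N \<in> null_sets P" using AE_in_null_sets[OF eq] by (simp add: N_def)
  have "Y -` S \<inter> N \<in> null_sets P" by (rule complete2[OF _ N]) auto
  then have "Y -` S \<inter> N \<in> sets G" using G by blast
  moreover have "X -` S \<inter> space G \<in> sets G" using X \<open>open S\<close> by (auto intro: measurable_sets)
  moreover have "Y -` S \<inter> space G = (X -` S \<inter> space G - N) \<union> (Y -` S \<inter> N)"
    using G by (auto simp: N_def)
  ultimately show "Y -` S \<inter> space G \<in> sets G" using N G by auto
qed

lemma sq_\<xi>: "sq_integrable P \<xi>"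
  using measurable_F_P[OF \<xi>_F0] T \<xi>_sq by (simp add: sq_integrable_def)

lemma W_F: "t \<in> {0..T} \<Longrightarrow> W t \<in> borel_measurable (F t)"
  using bm by (simp add: brownian_motion_def)

lemma W_P: "t \<in> {0..T} \<Longrightarrow> W t \<in> borel_measurable P"
  using measurable_F_P[OF W_F] by simp

lemma increment_distributed:
  assumes "0 \<le> s" "s < t" "t \<le> T"
  shows "distributed P lborel (\<lambda>\<omega>. W t \<omega> - W s \<omega>) (\<lambda>x. ennreal (\<Prod>i\<in>UNIV. normal_density 0 (sqrt (t - s)) (x $ i)))"
    "indep_set (sets (F s)) (sets (vimage_algebra (space P) (\<lambda>\<omega>. W t \<omega> - W s \<omega>) borel))"
  using bm assms by (auto simp: brownian_motion_def)

lemma increment_measurable: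
  assumes "0 \<le> s" "s \<le> t" "t \<le> T"
  shows "(\<lambda>\<omega>. W t \<omega> - W s \<omega>) \<in> borel_measurable P"
  using W_P[of s] W_P[of t] assms by auto

lemma increment_moments:
  assumes "0 \<le> s" "s \<le> t" "t \<le> T"
  shows "expectation (\<lambda>\<omega>. (W t \<omega> - W s \<omega>) $ i) = 0"
    "expectation (\<lambda>\<omega>. (W t \<omega> - W s \<omega>) $ i * (W t \<omega> - W s \<omega>) $ j) = (if i = j then t - s else 0)"
    "sq_integrable P (\<lambda>\<omega>. W t \<omega> - W s \<omega>)"
proof -
  have "expectation (\<lambda>\<omega>. (W t \<omega> - W s \<omega>) $ i) = 0 \<and>
    expectation (\<lambda>\<omega>. (W t \<omega> - W s \<omega>) $ i * (W t \<omega> - W s \<omega>) $ j) = (if i = j then t - s else 0) \<and>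
    sq_integrable P (\<lambda>\<omega>. W t \<omega> - W s \<omega>)"
  proof (cases "s = t")
    case True
    then show ?thesis by (simp add: sq_integrable_def)
  next
    case False
    then have "s < t" using assms by simp
    note d = normal_vec_moments[OF increment_distributed(1)[OF assms(1) this assms(3)]]
    show ?thesis
      using d(2)[of i] d(4)[of i j] d(3) increment_measurable[OF assms] \<open>s < t\<close> by (auto intro!: sq_integrable_vecI)
  qed
  then show "expectation (\<lambda>\<omega>. (W t \<omega> - W s \<omega>) $ i) = 0"
    "expectation (\<lambda>\<omega>. (W t \<omega> - W s \<omega>) $ i * (W t \<omega> - W s \<omega>) $ j) = (if i = j then t - s else 0)"
    "sq_integrable P (\<lambda>\<omega>. W t \<omega> - W s \<omega>)" by auto
qed

lemma increment_orth:
  fixes Y :: "'w \<Rightarrow> real"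
  assumes "0 \<le> s" "s \<le> t" "t \<le> T" and Y: "Y \<in> borel_measurable (F s)" "integrable P Y"
  shows "expectation (\<lambda>\<omega>. (W t \<omega> - W s \<omega>) $ i * Y \<omega>) = 0"
proof (cases "s = t")
  case False
  then have "s < t" using assms by simp
  let ?V = "vimage_algebra (space P) (\<lambda>\<omega>. W t \<omega> - W s \<omega>) borel"
  have V: "(\<lambda>\<omega>. W t \<omega> - W s \<omega>) \<in> measurable ?V borel" by (rule measurable_vimage_algebra1) simp
  have "(\<lambda>\<omega>. (W t \<omega> - W s \<omega>) $ i) \<in> borel_measurable ?V"
    by (rule borel_measurable_component[OF V])
  moreover have "integrable P (\<lambda>\<omega>. (W t \<omega> - W s \<omega>) $ i)"
    by (rule sq_integrable_imp_integrable[OF finite_measure_axioms sq_integrable_component[OF increment_moments(3)[OF assms(1-3)]]])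
  ultimately have "expectation (\<lambda>\<omega>. Y \<omega> * (W t \<omega> - W s \<omega>) $ i) = expectation Y * expectation (\<lambda>\<omega>. (W t \<omega> - W s \<omega>) $ i)"
    using increment_distributed(2)[OF assms(1) \<open>s < t\<close> assms(3)] Y
    by (intro expectation_mult_indep_set[of "F s" ?V]) auto
  then show ?thesis using increment_moments(1)[OF assms(1-3)] by (simp add: mult.commute)
qed simp

text \<open>Increments are counted from \<open>W 0\<close>, because \<open>W 0 = 0\<close> holds
  only almost surely. The increment after \<open>s\<close> is orthogonal to the past, so only the
  variance up to \<open>s\<close> remains.\<close>

lemma covariance_ordered:
  assumes "0 \<le> s" "s \<le> t" "t \<le> T"
  shows "expectation (\<lambda>\<omega>. (W s \<omega> - W 0 \<omega>) $ i * (W t \<omega> - W 0 \<omega>) $ j) = (if i = j then s else 0)"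
proof -
  have Vs: "sq_integrable P (\<lambda>\<omega>. W s \<omega> - W 0 \<omega>)" using increment_moments(3)[of 0 s] assms by simp
  have Vst: "sq_integrable P (\<lambda>\<omega>. W t \<omega> - W s \<omega>)" using increment_moments(3)[of s t] assms by simp
  have m: "(\<lambda>\<omega>. (W s \<omega> - W 0 \<omega>) $ i) \<in> borel_measurable (F s)"
    using W_F[of s] measurable_F_mono[OF W_F[of 0], of s] assms
    by (intro borel_measurable_component borel_measurable_diff) auto
  have i1: "integrable P (\<lambda>\<omega>. (W s \<omega> - W 0 \<omega>) $ i * (W s \<omega> - W 0 \<omega>) $ j)"
    and i2: "integrable P (\<lambda>\<omega>. (W t \<omega> - W s \<omega>) $ j * (W s \<omega> - W 0 \<omega>) $ i)"
    by (intro sq_integrable_imp_mult sq_integrable_component Vs Vst)+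
  have "expectation (\<lambda>\<omega>. (W s \<omega> - W 0 \<omega>) $ i * (W t \<omega> - W 0 \<omega>) $ j) =
    expectation (\<lambda>\<omega>. (W s \<omega> - W 0 \<omega>) $ i * (W s \<omega> - W 0 \<omega>) $ j + (W t \<omega> - W s \<omega>) $ j * (W s \<omega> - W 0 \<omega>) $ i)"
    by (intro Bochner_Integration.integral_cong refl) (simp add: algebra_simps)
  also have "\<dots> = (if i = j then s else 0) + 0"
    using i1 i2 increment_moments(2)[of 0 s i j] assms
      increment_orth[OF assms m sq_integrable_imp_integrable[OF finite_measure_axioms sq_integrable_component[OF Vs]], of j]
    by simp
  finally show ?thesis by simp
qed

text \<open>Bilinear expansion of the covariance \<open>min s t\<close>. The length of an overlap of
  half-open intervals is the form in which the isometry for step functions sums these terms.\<close>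

lemma increment_covariance:
  assumes ab: "0 \<le> a" "a \<le> b" "b \<le> T" and cd: "0 \<le> c" "c \<le> d" "d \<le> T"
  shows "expectation (\<lambda>\<omega>. (W b \<omega> - W a \<omega>) $ i * (W d \<omega> - W c \<omega>) $ j) =
    (if i = j then measure lborel ({a<..b} \<inter> {c<..d}) else 0)"
proof -
  define V where "V t \<omega> = W t \<omega> - W 0 \<omega>" for t \<omega>
  have V: "sq_integrable P (V t)" if "t \<in> {0..T}" for t
    using increment_moments(3)[of 0 t] that by (simp add: V_def[abs_def])
  have cov: "expectation (\<lambda>\<omega>. V s \<omega> $ i * V t \<omega> $ j) = (if i = j then min s t else 0)" if "s \<in> {0..T}" "t \<in> {0..T}" for s t
  proof (cases "s \<le> t")
    case True
    then show ?thesis using covariance_ordered[of s t i j] that by (simp add: V_def)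
  next
    case False
    then show ?thesis using covariance_ordered[of t s j i] that by (auto simp: V_def mult.commute)
  qed
  have int: "integrable P (\<lambda>\<omega>. V s \<omega> $ i * V t \<omega> $ j)" if "s \<in> {0..T}" "t \<in> {0..T}" for s t
    using that by (intro sq_integrable_imp_mult sq_integrable_component V)
  have in_T: "a \<in> {0..T}" "b \<in> {0..T}" "c \<in> {0..T}" "d \<in> {0..T}" using ab cd by auto
  have "expectation (\<lambda>\<omega>. (W b \<omega> - W a \<omega>) $ i * (W d \<omega> - W c \<omega>) $ j) =
    expectation (\<lambda>\<omega>. V b \<omega> $ i * V d \<omega> $ j - V b \<omega> $ i * V c \<omega> $ j - (V a \<omega> $ i * V d \<omega> $ j - V a \<omega> $ i * V c \<omega> $ j))"
    by (intro Bochner_Integration.integral_cong refl) (simp add: V_def algebra_simps)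
  also have "\<dots> = (if i = j then min b d - min b c - (min a d - min a c) else 0)"
    using in_T by (simp add: int cov)
  also have "min b d - min b c - (min a d - min a c) = measure lborel ({a<..b} \<inter> {c<..d})"
  proof -
    have "{a<..b} \<inter> {c<..d} = {max a c<..min b d}" by auto
    then show ?thesis using ab cd by (cases "max a c \<le> min b d") (auto simp: min_def max_def split: if_splits)
  qed
  finally show ?thesis by simp
qed

section \<open>Integrals of step functions: orthogonality and isometry\<close>

definition grid :: "nat \<Rightarrow> (nat \<Rightarrow> real) \<Rightarrow> bool" where
  "grid n p \<longleftrightarrow> 0 \<le> p 0 \<and> p n \<le> T \<and> (\<forall>i<n. p i \<le> p (Suc i))"

lemma grid_bounds:
  assumes "grid n p" "i \<le> n"
  shows "0 \<le> p i" "p i \<le> T"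
proof -
  have mono: "p i \<le> p j" if "i \<le> j" "j \<le> n" for i j
    using that(1,2)
  proof (induction j rule: dec_induct)
    case (step j)
    then have "p j \<le> p (Suc j)" using assms by (auto simp: grid_def)
    then show ?case using step by simp
  qed simp
  show "0 \<le> p i" using mono[of 0 i] assms by (auto simp: grid_def)
  show "p i \<le> T" using mono[of i n] assms by (auto simp: grid_def)
qed

lemma grid_increment:
  assumes "grid n p" "i < n" "0 \<le> s" "s \<le> t" "t \<le> T"
  shows "s \<le> max s (min t (p i))" "max s (min t (p i)) \<le> max s (min t (p (Suc i)))" "max s (min t (p (Suc i))) \<le> t"
  using assms by (auto simp: grid_def intro: max.mono min.mono)

lemma step_integral_sq:
  assumes "grid n p" "t \<in> {0..T}"
  shows "sq_integrable P (step_integral W n p c t)"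
  unfolding step_integral_def
proof (rule sq_integrable_sum)
  fix i assume "i \<in> {..<n}"
  then show "sq_integrable P (\<lambda>\<omega>. c i *v (W (min t (p (Suc i))) \<omega> - W (min t (p i)) \<omega>))"
    using assms grid_bounds[OF assms(1), of i] grid_bounds[OF assms(1), of "Suc i"]
    by (intro sq_integrable_matrix increment_moments(3)) (auto simp: grid_def intro: min.mono)
qed

text \<open>The hypothesis \<open>orth\<close> concerns only Brownian increments between
  \<open>s\<close> and \<open>t\<close>. It thus covers three kinds of factors: those measurable for
  \<open>F s\<close>, those independent of the noise, and residuals of a projection onto the
  past.\<close>

lemma step_integral_orth:
  fixes Y :: "'w \<Rightarrow> real"
  assumes g: "grid n p" and st: "0 \<le> s" "s \<le> t" "t \<le> T" and Y: "sq_integrable P Y"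
    and orth: "\<And>a b k. s \<le> a \<Longrightarrow> a \<le> b \<Longrightarrow> b \<le> t \<Longrightarrow> expectation (\<lambda>\<omega>. (W b \<omega> - W a \<omega>) $ k * Y \<omega>) = 0"
  shows "expectation (\<lambda>\<omega>. (step_integral W n p c t \<omega> - step_integral W n p c s \<omega>) $ j * Y \<omega>) = 0"
proof -
  \<comment> \<open>Grid points clamped to \<open>{s..t}\<close>: the increment of a step integral
    between \<open>s\<close> and \<open>t\<close> is again a sum over the grid, in which degenerate
    intervals contribute zero.\<close>
  let ?b = "\<lambda>i. max s (min t (p (Suc i)))" and ?a = "\<lambda>i. max s (min t (p i))"
  have eq: "step_integral W n p c t \<omega> - step_integral W n p c s \<omega> = (\<Sum>i<n. c i *v (W (?b i) \<omega> - W (?a i) \<omega>))" for \<omega>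
  proof -
    have "W (min t x) \<omega> - W (min s x) \<omega> = W (max s (min t x)) \<omega> - W s \<omega>" for x
      using st by (auto simp: min_def max_def)
    note e = this
    have *: "W (min t y) \<omega> - W (min t x) \<omega> - (W (min s y) \<omega> - W (min s x) \<omega>) = W (max s (min t y)) \<omega> - W (max s (min t x)) \<omega>" for x y
    proof -
      have "W (min t y) \<omega> - W (min t x) \<omega> - (W (min s y) \<omega> - W (min s x) \<omega>) =
        (W (min t y) \<omega> - W (min s y) \<omega>) - (W (min t x) \<omega> - W (min s x) \<omega>)" by simp
      then show ?thesis unfolding e by simp
    qed
    show ?thesis
      unfolding step_integral_def sum_subtractf[symmetric]
      by (intro sum.cong refl) (simp only: matrix_vector_mult_diff_distrib[symmetric] *)
  qed
  have int: "integrable P (\<lambda>\<omega>. (W (?b i) \<omega> - W (?a i) \<omega>) $ k * Y \<omega>)" if "i < n" for i k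
    using grid_increment[OF g that st] st
    by (intro sq_integrable_imp_mult sq_integrable_component increment_moments(3) Y) auto
  have "expectation (\<lambda>\<omega>. (step_integral W n p c t \<omega> - step_integral W n p c s \<omega>) $ j * Y \<omega>) =
    expectation (\<lambda>\<omega>. \<Sum>i<n. \<Sum>k\<in>UNIV. c i $ j $ k * ((W (?b i) \<omega> - W (?a i) \<omega>) $ k * Y \<omega>))"
    unfolding eq
    by (intro Bochner_Integration.integral_cong refl)
      (simp add: matrix_vector_mult_def sum_distrib_right mult.assoc)
  also have "\<dots> = (\<Sum>i<n. \<Sum>k\<in>UNIV. c i $ j $ k * expectation (\<lambda>\<omega>. (W (?b i) \<omega> - W (?a i) \<omega>) $ k * Y \<omega>))"
    using int by (simp add: Bochner_Integration.integral_sum Bochner_Integration.integrable_sum del: vector_minus_component)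
  also have "\<dots> = 0"
    using grid_increment[OF g _ st] orth by (intro sum.neutral ballI) (simp del: vector_minus_component)
  finally show ?thesis .
qed

text \<open>Polarised isometry on two different grids, because two integrals of the same
  \<open>\<sigma>\<close> come with unrelated approximating sequences.\<close>

lemma step_isometry:
  assumes g: "grid n p" and g': "grid n' p'" and t: "t \<in> {0..T}"
  shows "expectation (\<lambda>\<omega>. step_integral W n p c t \<omega> \<bullet> step_integral W n' p' c' t \<omega>) =
    (\<integral>s. step_fun n p c s \<bullet> step_fun n' p' c' s \<partial>lebesgue_on {0..t})"
proof -
  define D where "D q i \<omega> = W (min t (q (Suc i))) \<omega> - W (min t (q i)) \<omega>" for q :: "nat \<Rightarrow> real" and i \<omega>
  define J where "J q i = {q i<..q (Suc i)}" for q :: "nat \<Rightarrow> real" and i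
  have D: "sq_integrable P (D q i)" if "grid m q" "i < m" for m q i
    unfolding D_def using that t grid_bounds[OF that(1), of i] grid_bounds[OF that(1), of "Suc i"]
    by (intro increment_moments(3)) (auto simp: grid_def intro: min.mono)
  have cov: "expectation (\<lambda>\<omega>. D p i \<omega> $ l * D p' i' \<omega> $ k) = (if l = k then measure lborel (J p i \<inter> J p' i' \<inter> {0..t}) else 0)"
    if "i < n" "i' < n'" for i i' l k
  proof -
    \<comment> \<open>For half-open intervals, clamping the endpoints at \<open>t\<close> amounts to
      intersecting with \<open>{0..t}\<close>, since no grid point is negative.\<close>
    have "{min t (p i)<..min t (p (Suc i))} \<inter> {min t (p' i')<..min t (p' (Suc i'))} = J p i \<inter> J p' i' \<inter> {0..t}"
      using grid_bounds[OF g, of i] that by (auto simp: J_def)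
    then show ?thesis
      unfolding D_def using that t grid_bounds[OF g, of i] grid_bounds[OF g, of "Suc i"] grid_bounds[OF g', of i'] grid_bounds[OF g', of "Suc i'"] g g'
      by (subst increment_covariance) (auto simp: grid_def intro: min.mono)
  qed
  have inner_mv: "(C *v x) \<bullet> (C' *v y) = (\<Sum>m\<in>UNIV. \<Sum>l\<in>UNIV. \<Sum>k\<in>UNIV. C $ m $ l * C' $ m $ k * (x $ l * y $ k))"
    for C C' :: "real^'d^'d" and x y
    by (simp add: inner_vec_def matrix_vector_mult_def sum_product mult_ac)
  have E: "expectation (\<lambda>\<omega>. (C *v D p i \<omega>) \<bullet> (C' *v D p' i' \<omega>)) = (C \<bullet> C') * measure lborel (J p i \<inter> J p' i' \<inter> {0..t})"
    if i: "i < n" "i' < n'" for i i' and C C' :: "real^'d^'d"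
  proof -
    have int: "integrable P (\<lambda>\<omega>. D p i \<omega> $ l * D p' i' \<omega> $ k)" for l k
      by (intro sq_integrable_imp_mult sq_integrable_component D[OF g i(1)] D[OF g' i(2)])
    have "expectation (\<lambda>\<omega>. (C *v D p i \<omega>) \<bullet> (C' *v D p' i' \<omega>)) =
      expectation (\<lambda>\<omega>. \<Sum>m\<in>UNIV. \<Sum>l\<in>UNIV. \<Sum>k\<in>UNIV. C $ m $ l * C' $ m $ k * (D p i \<omega> $ l * D p' i' \<omega> $ k))"
      by (intro Bochner_Integration.integral_cong refl inner_mv)
    also have "\<dots> = (\<Sum>m\<in>UNIV. \<Sum>l\<in>UNIV. expectation (\<lambda>\<omega>. \<Sum>k\<in>UNIV. C $ m $ l * C' $ m $ k * (D p i \<omega> $ l * D p' i' \<omega> $ k)))"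
      by (intro integral_sum_sum Bochner_Integration.integrable_sum integrable_mult_right int)
    also have "\<dots> = (\<Sum>m\<in>UNIV. \<Sum>l\<in>UNIV. \<Sum>k\<in>UNIV. C $ m $ l * C' $ m $ k * expectation (\<lambda>\<omega>. D p i \<omega> $ l * D p' i' \<omega> $ k))"
      using int by (simp add: Bochner_Integration.integral_sum)
    also have "\<dots> = (\<Sum>m\<in>UNIV. \<Sum>l\<in>UNIV. C $ m $ l * C' $ m $ l * measure lborel (J p i \<inter> J p' i' \<inter> {0..t}))"
      by (simp add: cov[OF i] if_distrib[of "(*) _"] cong: if_cong)
    also have "\<dots> = (C \<bullet> C') * measure lborel (J p i \<inter> J p' i' \<inter> {0..t})"
      by (simp add: inner_vec_def sum_distrib_right)
    finally show ?thesis .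
  qed
  have "expectation (\<lambda>\<omega>. step_integral W n p c t \<omega> \<bullet> step_integral W n' p' c' t \<omega>) =
    expectation (\<lambda>\<omega>. \<Sum>i<n. \<Sum>i'<n'. (c i *v D p i \<omega>) \<bullet> (c' i' *v D p' i' \<omega>))"
    by (simp add: step_integral_def D_def inner_sum_left inner_sum_right) (subst sum.swap, rule refl)
  also have "\<dots> = (\<Sum>i<n. \<Sum>i'<n'. expectation (\<lambda>\<omega>. (c i *v D p i \<omega>) \<bullet> (c' i' *v D p' i' \<omega>)))"
    using D[OF g] D[OF g'] by (intro integral_sum_sum sq_integrable_imp_inner sq_integrable_matrix) auto
  also have "\<dots> = (\<Sum>i<n. \<Sum>i'<n'. (c i \<bullet> c' i') * measure lborel (J p i \<inter> J p' i' \<inter> {0..t}))"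
    by (intro sum.cong refl) (simp add: E)
  also have "\<dots> = (\<Sum>i<n. \<Sum>i'<n'. \<integral>s. indicator (J p i \<inter> J p' i') s * (c i \<bullet> c' i') \<partial>lebesgue_on {0..t})"
  proof (intro sum.cong refl)
    fix i i'
    have m: "J p i \<inter> J p' i' \<in> sets borel" by (simp add: J_def)
    have "(\<integral>s. indicator (J p i \<inter> J p' i') s * (c i \<bullet> c' i') \<partial>lebesgue_on {0..t}) =
      measure (lebesgue_on {0..t}) (J p i \<inter> J p' i' \<inter> {0..t}) * (c i \<bullet> c' i')"
      using m by simp
    also have "measure (lebesgue_on {0..t}) (J p i \<inter> J p' i' \<inter> {0..t}) = measure lborel (J p i \<inter> J p' i' \<inter> {0..t})"
      using m by (subst measure_restrict_space) (auto simp: measure_completion)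
    finally show "(c i \<bullet> c' i') * measure lborel (J p i \<inter> J p' i' \<inter> {0..t}) =
      (\<integral>s. indicator (J p i \<inter> J p' i') s * (c i \<bullet> c' i') \<partial>lebesgue_on {0..t})" by (metis mult.commute)
  qed
  also have "\<dots> = (\<integral>s. (\<Sum>i<n. \<Sum>i'<n'. indicator (J p i \<inter> J p' i') s * (c i \<bullet> c' i')) \<partial>lebesgue_on {0..t})"
  proof -
    have int: "integrable (lebesgue_on {0..t}) (\<lambda>s. indicator (J p i \<inter> J p' i') s * (c i \<bullet> c' i'))" for i i'
    proof (rule finite_measure.integrable_const_bound[OF finite_measure_lebesgue_on_Icc, where B="\<bar>c i \<bullet> c' i'\<bar>"])
      have "(\<lambda>s. indicator (J p i \<inter> J p' i') s * (c i \<bullet> c' i')) \<in> borel_measurable borel" unfolding J_def by measurable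
      then show "(\<lambda>s. indicator (J p i \<inter> J p' i') s * (c i \<bullet> c' i')) \<in> borel_measurable (lebesgue_on {0..t})"
        by (intro measurable_restrict_space1 measurable_completion) simp
    qed (auto split: split_indicator)
    show ?thesis by (rule integral_sum_sum[symmetric]) (rule int)
  qed
  also have "\<dots> = (\<integral>s. step_fun n p c s \<bullet> step_fun n' p' c' s \<partial>lebesgue_on {0..t})"
  proof (intro Bochner_Integration.integral_cong refl)
    fix s
    show "(\<Sum>i<n. \<Sum>i'<n'. indicator (J p i \<inter> J p' i') s * (c i \<bullet> c' i')) = step_fun n p c s \<bullet> step_fun n' p' c' s"
      unfolding step_fun_def inner_sum_left inner_sum_right J_def[symmetric]
      by (subst sum.swap) (intro sum.cong refl, simp add: indicator_inter_arith)
  qed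
  finally show ?thesis .
qed

end

lemma sq_integrable_nn_eq:
  assumes "sq_integrable M X"
  shows "(\<integral>\<^sup>+\<omega>. ennreal ((norm (X \<omega>))\<^sup>2) \<partial>M) = ennreal (\<integral>\<omega>. (norm (X \<omega>))\<^sup>2 \<partial>M)"
  using assms by (intro nn_integral_eq_integral) (auto simp: sq_integrable_def)

lemma sq_integrable_nn_tendsto:
  assumes "\<And>j. sq_integrable M (X j)" "(\<lambda>j. \<integral>\<^sup>+\<omega>. ennreal ((norm (X j \<omega>))\<^sup>2) \<partial>M) \<longlonglongrightarrow> 0"
  shows "(\<lambda>j. \<integral>\<omega>. (norm (X j \<omega>))\<^sup>2 \<partial>M) \<longlonglongrightarrow> 0"
  using assms(2) unfolding sq_integrable_nn_eq[OF assms(1)]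
  by (intro tendsto_ennrealD) auto

lemma sq_integrable_AE_zero:
  assumes "sq_integrable M X" "(\<integral>\<omega>. (norm (X \<omega>))\<^sup>2 \<partial>M) = 0"
  shows "AE \<omega> in M. X \<omega> = 0"
proof -
  have "AE \<omega> in M. (norm (X \<omega>))\<^sup>2 = 0"
    using integral_nonneg_eq_0_iff_AE[of M "\<lambda>\<omega>. (norm (X \<omega>))\<^sup>2"] assms by (simp add: sq_integrable_def)
  then show ?thesis by eventually_elim simp
qed

lemma step_fun_sq_integrable:
  assumes "finite_measure M" "(\<lambda>x::real. x) \<in> borel_measurable M"
  shows "sq_integrable M (step_fun n p c)"
proof -
  have "step_fun n p c \<in> borel_measurable borel" unfolding step_fun_def[abs_def] by measurable
  from measurable_compose[OF assms(2) this] have m: "step_fun n p c \<in> borel_measurable M" .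
  show ?thesis
  proof (rule sq_integrable_bound[OF sq_integrable_const[OF assms(1), of "\<Sum>i<n. norm (c i)"] m, where C=1])
    have "norm (step_fun n p c s) \<le> (\<Sum>i<n. norm (c i))" for s
      unfolding step_fun_def by (intro sum_norm_le) (auto split: split_indicator)
    then show "AE s in M. norm (step_fun n p c s) \<le> 1 * norm (\<Sum>i<n. norm (c i))"
      by (intro AE_I2) (simp add: sum_nonneg)
  qed
qed

lemma Linf_sq_integrable:
  assumes "Linf T f"
  shows "sq_integrable (lebesgue_on {0..T}) f"
proof -
  obtain C where C: "f \<in> borel_measurable (lebesgue_on {0..T})" "C > 0" "AE t in lebesgue_on {0..T}. norm (f t) \<le> C"
    using LinfE[OF assms] by blast
  show ?thesis
    by (rule sq_integrable_bound[OF sq_integrable_const[OF finite_measure_lebesgue_on_Icc, where c=C] C(1), where C=1])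
      (use C in auto)
qed

section \<open>The stochastic integral as an L2 limit of step integrals\<close>

context noise
begin

lemma stoch_integral_F: "stoch_integral T P F W \<sigma> I \<Longrightarrow> t \<in> {0..T} \<Longrightarrow> I t \<in> borel_measurable (F t)"
  by (simp add: stoch_integral_def)

lemma stoch_integral_approx:
  assumes I: "stoch_integral T P F W \<sigma> I" and \<sigma>: "Linf T \<sigma>"
  shows "\<exists>n p c. (\<forall>j. grid (n j) (p j)) \<and> (\<forall>t\<in>{0..T}. sq_integrable P (I t)) \<and>
    (\<forall>t\<in>{0..T}. (\<lambda>j. expectation (\<lambda>\<omega>. (norm (I t \<omega> - step_integral W (n j) (p j) (c j) t \<omega>))\<^sup>2)) \<longlonglongrightarrow> 0) \<and>
    (\<lambda>j. \<integral>s. (norm (\<sigma> s - step_fun (n j) (p j) (c j) s))\<^sup>2 \<partial>lebesgue_on {0..T}) \<longlonglongrightarrow> 0"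
proof -
  obtain n p c where a: "\<And>j. 0 \<le> p j 0 \<and> p j (n j) \<le> T \<and> (\<forall>i<n j. p j i \<le> p j (Suc i))"
    and b: "(\<lambda>j. \<integral>\<^sup>+s\<in>{0..T}. ennreal ((norm (\<sigma> s - step_fun (n j) (p j) (c j) s))\<^sup>2) \<partial>lebesgue) \<longlonglongrightarrow> 0"
    and c: "\<And>t. t \<in> {0..T} \<Longrightarrow> (\<lambda>j. \<integral>\<^sup>+\<omega>. ennreal ((norm (I t \<omega> - step_integral W (n j) (p j) (c j) t \<omega>))\<^sup>2) \<partial>P) \<longlonglongrightarrow> 0"
    using I unfolding stoch_integral_def by blast
  have g: "grid (n j) (p j)" for j using a by (simp add: grid_def)
  have Im: "I t \<in> borel_measurable P" if "t \<in> {0..T}" for t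
    using measurable_F_P[OF stoch_integral_F[OF I that] that] .
  have Isq: "sq_integrable P (I t)" if t: "t \<in> {0..T}" for t
  proof -
    \<comment> \<open>A single step integral at finite L2 distance is enough for square
      integrability of \<open>I t\<close>; the bound 1 is arbitrary.\<close>
    have "eventually (\<lambda>j. (\<integral>\<^sup>+\<omega>. ennreal ((norm (I t \<omega> - step_integral W (n j) (p j) (c j) t \<omega>))\<^sup>2) \<partial>P) < 1) sequentially"
      using order_tendstoD(2)[OF c[OF t], of 1] by simp
    then obtain j where j: "(\<integral>\<^sup>+\<omega>. ennreal ((norm (I t \<omega> - step_integral W (n j) (p j) (c j) t \<omega>))\<^sup>2) \<partial>P) < 1"
      by (auto simp: eventually_sequentially)
    have "sq_integrable P (\<lambda>\<omega>. I t \<omega> - step_integral W (n j) (p j) (c j) t \<omega>)"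
      using Im[OF t] step_integral_sq[OF g t, of j "c j"] j
      by (intro sq_integrable_nn borel_measurable_diff) (auto simp: sq_integrable_def intro: less_trans)
    from sq_integrable_add[OF this step_integral_sq[OF g t, of j "c j"]] show ?thesis by simp
  qed
  show ?thesis
  proof (intro exI conjI allI ballI)
    show "grid (n j) (p j)" for j by (rule g)
    show "sq_integrable P (I t)" if "t \<in> {0..T}" for t by (rule Isq[OF that])
    show "(\<lambda>j. expectation (\<lambda>\<omega>. (norm (I t \<omega> - step_integral W (n j) (p j) (c j) t \<omega>))\<^sup>2)) \<longlonglongrightarrow> 0" if t: "t \<in> {0..T}" for t
      by (rule sq_integrable_nn_tendsto[OF _ c[OF t]]) (intro sq_integrable_diff Isq[OF t] step_integral_sq[OF g t])
    have "(\<lambda>j. \<integral>\<^sup>+s. ennreal ((norm (\<sigma> s - step_fun (n j) (p j) (c j) s))\<^sup>2) \<partial>lebesgue_on {0..T}) \<longlonglongrightarrow> 0"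
      using b by (simp add: nn_integral_restrict_space)
    then show "(\<lambda>j. \<integral>s. (norm (\<sigma> s - step_fun (n j) (p j) (c j) s))\<^sup>2 \<partial>lebesgue_on {0..T}) \<longlonglongrightarrow> 0"
      by (rule sq_integrable_nn_tendsto[rotated])
        (intro sq_integrable_diff Linf_sq_integrable[OF \<sigma>] step_fun_sq_integrable finite_measure_lebesgue_on_Icc borel_measurable_id_lebesgue_on)
  qed
qed

lemma stoch_integral_sq:
  assumes "stoch_integral T P F W \<sigma> I" "Linf T \<sigma>" "t \<in> {0..T}"
  shows "sq_integrable P (I t)"
  using stoch_integral_approx[OF assms(1,2)] assms(3) by blast

text \<open>Orthogonality is stable under L2 limits: for each \<open>j\<close> the step integral
  drops out, and the two remaining approximation errors tend to zero when paired with
  \<open>Y\<close>.\<close>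

lemma stoch_integral_orth:
  fixes Y :: "'w \<Rightarrow> real"
  assumes I: "stoch_integral T P F W \<sigma> I" and \<sigma>: "Linf T \<sigma>"
    and st: "0 \<le> s" "s \<le> t" "t \<le> T" and Y: "sq_integrable P Y"
    and orth: "\<And>a b k. s \<le> a \<Longrightarrow> a \<le> b \<Longrightarrow> b \<le> t \<Longrightarrow> expectation (\<lambda>\<omega>. (W b \<omega> - W a \<omega>) $ k * Y \<omega>) = 0"
  shows "expectation (\<lambda>\<omega>. (I t \<omega> - I s \<omega>) $ i * Y \<omega>) = 0"
proof -
  obtain n p c where g: "\<And>j. grid (n j) (p j)" and Isq: "\<And>t. t \<in> {0..T} \<Longrightarrow> sq_integrable P (I t)"
    and lim: "\<And>t. t \<in> {0..T} \<Longrightarrow> (\<lambda>j. expectation (\<lambda>\<omega>. (norm (I t \<omega> - step_integral W (n j) (p j) (c j) t \<omega>))\<^sup>2)) \<longlonglongrightarrow> 0"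
    using stoch_integral_approx[OF I \<sigma>] by blast
  define S where "S j = step_integral W (n j) (p j) (c j)" for j
  have S: "sq_integrable P (S j t)" if "t \<in> {0..T}" for j t unfolding S_def by (rule step_integral_sq[OF g that])
  have in_T: "s \<in> {0..T}" "t \<in> {0..T}" using st by auto
  have X: "sq_integrable P (\<lambda>\<omega>. (I u \<omega> - S j u \<omega>) $ i)" if "u \<in> {0..T}" for u j
    by (intro sq_integrable_component sq_integrable_diff Isq S that)
  have l: "(\<lambda>j. expectation (\<lambda>\<omega>. (I u \<omega> - S j u \<omega>) $ i * Y \<omega>)) \<longlonglongrightarrow> 0" if u: "u \<in> {0..T}" for u
  proof (rule sq_integrable_tendsto_mult[OF X[OF u] Y])
    show "(\<lambda>j. expectation (\<lambda>\<omega>. ((I u \<omega> - S j u \<omega>) $ i)\<^sup>2)) \<longlonglongrightarrow> 0"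
    proof (rule real_tendsto_sandwich[OF _ _ tendsto_const lim[OF u, folded S_def]])
      show "\<forall>\<^sub>F j in sequentially. 0 \<le> expectation (\<lambda>\<omega>. ((I u \<omega> - S j u \<omega>) $ i)\<^sup>2)"
        by (intro always_eventually allI integral_nonneg_AE AE_I2) simp
      show "\<forall>\<^sub>F j in sequentially. expectation (\<lambda>\<omega>. ((I u \<omega> - S j u \<omega>) $ i)\<^sup>2) \<le> expectation (\<lambda>\<omega>. (norm (I u \<omega> - S j u \<omega>))\<^sup>2)"
      proof (intro always_eventually allI integral_mono)
        fix j \<omega>
        show "integrable P (\<lambda>\<omega>. ((I u \<omega> - S j u \<omega>) $ i)\<^sup>2)" using X[OF u] by (simp add: sq_integrable_def)
        show "integrable P (\<lambda>\<omega>. (norm (I u \<omega> - S j u \<omega>))\<^sup>2)"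
          using sq_integrable_diff[OF Isq[OF u] S[OF u]] by (simp add: sq_integrable_def)
        show "((I u \<omega> - S j u \<omega>) $ i)\<^sup>2 \<le> (norm (I u \<omega> - S j u \<omega>))\<^sup>2"
          using power_mono[OF component_le_norm_cart[of "I u \<omega> - S j u \<omega>" i], of 2] by simp
      qed
    qed
  qed
  have "expectation (\<lambda>\<omega>. (I t \<omega> - I s \<omega>) $ i * Y \<omega>) =
      expectation (\<lambda>\<omega>. (I t \<omega> - S j t \<omega>) $ i * Y \<omega>) - expectation (\<lambda>\<omega>. (I s \<omega> - S j s \<omega>) $ i * Y \<omega>)" for j
  proof -
    have i3: "integrable P (\<lambda>\<omega>. (S j t \<omega> - S j s \<omega>) $ i * Y \<omega>)"
      by (intro sq_integrable_imp_mult sq_integrable_component sq_integrable_diff S in_T Y)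
    have "expectation (\<lambda>\<omega>. (I t \<omega> - I s \<omega>) $ i * Y \<omega>) =
      expectation (\<lambda>\<omega>. (I t \<omega> - S j t \<omega>) $ i * Y \<omega> - (I s \<omega> - S j s \<omega>) $ i * Y \<omega> + (S j t \<omega> - S j s \<omega>) $ i * Y \<omega>)"
      by (intro Bochner_Integration.integral_cong refl) (simp add: algebra_simps)
    also have "\<dots> = expectation (\<lambda>\<omega>. (I t \<omega> - S j t \<omega>) $ i * Y \<omega>) - expectation (\<lambda>\<omega>. (I s \<omega> - S j s \<omega>) $ i * Y \<omega>)
        + expectation (\<lambda>\<omega>. (S j t \<omega> - S j s \<omega>) $ i * Y \<omega>)"
      using sq_integrable_imp_mult[OF X[OF in_T(1)] Y] sq_integrable_imp_mult[OF X[OF in_T(2)] Y] i3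
      by (simp del: vector_minus_component)
    also have "expectation (\<lambda>\<omega>. (S j t \<omega> - S j s \<omega>) $ i * Y \<omega>) = 0"
      unfolding S_def by (rule step_integral_orth[OF g st Y orth])
    finally show ?thesis by simp
  qed
  then have "(\<lambda>j. expectation (\<lambda>\<omega>. (I t \<omega> - I s \<omega>) $ i * Y \<omega>)) \<longlonglongrightarrow> 0 - 0"
    using tendsto_diff[OF l[OF in_T(2)] l[OF in_T(1)]] by simp
  then show ?thesis by (simp add: LIMSEQ_const_iff)
qed

text \<open>Grid points are nonnegative, so at time 0 every clamped increment is zero.\<close>

lemma stoch_integral_0:
  assumes I: "stoch_integral T P F W \<sigma> I" and \<sigma>: "Linf T \<sigma>"
  shows "AE \<omega> in P. I 0 \<omega> = 0"
proof -
  obtain n p c where g: "\<And>j. grid (n j) (p j)" and Isq: "\<And>t. t \<in> {0..T} \<Longrightarrow> sq_integrable P (I t)"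
    and lim: "\<And>t. t \<in> {0..T} \<Longrightarrow> (\<lambda>j. expectation (\<lambda>\<omega>. (norm (I t \<omega> - step_integral W (n j) (p j) (c j) t \<omega>))\<^sup>2)) \<longlonglongrightarrow> 0"
    using stoch_integral_approx[OF I \<sigma>] by blast
  have "step_integral W (n j) (p j) (c j) 0 \<omega> = 0" for j \<omega>
    unfolding step_integral_def
    using grid_bounds[OF g[of j]] by (intro sum.neutral ballI) (simp add: min_absorb1)
  then have "expectation (\<lambda>\<omega>. (norm (I 0 \<omega>))\<^sup>2) = 0"
    using lim[of 0] T by (simp add: LIMSEQ_const_iff)
  then show ?thesis using Isq[of 0] T by (intro sq_integrable_AE_zero) auto
qed

text \<open>The isometry bounds the distance between step integrals of the two sequences by the
  distances of their step functions to the common integrand \<open>\<sigma>\<close>.\<close>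

lemma stoch_integral_unique_at:
  assumes I: "stoch_integral T P F W \<sigma> I" and I': "stoch_integral T P F W \<sigma> I'" and \<sigma>: "Linf T \<sigma>" and t: "t \<in> {0..T}"
  shows "AE \<omega> in P. I t \<omega> = I' t \<omega>"
proof -
  obtain n p c where g: "\<And>j. grid (n j) (p j)" and Isq: "\<And>t. t \<in> {0..T} \<Longrightarrow> sq_integrable P (I t)"
    and lim: "\<And>t. t \<in> {0..T} \<Longrightarrow> (\<lambda>j. expectation (\<lambda>\<omega>. (norm (I t \<omega> - step_integral W (n j) (p j) (c j) t \<omega>))\<^sup>2)) \<longlonglongrightarrow> 0"
    and lims: "(\<lambda>j. \<integral>s. (norm (\<sigma> s - step_fun (n j) (p j) (c j) s))\<^sup>2 \<partial>lebesgue_on {0..T}) \<longlonglongrightarrow> 0"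
    using stoch_integral_approx[OF I \<sigma>] by blast
  obtain n' p' c' where g': "\<And>j. grid (n' j) (p' j)" and Isq': "\<And>t. t \<in> {0..T} \<Longrightarrow> sq_integrable P (I' t)"
    and lim': "\<And>t. t \<in> {0..T} \<Longrightarrow> (\<lambda>j. expectation (\<lambda>\<omega>. (norm (I' t \<omega> - step_integral W (n' j) (p' j) (c' j) t \<omega>))\<^sup>2)) \<longlonglongrightarrow> 0"
    and lims': "(\<lambda>j. \<integral>s. (norm (\<sigma> s - step_fun (n' j) (p' j) (c' j) s))\<^sup>2 \<partial>lebesgue_on {0..T}) \<longlonglongrightarrow> 0"
    using stoch_integral_approx[OF I' \<sigma>] by blast
  define S where "S j = step_integral W (n j) (p j) (c j) t" for j
  define S' where "S' j = step_integral W (n' j) (p' j) (c' j) t" for j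
  define h where "h j = step_fun (n j) (p j) (c j)" for j
  define h' where "h' j = step_fun (n' j) (p' j) (c' j)" for j
  have S: "sq_integrable P (S j)" "sq_integrable P (S' j)" for j
    unfolding S_def S'_def by (intro step_integral_sq[OF g t] step_integral_sq[OF g' t])+
  have h: "sq_integrable (lebesgue_on {0..u}) (h j)" "sq_integrable (lebesgue_on {0..u}) (h' j)" for j u
    unfolding h_def h'_def
    by (intro step_fun_sq_integrable finite_measure_lebesgue_on_Icc borel_measurable_id_lebesgue_on)+
  have iso: "expectation (\<lambda>\<omega>. (norm (S j \<omega> - S' j \<omega>))\<^sup>2) = (\<integral>s. (norm (h j s - h' j s))\<^sup>2 \<partial>lebesgue_on {0..t})" for j
  proof -
    have "expectation (\<lambda>\<omega>. (norm (S j \<omega> - S' j \<omega>))\<^sup>2) =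
      expectation (\<lambda>\<omega>. S j \<omega> \<bullet> S j \<omega> - 2 * (S j \<omega> \<bullet> S' j \<omega>) + S' j \<omega> \<bullet> S' j \<omega>)"
      by (intro Bochner_Integration.integral_cong refl) (simp add: power2_norm_eq_inner inner_diff_left inner_diff_right inner_commute)
    also have "\<dots> = expectation (\<lambda>\<omega>. S j \<omega> \<bullet> S j \<omega>) - 2 * expectation (\<lambda>\<omega>. S j \<omega> \<bullet> S' j \<omega>) + expectation (\<lambda>\<omega>. S' j \<omega> \<bullet> S' j \<omega>)"
      using sq_integrable_imp_inner[OF S(1) S(1), of j j] sq_integrable_imp_inner[OF S(1) S(2), of j j] sq_integrable_imp_inner[OF S(2) S(2), of j j] by simp
    also have "\<dots> = (\<integral>s. h j s \<bullet> h j s \<partial>lebesgue_on {0..t}) - 2 * (\<integral>s. h j s \<bullet> h' j s \<partial>lebesgue_on {0..t}) + (\<integral>s. h' j s \<bullet> h' j s \<partial>lebesgue_on {0..t})"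
      unfolding S_def S'_def h_def h'_def by (simp add: step_isometry[OF g g t] step_isometry[OF g g' t] step_isometry[OF g' g' t])
    also have "\<dots> = (\<integral>s. h j s \<bullet> h j s - 2 * (h j s \<bullet> h' j s) + h' j s \<bullet> h' j s \<partial>lebesgue_on {0..t})"
      using sq_integrable_imp_inner[OF h(1) h(1), of t j j] sq_integrable_imp_inner[OF h(1) h(2), of t j j] sq_integrable_imp_inner[OF h(2) h(2), of t j j] by simp
    also have "\<dots> = (\<integral>s. (norm (h j s - h' j s))\<^sup>2 \<partial>lebesgue_on {0..t})"
      by (intro Bochner_Integration.integral_cong refl) (simp add: power2_norm_eq_inner inner_diff_left inner_diff_right inner_commute)
    finally show ?thesis .
  qed
  let ?e = "\<lambda>j. \<integral>s. (norm (\<sigma> s - h j s))\<^sup>2 \<partial>lebesgue_on {0..T}" and ?e' = "\<lambda>j. \<integral>s. (norm (\<sigma> s - h' j s))\<^sup>2 \<partial>lebesgue_on {0..T}"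
  let ?a = "\<lambda>j. expectation (\<lambda>\<omega>. (norm (I t \<omega> - S j \<omega>))\<^sup>2)" and ?a' = "\<lambda>j. expectation (\<lambda>\<omega>. (norm (I' t \<omega> - S' j \<omega>))\<^sup>2)"
  have ss: "expectation (\<lambda>\<omega>. (norm (S j \<omega> - S' j \<omega>))\<^sup>2) \<le> 2 * ?e j + 2 * ?e' j" for j
  proof -
    have hh: "integrable (lebesgue_on {0..T}) (\<lambda>s. (norm (h j s - h' j s))\<^sup>2)"
      using sq_integrable_diff[OF h(1) h(2), of T j j] by (simp add: sq_integrable_def)
    have "(\<integral>s. (norm (h j s - h' j s))\<^sup>2 \<partial>lebesgue_on {0..t}) = (\<integral>s. indicator {0..t} s *\<^sub>R (norm (h j s - h' j s))\<^sup>2 \<partial>lebesgue_on {0..T})"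
      using set_integral_eq_indicator_lebesgue_on[of t T 0 "\<lambda>s. (norm (h j s - h' j s))\<^sup>2"] t by (simp add: set_integral_eq_lebesgue_on)
    also have "\<dots> \<le> (\<integral>s. (norm (h j s - h' j s))\<^sup>2 \<partial>lebesgue_on {0..T})"
    proof (rule integral_mono[OF _ hh])
      show "integrable (lebesgue_on {0..T}) (\<lambda>s. indicator {0..t} s *\<^sub>R (norm (h j s - h' j s))\<^sup>2)"
        by (rule integrable_mult_indicator[OF _ hh]) (use t in \<open>auto simp: sets_restrict_space_iff\<close>)
    qed (auto split: split_indicator)
    also have "\<dots> \<le> (\<integral>s. 2 * (norm (\<sigma> s - h j s))\<^sup>2 + 2 * (norm (\<sigma> s - h' j s))\<^sup>2 \<partial>lebesgue_on {0..T})"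
    proof (rule integral_mono[OF hh])
      show "integrable (lebesgue_on {0..T}) (\<lambda>s. 2 * (norm (\<sigma> s - h j s))\<^sup>2 + 2 * (norm (\<sigma> s - h' j s))\<^sup>2)"
        using sq_integrable_diff[OF Linf_sq_integrable[OF \<sigma>] h(1), of j] sq_integrable_diff[OF Linf_sq_integrable[OF \<sigma>] h(2), of j]
        by (simp add: sq_integrable_def)
      show "(norm (h j s - h' j s))\<^sup>2 \<le> 2 * (norm (\<sigma> s - h j s))\<^sup>2 + 2 * (norm (\<sigma> s - h' j s))\<^sup>2" for s
        using norm_add_sq_le[of "h j s - \<sigma> s" "\<sigma> s - h' j s"] by (simp add: norm_minus_commute)
    qed
    also have "\<dots> = 2 * ?e j + 2 * ?e' j"
      using sq_integrable_diff[OF Linf_sq_integrable[OF \<sigma>] h(1), of j] sq_integrable_diff[OF Linf_sq_integrable[OF \<sigma>] h(2), of j]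
      by (simp add: sq_integrable_def)
    finally show ?thesis by (simp add: iso)
  qed
  let ?z = "expectation (\<lambda>\<omega>. (norm (I t \<omega> - I' t \<omega>))\<^sup>2)"
  \<comment> \<open>The constants come from applying \<open>norm_add_sq_le\<close> twice: first
    \<open>I t - S j\<close> is split off, then the rest is divided into \<open>S j - S' j\<close>
    and \<open>S' j - I' t\<close>.\<close>
  have le: "?z \<le> 2 * ?a j + 4 * (2 * ?e j + 2 * ?e' j) + 4 * ?a' j" for j
  proof -
    note sq = sq_integrable_diff[OF Isq[OF t] S(1), of j] sq_integrable_diff[OF Isq'[OF t] S(2), of j] sq_integrable_diff[OF S(1) S(2), of j j]
      sq_integrable_diff[OF Isq[OF t] Isq'[OF t]]
    have "?z \<le> expectation (\<lambda>\<omega>. 2 * (norm (I t \<omega> - S j \<omega>))\<^sup>2 + (4 * (norm (S j \<omega> - S' j \<omega>))\<^sup>2 + 4 * (norm (I' t \<omega> - S' j \<omega>))\<^sup>2))"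
    proof (rule integral_mono)
      show "integrable P (\<lambda>\<omega>. (norm (I t \<omega> - I' t \<omega>))\<^sup>2)"
        "integrable P (\<lambda>\<omega>. 2 * (norm (I t \<omega> - S j \<omega>))\<^sup>2 + (4 * (norm (S j \<omega> - S' j \<omega>))\<^sup>2 + 4 * (norm (I' t \<omega> - S' j \<omega>))\<^sup>2))"
        using sq by (simp_all add: sq_integrable_def)
      show "(norm (I t \<omega> - I' t \<omega>))\<^sup>2 \<le> 2 * (norm (I t \<omega> - S j \<omega>))\<^sup>2 + (4 * (norm (S j \<omega> - S' j \<omega>))\<^sup>2 + 4 * (norm (I' t \<omega> - S' j \<omega>))\<^sup>2)" for \<omega>
        using norm_add_sq_le[of "I t \<omega> - S j \<omega>" "(S j \<omega> - S' j \<omega>) + (S' j \<omega> - I' t \<omega>)"]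
          norm_add_sq_le[of "S j \<omega> - S' j \<omega>" "S' j \<omega> - I' t \<omega>"] norm_minus_commute[of "I' t \<omega>" "S' j \<omega>"] by simp
    qed
    also have "\<dots> = 2 * ?a j + (4 * expectation (\<lambda>\<omega>. (norm (S j \<omega> - S' j \<omega>))\<^sup>2) + 4 * ?a' j)"
      using sq by (simp add: sq_integrable_def)
    also have "\<dots> \<le> 2 * ?a j + 4 * (2 * ?e j + 2 * ?e' j) + 4 * ?a' j" using ss[of j] by simp
    finally show ?thesis .
  qed
  have "(\<lambda>j. 2 * ?a j + 4 * (2 * ?e j + 2 * ?e' j) + 4 * ?a' j) \<longlonglongrightarrow> 2 * 0 + 4 * (2 * 0 + 2 * 0) + 4 * 0"
    using lim[OF t] lim'[OF t] lims lims' unfolding S_def S'_def h_def h'_def by (intro tendsto_intros)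
  then have "?z \<le> 0" using le by (intro LIMSEQ_le_const) auto
  moreover have "?z \<ge> 0" by (intro integral_nonneg_AE AE_I2) simp
  ultimately have "AE \<omega> in P. I t \<omega> - I' t \<omega> = 0"
    using sq_integrable_diff[OF Isq[OF t] Isq'[OF t]] by (intro sq_integrable_AE_zero) auto
  then show ?thesis by eventually_elim simp
qed

text \<open>Equality at each time becomes equality at all times through a countable dense set.
  Rationals of the open interval suffice, as their closure is \<open>{0..T}\<close> for
  \<open>T > 0\<close>.\<close>

lemma AE_eq_continuous:
  fixes X Y :: "real \<Rightarrow> 'w \<Rightarrow> 'b::euclidean_space"
  assumes X: "AE \<omega> in P. continuous_on {0..T} (\<lambda>t. X t \<omega>)" and Y: "AE \<omega> in P. continuous_on {0..T} (\<lambda>t. Y t \<omega>)"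
    and eq: "\<And>t. t \<in> {0..T} \<Longrightarrow> AE \<omega> in P. X t \<omega> = Y t \<omega>"
  shows "AE \<omega> in P. \<forall>t\<in>{0..T}. X t \<omega> = Y t \<omega>"
proof -
  let ?S = "{0<..<T} \<inter> \<rat>"
  have cl: "closure ?S = {0..T}"
    using closure_open_Int_superset[of "{0<..<T}" "\<rat>"] T by (simp add: Rats_closure_real)
  have "AE \<omega> in P. \<forall>t\<in>?S. X t \<omega> = Y t \<omega>"
    by (rule AE_ball_countable') (auto intro!: eq countable_Int2 countable_rat)
  with X Y show ?thesis
  proof eventually_elim
    case (elim \<omega>)
    show ?case
    proof
      fix t assume "t \<in> {0..T}"
      moreover have "continuous_on (closure ?S) (\<lambda>t. X t \<omega> - Y t \<omega>)"
        unfolding cl using elim by (intro continuous_on_diff)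
      ultimately have "X t \<omega> - Y t \<omega> = 0"
        using elim(3) cl continuous_constant_on_closure[of ?S "\<lambda>t. X t \<omega> - Y t \<omega>" 0 t] by simp
      then show "X t \<omega> = Y t \<omega>" by simp
    qed
  qed
qed

lemma stoch_integral_unique:
  assumes I: "stoch_integral T P F W \<sigma> I" and I': "stoch_integral T P F W \<sigma> I'" and \<sigma>: "Linf T \<sigma>"
  shows "AE \<omega> in P. \<forall>t\<in>{0..T}. I t \<omega> = I' t \<omega>"
  using I I' stoch_integral_unique_at[OF I I' \<sigma>] by (intro AE_eq_continuous) (auto simp: stoch_integral_def)

lemma stoch_integral_martingale:
  fixes Y :: "'w \<Rightarrow> real"
  assumes I: "stoch_integral T P F W \<sigma> I" and \<sigma>: "Linf T \<sigma>"
    and st: "0 \<le> s" "s \<le> t" "t \<le> T" and Y: "sq_integrable P Y" "Y \<in> borel_measurable (F s)"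
  shows "expectation (\<lambda>\<omega>. (I t \<omega> - I s \<omega>) $ i * Y \<omega>) = 0"
proof (rule stoch_integral_orth[OF I \<sigma> st Y(1)])
  fix a b k assume "s \<le> a" "a \<le> b" "b \<le> t"
  then show "expectation (\<lambda>\<omega>. (W b \<omega> - W a \<omega>) $ k * Y \<omega>) = 0"
    using st measurable_F_mono[OF Y(2)]
    by (intro increment_orth sq_integrable_imp_integrable[OF finite_measure_axioms Y(1)]) auto
qed

text \<open>\<open>I T - I t\<close> is orthogonal to \<open>I t\<close>. A bound uniform in
  \<open>t\<close> makes the integral square integrable over time and scenario jointly.\<close>

lemma stoch_integral_second_moment:
  assumes I: "stoch_integral T P F W \<sigma> I" and \<sigma>: "Linf T \<sigma>" and t: "t \<in> {0..T}"
  shows "expectation (\<lambda>\<omega>. (norm (I t \<omega>))\<^sup>2) \<le> expectation (\<lambda>\<omega>. (norm (I T \<omega>))\<^sup>2)"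
proof -
  have It: "sq_integrable P (I t)" and IT: "sq_integrable P (I T)" using stoch_integral_sq[OF I \<sigma>] t T by auto
  have D: "sq_integrable P (\<lambda>\<omega>. I T \<omega> - I t \<omega>)" by (rule sq_integrable_diff[OF IT It])
  have int: "integrable P (\<lambda>\<omega>. (I T \<omega> - I t \<omega>) $ i * I t \<omega> $ i)" for i
    by (intro sq_integrable_imp_mult sq_integrable_component D It)
  have "expectation (\<lambda>\<omega>. (I T \<omega> - I t \<omega>) \<bullet> I t \<omega>) = (\<Sum>i\<in>UNIV. expectation (\<lambda>\<omega>. (I T \<omega> - I t \<omega>) $ i * I t \<omega> $ i))"
    unfolding inner_vec_def inner_real_def by (rule Bochner_Integration.integral_sum) (rule int)
  also have "\<dots> = 0"
    using t stoch_integral_F[OF I t]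
    by (intro sum.neutral ballI stoch_integral_martingale[OF I \<sigma>] sq_integrable_component It borel_measurable_component) auto
  finally have orth: "expectation (\<lambda>\<omega>. (I T \<omega> - I t \<omega>) \<bullet> I t \<omega>) = 0" .
  have "expectation (\<lambda>\<omega>. (norm (I T \<omega>))\<^sup>2) =
    expectation (\<lambda>\<omega>. (norm (I t \<omega>))\<^sup>2 + 2 * ((I T \<omega> - I t \<omega>) \<bullet> I t \<omega>) + (norm (I T \<omega> - I t \<omega>))\<^sup>2)"
    by (intro Bochner_Integration.integral_cong refl) (simp add: power2_norm_eq_inner inner_diff_left inner_diff_right inner_commute)
  also have "\<dots> = expectation (\<lambda>\<omega>. (norm (I t \<omega>))\<^sup>2) + expectation (\<lambda>\<omega>. (norm (I T \<omega> - I t \<omega>))\<^sup>2)"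
    using sq_integrable_imp_inner[OF D It] D It orth by (simp add: sq_integrable_def)
  finally show ?thesis using integral_nonneg_AE[of "\<lambda>\<omega>. (norm (I T \<omega> - I t \<omega>))\<^sup>2" P] by simp
qed

section \<open>The \<sigma>-algebra of the noise and the filtration generated by it\<close>

definition noise_algebra :: "'w measure" where
  "noise_algebra = vimage_algebra (space P) (\<lambda>\<omega>. (\<xi> \<omega>, traj T W \<omega>)) (borel \<Otimes>\<^sub>M path_algebra T)"

lemma indep_of_noiseD:
  assumes "indep_of_noise T P W \<xi> M X"
  shows "indep_set (sets (vimage_algebra (space P) X M)) (sets noise_algebra)"
    "\<xi> \<in> borel_measurable noise_algebra" "\<And>u. u \<in> {0..T} \<Longrightarrow> W u \<in> borel_measurable noise_algebra"
    "space noise_algebra = space P" "X \<in> measurable P M"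
proof -
  show "indep_set (sets (vimage_algebra (space P) X M)) (sets noise_algebra)" "X \<in> measurable P M"
    using assms by (auto simp: indep_of_noise_def indep_rv_def noise_algebra_def)
  have "(\<lambda>\<omega>. (\<xi> \<omega>, traj T W \<omega>)) \<in> measurable P (borel \<Otimes>\<^sub>M path_algebra T)"
    using assms by (simp add: indep_of_noise_def indep_rv_def)
  then have m: "(\<lambda>\<omega>. (\<xi> \<omega>, traj T W \<omega>)) \<in> measurable noise_algebra (borel \<Otimes>\<^sub>M path_algebra T)"
    unfolding noise_algebra_def by (intro measurable_vimage_algebra1) (auto simp: measurable_def)
  show "\<xi> \<in> borel_measurable noise_algebra"
    using measurable_compose[OF m measurable_fst] by simp
  show "W u \<in> borel_measurable noise_algebra" if u: "u \<in> {0..T}" for u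
    using measurable_compose[OF measurable_compose[OF m measurable_snd] measurable_component_singleton[OF u]] u
    by (simp add: traj_def)
  show "space noise_algebra = space P" by (simp add: noise_algebra_def)
qed

text \<open>The first factor is a centred function of the noise and \<open>Y\<close> is a function
  of \<open>X\<close>, so the product formula gives zero. These are the two inputs for the
  orthogonality of the fluctuation.\<close>

lemma indep_of_noise_orth:
  fixes Y :: "'w \<Rightarrow> real"
  assumes X: "indep_of_noise T P W \<xi> M X" and Y: "sq_integrable P Y" "Y \<in> borel_measurable (vimage_algebra (space P) X M)"
  shows "\<lbrakk>0 \<le> a; a \<le> b; b \<le> T\<rbrakk> \<Longrightarrow> expectation (\<lambda>\<omega>. (W b \<omega> - W a \<omega>) $ i * Y \<omega>) = 0"
    "expectation (\<lambda>\<omega>. (\<xi> \<omega> - expectation \<xi>) $ i * Y \<omega>) = 0"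
proof -
  note D = indep_of_noiseD[OF X]
  note int = sq_integrable_imp_integrable[OF finite_measure_axioms]
  show "expectation (\<lambda>\<omega>. (W b \<omega> - W a \<omega>) $ i * Y \<omega>) = 0" if ab: "0 \<le> a" "a \<le> b" "b \<le> T"
  proof -
    have "expectation (\<lambda>\<omega>. Y \<omega> * (W b \<omega> - W a \<omega>) $ i) = expectation Y * expectation (\<lambda>\<omega>. (W b \<omega> - W a \<omega>) $ i)"
      using D ab by (intro expectation_mult_indep_set[OF D(1)] Y int borel_measurable_component borel_measurable_diff
          sq_integrable_component increment_moments(3)) auto
    then show ?thesis using increment_moments(1)[OF ab] by (simp add: mult.commute)
  qed
  have c: "sq_integrable P (\<lambda>\<omega>. \<xi> \<omega> - expectation \<xi>)"
    by (intro sq_integrable_diff sq_\<xi> sq_integrable_const finite_measure_axioms)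
  have "expectation (\<lambda>\<omega>. Y \<omega> * (\<xi> \<omega> - expectation \<xi>) $ i) = expectation Y * expectation (\<lambda>\<omega>. (\<xi> \<omega> - expectation \<xi>) $ i)"
    using D by (intro expectation_mult_indep_set[OF D(1)] Y int borel_measurable_component borel_measurable_diff
        sq_integrable_component c) auto
  also have "expectation (\<lambda>\<omega>. (\<xi> \<omega> - expectation \<xi>) $ i) = 0"
    using int[OF sq_\<xi>] int[OF c] prob_space integral_bounded_linear[OF bounded_linear_vec_nth int[OF c], of i]
    by (simp del: vector_minus_component)
  finally show "expectation (\<lambda>\<omega>. (\<xi> \<omega> - expectation \<xi>) $ i * Y \<omega>) = 0" by (simp add: mult.commute)
qed

definition generators :: "real \<Rightarrow> 'w set set" where
  "generators s = {\<xi> -` E \<inter> space P | E. E \<in> sets borel} \<union>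
    {W u -` E \<inter> space P | u E. 0 \<le> u \<and> u \<le> T \<and> u \<le> s \<and> E \<in> sets borel} \<union> null_sets P"

lemma generators_Pow: "generators s \<subseteq> Pow (space P)"
  by (auto simp: generators_def dest: null_setsD2 sets.sets_into_space)

lemma gen_filtration_eq: "gen_filtration T P W \<xi> t = sigma (space P) (\<Inter>s\<in>{t<..}. sigma_sets (space P) (generators s))"
  unfolding gen_filtration_def generators_def ..

lemma space_gen_filtration [simp]: "space (gen_filtration T P W \<xi> t) = space P"
  unfolding gen_filtration_eq by (simp add: space_measure_of_conv)

lemma sets_gen_filtration:
  "sets (gen_filtration T P W \<xi> t) = sigma_sets (space P) (\<Inter>s\<in>{t<..}. sigma_sets (space P) (generators s))"
  unfolding gen_filtration_eq
proof (rule sets_measure_of)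
  have "sigma_sets (space P) (generators (t + 1)) \<subseteq> Pow (space P)"
    using sigma_sets_into_sp[OF generators_Pow] by blast
  then show "(\<Inter>s\<in>{t<..}. sigma_sets (space P) (generators s)) \<subseteq> Pow (space P)" by fastforce
qed

lemma sets_gen_filtration_le:
  assumes "t < s"
  shows "sets (gen_filtration T P W \<xi> t) \<subseteq> sigma_sets (space P) (generators s)"
proof -
  have "sigma_sets (space P) (\<Inter>s\<in>{t<..}. sigma_sets (space P) (generators s)) \<subseteq> sigma_sets (space P) (sigma_sets (space P) (generators s))"
    using assms by (intro sigma_sets_mono') auto
  then show ?thesis unfolding sets_gen_filtration sigma_sets_sigma_sets_eq[OF generators_Pow] .
qed

lemma generators_gen_filtration: "generators t \<subseteq> sets (gen_filtration T P W \<xi> t)"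
proof -
  have "generators t \<subseteq> sigma_sets (space P) (generators s)" if "t < s" for s
  proof -
    have "generators t \<subseteq> generators s" unfolding generators_def using that by (intro Un_mono) force+
    then show ?thesis by (auto intro: sigma_sets.Basic)
  qed
  then have "generators t \<subseteq> (\<Inter>s\<in>{t<..}. sigma_sets (space P) (generators s))" by blast
  then show ?thesis unfolding sets_gen_filtration by (rule order_trans[OF _ sigma_sets_superset_generator])
qed

lemma gen_filtration_mono:
  assumes "s \<le> t"
  shows "sets (gen_filtration T P W \<xi> s) \<subseteq> sets (gen_filtration T P W \<xi> t)"
  unfolding sets_gen_filtration using assms by (intro sigma_sets_mono') auto

text \<open>Right-continuity of \<open>F\<close> absorbs the right limit in the definition of the
  generated filtration.\<close>

lemma gen_filtration_F:
  assumes t: "t \<in> {0..T}"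
  shows "sets (gen_filtration T P W \<xi> t) \<subseteq> sets (F t)"
proof -
  have gen: "sigma_sets (space P) (generators s) \<subseteq> sets (F u)" if "u \<in> {0..T}" "s \<le> u \<or> u = T" for s u
  proof -
    have "generators s \<subseteq> sets (F u)"
      unfolding generators_def
    proof (intro Un_least)
      have "\<xi> \<in> borel_measurable (F u)" using measurable_F_mono[OF \<xi>_F0] that by simp
      then show "{\<xi> -` E \<inter> space P |E. E \<in> sets borel} \<subseteq> sets (F u)"
        using measurable_sets[of \<xi> "F u"] by auto
      have "W v \<in> borel_measurable (F u)" if "0 \<le> v" "v \<le> T" "v \<le> s" for v
        using measurable_F_mono[OF W_F[of v], of u] that \<open>s \<le> u \<or> u = T\<close> by auto
      then show "{W v -` E \<inter> space P |v E. 0 \<le> v \<and> v \<le> T \<and> v \<le> s \<and> E \<in> sets borel} \<subseteq> sets (F u)"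
        using measurable_sets[of _ "F u" borel] by fastforce
      show "null_sets P \<subseteq> sets (F u)" using null_sets_F that by auto
    qed
    then show ?thesis using sets.sigma_sets_subset[of _ "F u"] by simp
  qed
  show ?thesis
  \<comment> \<open>At \<open>T\<close> there is no later \<sigma>-algebra of \<open>F\<close> to
    intersect with; but the generators contain no \<open>W u\<close> with \<open>u > T\<close>, so
    all of them already lie in \<open>F T\<close>.\<close>
  proof (cases "t = T")
    case True
    then show ?thesis using order_trans[OF sets_gen_filtration_le gen, of t "T + 1" T] T by simp
  next
    case False
    then have "sets (F t) = (\<Inter>s\<in>{t<..T}. sets (F s))" using t usual by (simp add: usual_conditions_def)
    moreover have "sets (gen_filtration T P W \<xi> t) \<subseteq> sets (F s)" if "s \<in> {t<..T}" for s
      using order_trans[OF sets_gen_filtration_le gen, of t s s] that t by auto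
    ultimately show ?thesis by blast
  qed
qed

lemma gen_filtration_\<xi>: "\<xi> \<in> borel_measurable (gen_filtration T P W \<xi> t)"
proof (rule measurableI)
  fix A :: "(real^'d) set" assume "A \<in> sets borel"
  then have "\<xi> -` A \<inter> space P \<in> generators t" by (auto simp: generators_def)
  then show "\<xi> -` A \<inter> space (gen_filtration T P W \<xi> t) \<in> sets (gen_filtration T P W \<xi> t)"
    using generators_gen_filtration by auto
qed simp

lemma gen_filtration_W:
  assumes "0 \<le> u" "u \<le> t" "u \<le> T"
  shows "W u \<in> borel_measurable (gen_filtration T P W \<xi> t)"
proof (rule measurableI)
  fix A :: "(real^'d) set" assume "A \<in> sets borel"
  then have "W u -` A \<inter> space P \<in> generators t" using assms by (auto simp: generators_def)
  then show "W u -` A \<inter> space (gen_filtration T P W \<xi> t) \<in> sets (gen_filtration T P W \<xi> t)"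
    using generators_gen_filtration by auto
qed simp

lemma gen_filtration_null: "null_sets P \<subseteq> sets (gen_filtration T P W \<xi> t)"
  using generators_gen_filtration by (auto simp: generators_def)

text \<open>Independence of the bare \<sigma>-algebra of \<open>\<xi>\<close> and \<open>W\<close>
  survives completion: by induction over the generated events, each one agrees up to a null set with
  an event of \<open>noise_algebra\<close>. The right limit at \<open>T\<close> is bounded by the
  index \<open>T + 1\<close>, which brings no further noise.\<close>

lemma indep_gen_filtration:
  assumes X: "indep_of_noise T P W \<xi> M X"
  shows "indep_set (sets (vimage_algebra (space P) X M)) (sets (gen_filtration T P W \<xi> T))"
proof -
  note D = indep_of_noiseD[OF X]
  have sets1: "sets (vimage_algebra (space P) X M) \<subseteq> events" and sets2: "sets noise_algebra \<subseteq> events"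
    using D(1) by (auto simp: indep_set_def indep_sets_def split: bool.splits)
  have ev: "sets (gen_filtration T P W \<xi> T) \<subseteq> events"
    using gen_filtration_F[of T] sets_F_P[of T] T by auto
  have approx: "\<exists>C'\<in>sets noise_algebra. AE \<omega> in P. \<omega> \<in> C \<longleftrightarrow> \<omega> \<in> C'"
    if "C \<in> sigma_sets (space P) (generators (T + 1))" for C
    using that
  proof (induction rule: sigma_sets.induct)
    case (Basic a)
    then consider (xi) E where "a = \<xi> -` E \<inter> space P" "E \<in> sets borel"
      | (W) u E where "a = W u -` E \<inter> space P" "u \<in> {0..T}" "E \<in> sets borel" | (null) "a \<in> null_sets P"
      by (auto simp: generators_def)
    then show ?case
    proof cases
      case xi
      then have "a \<in> sets noise_algebra" using measurable_sets[OF D(2)] D(4) by auto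
      then show ?thesis by (intro bexI[of _ a]) auto
    next
      case W
      then have "a \<in> sets noise_algebra" using measurable_sets[OF D(3)] D(4) by auto
      then show ?thesis by (intro bexI[of _ a]) auto
    next
      case null
      then show ?thesis by (intro bexI[of _ "{}"]) (auto dest: AE_not_in)
    qed
  next
    case (Compl a)
    then obtain C' where "C' \<in> sets noise_algebra" "AE \<omega> in P. \<omega> \<in> a \<longleftrightarrow> \<omega> \<in> C'" by blast
    then show ?case
      using sets.compl_sets[of C' noise_algebra] D(4) AE_space[of P]
      by (intro bexI[of _ "space P - C'"]) (auto elim: eventually_elim2)
  next
    case (Union a)
    then obtain C' where "\<And>i. C' i \<in> sets noise_algebra" "\<And>i. AE \<omega> in P. \<omega> \<in> a i \<longleftrightarrow> \<omega> \<in> C' i" by metis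
    moreover from this have "AE \<omega> in P. \<forall>i. \<omega> \<in> a i \<longleftrightarrow> \<omega> \<in> C' i" by (simp add: AE_all_countable)
    ultimately show ?case by (intro bexI[of _ "\<Union>i. C' i"]) (auto elim: eventually_mono)
  qed (auto intro!: bexI[of _ "{}"])
  show ?thesis
  proof (rule indep_setI[OF sets1 ev])
    fix A C assume A: "A \<in> sets (vimage_algebra (space P) X M)" and C: "C \<in> sets (gen_filtration T P W \<xi> T)"
    have "C \<in> sigma_sets (space P) (generators (T + 1))" using sets_gen_filtration_le[of T "T + 1"] C by auto
    then obtain C' where C': "C' \<in> sets noise_algebra" "AE \<omega> in P. \<omega> \<in> C \<longleftrightarrow> \<omega> \<in> C'" using approx by blast
    have "prob C = prob C'" "prob (A \<inter> C) = prob (A \<inter> C')"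
      using C' A C sets1 sets2 ev by (auto intro!: finite_measure_eq_AE elim: eventually_mono)
    then show "prob (A \<inter> C) = prob A * prob C" using indep_setD[OF D(1) A C'(1)] by simp
  qed
qed

end

section \<open>Square integrable processes\<close>

lemma integral_lebesgue_on_indicator:
  fixes g :: "real \<Rightarrow> 'b::euclidean_space"
  assumes "t \<le> b"
  shows "integral\<^sup>L (lebesgue_on {a..t}) g = (\<integral>s. indicator {a..t} s *\<^sub>R g s \<partial>lebesgue_on {a..b})"
  using set_integral_eq_indicator_lebesgue_on[OF assms, of a g] by (simp add: set_integral_eq_lebesgue_on)

lemma borel_measurable_indicator_lebesgue_on:
  "(indicator {c..d} :: real \<Rightarrow> real) \<in> borel_measurable (lebesgue_on S)"
  by (rule measurable_compose[OF borel_measurable_id_lebesgue_on]) simp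

text \<open>A continuous adapted process is the pointwise limit of processes that are constant
  between countably many times.\<close>

lemma prog_measurable_continuous:
  fixes X :: "real \<Rightarrow> 'w \<Rightarrow> 'b::euclidean_space"
  assumes X: "\<And>t. t \<in> {0..T} \<Longrightarrow> X t \<in> borel_measurable (G t)"
    and G: "\<And>s t. s \<in> {0..T} \<Longrightarrow> t \<in> {0..T} \<Longrightarrow> s \<le> t \<Longrightarrow> sets (G s) \<subseteq> sets (G t)" "\<And>t. space (G t) = \<Omega>"
    and cont: "\<And>\<omega>. \<omega> \<in> \<Omega> \<Longrightarrow> continuous_on {0..T} (\<lambda>t. X t \<omega>)"
  shows "prog_measurable T G X"
  unfolding prog_measurable_def
proof
  fix t assume t: "t \<in> {0..T}"
  let ?M = "restrict_space borel {0..t} \<Otimes>\<^sub>M G t"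
  \<comment> \<open>The next multiple of \<open>1 / n\<close> after \<open>s\<close>, clamped so
    that no value of \<open>X\<close> beyond time \<open>t\<close> is used. For \<open>n = 0\<close>
    division by zero yields the time 0, which still lies in \<open>{0..t}\<close>.\<close>
  define d where "d n s = max 0 (min t ((of_int \<lfloor>real n * s\<rfloor> + 1) / real n))" for n :: nat and s :: real
  have spM: "space ?M = {0..t} \<times> \<Omega>" by (simp add: space_pair_measure G space_restrict_space)
  have "(\<lambda>p. X (fst p) (snd p)) \<in> borel_measurable ?M"
  proof (rule borel_measurable_LIMSEQ_metric)
    fix n
    define Z where "Z k p = X (max 0 (min t ((of_int k + 1) / real n))) (snd p)" for k :: int and p :: "real \<times> 'w"
    have Z: "Z k \<in> borel_measurable ?M" for k
    proof -
      define u where "u = max 0 (min t ((of_int k + 1) / real n))"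
      have u: "u \<in> {0..T}" "u \<le> t" using t by (auto simp: u_def)
      have "sets (G u) \<subseteq> sets (G t)" by (rule G(1)[OF u(1) t u(2)])
      with X[OF u(1)] have "X u \<in> borel_measurable (G t)" by (auto simp: measurable_def G(2))
      then show ?thesis unfolding Z_def u_def[symmetric] by measurable
    qed
    have fl: "(\<lambda>p. \<lfloor>real n * fst p\<rfloor>) \<in> measurable ?M (count_space UNIV)"
    proof -
      have "(\<lambda>x::real. x) \<in> measurable (restrict_space borel {0..t}) borel" by (simp add: measurable_restrict_space1)
      then have [measurable]: "fst \<in> borel_measurable ?M" using measurable_compose[OF measurable_fst] by fastforce
      show ?thesis by measurable
    qed
    have "(\<lambda>p. Z \<lfloor>real n * fst p\<rfloor> p) \<in> borel_measurable ?M"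
      by (rule measurable_compose_countable[OF Z fl])
    then show "(\<lambda>p. X (d n (fst p)) (snd p)) \<in> borel_measurable ?M" by (simp add: Z_def d_def)
  next
    fix p assume p: "p \<in> space ?M"
    then have s: "fst p \<in> {0..t}" "snd p \<in> \<Omega>" by (auto simp: spM)
    have lim: "(\<lambda>n. d n (fst p)) \<longlonglongrightarrow> fst p"
    proof (rule LIMSEQ_I)
      fix e :: real assume "e > 0"
      then obtain N where N: "1 / real (Suc N) < e" using nat_approx_posE by metis
      have "\<bar>d n (fst p) - fst p\<bar> < e" if "n \<ge> Suc N" for n
      proof -
        have n: "real n > 0" "1 / real n \<le> 1 / real (Suc N)" using that by (auto intro!: divide_left_mono)
        define z where "z = (of_int \<lfloor>real n * fst p\<rfloor> + 1) / real n"
        have "real n * fst p < of_int \<lfloor>real n * fst p\<rfloor> + 1" "of_int \<lfloor>real n * fst p\<rfloor> \<le> real n * fst p"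
          by linarith+
        then have "fst p < z" "z \<le> fst p + 1 / real n"
          unfolding z_def using n by (auto simp: field_simps)
        then show ?thesis unfolding d_def z_def[symmetric] using s n N by (auto simp: min_def max_def)
      qed
      then show "\<exists>no. \<forall>n\<ge>no. norm (d n (fst p) - fst p) < e" by auto
    qed
    have c: "continuous_on {0..T} (\<lambda>u. X u (snd p))" using cont s by simp
    have "\<forall>n. d n (fst p) \<in> {0..T}" using t by (auto simp: d_def)
    moreover have "fst p \<in> {0..T}" using s t by auto
    ultimately show "(\<lambda>n. X (d n (fst p)) (snd p)) \<longlonglongrightarrow> X (fst p) (snd p)"
      using lim c unfolding continuous_on_sequentially o_def by (auto dest!: spec[of _ "\<lambda>n. d n (fst p)"])
  qed
  then show "(\<lambda>(s, \<omega>). X s \<omega>) \<in> borel_measurable ?M" by (simp add: case_prod_beta')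
qed

lemma prog_measurable_mono:
  assumes X: "prog_measurable T G X"
    and GF: "\<And>t. t \<in> {0..T} \<Longrightarrow> sets (G t) \<subseteq> sets (F t)" "\<And>t. space (G t) = space (F t)"
  shows "prog_measurable T F X"
  unfolding prog_measurable_def
proof
  fix t assume t: "t \<in> {0..T}"
  have "(\<lambda>x. x) \<in> measurable (F t) (G t)" using GF t by (auto simp: measurable_def)
  from measurable_compose[OF measurable_snd this]
  have "(\<lambda>p. (fst p, snd p)) \<in> measurable (restrict_space borel {0..t} \<Otimes>\<^sub>M F t) (restrict_space borel {0..t} \<Otimes>\<^sub>M G t)"
    by (intro measurable_Pair) auto
  moreover have "(\<lambda>(s, \<omega>). X s \<omega>) \<in> borel_measurable (restrict_space borel {0..t} \<Otimes>\<^sub>M G t)"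
    using X t by (simp add: prog_measurable_def)
  ultimately show "(\<lambda>(s, \<omega>). X s \<omega>) \<in> borel_measurable (restrict_space borel {0..t} \<Otimes>\<^sub>M F t)"
    using measurable_compose by (fastforce simp: case_prod_beta')
qed

lemma prog_measurable_section:
  assumes X: "prog_measurable T G X" and t: "t \<in> {0..T}"
  shows "X t \<in> borel_measurable (G t)"
proof -
  have "(\<lambda>(s, \<omega>). X s \<omega>) \<in> borel_measurable (restrict_space borel {0..t} \<Otimes>\<^sub>M G t)"
    using X t by (simp add: prog_measurable_def)
  from measurable_compose[OF measurable_Pair1' this, of t] t show ?thesis by (simp add: space_restrict_space)
qed

lemma prog_measurable_add:
  assumes "prog_measurable T G X" "prog_measurable T G Y"
  shows "prog_measurable T G (\<lambda>t \<omega>. X t \<omega> + Y t \<omega>)"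
  using assms unfolding prog_measurable_def case_prod_beta' by (intro ballI borel_measurable_add) auto

lemma prog_measurable_lebesgue_on:
  assumes X: "prog_measurable T G X" and t: "t \<in> {0..T}"
  shows "(\<lambda>p. X (fst p) (snd p)) \<in> borel_measurable (lebesgue_on {0..t} \<Otimes>\<^sub>M G t)"
proof -
  have "(\<lambda>x. x) \<in> measurable (lebesgue_on {0..t}) (restrict_space borel {0..t})"
    by (intro measurable_restrict_space2 borel_measurable_id_lebesgue_on) auto
  from measurable_compose[OF measurable_fst this]
  have "(\<lambda>p. (fst p, snd p)) \<in> measurable (lebesgue_on {0..t} \<Otimes>\<^sub>M G t) (restrict_space borel {0..t} \<Otimes>\<^sub>M G t)"
    by (intro measurable_Pair) auto
  moreover have "(\<lambda>(s, \<omega>). X s \<omega>) \<in> borel_measurable (restrict_space borel {0..t} \<Otimes>\<^sub>M G t)"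
    using X t by (simp add: prog_measurable_def)
  ultimately show ?thesis
    using measurable_compose by (fastforce simp: case_prod_beta')
qed

section \<open>Processes that are square integrable over time and scenario\<close>

context noise
begin

abbreviation LP :: "(real \<times> 'w) measure" where
  "LP \<equiv> lebesgue_on {0..T} \<Otimes>\<^sub>M P"

sublocale LL: finite_measure "lebesgue_on {0..T}"
  by (rule finite_measure_lebesgue_on_Icc)

sublocale LP: pair_sigma_finite "lebesgue_on {0..T}" P ..

lemma finite_LP: "finite_measure LP"
  by (rule finite_measure_pair_measure) unfold_locales

definition sq_process :: "(real \<Rightarrow> 'w \<Rightarrow> 'b::euclidean_space) \<Rightarrow> bool" where
  "sq_process X \<longleftrightarrow> sq_integrable LP (\<lambda>p. X (fst p) (snd p))"

lemma AE_LP_fst: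
  assumes "AE t in lebesgue_on {0..T}. Q t"
  shows "AE p in LP. Q (fst p)"
proof -
  from AE_E[OF assms] obtain N where N: "{t \<in> space (lebesgue_on {0..T}). \<not> Q t} \<subseteq> N"
    "emeasure (lebesgue_on {0..T}) N = 0" "N \<in> sets (lebesgue_on {0..T})" by blast
  have "N \<times> space P \<in> null_sets LP"
    using N by (auto simp: null_sets_def emeasure_pair_measure_Times)
  then show ?thesis by (rule AE_I') (use N in \<open>auto simp: space_pair_measure\<close>)
qed

lemma AE_LP_snd:
  assumes "AE \<omega> in P. Q \<omega>"
  shows "AE p in LP. Q (snd p)"
proof -
  from assms obtain N where N: "{\<omega> \<in> space P. \<not> Q \<omega>} \<subseteq> N" "N \<in> null_sets P"
    by (auto elim!: AE_E)
  have "{0..T} \<times> N \<in> null_sets LP"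
    using N by (auto simp: null_sets_def emeasure_pair_measure_Times sets_restrict_space_iff)
  then show ?thesis by (rule AE_I') (use N in \<open>auto simp: space_pair_measure\<close>)
qed

text \<open>The predicate need not define a measurable set, so the quantifiers are exchanged for a
  measurable null set that contains its failures.\<close>

lemma AE_LP_swap:
  assumes "AE p in LP. Q (fst p) (snd p)"
  shows "AE \<omega> in P. AE t in lebesgue_on {0..T}. Q t \<omega>"
proof -
  from assms obtain N where N: "{p \<in> space LP. \<not> Q (fst p) (snd p)} \<subseteq> N" "N \<in> null_sets LP"
    by (auto elim!: AE_E)
  have "AE p in LP. (fst p, snd p) \<notin> N" using AE_not_in[OF N(2)] by simp
  from LP.AE_pair[OF this] have "AE t in lebesgue_on {0..T}. AE \<omega> in P. (t, \<omega>) \<notin> N" by simp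
  moreover have "{p \<in> space LP. (fst p, snd p) \<notin> N} = space LP - N" by auto
  then have "{p \<in> space LP. (fst p, snd p) \<notin> N} \<in> sets LP" using N(2) by auto
  ultimately have "AE \<omega> in P. AE t in lebesgue_on {0..T}. (t, \<omega>) \<notin> N"
    using LP.AE_commute[of "\<lambda>t \<omega>. (t, \<omega>) \<notin> N"] by blast
  then show ?thesis using AE_space
  proof eventually_elim
    case (elim \<omega>)
    from elim(1) AE_space show ?case
    proof eventually_elim
      case (elim t)
      then have "(t, \<omega>) \<in> space LP" using \<open>\<omega> \<in> space P\<close> by (simp add: space_pair_measure)
      then show ?case using elim(1) subsetD[OF N(1), of "(t, \<omega>)"] by auto
    qed
  qed
qed

lemma sq_process_measurable: "sq_process X \<Longrightarrow> (\<lambda>p. X (fst p) (snd p)) \<in> borel_measurable LP"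
  by (auto simp: sq_process_def)

lemma sq_process_bound:
  assumes "sq_process Y" "(\<lambda>p. X (fst p) (snd p)) \<in> borel_measurable LP"
    "AE p in LP. norm (X (fst p) (snd p)) \<le> C * norm (Y (fst p) (snd p))"
  shows "sq_process X"
  using assms unfolding sq_process_def by (rule sq_integrable_bound)

lemma sq_process_const:
  assumes U: "sq_integrable P U"
  shows "sq_process (\<lambda>t. U)"
  unfolding sq_process_def
proof (rule sq_integrable_nn)
  note [measurable] = sq_integrable_measurable[OF U]
  show "(\<lambda>p. U (snd p)) \<in> borel_measurable LP" by measurable
  have "(\<integral>\<^sup>+p. ennreal ((norm (U (snd p)))\<^sup>2) \<partial>LP) = (\<integral>\<^sup>+t. (\<integral>\<^sup>+\<omega>. ennreal ((norm (U \<omega>))\<^sup>2) \<partial>P) \<partial>lebesgue_on {0..T})"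
    by (subst nn_integral_fst[symmetric]) auto
  also have "\<dots> < \<infinity>"
  proof -
    have "emeasure (lebesgue_on {0..T}) {0..T} < \<top>"
      using LL.emeasure_finite[of "{0..T}"] unfolding less_top[symmetric] by simp
    then show ?thesis unfolding sq_integrable_nn_eq[OF U] by (simp add: ennreal_mult_less_top)
  qed
  finally show "(\<integral>\<^sup>+p. ennreal ((norm (U (snd p)))\<^sup>2) \<partial>LP) < \<infinity>" .
qed

lemma sq_process_deterministic:
  assumes x: "sq_integrable (lebesgue_on {0..T}) x"
  shows "sq_process (\<lambda>t \<omega>. x t)"
  unfolding sq_process_def
proof (rule sq_integrable_nn)
  note [measurable] = sq_integrable_measurable[OF x]
  show "(\<lambda>p. x (fst p)) \<in> borel_measurable LP" by measurable
  have "(\<integral>\<^sup>+p. ennreal ((norm (x (fst p)))\<^sup>2) \<partial>LP) = (\<integral>\<^sup>+t. (\<integral>\<^sup>+\<omega>. ennreal ((norm (x t))\<^sup>2) \<partial>P) \<partial>lebesgue_on {0..T})"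
    by (subst nn_integral_fst[symmetric]) auto
  also have "\<dots> = (\<integral>\<^sup>+t. ennreal ((norm (x t))\<^sup>2) \<partial>lebesgue_on {0..T})" by (simp add: emeasure_space_1)
  also have "\<dots> < \<infinity>" unfolding sq_integrable_nn_eq[OF x] by simp
  finally show "(\<integral>\<^sup>+p. ennreal ((norm (x (fst p)))\<^sup>2) \<partial>LP) < \<infinity>" .
qed

lemma sq_process_add: "sq_process X \<Longrightarrow> sq_process Y \<Longrightarrow> sq_process (\<lambda>t \<omega>. X t \<omega> + Y t \<omega>)"
  unfolding sq_process_def by (rule sq_integrable_add)

lemma sq_process_diff: "sq_process X \<Longrightarrow> sq_process Y \<Longrightarrow> sq_process (\<lambda>t \<omega>. X t \<omega> - Y t \<omega>)"
  unfolding sq_process_def by (rule sq_integrable_diff)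

lemma sq_process_minus: "sq_process X \<Longrightarrow> sq_process (\<lambda>t \<omega>. - X t \<omega>)"
  unfolding sq_process_def by (rule sq_integrable_minus)

lemma sq_process_norm: "sq_process X \<Longrightarrow> sq_process (\<lambda>t \<omega>. norm (X t \<omega>))"
  using measurable_compose[OF sq_process_measurable borel_measurable_norm]
  by (intro sq_process_bound[where Y=X and C=1 and X="\<lambda>t \<omega>. norm (X t \<omega>)"]) simp_all

lemma sq_process_matrix:
  fixes X :: "real \<Rightarrow> 'w \<Rightarrow> real^'n" and K :: "real \<Rightarrow> real^'n^'m"
  assumes X: "sq_process X" and K: "Linf T K"
  shows "sq_process (\<lambda>t \<omega>. K t *v X t \<omega>)"
proof -
  obtain C where C: "K \<in> borel_measurable (lebesgue_on {0..T})" "C > 0" "AE t in lebesgue_on {0..T}. norm (K t) \<le> C"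
    using LinfE[OF K] by blast
  show ?thesis
  proof (rule sq_process_bound[OF X, where C=C])
    have "(\<lambda>p. K (fst p)) \<in> borel_measurable LP" using C(1) by measurable
    then show "(\<lambda>p. K (fst p) *v X (fst p) (snd p)) \<in> borel_measurable LP"
      using sq_process_measurable[OF X] by (rule borel_measurable_matrix_vector_mult)
    show "AE p in LP. norm (K (fst p) *v X (fst p) (snd p)) \<le> C * norm (X (fst p) (snd p))"
      using AE_LP_fst[OF C(3)]
      by eventually_elim (meson mult_right_mono norm_ge_zero norm_matrix_vector_mult_le order_trans)
  qed
qed

lemma sq_process_bilinear:
  fixes b :: "'b::euclidean_space \<Rightarrow> 'c::euclidean_space \<Rightarrow> 'e::euclidean_space"
  assumes "sq_process X" "sq_process Y" "bounded_bilinear b"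
  shows "integrable LP (\<lambda>p. b (X (fst p) (snd p)) (Y (fst p) (snd p)))"
  using assms unfolding sq_process_def by (rule sq_integrable_bilinear)

lemmas sq_process_inner = sq_process_bilinear[OF _ _ bounded_bilinear_inner]

lemma sq_process_section_time:
  assumes X: "sq_process X"
  shows "AE t in lebesgue_on {0..T}. sq_integrable P (X t)"
proof -
  have "AE t in lebesgue_on {0..T}. integrable P (\<lambda>\<omega>. (norm (X (fst (t, \<omega>)) (snd (t, \<omega>))))\<^sup>2)"
    using X by (intro LP.AE_integrable_fst') (simp add: sq_process_def sq_integrable_def)
  then show ?thesis using AE_space
  proof eventually_elim
    case (elim t)
    have "X t \<in> borel_measurable P"
      using measurable_compose[OF measurable_Pair1'[OF elim(2)] sq_process_measurable[OF X]] by simp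
    then show ?case using elim by (simp add: sq_integrable_def)
  qed
qed

lemma sq_process_section_path:
  assumes X: "sq_process X"
  shows "AE \<omega> in P. sq_integrable (lebesgue_on {0..T}) (\<lambda>t. X t \<omega>)"
proof -
  have "AE \<omega> in P. integrable (lebesgue_on {0..T}) (\<lambda>t. (norm (X t \<omega>))\<^sup>2)"
    using X by (intro LP.AE_integrable_snd) (simp add: sq_process_def sq_integrable_def case_prod_beta')
  then show ?thesis using AE_space
  proof eventually_elim
    case (elim \<omega>)
    have "(\<lambda>t. X t \<omega>) \<in> borel_measurable (lebesgue_on {0..T})"
      using measurable_compose[OF measurable_Pair2'[OF elim(2)] sq_process_measurable[OF X]] by simp
    then show ?case using elim by (simp add: sq_integrable_def)
  qed
qed

lemma sq_process_integrable_path: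
  assumes "sq_process X"
  shows "AE \<omega> in P. integrable (lebesgue_on {0..T}) (\<lambda>t. X t \<omega>)"
  using sq_process_section_path[OF assms]
  by eventually_elim (rule sq_integrable_imp_integrable[OF finite_measure_lebesgue_on_Icc])

lemma sq_integrable_integral:
  assumes X: "sq_process X"
  shows "sq_integrable P (\<lambda>\<omega>. integral\<^sup>L (lebesgue_on {0..T}) (\<lambda>s. X s \<omega>))"
  unfolding sq_integrable_def
proof
  have "(\<lambda>(\<omega>, s). X s \<omega>) \<in> borel_measurable (P \<Otimes>\<^sub>M lebesgue_on {0..T})"
    using measurable_pair_swap[OF sq_process_measurable[OF X]] by (simp add: case_prod_beta')
  then show m: "(\<lambda>\<omega>. integral\<^sup>L (lebesgue_on {0..T}) (\<lambda>s. X s \<omega>)) \<in> borel_measurable P"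
    by (rule LL.borel_measurable_lebesgue_integral)
  have i2: "integrable P (\<lambda>\<omega>. \<integral>s. (norm (X s \<omega>))\<^sup>2 \<partial>lebesgue_on {0..T})"
    using X by (intro LP.integrable_snd) (simp add: sq_process_def sq_integrable_def case_prod_beta')
  show "integrable P (\<lambda>\<omega>. (norm (integral\<^sup>L (lebesgue_on {0..T}) (\<lambda>s. X s \<omega>)))\<^sup>2)"
  proof (rule Bochner_Integration.integrable_bound)
    show "integrable P (\<lambda>\<omega>. T * (\<integral>s. (norm (X s \<omega>))\<^sup>2 \<partial>lebesgue_on {0..T}))" using i2 by simp
    show "(\<lambda>\<omega>. (norm (integral\<^sup>L (lebesgue_on {0..T}) (\<lambda>s. X s \<omega>)))\<^sup>2) \<in> borel_measurable P" using m by measurable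
    show "AE \<omega> in P. norm ((norm (integral\<^sup>L (lebesgue_on {0..T}) (\<lambda>s. X s \<omega>)))\<^sup>2)
      \<le> norm (T * (\<integral>s. (norm (X s \<omega>))\<^sup>2 \<partial>lebesgue_on {0..T}))"
      using sq_process_section_path[OF X]
    proof eventually_elim
      case (elim \<omega>)
      let ?L = "lebesgue_on {0..T}"
      define a where "a = (\<integral>s. norm (X s \<omega>) \<partial>?L)"
      have i: "integrable ?L (\<lambda>s. X s \<omega>)" "integrable ?L (\<lambda>s. (norm (X s \<omega>))\<^sup>2)"
        using elim sq_integrable_imp_integrable[OF finite_measure_lebesgue_on_Icc elim] by (auto simp: sq_integrable_def)
      have mT: "measure ?L {0..T} = T" using T by (simp add: measure_restrict_space)
      \<comment> \<open>Expanding the square around the time average \<open>a / T\<close> is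
        Cauchy-Schwarz against a constant function, which accounts for the factor \<open>T\<close>
        in the bound.\<close>
      have "0 \<le> (\<integral>s. (norm (X s \<omega>) - a / T)\<^sup>2 \<partial>?L)" by (intro integral_nonneg_AE AE_I2) simp
      also have "\<dots> = (\<integral>s. (norm (X s \<omega>))\<^sup>2 - 2 * (a / T) * norm (X s \<omega>) + (a / T)\<^sup>2 \<partial>?L)"
        by (intro Bochner_Integration.integral_cong refl) (simp add: power2_diff)
      also have "\<dots> = (\<integral>s. (norm (X s \<omega>))\<^sup>2 \<partial>?L) - 2 * (a / T) * a + (a / T)\<^sup>2 * T"
        using i mT by (simp add: a_def)
      also have "\<dots> = (\<integral>s. (norm (X s \<omega>))\<^sup>2 \<partial>?L) - a\<^sup>2 / T" using T by (simp add: power2_eq_square field_simps)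
      finally have "a\<^sup>2 \<le> T * (\<integral>s. (norm (X s \<omega>))\<^sup>2 \<partial>?L)" using T by (simp add: field_simps)
      moreover have "(norm (integral\<^sup>L ?L (\<lambda>s. X s \<omega>)))\<^sup>2 \<le> a\<^sup>2"
        unfolding a_def by (intro power_mono integral_norm_bound) simp
      ultimately show ?case by simp
    qed
  qed
qed

lemma integral_LP:
  fixes f :: "real \<Rightarrow> 'w \<Rightarrow> 'b::euclidean_space"
  assumes "integrable LP (\<lambda>p. f (fst p) (snd p))"
  shows "expectation (\<lambda>\<omega>. \<integral>t. f t \<omega> \<partial>lebesgue_on {0..T}) = (\<integral>t. expectation (f t) \<partial>lebesgue_on {0..T})"
    "integrable (lebesgue_on {0..T}) (\<lambda>t. expectation (f t))"
    "integrable P (\<lambda>\<omega>. \<integral>t. f t \<omega> \<partial>lebesgue_on {0..T})"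
    "AE t in lebesgue_on {0..T}. integrable P (f t)"
  using LP.Fubini_integral[of f] LP.integrable_fst[of f] LP.integrable_snd[of f] LP.AE_integrable_fst[of f] assms
  by (auto simp: case_prod_beta')

lemma expectation_integral:
  fixes f :: "real \<Rightarrow> 'w \<Rightarrow> 'b::euclidean_space"
  assumes f: "integrable LP (\<lambda>p. f (fst p) (snd p))" and t: "t \<le> T"
  shows "expectation (\<lambda>\<omega>. \<integral>s. f s \<omega> \<partial>lebesgue_on {0..t}) = (\<integral>s. expectation (f s) \<partial>lebesgue_on {0..t})"
    "integrable P (\<lambda>\<omega>. \<integral>s. f s \<omega> \<partial>lebesgue_on {0..t})"
proof -
  have "(\<lambda>p. indicator {0..t} (fst p) :: real) \<in> borel_measurable LP"
    by (rule measurable_compose[OF measurable_fst borel_measurable_indicator_lebesgue_on])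
  then have "(\<lambda>p. indicator {0..t} (fst p) *\<^sub>R f (fst p) (snd p)) \<in> borel_measurable LP"
    using f by (intro borel_measurable_scaleR) auto
  then have "integrable LP (\<lambda>p. indicator {0..t} (fst p) *\<^sub>R f (fst p) (snd p))"
    by (rule Bochner_Integration.integrable_bound[OF f]) (auto split: split_indicator)
  note * = integral_LP[of "\<lambda>s \<omega>. indicator {0..t} s *\<^sub>R f s \<omega>", OF this]
  show "expectation (\<lambda>\<omega>. \<integral>s. f s \<omega> \<partial>lebesgue_on {0..t}) = (\<integral>s. expectation (f s) \<partial>lebesgue_on {0..t})"
    "integrable P (\<lambda>\<omega>. \<integral>s. f s \<omega> \<partial>lebesgue_on {0..t})"
    unfolding integral_lebesgue_on_indicator[OF t] using *(1,3) by simp_all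
qed

text \<open>The vector \<open>E[U Y\<^sub>t]\<close> solves a homogeneous linear equation, so uncorrelatedness with the
  data of a linear equation is inherited by its solution.\<close>

lemma weak_gronwall:
  fixes U :: "'w \<Rightarrow> real" and Y g :: "real \<Rightarrow> 'w \<Rightarrow> real^'d"
  assumes U: "sq_integrable P U" and K: "Linf T K" and Y: "sq_process Y" and g: "sq_process g" and t0: "t0 \<in> {0..T}"
    and eq: "\<And>t. t \<in> {0..t0} \<Longrightarrow> AE \<omega> in P. Y t \<omega> = V t \<omega> + (\<integral>s. K s *v Y s \<omega> + g s \<omega> \<partial>lebesgue_on {0..t})"
    and V: "\<And>t. t \<in> {0..t0} \<Longrightarrow> sq_integrable P (V t)" "\<And>t. t \<in> {0..t0} \<Longrightarrow> expectation (\<lambda>\<omega>. U \<omega> *\<^sub>R V t \<omega>) = 0"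
    and Ym: "\<And>t. t \<in> {0..t0} \<Longrightarrow> Y t \<in> borel_measurable P"
    and g0: "AE s in lebesgue_on {0..t0}. expectation (\<lambda>\<omega>. U \<omega> *\<^sub>R g s \<omega>) = 0"
    and t: "t \<in> {0..t0}"
  shows "expectation (\<lambda>\<omega>. U \<omega> *\<^sub>R Y t \<omega>) = 0"
proof -
  define e where "e s = expectation (\<lambda>\<omega>. U \<omega> *\<^sub>R Y s \<omega>)" for s
  define k where "k s \<omega> = K s *v Y s \<omega> + g s \<omega>" for s \<omega>
  have k: "sq_process k" unfolding k_def by (intro sq_process_add sq_process_matrix Y K g)
  have Uk: "integrable LP (\<lambda>p. U (snd p) *\<^sub>R k (fst p) (snd p))"
    using sq_process_bilinear[OF sq_process_const[OF U] k bounded_bilinear_scaleR] by simp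
  have UY: "integrable LP (\<lambda>p. U (snd p) *\<^sub>R Y (fst p) (snd p))"
    using sq_process_bilinear[OF sq_process_const[OF U] Y bounded_bilinear_scaleR] by simp
  have Ug: "integrable LP (\<lambda>p. U (snd p) *\<^sub>R g (fst p) (snd p))"
    using sq_process_bilinear[OF sq_process_const[OF U] g bounded_bilinear_scaleR] by simp
  have aeT: "AE s in lebesgue_on {0..T}. expectation (\<lambda>\<omega>. U \<omega> *\<^sub>R k s \<omega>) = K s *v e s + expectation (\<lambda>\<omega>. U \<omega> *\<^sub>R g s \<omega>)"
    using integral_LP(4)[of "\<lambda>s \<omega>. U \<omega> *\<^sub>R Y s \<omega>", OF UY] integral_LP(4)[of "\<lambda>s \<omega>. U \<omega> *\<^sub>R g s \<omega>", OF Ug]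
  proof eventually_elim
    case (elim s)
    have "expectation (\<lambda>\<omega>. U \<omega> *\<^sub>R k s \<omega>) = expectation (\<lambda>\<omega>. K s *v (U \<omega> *\<^sub>R Y s \<omega>) + U \<omega> *\<^sub>R g s \<omega>)"
      by (simp add: k_def scaleR_add_right matrix_vector_mult_scaleR)
    also have "\<dots> = K s *v e s + expectation (\<lambda>\<omega>. U \<omega> *\<^sub>R g s \<omega>)"
      using elim integral_bounded_linear[OF matrix_vector_mul_bounded_linear elim(1), of "K s"]
        integrable_bounded_linear[OF matrix_vector_mul_bounded_linear elim(1), of "K s"] by (simp add: e_def)
    finally show ?case .
  qed
  have ae: "AE s in lebesgue_on {0..t0}. expectation (\<lambda>\<omega>. U \<omega> *\<^sub>R k s \<omega>) = K s *v e s"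
  proof -
    have "AE s in lebesgue_on {0..t0}. expectation (\<lambda>\<omega>. U \<omega> *\<^sub>R k s \<omega>) = K s *v e s + expectation (\<lambda>\<omega>. U \<omega> *\<^sub>R g s \<omega>)"
      by (rule AE_lebesgue_on_mono[OF aeT]) (use t0 in simp)
    with g0 show ?thesis by eventually_elim simp
  qed
  have eqe: "e t = (\<integral>s. expectation (\<lambda>\<omega>. U \<omega> *\<^sub>R k s \<omega>) \<partial>lebesgue_on {0..t})" if t: "t \<in> {0..t0}" for t
  proof -
    have tT: "t \<le> T" using t t0 by simp
    note ei = expectation_integral[of "\<lambda>s \<omega>. U \<omega> *\<^sub>R k s \<omega>", OF Uk tT]
    have UV: "integrable P (\<lambda>\<omega>. U \<omega> *\<^sub>R V t \<omega>)" by (rule sq_integrable_imp_scaleR[OF U V(1)[OF t]])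
    have "e t = expectation (\<lambda>\<omega>. U \<omega> *\<^sub>R V t \<omega> + (\<integral>s. U \<omega> *\<^sub>R k s \<omega> \<partial>lebesgue_on {0..t}))"
      unfolding e_def
    proof (rule integral_cong_AE)
      show "(\<lambda>\<omega>. U \<omega> *\<^sub>R Y t \<omega>) \<in> borel_measurable P" using U Ym[OF t] by (intro borel_measurable_scaleR) auto
      show "(\<lambda>\<omega>. U \<omega> *\<^sub>R V t \<omega> + (\<integral>s. U \<omega> *\<^sub>R k s \<omega> \<partial>lebesgue_on {0..t})) \<in> borel_measurable P"
        using UV ei(2) by (intro borel_measurable_add) auto
      show "AE \<omega> in P. U \<omega> *\<^sub>R Y t \<omega> = U \<omega> *\<^sub>R V t \<omega> + (\<integral>s. U \<omega> *\<^sub>R k s \<omega> \<partial>lebesgue_on {0..t})"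
        using eq[OF t] unfolding k_def[symmetric] by eventually_elim (simp add: scaleR_add_right)
    qed
    also have "\<dots> = (\<integral>s. expectation (\<lambda>\<omega>. U \<omega> *\<^sub>R k s \<omega>) \<partial>lebesgue_on {0..t})"
      using UV ei V(2)[OF t] by simp
    finally show ?thesis .
  qed
  have "e 0 = 0" using eqe[of 0] t0 by simp
  have "ode_on t0 e (\<lambda>s. expectation (\<lambda>\<omega>. U \<omega> *\<^sub>R k s \<omega>))"
  proof (rule ode_onI)
    show "integrable (lebesgue_on {0..t0}) (\<lambda>s. expectation (\<lambda>\<omega>. U \<omega> *\<^sub>R k s \<omega>))"
      by (rule integrable_lebesgue_on_mono[OF integral_LP(2)[of "\<lambda>s \<omega>. U \<omega> *\<^sub>R k s \<omega>", OF Uk]]) (use t0 in simp)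
    show "e s = e 0 + (\<integral>s. expectation (\<lambda>\<omega>. U \<omega> *\<^sub>R k s \<omega>) \<partial>lebesgue_on {0..s})" if "s \<in> {0..t0}" for s
      using eqe[OF that] \<open>e 0 = 0\<close> by simp
  qed
  moreover obtain C where C: "C > 0" "AE t in lebesgue_on {0..T}. norm (K t) \<le> C" using LinfE[OF K] by blast
  moreover have "AE s in lebesgue_on {0..t0}. norm (expectation (\<lambda>\<omega>. U \<omega> *\<^sub>R k s \<omega>)) \<le> C * norm (e s) + 0"
  proof -
    have "AE s in lebesgue_on {0..t0}. norm (K s) \<le> C" by (rule AE_lebesgue_on_mono[OF C(2)]) (use t0 in simp)
    with ae show ?thesis
    proof eventually_elim
      case (elim s)
      have "norm (K s *v e s) \<le> C * norm (e s)"
        using norm_matrix_vector_mult_le[of "K s" "e s"] mult_right_mono[OF elim(2), of "norm (e s)"] by simp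
      then show ?case using elim(1) by simp
    qed
  qed
  ultimately have "norm (e t) \<le> (norm (e 0) + integral\<^sup>L (lebesgue_on {0..t0}) (\<lambda>s. 0)) * exp (C * t0)"
    using t by (intro ode_on_bound) auto
  then show ?thesis using \<open>e 0 = 0\<close> by (simp add: e_def)
qed

lemma prog_measurable_LP:
  assumes "prog_measurable T F X"
  shows "(\<lambda>p. X (fst p) (snd p)) \<in> borel_measurable LP"
proof -
  have "(\<lambda>x. x) \<in> measurable P (F T)" using sets_F_P[of T] T by (auto simp: measurable_def)
  from measurable_compose[OF measurable_snd this]
  have "(\<lambda>p. (fst p, snd p)) \<in> measurable LP (lebesgue_on {0..T} \<Otimes>\<^sub>M F T)"
    by (intro measurable_Pair) auto
  from measurable_compose[OF this prog_measurable_lebesgue_on[OF assms, of T]] T show ?thesis by simp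
qed

lemma H2_sq_process:
  assumes "\<alpha> \<in> H2 T P F"
  shows "sq_process \<alpha>"
  unfolding sq_process_def
proof (rule sq_integrable_nn)
  have p: "prog_measurable T F \<alpha>" using assms by (simp add: H2_def)
  show m: "(\<lambda>p. \<alpha> (fst p) (snd p)) \<in> borel_measurable LP" by (rule prog_measurable_LP[OF p])
  have "(\<integral>\<^sup>+p. ennreal ((norm (\<alpha> (fst p) (snd p)))\<^sup>2) \<partial>LP) = (\<integral>\<^sup>+\<omega>. (\<integral>\<^sup>+t. ennreal ((norm (\<alpha> t \<omega>))\<^sup>2) \<partial>lebesgue_on {0..T}) \<partial>P)"
    using m by (subst LP.nn_integral_snd[symmetric]) auto
  also have "\<dots> < \<infinity>" using assms by (simp add: H2_def nn_integral_restrict_space)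
  finally show "(\<integral>\<^sup>+p. ennreal ((norm (\<alpha> (fst p) (snd p)))\<^sup>2) \<partial>LP) < \<infinity>" .
qed

lemma H2I:
  assumes p: "prog_measurable T G \<alpha>" and sq: "sq_process \<alpha>"
  shows "\<alpha> \<in> H2 T P G"
proof -
  have m: "(\<lambda>p. ennreal ((norm (\<alpha> (fst p) (snd p)))\<^sup>2)) \<in> borel_measurable LP"
    using sq_process_measurable[OF sq] by measurable
  have "(\<integral>\<^sup>+\<omega>. (\<integral>\<^sup>+t\<in>{0..T}. ennreal ((norm (\<alpha> t \<omega>))\<^sup>2) \<partial>lebesgue) \<partial>P) = (\<integral>\<^sup>+p. ennreal ((norm (\<alpha> (fst p) (snd p)))\<^sup>2) \<partial>LP)"
    by (subst LP.nn_integral_snd[OF m, symmetric]) (simp add: nn_integral_restrict_space)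
  also have "\<dots> < \<infinity>"
    using sq_integrable_nn_eq[OF sq[unfolded sq_process_def]] by simp
  finally show ?thesis using p by (simp add: H2_def)
qed

lemma H2_mono:
  assumes "\<alpha> \<in> H2 T P G" "\<And>t. t \<in> {0..T} \<Longrightarrow> sets (G t) \<subseteq> sets (F t)" "\<And>t. space (G t) = space P"
  shows "\<alpha> \<in> H2 T P F"
  using assms prog_measurable_mono[of T G \<alpha> F] by (auto simp: H2_def)

text \<open>Discontinuous paths are set to zero. The result is continuous in every scenario, as the
  discretisation behind progressive measurability requires, and stays adapted because
  \<open>G\<close> contains the null sets.\<close>

lemma continuous_modification:
  fixes X :: "real \<Rightarrow> 'w \<Rightarrow> 'b::euclidean_space"
  assumes X: "\<And>t. t \<in> {0..T} \<Longrightarrow> X t \<in> borel_measurable (G t)" and c: "AE \<omega> in P. continuous_on {0..T} (\<lambda>t. X t \<omega>)"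
    and G: "\<And>s t. s \<in> {0..T} \<Longrightarrow> t \<in> {0..T} \<Longrightarrow> s \<le> t \<Longrightarrow> sets (G s) \<subseteq> sets (G t)" "\<And>t. space (G t) = space P"
      "\<And>t. t \<in> {0..T} \<Longrightarrow> null_sets P \<subseteq> sets (G t)"
  shows "\<exists>X'. prog_measurable T G X' \<and> (\<forall>\<omega>\<in>space P. continuous_on {0..T} (\<lambda>t. X' t \<omega>)) \<and> (AE \<omega> in P. \<forall>t. X' t \<omega> = X t \<omega>)"
proof -
  define X' where "X' t \<omega> = (if continuous_on {0..T} (\<lambda>t. X t \<omega>) then X t \<omega> else 0)" for t \<omega>
  have ae: "AE \<omega> in P. \<forall>t. X' t \<omega> = X t \<omega>" using c by eventually_elim (simp add: X'_def)
  have cont: "continuous_on {0..T} (\<lambda>t. X' t \<omega>)" for \<omega>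
    by (cases "continuous_on {0..T} (\<lambda>t. X t \<omega>)") (simp_all add: X'_def)
  have "X' t \<in> borel_measurable (G t)" if "t \<in> {0..T}" for t
    by (rule measurable_AE_cong_null[OF X[OF that] G(2) G(3)[OF that]]) (use ae in \<open>auto elim: eventually_mono\<close>)
  then have "prog_measurable T G X'" using G cont by (intro prog_measurable_continuous[where \<Omega>="space P"]) auto
  then show ?thesis using cont ae by blast
qed

end

section \<open>The controlled state\<close>

lemma integrable_Linf_matrix:
  fixes g :: "real \<Rightarrow> real^'n" and K :: "real \<Rightarrow> real^'n^'m"
  assumes K: "Linf T K" and g: "integrable (lebesgue_on {0..T}) g"
  shows "integrable (lebesgue_on {0..T}) (\<lambda>s. K s *v g s)"
proof -
  obtain C where C: "K \<in> borel_measurable (lebesgue_on {0..T})" "C > 0" "AE t in lebesgue_on {0..T}. norm (K t) \<le> C"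
    using LinfE[OF K] by blast
  show ?thesis
  proof (rule Bochner_Integration.integrable_bound)
    show "integrable (lebesgue_on {0..T}) (\<lambda>s. C * norm (g s))" using g by simp
    show "(\<lambda>s. K s *v g s) \<in> borel_measurable (lebesgue_on {0..T})" using C(1) g by (intro borel_measurable_matrix_vector_mult) auto
    show "AE s in lebesgue_on {0..T}. norm (K s *v g s) \<le> norm (C * norm (g s))"
      using C(3)
    proof eventually_elim
      case (elim s)
      then show ?case
        using norm_matrix_vector_mult_le[of "K s" "g s"] mult_right_mono[OF elim, of "norm (g s)"] C(2) by simp
    qed
  qed
qed

lemma sq_integrable_norm: "sq_integrable M X \<Longrightarrow> sq_integrable M (\<lambda>\<omega>. norm (X \<omega>))"
  using measurable_compose[OF sq_integrable_measurable borel_measurable_norm] by (simp add: sq_integrable_def)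

locale linear_state = noise P T F W \<xi>
  for P :: "'w measure" and T :: real and F :: "real \<Rightarrow> 'w measure" and W :: "real \<Rightarrow> 'w \<Rightarrow> real^'d" and \<xi> :: "'w \<Rightarrow> real^'d" +
  fixes A :: "real \<Rightarrow> real^'d^'d" and B :: "real \<Rightarrow> real^'k^'d" and \<sigma> :: "real \<Rightarrow> real^'d^'d"
  assumes A: "Linf T A" and B: "Linf T B" and \<sigma>: "Linf T \<sigma>"
begin

lemma continuous_modification_F:
  fixes X :: "real \<Rightarrow> 'w \<Rightarrow> 'b::euclidean_space"
  assumes "\<And>t. t \<in> {0..T} \<Longrightarrow> X t \<in> borel_measurable (F t)" "AE \<omega> in P. continuous_on {0..T} (\<lambda>t. X t \<omega>)"
  obtains X' where "prog_measurable T F X'" "AE \<omega> in P. \<forall>t. X' t \<omega> = X t \<omega>"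
proof -
  have "\<exists>X'. prog_measurable T F X' \<and> (\<forall>\<omega>\<in>space P. continuous_on {0..T} (\<lambda>t. X' t \<omega>)) \<and> (AE \<omega> in P. \<forall>t. X' t \<omega> = X t \<omega>)"
  proof (rule continuous_modification[OF assms])
    show "sets (F s) \<subseteq> sets (F t)" if "s \<le> t" for s t by (rule sets_F_mono[OF that])
    show "null_sets P \<subseteq> sets (F t)" if "t \<in> {0..T}" for t using null_sets_F that by simp
  qed simp_all
  then show ?thesis using that by blast
qed

abbreviation is_state :: "(real \<Rightarrow> 'w \<Rightarrow> real^'k) \<Rightarrow> (real \<Rightarrow> 'w \<Rightarrow> real^'d) \<Rightarrow> bool" where
  "is_state lam X \<equiv> state_process T P F W \<xi> A B \<sigma> lam X"

lemma is_state_prog: "is_state lam X \<Longrightarrow> prog_measurable T F X"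
  and is_state_continuous: "is_state lam X \<Longrightarrow> AE \<omega> in P. continuous_on {0..T} (\<lambda>t. X t \<omega>)"
  by (auto simp: state_process_def)

lemma is_state_measurable: "is_state lam X \<Longrightarrow> t \<in> {0..T} \<Longrightarrow> X t \<in> borel_measurable P"
  using measurable_F_P[OF prog_measurable_section[OF is_state_prog]] by blast

text \<open>Once \<open>\<xi>\<close> and the stochastic integral are subtracted, the path is
  absolutely continuous; states can then be treated scenario by scenario with the calculus of
  integrated equations.\<close>

lemma is_state_ode:
  assumes X: "is_state lam X" and lam: "lam \<in> H2 T P F"
  shows "\<exists>I. stoch_integral T P F W \<sigma> I \<and> (AE \<omega> in P.
    ode_on T (\<lambda>t. X t \<omega> - \<xi> \<omega> - I t \<omega>) (\<lambda>s. A s *v X s \<omega> + B s *v lam s \<omega>) \<and> X 0 \<omega> - \<xi> \<omega> - I 0 \<omega> = 0)"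
proof -
  obtain I where I: "stoch_integral T P F W \<sigma> I"
    and eq: "AE \<omega> in P. \<forall>t\<in>{0..T}. X t \<omega> = \<xi> \<omega> + (LINT s:{0..t}|lebesgue. A s *v X s \<omega> + B s *v lam s \<omega>) + I t \<omega>"
    using X unfolding state_process_def by blast
  have "AE \<omega> in P. ode_on T (\<lambda>t. X t \<omega> - \<xi> \<omega> - I t \<omega>) (\<lambda>s. A s *v X s \<omega> + B s *v lam s \<omega>) \<and> X 0 \<omega> - \<xi> \<omega> - I 0 \<omega> = 0"
    using eq is_state_continuous[OF X] sq_process_integrable_path[OF H2_sq_process[OF lam]]
  proof eventually_elim
    case (elim \<omega>)
    have e: "X t \<omega> - \<xi> \<omega> - I t \<omega> = integral\<^sup>L (lebesgue_on {0..t}) (\<lambda>s. A s *v X s \<omega> + B s *v lam s \<omega>)" if "t \<in> {0..T}" for t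
      using elim(1) that by (simp add: set_integral_eq_lebesgue_on)
    have z: "X 0 \<omega> - \<xi> \<omega> - I 0 \<omega> = 0" using e[of 0] T by simp
    have i: "integrable (lebesgue_on {0..T}) (\<lambda>s. A s *v X s \<omega> + B s *v lam s \<omega>)"
      by (intro Bochner_Integration.integrable_add integrable_Linf_matrix A B continuous_on_integrable_lebesgue_on elim)
    show ?case
    proof (intro conjI ode_onI)
      show "X t \<omega> - \<xi> \<omega> - I t \<omega> = X 0 \<omega> - \<xi> \<omega> - I 0 \<omega> + integral\<^sup>L (lebesgue_on {0..t}) (\<lambda>s. A s *v X s \<omega> + B s *v lam s \<omega>)"
        if "t \<in> {0..T}" for t unfolding z using e[OF that] by simp
    qed (use i z in auto)
  qed
  then show ?thesis using I by blast
qed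

text \<open>\<open>I\<close> is adapted with almost surely continuous paths. The modification is
  jointly measurable, which Fubini needs, and its second moments are bounded by the one at time
  \<open>T\<close>.\<close>

lemma stoch_integral_modification:
  assumes I: "stoch_integral T P F W \<sigma> I"
  shows "\<exists>I'. prog_measurable T F I' \<and> sq_process I' \<and> (\<forall>t\<in>{0..T}. sq_integrable P (I' t)) \<and> (AE \<omega> in P. \<forall>t. I' t \<omega> = I t \<omega>)"
proof -
  have c: "AE \<omega> in P. continuous_on {0..T} (\<lambda>t. I t \<omega>)" using I by (simp add: stoch_integral_def)
  obtain I' where I': "prog_measurable T F I'" "AE \<omega> in P. \<forall>t. I' t \<omega> = I t \<omega>"
    using continuous_modification_F[OF stoch_integral_F[OF I] c] by blast
  have m: "I' t \<in> borel_measurable P" if "t \<in> {0..T}" for t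
    using measurable_F_P[OF prog_measurable_section[OF I'(1) that] that] .
  have sq: "sq_integrable P (I' t)" if "t \<in> {0..T}" for t
    by (rule sq_integrable_cong_AE[OF stoch_integral_sq[OF I \<sigma> that] m[OF that]]) (use I'(2) in \<open>auto elim: eventually_mono\<close>)
  have le: "expectation (\<lambda>\<omega>. (norm (I' t \<omega>))\<^sup>2) \<le> expectation (\<lambda>\<omega>. (norm (I T \<omega>))\<^sup>2)" if t: "t \<in> {0..T}" for t
  proof -
    have "expectation (\<lambda>\<omega>. (norm (I' t \<omega>))\<^sup>2) = expectation (\<lambda>\<omega>. (norm (I t \<omega>))\<^sup>2)"
      using m[OF t] sq_integrable_measurable[OF stoch_integral_sq[OF I \<sigma> t]] I'(2)
      by (intro integral_cong_AE) (auto elim: eventually_mono)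
    then show ?thesis using stoch_integral_second_moment[OF I \<sigma> t] by simp
  qed
  have "sq_process I'"
    unfolding sq_process_def
  proof (rule sq_integrable_nn)
    show mm: "(\<lambda>p. I' (fst p) (snd p)) \<in> borel_measurable LP" by (rule prog_measurable_LP[OF I'(1)])
    have "(\<integral>\<^sup>+p. ennreal ((norm (I' (fst p) (snd p)))\<^sup>2) \<partial>LP) = (\<integral>\<^sup>+t. (\<integral>\<^sup>+\<omega>. ennreal ((norm (I' t \<omega>))\<^sup>2) \<partial>P) \<partial>lebesgue_on {0..T})"
      using mm by (subst nn_integral_fst[symmetric]) auto
    also have "\<dots> \<le> (\<integral>\<^sup>+t. ennreal (expectation (\<lambda>\<omega>. (norm (I T \<omega>))\<^sup>2)) \<partial>lebesgue_on {0..T})"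
      by (intro nn_integral_mono) (simp add: sq_integrable_nn_eq[OF sq] le ennreal_leI)
    also have "\<dots> < \<infinity>"
    proof -
      have "emeasure (lebesgue_on {0..T}) {0..T} < \<top>"
        using LL.emeasure_finite[of "{0..T}"] unfolding less_top[symmetric] by simp
      then show ?thesis by (simp add: ennreal_mult_less_top)
    qed
    finally show "(\<integral>\<^sup>+p. ennreal ((norm (I' (fst p) (snd p)))\<^sup>2) \<partial>LP) < \<infinity>" .
  qed
  then show ?thesis using I' sq by blast
qed

lemma is_state_sq:
  assumes X: "is_state lam X" and lam: "lam \<in> H2 T P F"
  shows "sq_process X" "\<And>t. t \<in> {0..T} \<Longrightarrow> sq_integrable P (X t)"
proof -
  obtain I where I: "stoch_integral T P F W \<sigma> I" and ode: "AE \<omega> in P.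
    ode_on T (\<lambda>t. X t \<omega> - \<xi> \<omega> - I t \<omega>) (\<lambda>s. A s *v X s \<omega> + B s *v lam s \<omega>) \<and> X 0 \<omega> - \<xi> \<omega> - I 0 \<omega> = 0"
    using is_state_ode[OF assms] by blast
  obtain I' where I': "sq_process I'" "\<And>t. t \<in> {0..T} \<Longrightarrow> sq_integrable P (I' t)" "AE \<omega> in P. \<forall>t. I' t \<omega> = I t \<omega>"
    using stoch_integral_modification[OF I] by blast
  obtain C where C: "C > 0" "AE t in lebesgue_on {0..T}. norm (A t) \<le> C" using LinfE[OF A] by blast
  \<comment> \<open>Forcing for the shifted path \<open>X - \<xi> - I\<close>: expressing the drift
    through the shifted path costs \<open>C\<close> times the norms of \<open>\<xi>\<close> and of
    the stochastic integral, and the control adds its own term.\<close>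
  define k where "k s \<omega> = C * (norm (\<xi> \<omega>) + norm (I' s \<omega>)) + norm (B s *v lam s \<omega>)" for s \<omega>
  have k: "sq_process k"
  proof -
    have "sq_process (\<lambda>s \<omega>. norm (\<xi> \<omega>) + norm (I' s \<omega>))"
      by (intro sq_process_add sq_process_norm I' sq_process_const[OF sq_\<xi>])
    then have "sq_process (\<lambda>s \<omega>. C * (norm (\<xi> \<omega>) + norm (I' s \<omega>)))"
      unfolding sq_process_def by (rule sq_integrable_mult)
    moreover have "sq_process (\<lambda>s \<omega>. norm (B s *v lam s \<omega>))"
      by (intro sq_process_norm sq_process_matrix B H2_sq_process lam)
    ultimately show ?thesis unfolding k_def by (rule sq_process_add)
  qed
  define Y where "Y \<omega> = exp (C * T) * integral\<^sup>L (lebesgue_on {0..T}) (\<lambda>s. k s \<omega>)" for \<omega>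
  have Y: "sq_integrable P Y"
    unfolding Y_def by (intro sq_integrable_mult sq_integrable_integral k)
  have bd: "AE \<omega> in P. \<forall>t\<in>{0..T}. norm (X t \<omega>) \<le> norm (\<xi> \<omega>) + norm (I' t \<omega>) + norm (Y \<omega>)"
    using ode I'(3) sq_process_integrable_path[OF k]
  proof eventually_elim
    case (elim \<omega>)
    show ?case
    proof
      fix t assume t: "t \<in> {0..T}"
      have "norm (X t \<omega> - \<xi> \<omega> - I t \<omega>) \<le> (norm (X 0 \<omega> - \<xi> \<omega> - I 0 \<omega>) + integral\<^sup>L (lebesgue_on {0..T}) (\<lambda>s. k s \<omega>)) * exp (C * T)"
      proof (rule ode_on_bound[OF conjunct1[OF elim(1)] _ _ elim(3) _ t])
        show "AE s in lebesgue_on {0..T}. norm (A s *v X s \<omega> + B s *v lam s \<omega>) \<le> C * norm (X s \<omega> - \<xi> \<omega> - I s \<omega>) + k s \<omega>"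
          using C(2)
        proof eventually_elim
          case (elim s)
          have "norm (A s *v X s \<omega> + B s *v lam s \<omega>) \<le> C * norm (X s \<omega>) + norm (B s *v lam s \<omega>)"
            using norm_triangle_ineq[of "A s *v X s \<omega>" "B s *v lam s \<omega>"] norm_matrix_vector_mult_le[of "A s" "X s \<omega>"]
              mult_right_mono[OF elim, of "norm (X s \<omega>)"] by simp
          moreover have "norm (X s \<omega>) \<le> norm (X s \<omega> - \<xi> \<omega> - I s \<omega>) + (norm (\<xi> \<omega>) + norm (I' s \<omega>))"
            using norm_triangle_ineq[of "X s \<omega> - \<xi> \<omega> - I s \<omega>" "\<xi> \<omega> + I s \<omega>"] norm_triangle_ineq[of "\<xi> \<omega>" "I s \<omega>"]
              \<open>\<forall>t. I' t \<omega> = I t \<omega>\<close> by simp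
          then have "C * norm (X s \<omega>) \<le> C * (norm (X s \<omega> - \<xi> \<omega> - I s \<omega>) + (norm (\<xi> \<omega>) + norm (I' s \<omega>)))"
            using C(1) by (intro mult_left_mono) auto
          ultimately show ?case by (simp add: k_def algebra_simps)
        qed
      qed (use C(1) in \<open>auto simp: k_def\<close>)
      then have "norm (X t \<omega> - \<xi> \<omega> - I t \<omega>) \<le> norm (Y \<omega>)"
        using elim(1) by (simp add: Y_def mult.commute)
      then show "norm (X t \<omega>) \<le> norm (\<xi> \<omega>) + norm (I' t \<omega>) + norm (Y \<omega>)"
        using norm_triangle_ineq[of "X t \<omega> - \<xi> \<omega> - I t \<omega>" "\<xi> \<omega> + I t \<omega>"] norm_triangle_ineq[of "\<xi> \<omega>" "I t \<omega>"] elim(2) by simp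
    qed
  qed
  show "sq_process X"
  proof (rule sq_process_bound[where C=1])
    show "sq_process (\<lambda>t \<omega>. norm (\<xi> \<omega>) + norm (I' t \<omega>) + norm (Y \<omega>))"
      by (intro sq_process_add sq_process_norm I' sq_process_const sq_\<xi> Y)
    show "(\<lambda>p. X (fst p) (snd p)) \<in> borel_measurable LP" by (rule prog_measurable_LP[OF is_state_prog[OF X]])
    show "AE p in LP. norm (X (fst p) (snd p)) \<le> 1 * norm (norm (\<xi> (snd p)) + norm (I' (fst p) (snd p)) + norm (Y (snd p)))"
      using AE_LP_snd[OF bd] AE_space by eventually_elim (auto simp: space_pair_measure)
  qed
  show "sq_integrable P (X t)" if t: "t \<in> {0..T}" for t
  proof (rule sq_integrable_bound[where C=1])
    show "sq_integrable P (\<lambda>\<omega>. norm (\<xi> \<omega>) + norm (I' t \<omega>) + norm (Y \<omega>))"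
      by (intro sq_integrable_add sq_integrable_norm Y I' sq_\<xi> t)
    show "X t \<in> borel_measurable P" by (rule is_state_measurable[OF X t])
    show "AE \<omega> in P. norm (X t \<omega>) \<le> 1 * norm (norm (\<xi> \<omega>) + norm (I' t \<omega>) + norm (Y \<omega>))"
      using bd by eventually_elim (use t in auto)
  qed
qed

text \<open>Both states contain the same \<open>\<xi>\<close> and, by uniqueness of the stochastic
  integral, the same noise term.\<close>

lemma is_state_diff:
  assumes X: "is_state lam X" and lam: "lam \<in> H2 T P F" and X': "is_state \<beta> X'" and \<beta>: "\<beta> \<in> H2 T P F"
  shows "AE \<omega> in P. ode_on T (\<lambda>t. X' t \<omega> - X t \<omega>) (\<lambda>t. A t *v (X' t \<omega> - X t \<omega>) + B t *v (\<beta> t \<omega> - lam t \<omega>)) \<and> X' 0 \<omega> - X 0 \<omega> = 0"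
proof -
  obtain I where I: "stoch_integral T P F W \<sigma> I" and ode: "AE \<omega> in P.
    ode_on T (\<lambda>t. X t \<omega> - \<xi> \<omega> - I t \<omega>) (\<lambda>s. A s *v X s \<omega> + B s *v lam s \<omega>) \<and> X 0 \<omega> - \<xi> \<omega> - I 0 \<omega> = 0"
    using is_state_ode[OF X lam] by blast
  obtain I' where I': "stoch_integral T P F W \<sigma> I'" and ode': "AE \<omega> in P.
    ode_on T (\<lambda>t. X' t \<omega> - \<xi> \<omega> - I' t \<omega>) (\<lambda>s. A s *v X' s \<omega> + B s *v \<beta> s \<omega>) \<and> X' 0 \<omega> - \<xi> \<omega> - I' 0 \<omega> = 0"
    using is_state_ode[OF X' \<beta>] by blast
  show ?thesis
    using ode ode' stoch_integral_unique[OF I I' \<sigma>]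
  proof eventually_elim
    case (elim \<omega>)
    have eq: "(A s *v X' s \<omega> + B s *v \<beta> s \<omega>) - (A s *v X s \<omega> + B s *v lam s \<omega>) = A s *v (X' s \<omega> - X s \<omega>) + B s *v (\<beta> s \<omega> - lam s \<omega>)" for s
      by (simp add: matrix_vector_mult_diff_distrib)
    note o = ode_on_diff[OF conjunct1[OF elim(2)] conjunct1[OF elim(1)], unfolded eq]
    have "ode_on T (\<lambda>t. X' t \<omega> - X t \<omega>) (\<lambda>t. A t *v (X' t \<omega> - X t \<omega>) + B t *v (\<beta> t \<omega> - lam t \<omega>))"
      by (rule ode_on_cong[OF o]) (use elim(3) T ode_onD(1)[OF o] in auto)
    moreover have "X' 0 \<omega> - X 0 \<omega> = 0"
    proof -
      have "I 0 \<omega> = I' 0 \<omega>" using elim(3) T by simp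
      then show ?thesis using elim(1,2) by (simp add: diff_diff_eq)
    qed
    ultimately show ?case by simp
  qed
qed

lemma ode_unique_zero:
  fixes y :: "real \<Rightarrow> real^'n"
  assumes y: "ode_on T y g" and y0: "y 0 = 0" and K: "Linf T K" and g: "AE s in lebesgue_on {0..T}. g s = K s *v y s"
    and t: "t \<in> {0..T}"
  shows "y t = 0"
proof -
  obtain C where C: "C > 0" "AE t in lebesgue_on {0..T}. norm (K t) \<le> C" using LinfE[OF K] by blast
  have "norm (y t) \<le> (norm (y 0) + integral\<^sup>L (lebesgue_on {0..T}) (\<lambda>s. 0)) * exp (C * T)"
  proof (rule ode_on_bound[OF y _ _ _ _ t])
    show "AE s in lebesgue_on {0..T}. norm (g s) \<le> C * norm (y s) + 0"
      using C(2) g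
    proof eventually_elim
      case (elim s)
      then show ?case using norm_matrix_vector_mult_le[of "K s" "y s"] mult_right_mono[OF elim(1), of "norm (y s)"] by simp
    qed
  qed (use C in auto)
  then show ?thesis using y0 by simp
qed

lemma is_state_unique:
  assumes X: "is_state lam X" and lam: "lam \<in> H2 T P F" and X': "is_state lam X'"
  shows "AE \<omega> in P. \<forall>t\<in>{0..T}. X' t \<omega> = X t \<omega>"
  using is_state_diff[OF X lam X' lam]
proof eventually_elim
  case (elim \<omega>)
  then show ?case using ode_unique_zero[OF conjunct1[OF elim] _ A] by auto
qed

text \<open>Progressive measurability makes the integrand jointly measurable on
  \<open>{0..t}\<close> and \<open>G t\<close>, so integrating out time leaves a
  \<open>G t\<close>-measurable variable.\<close>

lemma adapted_integral:
  fixes K :: "real \<Rightarrow> real^'n^'m"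
  assumes h: "prog_measurable T G h" and K: "K \<in> borel_measurable (lebesgue_on {0..T})" and t: "t \<in> {0..T}"
  shows "(\<lambda>\<omega>. integral\<^sup>L (lebesgue_on {0..t}) (\<lambda>s. K s *v h s \<omega>)) \<in> borel_measurable (G t)"
proof -
  interpret finite_measure "lebesgue_on {0..t}" by (rule finite_measure_lebesgue_on_Icc)
  have "K \<in> borel_measurable (lebesgue_on {0..t})" using measurable_lebesgue_on_mono[OF K] t by simp
  then have "(\<lambda>p. K (fst p)) \<in> borel_measurable (lebesgue_on {0..t} \<Otimes>\<^sub>M G t)" by measurable
  then have "(\<lambda>p. K (fst p) *v h (fst p) (snd p)) \<in> borel_measurable (lebesgue_on {0..t} \<Otimes>\<^sub>M G t)"
    using prog_measurable_lebesgue_on[OF h t] by (rule borel_measurable_matrix_vector_mult)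
  from measurable_pair_swap[OF this] have "(\<lambda>(\<omega>, s). K s *v h s \<omega>) \<in> borel_measurable (G t \<Otimes>\<^sub>M lebesgue_on {0..t})"
    by (simp add: case_prod_beta')
  then show ?thesis by (rule borel_measurable_lebesgue_integral)
qed

lemma prog_measurable_diff_fun:
  assumes "prog_measurable T G X" "prog_measurable T G Y"
  shows "prog_measurable T G (\<lambda>t \<omega>. X t \<omega> - Y t \<omega>)"
  using assms unfolding prog_measurable_def case_prod_beta' by (intro ballI borel_measurable_diff) auto

text \<open>No stochastic equation has to be solved: a state of one control becomes a state of
  another by adding the noise-free response \<open>D\<close> to the difference of the controls. A
  flow of the class supplies the state to start from.\<close>

lemma is_state_exists:
  assumes X: "is_state lam X" and lam: "lam \<in> H2 T P F" and \<beta>: "\<beta> \<in> H2 T P F"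
  shows "\<exists>X'. is_state \<beta> X'"
proof -
  obtain Xf :: "real \<Rightarrow> real^'d^'d" and Yf :: "real \<Rightarrow> real^'d^'d" where f: "ode_on T Xf (\<lambda>t. A t ** Xf t)" "ode_on T Yf (\<lambda>t. - (Yf t ** A t))" "\<forall>t\<in>{0..T}. Xf t ** Yf t = mat 1"
    using fundamental_matrix_exists[OF A] T by (auto simp: less_imp_le)
  define h where "h s \<omega> = \<beta> s \<omega> - lam s \<omega>" for s \<omega>
  have hp: "prog_measurable T F h"
    unfolding h_def using lam \<beta> by (intro prog_measurable_diff_fun) (auto simp: H2_def)
  have hs: "sq_process h" unfolding h_def by (intro sq_process_diff H2_sq_process lam \<beta>)
  define D where "D t \<omega> = Xf t *v integral\<^sup>L (lebesgue_on {0..t}) (\<lambda>s. Yf s *v (B s *v h s \<omega>))" for t \<omega>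
  have Dm: "D t \<in> borel_measurable (F t)" if t: "t \<in> {0..T}" for t
  proof -
    have [measurable]: "Yf \<in> borel_measurable (lebesgue_on {0..T})" "B \<in> borel_measurable (lebesgue_on {0..T})"
      using B f(2) by (auto simp: Linf_def intro!: continuous_on_measurable_lebesgue_on ode_on_continuous)
    have "(\<lambda>s. Yf s ** B s) \<in> borel_measurable (lebesgue_on {0..T})" by measurable
    from adapted_integral[OF hp this t] show ?thesis
      unfolding D_def by (intro borel_measurable_matrix_vector_mult) (auto simp: matrix_vector_mul_assoc)
  qed
  have Dode: "AE \<omega> in P. ode_on T (\<lambda>t. D t \<omega>) (\<lambda>t. A t *v D t \<omega> + B t *v h t \<omega>) \<and> D 0 \<omega> = 0"
    using sq_process_integrable_path[OF hs]
  proof eventually_elim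
    case (elim \<omega>)
    show ?case
      using linear_ode_solution[OF f A less_imp_le[OF T] integrable_Linf_matrix[OF B elim], of "\<lambda>t. D t \<omega>"] T by (simp add: D_def)
  qed
  have Dc: "AE \<omega> in P. continuous_on {0..T} (\<lambda>t. D t \<omega>)"
    using Dode by eventually_elim (auto intro: ode_on_continuous)
  obtain D' where D': "prog_measurable T F D'" "AE \<omega> in P. \<forall>t. D' t \<omega> = D t \<omega>"
    using continuous_modification_F[OF Dm Dc] by blast
  obtain I where I: "stoch_integral T P F W \<sigma> I"
    and eq: "AE \<omega> in P. \<forall>t\<in>{0..T}. X t \<omega> = \<xi> \<omega> + (LINT s:{0..t}|lebesgue. A s *v X s \<omega> + B s *v lam s \<omega>) + I t \<omega>"
    using X unfolding state_process_def by blast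
  have "is_state \<beta> (\<lambda>t \<omega>. X t \<omega> + D' t \<omega>)"
    unfolding state_process_def
  proof (intro conjI exI)
    show "prog_measurable T F (\<lambda>t \<omega>. X t \<omega> + D' t \<omega>)" by (rule prog_measurable_add[OF is_state_prog[OF X] D'(1)])
    show "AE \<omega> in P. continuous_on {0..T} (\<lambda>t. X t \<omega> + D' t \<omega>)"
      using is_state_continuous[OF X] Dc D'(2) by eventually_elim (auto intro!: continuous_intros)
    show "stoch_integral T P F W \<sigma> I" by (rule I)
    show "AE \<omega> in P. \<forall>t\<in>{0..T}. X t \<omega> + D' t \<omega> =
        \<xi> \<omega> + (LINT s:{0..t}|lebesgue. A s *v (X s \<omega> + D' s \<omega>) + B s *v \<beta> s \<omega>) + I t \<omega>"
      using eq Dode D'(2) is_state_continuous[OF X] sq_process_integrable_path[OF H2_sq_process[OF lam]]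
    proof eventually_elim
      case (elim \<omega>)
      show ?case
      proof
        fix t assume t: "t \<in> {0..T}"
        have i: "integrable (lebesgue_on {0..T}) (\<lambda>s. A s *v X s \<omega> + B s *v lam s \<omega>)"
          by (intro Bochner_Integration.integrable_add integrable_Linf_matrix A B continuous_on_integrable_lebesgue_on elim)
        have i': "integrable (lebesgue_on {0..t}) (\<lambda>s. A s *v X s \<omega> + B s *v lam s \<omega>)"
          by (rule integrable_lebesgue_on_mono[OF i]) (use t in simp)
        have "(LINT s:{0..t}|lebesgue. A s *v (X s \<omega> + D' s \<omega>) + B s *v \<beta> s \<omega>) =
          (\<integral>s. (A s *v X s \<omega> + B s *v lam s \<omega>) + (A s *v D s \<omega> + B s *v h s \<omega>) \<partial>lebesgue_on {0..t})"
          unfolding set_integral_eq_lebesgue_on using elim(3)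
          by (intro Bochner_Integration.integral_cong refl)
            (simp add: h_def matrix_vector_right_distrib matrix_vector_mult_diff_distrib)
        also have "\<dots> = (\<integral>s. A s *v X s \<omega> + B s *v lam s \<omega> \<partial>lebesgue_on {0..t}) + (\<integral>s. A s *v D s \<omega> + B s *v h s \<omega> \<partial>lebesgue_on {0..t})"
          by (rule Bochner_Integration.integral_add[OF i' ode_onD(3)[OF conjunct1[OF elim(2)] t]])
        also have "(\<integral>s. A s *v D s \<omega> + B s *v h s \<omega> \<partial>lebesgue_on {0..t}) = D t \<omega>"
          using ode_onD(2)[OF conjunct1[OF elim(2)] t] elim(2) by simp
        finally show "X t \<omega> + D' t \<omega> =
          \<xi> \<omega> + (LINT s:{0..t}|lebesgue. A s *v (X s \<omega> + D' s \<omega>) + B s *v \<beta> s \<omega>) + I t \<omega>"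
          using elim(1,3) t by (simp add: set_integral_eq_lebesgue_on)
      qed
    qed
  qed
  then show ?thesis by blast
qed

text \<open>\<open>state\<close> is a choice among all state processes; existence turns the choice
  into a genuine state.\<close>

lemma is_state_state:
  assumes "is_state lam X" "lam \<in> H2 T P F" "\<beta> \<in> H2 T P F"
  shows "is_state \<beta> (state T P F W \<xi> A B \<sigma> \<beta>)"
  unfolding state_def using is_state_exists[OF assms] by (rule someI_ex)

end

section \<open>The flow and its fluctuation\<close>

lemma space_C_borel: "space (C_borel T :: (real \<Rightarrow> 'b::euclidean_space) measure) =
    mspace (cfunspace (top_of_set {0..T}) (euclidean_metric :: 'b metric))"
  by (simp add: C_borel_def Let_def space_measure_of_conv)

lemma C_borel_continuous:
  assumes "x \<in> space (C_borel T :: (real \<Rightarrow> 'b::euclidean_space) measure)"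
  shows "continuous_on {0..T} x"
  using assms unfolding space_C_borel by simp

text \<open>Evaluation at \<open>t\<close> is continuous for the supremum metric. This makes
  \<open>\<mu> t\<close> measurable for the \<sigma>-algebra generated by the whole path of
  \<open>\<mu>\<close>.\<close>

lemma C_borel_eval:
  assumes t: "t \<in> {0..T}"
  shows "(\<lambda>x. x t) \<in> measurable (C_borel T) (borel :: 'b::euclidean_space measure)"
proof (rule borel_measurableI)
  fix S :: "'b set" assume S: "open S"
  let ?C = "cfunspace (top_of_set {0..T}) (euclidean_metric :: 'b metric)"
  interpret C: Metric_space "mspace ?C" "mdist ?C" by (rule Metric_space_mspace_mdist)
  let ?U = "(\<lambda>x. x t) -` S \<inter> mspace ?C"
  have "openin (mtopology_of ?C) ?U"
    unfolding mtopology_of_def C.openin_mtopology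
  proof (intro conjI allI impI)
    fix x assume x: "x \<in> ?U"
    then obtain e where e: "e > 0" "ball (x t) e \<subseteq> S" using S by (auto simp: open_contains_ball)
    have "C.mball x e \<subseteq> ?U"
    proof
      fix y assume "y \<in> C.mball x e"
      then have y: "y \<in> mspace ?C" "mdist ?C x y < e" "x \<in> mspace ?C" unfolding C.in_mball by blast+
      have "mdist euclidean_metric (x t) (y t) \<le> mdist ?C x y"
        by (rule mdist_cfunspace_imp_mdist_le[OF y(3,1) order_refl]) (use t in simp)
      then have "y t \<in> ball (x t) e" using y by simp
      then show "y \<in> ?U" using e y by auto
    qed
    then show "\<exists>r>0. C.mball x r \<subseteq> ?U" using e by blast
  qed auto
  moreover have "{U. openin (mtopology_of ?C) U} \<subseteq> Pow (mspace ?C)"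
    using openin_subset[of "mtopology_of ?C"] by (auto simp: topspace_mtopology_of)
  ultimately have "?U \<in> sets (C_borel T)"
    unfolding C_borel_def Let_def by (auto simp: sets_measure_of intro!: sigma_sets.Basic)
  then show "(\<lambda>x. x t) -` S \<inter> space (C_borel T) \<in> sets (C_borel T)" unfolding space_C_borel .
qed

text \<open>\<open>m\<close>, \<open>\<Phi>\<close>, \<open>\<Psi>\<close> and
  \<open>\<Theta>\<close> are parameters with defining equations, so that the locale can be
  interpreted at the constants of the final statement.\<close>

locale lq_flow = linear_state P T F W \<xi> A B \<sigma>
  for P :: "'w measure" and T :: real and F :: "real \<Rightarrow> 'w measure"
    and W :: "real \<Rightarrow> 'w \<Rightarrow> real^'d" and \<xi> :: "'w \<Rightarrow> real^'d"
    and A :: "real \<Rightarrow> real^'d^'d" and B :: "real \<Rightarrow> real^'k^'d" and \<sigma> :: "real \<Rightarrow> real^'d^'d" +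
  fixes Q Qbar Qtil :: "real \<Rightarrow> real^'d^'d" and R :: "real \<Rightarrow> real^'k^'k" and S :: "real \<Rightarrow> real^'d^'k"
    and L q :: "real \<Rightarrow> real^'d" and r :: "real \<Rightarrow> real^'k"
    and H Hbar Htil :: "real^'d^'d" and d1 d2 :: real
    and \<phi> \<psi> :: "real \<Rightarrow> real^'d^'d" and \<theta> :: "real \<Rightarrow> real^'d"
    and \<delta> lam :: "real \<Rightarrow> 'w \<Rightarrow> real^'k" and \<mu> X f :: "real \<Rightarrow> 'w \<Rightarrow> real^'d"
    and m :: "real \<Rightarrow> real^'d"
    and \<Phi> \<Psi> :: "real \<Rightarrow> real^'d^'k" and \<Theta> :: "real \<Rightarrow> real^'k"
  assumes m_def: "\<And>t. m t = expectation (\<mu> t)"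
    and \<Phi>_def: "\<And>t. \<Phi> t = matrix_inv (R t) ** (transpose (B t) ** \<phi> t + S t)"
    and \<Psi>_def: "\<And>t. \<Psi> t = matrix_inv (R t) ** (transpose (B t) ** \<psi> t)"
    and \<Theta>_def: "\<And>t. \<Theta> t = matrix_inv (R t) *v (transpose (B t) *v \<theta> t + r t)"
    and Q: "Linf T Q" and Qbar: "Linf T Qbar" and Qtil: "Linf T Qtil" and R: "continuous_on {0..T} R"
    and S: "Linf T S" and L: "Linf T L" and q: "Linf T q" and r: "Linf T r"
    and Q_sym: "AE t in lebesgue_on {0..T}. transpose (Q t) = Q t"
    and Qtil_sym: "AE t in lebesgue_on {0..T}. transpose (Qtil t) = Qtil t"
    and R_sym: "\<forall>t\<in>{0..T}. transpose (R t) = R t"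
    and H: "psd H" and Htil: "psd Htil"
    and d: "d1 \<ge> 0" "d2 > 0"
    and Q_bound: "AE t in lebesgue_on {0..T}. psd (Q t - d1 *\<^sub>R mat 1)"
    and R_bound: "\<forall>t\<in>{0..T}. psd (R t - d2 *\<^sub>R mat 1)"
    and S_bound: "d1 > 0 \<Longrightarrow>
        \<exists>c<d1 * d2. AE t in lebesgue_on {0..T}. (onorm (\<lambda>x. S t *v x))\<^sup>2 \<le> c"
      "d1 = 0 \<Longrightarrow> AE t in lebesgue_on {0..T}. S t = 0"
    and phi: "solves_phi T A B Q R S H \<phi>"
    and psi: "solves_psi T A B Qtil R S Htil \<phi> \<psi>"
    and theta: "solves_theta T A B q R S r \<phi> \<psi> m \<theta>"
    and flow: "correlated_flow T P F W \<xi> lam \<mu>"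
    and \<delta>_H2: "\<delta> \<in> H2 T P (\<lambda>_. F 0)" and \<delta>_indep: "indep_of_noise T P W \<xi> (path_algebra T) (traj T \<delta>)"
    and X: "is_state lam X"
    and lam_eq: "AE (t, \<omega>) in lebesgue_on {0..T} \<Otimes>\<^sub>M P. lam t \<omega> =
           - (matrix_inv (R t) *v ((transpose (B t) ** \<phi> t + S t) *v X t \<omega>
                + (transpose (B t) ** \<psi> t) *v \<mu> t \<omega> + \<delta> t \<omega>))"
    and \<mu>_ode_raw: "AE \<omega> in P. \<mu> 0 \<omega> = expectation \<xi> \<and>
        ode_on T (\<lambda>t. \<mu> t \<omega>) (\<lambda>t.
          (A t - B t ** matrix_inv (R t) ** (transpose (B t) ** \<phi> t + S t + transpose (B t) ** \<psi> t))
             *v \<mu> t \<omega> - (B t ** matrix_inv (R t)) *v \<delta> t \<omega>)"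
    and f_ode: "AE \<omega> in P. f 0 \<omega> = 0 \<and>
        ode_on T (\<lambda>t. f t \<omega>) (\<lambda>t. (A t - B t ** \<Phi> t) *v f t \<omega>
          + B t *v (\<Psi> t *v (\<mu> t \<omega> - m t) + matrix_inv (R t) *v \<delta> t \<omega> - \<Theta> t))"
begin

abbreviation Ri :: "real \<Rightarrow> real^'k^'k" where "Ri t \<equiv> matrix_inv (R t)"

text \<open>The closed-loop drift under the feedback \<open>- \<Phi> X\<close>; it is common to
  \<open>\<mu>\<close>, \<open>f\<close>, the optimal state and the fluctuation.\<close>

definition K :: "real \<Rightarrow> real^'d^'d" where "K t = A t - B t ** \<Phi> t"

abbreviation G1 :: "real \<Rightarrow> 'w measure" where "G1 \<equiv> gen_filtration T P W \<xi>"

lemma Ri: "continuous_on {0..T} Ri" "Linf T Ri"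
  using continuous_on_matrix_inv[OF R R_bound d(2)] Linf_continuous by auto

lemma phi_ode: "ode_on T \<phi> (\<lambda>t. - (\<phi> t ** A t + transpose (A t) ** \<phi> t + Q t
       - (\<phi> t ** B t + transpose (S t)) ** Ri t ** (transpose (B t) ** \<phi> t + S t)))" "\<phi> T = H"
  using phi by (auto simp: solves_phi_def)

lemma psi_ode: "ode_on T \<psi> (\<lambda>t. - (transpose (A t) ** \<psi> t + Qtil t
       - (\<phi> t ** B t + transpose (S t)) ** Ri t ** transpose (B t) ** \<psi> t))" "\<psi> T = Htil"
  using psi by (auto simp: solves_psi_def)

lemma theta_ode: "ode_on T \<theta> (\<lambda>t. - (\<psi> t *v vector_derivative m (at t within {0..T})
       + transpose (A t) *v \<theta> t + q t
       - ((\<phi> t ** B t + transpose (S t)) ** Ri t) *v (transpose (B t) *v \<theta> t + r t)))" "\<theta> T = 0"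
  using theta by (auto simp: solves_theta_def)

lemmas Linf_ode = Linf_ode_on[OF phi_ode(1)] Linf_ode_on[OF psi_ode(1)] Linf_ode_on[OF theta_ode(1)]

lemma Linf_feedback: "Linf T \<Phi>" "Linf T \<Psi>" "Linf T \<Theta>" "Linf T K"
proof -
  show \<Phi>: "Linf T \<Phi>" unfolding \<Phi>_def[abs_def] by (intro Linf_matrix_intros Ri B Linf_ode S)
  show "Linf T \<Psi>" unfolding \<Psi>_def[abs_def] by (intro Linf_matrix_intros Ri B Linf_ode)
  show "Linf T \<Theta>" unfolding \<Theta>_def[abs_def] by (intro Linf_matrix_intros Ri B Linf_ode r)
  show "Linf T K" unfolding K_def[abs_def] by (intro Linf_matrix_intros A B \<Phi>)
qed

lemma lam_H2: "lam \<in> H2 T P F"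
  using flow by (simp add: correlated_flow_def)

lemma \<mu>_traj: "traj T \<mu> \<in> measurable (F 0) (C_borel T)" "indep_of_noise T P W \<xi> (C_borel T) (traj T \<mu>)"
  using flow by (auto simp: correlated_flow_def)

lemma \<mu>_continuous:
  assumes "\<omega> \<in> space P"
  shows "continuous_on {0..T} (\<lambda>t. \<mu> t \<omega>)"
proof -
  have "traj T \<mu> \<omega> \<in> space (C_borel T)" using measurable_space[OF \<mu>_traj(1)] assms by simp
  from C_borel_continuous[OF this] show ?thesis
    by (rule continuous_on_eq) (simp add: traj_def)
qed

lemma \<mu>_F0: "t \<in> {0..T} \<Longrightarrow> \<mu> t \<in> borel_measurable (F 0)"
  using measurable_compose[OF \<mu>_traj(1) C_borel_eval[of t T]] by (simp add: traj_def)

lemma \<mu>_traj_measurable: "t \<in> {0..T} \<Longrightarrow> \<mu> t \<in> borel_measurable (vimage_algebra (space P) (traj T \<mu>) (C_borel T))"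
proof -
  assume t: "t \<in> {0..T}"
  have "traj T \<mu> \<in> space P \<rightarrow> space (C_borel T)" using measurable_space[OF \<mu>_traj(1)] by simp
  from measurable_compose[OF measurable_vimage_algebra1[OF this] C_borel_eval[OF t]] t
  show ?thesis by (simp add: traj_def)
qed

lemma \<mu>_P: "t \<in> {0..T} \<Longrightarrow> \<mu> t \<in> borel_measurable P"
  using measurable_F_P[OF \<mu>_F0, of t] T by simp

lemma \<mu>_prog: "prog_measurable T F \<mu>"
proof (rule prog_measurable_continuous)
  show "\<mu> t \<in> borel_measurable (F t)" if "t \<in> {0..T}" for t
    using measurable_F_mono[OF \<mu>_F0[OF that], of t] that by simp
  show "sets (F s) \<subseteq> sets (F t)" if "s \<le> t" for s t by (rule sets_F_mono[OF that])
  show "space (F t) = space P" for t by simp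
qed (rule \<mu>_continuous)

lemma \<delta>_F: "\<delta> \<in> H2 T P F"
proof (rule H2_mono[OF \<delta>_H2])
  show "sets (F 0) \<subseteq> sets (F t)" if "t \<in> {0..T}" for t using sets_F_mono[of 0 t] that by simp
qed simp

lemma sq_\<delta>: "sq_process \<delta>" by (rule H2_sq_process[OF \<delta>_F])

lemma \<delta>_traj_measurable: "t \<in> {0..T} \<Longrightarrow> \<delta> t \<in> borel_measurable (vimage_algebra (space P) (traj T \<delta>) (path_algebra T))"
proof -
  assume t: "t \<in> {0..T}"
  have "traj T \<delta> \<in> space P \<rightarrow> space (path_algebra T)"
    using measurable_space[OF indep_of_noiseD(5)[OF \<delta>_indep]] by simp
  from measurable_compose[OF measurable_vimage_algebra1[OF this] measurable_component_singleton[OF t]] t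
  show ?thesis by (simp add: traj_def)
qed

lemma sq_X: "sq_process X" "\<And>t. t \<in> {0..T} \<Longrightarrow> sq_integrable P (X t)"
  using is_state_sq[OF X lam_H2] by auto

lemma \<mu>_ode: "AE \<omega> in P. \<mu> 0 \<omega> = expectation \<xi> \<and>
    ode_on T (\<lambda>t. \<mu> t \<omega>) (\<lambda>t. K t *v \<mu> t \<omega> - B t *v (\<Psi> t *v \<mu> t \<omega> + Ri t *v \<delta> t \<omega>))"
  using \<mu>_ode_raw
proof eventually_elim
  case (elim \<omega>)
  have "(A t - B t ** Ri t ** (transpose (B t) ** \<phi> t + S t + transpose (B t) ** \<psi> t)) *v \<mu> t \<omega> - (B t ** Ri t) *v \<delta> t \<omega>
    = K t *v \<mu> t \<omega> - B t *v (\<Psi> t *v \<mu> t \<omega> + Ri t *v \<delta> t \<omega>)" for t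
    unfolding K_def \<Phi>_def \<Psi>_def
    by (simp add: matrix_vector_mult_diff_rdistrib matrix_vector_mult_add_rdistrib matrix_vector_right_distrib
        matrix_add_ldistrib matrix_vector_mul_assoc[symmetric] algebra_simps)
  then show ?case using elim by simp
qed

text \<open>Pathwise Gronwall with the forcing due to \<open>\<delta>\<close>. The bound
  \<open>Y\<close> is independent of time and square integrable.\<close>

lemma sq_\<mu>: "sq_process \<mu>" "\<And>t. t \<in> {0..T} \<Longrightarrow> sq_integrable P (\<mu> t)"
proof -
  define g where "g t \<omega> = - (B t *v (Ri t *v \<delta> t \<omega>))" for t \<omega>
  have g: "sq_process g" unfolding g_def by (intro sq_process_minus sq_process_matrix B Ri sq_\<delta>)
  have "Linf T (\<lambda>t. K t - B t ** \<Psi> t)" by (intro Linf_matrix_intros Linf_feedback B)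
  then obtain C where C: "C > 0" "AE t in lebesgue_on {0..T}. norm (K t - B t ** \<Psi> t) \<le> C" by (rule LinfE)
  define Y where "Y \<omega> = exp (C * T) * (norm (expectation \<xi>) + integral\<^sup>L (lebesgue_on {0..T}) (\<lambda>s. norm (g s \<omega>)))" for \<omega>
  have Y: "sq_integrable P Y"
    unfolding Y_def
    by (intro sq_integrable_mult sq_integrable_add sq_integrable_const finite_measure_axioms sq_integrable_integral sq_process_norm g)
  have bd: "AE \<omega> in P. \<forall>t\<in>{0..T}. norm (\<mu> t \<omega>) \<le> 1 * norm (Y \<omega>)"
    using \<mu>_ode sq_process_integrable_path[OF sq_process_norm[OF g]]
  proof eventually_elim
    case (elim \<omega>)
    show ?case
    proof
      fix t assume t: "t \<in> {0..T}"
      have "norm (\<mu> t \<omega>) \<le> (norm (\<mu> 0 \<omega>) + integral\<^sup>L (lebesgue_on {0..T}) (\<lambda>s. norm (g s \<omega>))) * exp (C * T)"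
      proof (rule ode_on_bound[OF conjunct2[OF elim(1)] _ _ elim(2) _ t])
        show "AE s in lebesgue_on {0..T}. norm (K s *v \<mu> s \<omega> - B s *v (\<Psi> s *v \<mu> s \<omega> + Ri s *v \<delta> s \<omega>)) \<le> C * norm (\<mu> s \<omega>) + norm (g s \<omega>)"
          using C(2)
        proof eventually_elim
          case (elim s)
          have "K s *v \<mu> s \<omega> - B s *v (\<Psi> s *v \<mu> s \<omega> + Ri s *v \<delta> s \<omega>) = (K s - B s ** \<Psi> s) *v \<mu> s \<omega> + g s \<omega>"
            by (simp add: g_def matrix_vector_mult_diff_rdistrib matrix_vector_right_distrib matrix_vector_mul_assoc)
          also have "norm \<dots> \<le> C * norm (\<mu> s \<omega>) + norm (g s \<omega>)"
            using norm_triangle_ineq[of "(K s - B s ** \<Psi> s) *v \<mu> s \<omega>" "g s \<omega>"]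
              norm_matrix_vector_mult_le[of "K s - B s ** \<Psi> s" "\<mu> s \<omega>"] mult_right_mono[OF elim, of "norm (\<mu> s \<omega>)"] by simp
          finally show ?case .
        qed
      qed (use C in auto)
      then have "norm (\<mu> t \<omega>) \<le> Y \<omega>" using elim(1) by (simp add: Y_def mult.commute)
      then show "norm (\<mu> t \<omega>) \<le> 1 * norm (Y \<omega>)" by simp
    qed
  qed
  show "sq_process \<mu>"
  proof (rule sq_process_bound[OF sq_process_const[OF Y], where C=1])
    show "(\<lambda>p. \<mu> (fst p) (snd p)) \<in> borel_measurable LP" by (rule prog_measurable_LP[OF \<mu>_prog])
    show "AE p in LP. norm (\<mu> (fst p) (snd p)) \<le> 1 * norm (Y (snd p))"
      using AE_LP_snd[OF bd] AE_space by eventually_elim (auto simp: space_pair_measure)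
  qed
  show "sq_integrable P (\<mu> t)" if t: "t \<in> {0..T}" for t
    by (rule sq_integrable_bound[OF Y \<mu>_P[OF t], where C=1]) (use bd t in \<open>auto elim: eventually_mono\<close>)
qed

section \<open>The fluctuation of the state around the flow\<close>

definition I :: "real \<Rightarrow> 'w \<Rightarrow> real^'d" where
  "I = (SOME I. stoch_integral T P F W \<sigma> I \<and> (AE \<omega> in P.
    ode_on T (\<lambda>t. X t \<omega> - \<xi> \<omega> - I t \<omega>) (\<lambda>s. A s *v X s \<omega> + B s *v lam s \<omega>) \<and> X 0 \<omega> - \<xi> \<omega> - I 0 \<omega> = 0))"

lemma I: "stoch_integral T P F W \<sigma> I"
  and I_ode: "AE \<omega> in P.
    ode_on T (\<lambda>t. X t \<omega> - \<xi> \<omega> - I t \<omega>) (\<lambda>s. A s *v X s \<omega> + B s *v lam s \<omega>) \<and> X 0 \<omega> - \<xi> \<omega> - I 0 \<omega> = 0"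
  using someI_ex[OF is_state_ode[OF X lam_H2]] unfolding I_def[symmetric] by auto

lemma lam_feedback: "AE p in LP. lam (fst p) (snd p) =
    - (\<Phi> (fst p) *v X (fst p) (snd p)) - \<Psi> (fst p) *v \<mu> (fst p) (snd p) - Ri (fst p) *v \<delta> (fst p) (snd p)"
  using lam_eq
proof eventually_elim
  case (elim p)
  obtain t \<omega> where p: "p = (t, \<omega>)" by (cases p)
  show ?case using elim unfolding p \<Phi>_def \<Psi>_def
    by (simp add: matrix_vector_right_distrib matrix_vector_mul_assoc)
qed

definition Z :: "real \<Rightarrow> 'w \<Rightarrow> real^'d" where "Z t \<omega> = X t \<omega> - \<mu> t \<omega>"

lemma sq_Z: "sq_process Z" "\<And>t. t \<in> {0..T} \<Longrightarrow> sq_integrable P (Z t)"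
  unfolding Z_def[abs_def] by (auto intro!: sq_process_diff sq_integrable_diff sq_X sq_\<mu>)

text \<open>\<open>B lam\<close> and the drift of \<open>\<mu>\<close> contain the same terms in
  \<open>\<Psi> \<mu>\<close> and \<open>Ri \<delta>\<close>; in the difference only the closed-loop
  drift and the noise remain.\<close>

lemma Z_eq: "AE \<omega> in P. \<forall>t\<in>{0..T}. Z t \<omega> = \<xi> \<omega> - expectation \<xi> + I t \<omega> + (\<integral>s. K s *v Z s \<omega> \<partial>lebesgue_on {0..t})"
  using I_ode \<mu>_ode AE_LP_swap[OF lam_feedback] sq_process_section_path[OF sq_Z(1)]
proof eventually_elim
  case (elim \<omega>)
  note o = ode_on_diff[OF conjunct1[OF elim(1)] conjunct2[OF elim(2)]]
  have "ode_on T (\<lambda>t. X t \<omega> - \<xi> \<omega> - I t \<omega> - \<mu> t \<omega>) (\<lambda>s. K s *v Z s \<omega>)"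
  proof (rule ode_on_cong[OF o])
    show "AE s in lebesgue_on {0..T}. A s *v X s \<omega> + B s *v lam s \<omega> - (K s *v \<mu> s \<omega> - B s *v (\<Psi> s *v \<mu> s \<omega> + Ri s *v \<delta> s \<omega>)) = K s *v Z s \<omega>"
      using elim(3)
    proof eventually_elim
      case (elim s)
      show ?case unfolding elim Z_def K_def
        by (simp add: matrix_vector_mult_diff_distrib matrix_vector_mult_diff_rdistrib matrix_vector_right_distrib
            matrix_vector_mul_assoc[symmetric] linear_neg[OF matrix_vector_mul_linear] algebra_simps)
    qed
    show "(\<lambda>s. K s *v Z s \<omega>) \<in> borel_measurable (lebesgue_on {0..T})"
      using elim(4) Linf_measurable[OF Linf_feedback(4)] by (intro borel_measurable_matrix_vector_mult) auto
  qed (use T in auto)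
  from ode_onD(2)[OF this] show ?case
    using elim(1,2) by (auto simp: Z_def algebra_simps)
qed

text \<open>One principle serves for the mean of \<open>Z\<close>, its correlation with
  \<open>\<mu>\<close> and \<open>\<delta>\<close>, the consistency condition and adaptedness. The
  horizon \<open>t0\<close> is there for the last purpose, where \<open>U\<close> is orthogonal only
  to increments of \<open>W\<close> up to the current time.\<close>

lemma Z_orth:
  assumes U: "sq_integrable P U" and t0: "t0 \<in> {0..T}"
    and U\<xi>: "\<And>i. expectation (\<lambda>\<omega>. (\<xi> \<omega> - expectation \<xi>) $ i * U \<omega>) = 0"
    and UW: "\<And>a b k. 0 \<le> a \<Longrightarrow> a \<le> b \<Longrightarrow> b \<le> t0 \<Longrightarrow> expectation (\<lambda>\<omega>. (W b \<omega> - W a \<omega>) $ k * U \<omega>) = 0"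
    and t: "t \<in> {0..t0}"
  shows "expectation (\<lambda>\<omega>. U \<omega> *\<^sub>R Z t \<omega>) = 0"
proof (rule weak_gronwall[OF U Linf_feedback(4) sq_Z(1) _ t0 _ _ _ _ _ t])
  have c: "sq_integrable P (\<lambda>\<omega>. \<xi> \<omega> - expectation \<xi>)"
    by (intro sq_integrable_diff sq_\<xi> sq_integrable_const finite_measure_axioms)
  have vec0: "expectation (\<lambda>\<omega>. U \<omega> *\<^sub>R Y \<omega>) = 0"
    if Y: "sq_integrable P Y" and 0: "\<And>i. expectation (\<lambda>\<omega>. Y \<omega> $ i * U \<omega>) = 0" for Y :: "'w \<Rightarrow> real^'d"
  proof (rule vec_eq_iff[THEN iffD2], rule allI)
    fix i
    have "expectation (\<lambda>\<omega>. U \<omega> *\<^sub>R Y \<omega>) $ i = expectation (\<lambda>\<omega>. (U \<omega> *\<^sub>R Y \<omega>) $ i)"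
      by (rule integral_bounded_linear[OF bounded_linear_vec_nth sq_integrable_imp_scaleR[OF U Y], symmetric])
    then show "expectation (\<lambda>\<omega>. U \<omega> *\<^sub>R Y \<omega>) $ i = 0 $ i" using 0[of i] by (simp add: mult.commute)
  qed
  show "sq_process (\<lambda>s \<omega>. 0)" by (simp add: sq_process_def sq_integrable_def)
  fix t assume t': "t \<in> {0..t0}"
  then have t: "t \<in> {0..T}" using t0 by simp
  show "AE \<omega> in P. Z t \<omega> = (\<xi> \<omega> - expectation \<xi> + I t \<omega>) + (\<integral>s. K s *v Z s \<omega> + 0 \<partial>lebesgue_on {0..t})"
    using Z_eq by eventually_elim (use t in simp)
  show "Z t \<in> borel_measurable P" using sq_Z(2)[OF t] by auto
  show V: "sq_integrable P (\<lambda>\<omega>. \<xi> \<omega> - expectation \<xi> + I t \<omega>)"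
    by (intro sq_integrable_add c stoch_integral_sq[OF I \<sigma> t])
  have It: "expectation (\<lambda>\<omega>. I t \<omega> $ i * U \<omega>) = 0" for i
  proof -
    have "expectation (\<lambda>\<omega>. (I t \<omega> - I 0 \<omega>) $ i * U \<omega>) = 0"
      by (rule stoch_integral_orth[OF I \<sigma> _ _ _ U UW]) (use t t' in auto)
    moreover have "expectation (\<lambda>\<omega>. (I t \<omega> - I 0 \<omega>) $ i * U \<omega>) = expectation (\<lambda>\<omega>. I t \<omega> $ i * U \<omega>)"
      using stoch_integral_0[OF I \<sigma>] stoch_integral_sq[OF I \<sigma> t] stoch_integral_sq[OF I \<sigma>, of 0] T U
      by (intro integral_cong_AE) (auto elim!: eventually_mono intro!: borel_measurable_times borel_measurable_diff borel_measurable_component)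
    ultimately show ?thesis by simp
  qed
  show "expectation (\<lambda>\<omega>. U \<omega> *\<^sub>R (\<xi> \<omega> - expectation \<xi> + I t \<omega>)) = 0"
  proof (rule vec0[OF V])
    fix i
    have "expectation (\<lambda>\<omega>. (\<xi> \<omega> - expectation \<xi> + I t \<omega>) $ i * U \<omega>) =
      expectation (\<lambda>\<omega>. (\<xi> \<omega> - expectation \<xi>) $ i * U \<omega> + I t \<omega> $ i * U \<omega>)"
      by (simp add: algebra_simps)
    also have "\<dots> = 0"
      using sq_integrable_imp_mult[OF sq_integrable_component[OF c] U, of i]
        sq_integrable_imp_mult[OF sq_integrable_component[OF stoch_integral_sq[OF I \<sigma> t]] U, of i] U\<xi>[of i] It[of i]
      by (simp del: vector_minus_component)
    finally show "expectation (\<lambda>\<omega>. (\<xi> \<omega> - expectation \<xi> + I t \<omega>) $ i * U \<omega>) = 0" .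
  qed
qed simp

lemma Z_orth_indep:
  fixes U :: "'w \<Rightarrow> real"
  assumes X: "indep_of_noise T P W \<xi> M Y" and U: "sq_integrable P U" "U \<in> borel_measurable (vimage_algebra (space P) Y M)"
    and t: "t \<in> {0..T}"
  shows "expectation (\<lambda>\<omega>. U \<omega> *\<^sub>R Z t \<omega>) = 0"
  using indep_of_noise_orth[OF X U] T by (intro Z_orth[OF U(1) _ _ _ t]) auto

lemma Z_mean: "t \<in> {0..T} \<Longrightarrow> expectation (Z t) = 0"
  using Z_orth_indep[OF \<mu>_traj(2), of "\<lambda>\<omega>. 1" t] sq_integrable_const[OF finite_measure_axioms, of "1::real"] by simp

lemma Z_\<mu>: "s \<in> {0..T} \<Longrightarrow> t \<in> {0..T} \<Longrightarrow> expectation (\<lambda>\<omega>. \<mu> s \<omega> $ i *\<^sub>R Z t \<omega>) = 0"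
  by (intro Z_orth_indep[OF \<mu>_traj(2)] sq_integrable_component sq_\<mu> borel_measurable_component \<mu>_traj_measurable)

text \<open>The exceptional null set of times \<open>s\<close> comes from \<open>\<delta>\<close>,
  whose time sections are square integrable only almost everywhere.\<close>

lemma Z_\<delta>: "AE s in lebesgue_on {0..T}. \<forall>i. \<forall>t\<in>{0..T}. expectation (\<lambda>\<omega>. \<delta> s \<omega> $ i *\<^sub>R Z t \<omega>) = 0"
  using sq_process_section_time[OF sq_\<delta>] AE_space
proof eventually_elim
  case (elim s)
  then show ?case
    by (intro allI ballI Z_orth_indep[OF \<delta>_indep] sq_integrable_component borel_measurable_component \<delta>_traj_measurable) auto
qed

text \<open>Let \<open>U\<close> be a coordinate of \<open>Z t\<close> minus its conditional
  expectation given the noise up to \<open>t\<close>. It is orthogonal to \<open>\<xi>\<close> and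
  to the increments of \<open>W\<close> up to \<open>t\<close>, hence by \<open>Z_orth\<close> to
  \<open>Z t\<close>, and also to the conditional expectation. Being orthogonal to both of its
  parts, \<open>U\<close> vanishes.\<close>

lemma Z_G1:
  assumes t: "t \<in> {0..T}"
  shows "Z t \<in> borel_measurable (G1 t)"
proof -
  have sub: "subalgebra P (G1 t)"
    using order_trans[OF gen_filtration_F[OF t] sets_F_P[OF t]] by (simp add: subalgebra_def)
  interpret G: finite_measure_subalgebra P "G1 t" by unfold_locales (rule sub)
  have "(\<lambda>\<omega>. Z t \<omega> $ i) \<in> borel_measurable (G1 t)" for i
  proof -
    define z where "z \<omega> = Z t \<omega> $ i" for \<omega>
    define c where "c = real_cond_exp P (G1 t) z"
    have z: "sq_integrable P z" unfolding z_def[abs_def] by (intro sq_integrable_component sq_Z t)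
    have zi: "integrable P z" by (rule sq_integrable_imp_integrable[OF finite_measure_axioms z])
    have cG: "c \<in> borel_measurable (G1 t)" unfolding c_def by simp
    have cP: "c \<in> borel_measurable P" by (rule measurable_from_subalg[OF sub cG])
    \<comment> \<open>Jensen's inequality for the square keeps the conditional expectation in
      L2.\<close>
    have "integrable P (\<lambda>\<omega>. (c \<omega>)\<^sup>2)"
      unfolding c_def
      by (rule G.integrable_convex_cond_exp[OF zi, where I=UNIV]) (use z convex_power2 in \<open>auto simp: sq_integrable_def\<close>)
    then have c: "sq_integrable P c" using cP by (simp add: sq_integrable_def)
    define U where "U \<omega> = z \<omega> - c \<omega>" for \<omega>
    have U: "sq_integrable P U" unfolding U_def[abs_def] by (rule sq_integrable_diff[OF z c])
    have orth: "expectation (\<lambda>\<omega>. V \<omega> * U \<omega>) = 0" if V: "sq_integrable P V" "V \<in> borel_measurable (G1 t)" for V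
    proof -
      have "expectation (\<lambda>\<omega>. V \<omega> * U \<omega>) = expectation (\<lambda>\<omega>. V \<omega> * z \<omega> - V \<omega> * c \<omega>)"
        by (simp add: U_def right_diff_distrib)
      also have "\<dots> = expectation (\<lambda>\<omega>. V \<omega> * z \<omega>) - expectation (\<lambda>\<omega>. V \<omega> * c \<omega>)"
        using sq_integrable_imp_mult[OF V(1) z] sq_integrable_imp_mult[OF V(1) c] by simp
      also have "expectation (\<lambda>\<omega>. V \<omega> * c \<omega>) = expectation (\<lambda>\<omega>. V \<omega> * z \<omega>)"
        unfolding c_def using z by (intro G.real_cond_exp_intg(2) sq_integrable_imp_mult V) auto
      finally show ?thesis by simp
    qed
    have "expectation (\<lambda>\<omega>. U \<omega> *\<^sub>R Z t \<omega>) = 0"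
    proof (rule Z_orth[OF U t])
      show "expectation (\<lambda>\<omega>. (\<xi> \<omega> - expectation \<xi>) $ i * U \<omega>) = 0" for i
        by (intro orth sq_integrable_component sq_integrable_diff sq_\<xi> sq_integrable_const finite_measure_axioms
            borel_measurable_component borel_measurable_diff gen_filtration_\<xi>) auto
      show "expectation (\<lambda>\<omega>. (W b \<omega> - W a \<omega>) $ k * U \<omega>) = 0" if "0 \<le> a" "a \<le> b" "b \<le> t" for a b k
        using that t by (intro orth sq_integrable_component increment_moments(3)
            borel_measurable_component borel_measurable_diff gen_filtration_W) auto
    qed (use t in auto)
    then have "expectation (\<lambda>\<omega>. (U \<omega> *\<^sub>R Z t \<omega>) $ i) = 0"
      using integral_bounded_linear[OF bounded_linear_vec_nth sq_integrable_imp_scaleR[OF U sq_Z(2)[OF t]], of i] by simp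
    then have "expectation (\<lambda>\<omega>. z \<omega> * U \<omega>) = 0" by (simp add: z_def mult.commute)
    moreover have "expectation (\<lambda>\<omega>. c \<omega> * U \<omega>) = 0" by (rule orth[OF c cG])
    moreover have "expectation (\<lambda>\<omega>. (norm (U \<omega>))\<^sup>2) = expectation (\<lambda>\<omega>. z \<omega> * U \<omega> - c \<omega> * U \<omega>)"
      by (simp add: U_def power2_eq_square left_diff_distrib)
    ultimately have "expectation (\<lambda>\<omega>. (norm (U \<omega>))\<^sup>2) = 0"
      using sq_integrable_imp_mult[OF z U] sq_integrable_imp_mult[OF c U] by simp
    from sq_integrable_AE_zero[OF U this] have "AE \<omega> in P. c \<omega> = z \<omega>" by eventually_elim (simp add: U_def)
    from measurable_AE_cong_null[OF cG _ gen_filtration_null this] show ?thesis by (simp add: z_def[abs_def])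
  qed
  then show ?thesis
    unfolding borel_measurable_euclidean_space[of "Z t"] by (auto simp: Basis_vec_def inner_axis)
qed

lemma Z'_exists: "\<exists>Z'. prog_measurable T G1 Z' \<and> (\<forall>\<omega>\<in>space P. continuous_on {0..T} (\<lambda>t. Z' t \<omega>)) \<and> (AE \<omega> in P. \<forall>t. Z' t \<omega> = Z t \<omega>)"
proof (rule continuous_modification[OF Z_G1])
  show "AE \<omega> in P. continuous_on {0..T} (\<lambda>t. Z t \<omega>)"
    using is_state_continuous[OF X] AE_space
    unfolding Z_def by eventually_elim (intro continuous_on_diff \<mu>_continuous)
  show "sets (G1 s) \<subseteq> sets (G1 t)" if "s \<le> t" for s t by (rule gen_filtration_mono[OF that])
  show "null_sets P \<subseteq> sets (G1 t)" for t by (rule gen_filtration_null)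
qed simp_all

definition Z' :: "real \<Rightarrow> 'w \<Rightarrow> real^'d" where
  "Z' = (SOME Z'. prog_measurable T G1 Z' \<and> (\<forall>\<omega>\<in>space P. continuous_on {0..T} (\<lambda>t. Z' t \<omega>)) \<and> (AE \<omega> in P. \<forall>t. Z' t \<omega> = Z t \<omega>))"

lemma Z': "prog_measurable T G1 Z'" "\<And>\<omega>. \<omega> \<in> space P \<Longrightarrow> continuous_on {0..T} (\<lambda>t. Z' t \<omega>)" "AE \<omega> in P. \<forall>t. Z' t \<omega> = Z t \<omega>"
  using someI_ex[OF Z'_exists] unfolding Z'_def[symmetric] by auto

end

lemmas matrix_vector_mult_minus_left = bounded_bilinear.minus_left[OF bounded_bilinear_matrix_vector_mult]
lemmas matrix_vector_mult_minus_right = bounded_bilinear.minus_right[OF bounded_bilinear_matrix_vector_mult]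

context noise
begin

lemma sq_process_cong_AE:
  assumes "sq_process X" "(\<lambda>p. Y (fst p) (snd p)) \<in> borel_measurable LP" "AE p in LP. X (fst p) (snd p) = Y (fst p) (snd p)"
  shows "sq_process Y"
  using assms unfolding sq_process_def by (rule sq_integrable_cong_AE)

lemma sq_process_integrable: "sq_process X \<Longrightarrow> integrable LP (\<lambda>p. X (fst p) (snd p))"
  unfolding sq_process_def by (rule sq_integrable_imp_integrable[OF finite_LP])

lemma prog_measurable_deterministic:
  fixes x :: "real \<Rightarrow> 'b::euclidean_space"
  assumes "x \<in> borel_measurable (restrict_space borel {0..T})"
  shows "prog_measurable T G (\<lambda>t \<omega>. x t)"
  unfolding prog_measurable_def
proof
  fix t assume t: "t \<in> {0..T}"
  have "restrict_space borel {0..t} = restrict_space (restrict_space borel {0..T}) {0..t}"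
    using t by (simp add: restrict_restrict_space Int_absorb1)
  then have "x \<in> borel_measurable (restrict_space borel {0..t})"
    using measurable_restrict_space1[OF assms, of "{0..t}"] by simp
  then show "(\<lambda>(s, \<omega>). x s) \<in> borel_measurable (restrict_space borel {0..t} \<Otimes>\<^sub>M G t)" by measurable
qed

lemma prog_measurable_matrix:
  fixes K :: "real \<Rightarrow> real^'n^'m"
  assumes K: "K \<in> borel_measurable borel" and X: "prog_measurable T G X"
  shows "prog_measurable T G (\<lambda>t \<omega>. K t *v X t \<omega>)"
proof -
  have "prog_measurable T G (\<lambda>t \<omega>. K t)"
    by (rule prog_measurable_deterministic) (rule measurable_restrict_space1[OF K])
  then show ?thesis
    using X unfolding prog_measurable_def case_prod_beta' by (intro ballI borel_measurable_matrix_vector_mult) auto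
qed

lemma expectation_matrix:
  fixes Y :: "'w \<Rightarrow> real^'n" and M :: "real^'n^'m"
  assumes "sq_integrable P Y"
  shows "expectation (\<lambda>\<omega>. M *v Y \<omega>) = M *v expectation Y"
  by (rule integral_bounded_linear[OF matrix_vector_mul_bounded_linear sq_integrable_imp_integrable[OF finite_measure_axioms assms]])

end

section \<open>The optimal deviation and its state\<close>

context lq_flow
begin

text \<open>The summed equation has deterministic coefficients and initial value, so by uniqueness
  almost all scenarios share one path.\<close>

lemma xh_exists: "\<exists>x. (AE \<omega> in P. \<forall>t\<in>{0..T}. \<mu> t \<omega> + f t \<omega> = x t) \<and> x 0 = expectation \<xi> \<and>
    ode_on T x (\<lambda>t. K t *v x t - B t *v (\<Psi> t *v m t + \<Theta> t))"
proof -
  define good where "good \<omega> \<longleftrightarrow> \<mu> 0 \<omega> + f 0 \<omega> = expectation \<xi> \<and>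
    ode_on T (\<lambda>t. \<mu> t \<omega> + f t \<omega>) (\<lambda>t. K t *v (\<mu> t \<omega> + f t \<omega>) - B t *v (\<Psi> t *v m t + \<Theta> t))" for \<omega>
  have good: "AE \<omega> in P. good \<omega>"
    using \<mu>_ode f_ode
  proof eventually_elim
    case (elim \<omega>)
    have "K t *v \<mu> t \<omega> - B t *v (\<Psi> t *v \<mu> t \<omega> + Ri t *v \<delta> t \<omega>) +
        ((A t - B t ** \<Phi> t) *v f t \<omega> + B t *v (\<Psi> t *v (\<mu> t \<omega> - m t) + Ri t *v \<delta> t \<omega> - \<Theta> t)) =
        K t *v (\<mu> t \<omega> + f t \<omega>) - B t *v (\<Psi> t *v m t + \<Theta> t)" for t
      unfolding K_def[symmetric] by (simp add: matrix_vector_right_distrib matrix_vector_mult_diff_distrib algebra_simps)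
    then show ?case
      using ode_on_add[OF conjunct2[OF elim(1)] conjunct2[OF elim(2)]] elim by (simp add: good_def)
  qed
  \<comment> \<open>Any good scenario can represent the common path; one exists because a property
    that holds almost surely cannot fail everywhere.\<close>
  obtain w where w: "good w" using eventually_happens'[OF ae_filter_bot good] by blast
  have "AE \<omega> in P. \<forall>t\<in>{0..T}. \<mu> t \<omega> + f t \<omega> = \<mu> t w + f t w"
    using good
  proof eventually_elim
    case (elim \<omega>)
    have o: "ode_on T (\<lambda>t. (\<mu> t \<omega> + f t \<omega>) - (\<mu> t w + f t w)) (\<lambda>t. (K t *v (\<mu> t \<omega> + f t \<omega>) - B t *v (\<Psi> t *v m t + \<Theta> t)) -
        (K t *v (\<mu> t w + f t w) - B t *v (\<Psi> t *v m t + \<Theta> t)))"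
      using elim w unfolding good_def by (intro ode_on_diff) auto
    show ?case
    proof
      fix t assume "t \<in> {0..T}"
      then have "(\<mu> t \<omega> + f t \<omega>) - (\<mu> t w + f t w) = 0"
        by (rule ode_unique_zero[OF o _ Linf_feedback(4), rotated -1])
          (use elim w in \<open>auto simp: good_def matrix_vector_mult_diff_distrib\<close>)
      then show "\<mu> t \<omega> + f t \<omega> = \<mu> t w + f t w" by simp
    qed
  qed
  then show ?thesis using w by (intro exI[of _ "\<lambda>t. \<mu> t w + f t w"]) (auto simp: good_def)
qed

definition xh :: "real \<Rightarrow> real^'d" where
  "xh = (SOME x. (AE \<omega> in P. \<forall>t\<in>{0..T}. \<mu> t \<omega> + f t \<omega> = x t) \<and> x 0 = expectation \<xi> \<and>
    ode_on T x (\<lambda>t. K t *v x t - B t *v (\<Psi> t *v m t + \<Theta> t)))"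

lemma xh: "AE \<omega> in P. \<forall>t\<in>{0..T}. \<mu> t \<omega> + f t \<omega> = xh t"
  "ode_on T xh (\<lambda>t. K t *v xh t - B t *v (\<Psi> t *v m t + \<Theta> t))"
  using someI_ex[OF xh_exists] unfolding xh_def[symmetric] by auto

lemma xh_continuous: "continuous_on {0..T} xh" by (rule ode_on_continuous[OF xh(2)])

text \<open>Expectation and time integral are exchanged in the equation of \<open>\<mu>\<close>; the
  mean of the drift is computed at those times where \<open>\<delta> t\<close> is square
  integrable.\<close>

lemma m_ode: "ode_on T m (\<lambda>t. K t *v m t - B t *v (\<Psi> t *v m t + Ri t *v expectation (\<delta> t)))"
proof -
  define g where "g t \<omega> = K t *v \<mu> t \<omega> - B t *v (\<Psi> t *v \<mu> t \<omega> + Ri t *v \<delta> t \<omega>)" for t \<omega>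
  have g: "sq_process g"
    unfolding g_def by (intro sq_process_diff sq_process_add sq_process_matrix Linf_feedback B Ri sq_\<mu> sq_\<delta>)
  note gi = sq_process_integrable[OF g]
  have Eg: "AE t in lebesgue_on {0..T}. expectation (g t) = K t *v m t - B t *v (\<Psi> t *v m t + Ri t *v expectation (\<delta> t))"
    using sq_process_section_time[OF sq_\<delta>] AE_space
  proof eventually_elim
    case (elim t)
    have \<mu>t: "sq_integrable P (\<mu> t)" using sq_\<mu>(2) elim(2) by simp
    note i = sq_integrable_imp_integrable[OF finite_measure_axioms]
    have j1: "sq_integrable P (\<lambda>\<omega>. K t *v \<mu> t \<omega>)" by (intro sq_integrable_matrix \<mu>t)
    have j3: "sq_integrable P (\<lambda>\<omega>. \<Psi> t *v \<mu> t \<omega>)" "sq_integrable P (\<lambda>\<omega>. Ri t *v \<delta> t \<omega>)"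
      by (intro sq_integrable_matrix \<mu>t elim)+
    have j2: "sq_integrable P (\<lambda>\<omega>. B t *v (\<Psi> t *v \<mu> t \<omega> + Ri t *v \<delta> t \<omega>))"
      by (intro sq_integrable_matrix sq_integrable_add j3)
    show ?case
      unfolding g_def m_def using i[OF j1] i[OF j2] i[OF j3(1)] i[OF j3(2)] \<mu>t elim(1) j3
      by (simp add: expectation_matrix sq_integrable_add)
  qed
  have eq: "m t = expectation \<xi> + (\<integral>s. expectation (g s) \<partial>lebesgue_on {0..t})" if t: "t \<in> {0..T}" for t
  proof -
    have tT: "t \<le> T" using t by simp
    note ei = expectation_integral[OF gi tT]
    have "m t = expectation (\<lambda>\<omega>. expectation \<xi> + (\<integral>s. g s \<omega> \<partial>lebesgue_on {0..t}))"
      unfolding m_def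
    proof (rule integral_cong_AE)
      show "\<mu> t \<in> borel_measurable P" by (rule \<mu>_P[OF t])
      show "(\<lambda>\<omega>. expectation \<xi> + (\<integral>s. g s \<omega> \<partial>lebesgue_on {0..t})) \<in> borel_measurable P"
        using ei(2) by simp
      show "AE \<omega> in P. \<mu> t \<omega> = expectation \<xi> + (\<integral>s. g s \<omega> \<partial>lebesgue_on {0..t})"
        using \<mu>_ode by eventually_elim (use t in \<open>auto simp: g_def dest: ode_onD(2)\<close>)
    qed
    also have "\<dots> = expectation \<xi> + (\<integral>s. expectation (g s) \<partial>lebesgue_on {0..t})"
      using ei prob_space by simp
    finally show ?thesis .
  qed
  have o: "ode_on T m (\<lambda>t. expectation (g t))"
  proof (rule ode_onI)
    show "integrable (lebesgue_on {0..T}) (\<lambda>t. expectation (g t))" by (rule integral_LP(2)[OF gi])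
    have "m 0 = expectation \<xi>" using eq[of 0] T by simp
    then show "m t = m 0 + (\<integral>s. expectation (g s) \<partial>lebesgue_on {0..t})" if "t \<in> {0..T}" for t using eq[OF that] by simp
  qed
  have ms: "(\<lambda>t. K t *v m t - B t *v (\<Psi> t *v m t + Ri t *v expectation (\<delta> t))) \<in> borel_measurable (lebesgue_on {0..T})"
  proof -
    have mm: "m \<in> borel_measurable (lebesgue_on {0..T})"
      by (rule continuous_on_measurable_lebesgue_on[OF ode_on_continuous[OF o]])
    have dm: "(\<lambda>t. expectation (\<delta> t)) \<in> borel_measurable (lebesgue_on {0..T})"
      using integral_LP(2)[OF sq_process_integrable[OF sq_\<delta>]] by simp
    show ?thesis
      by (intro borel_measurable_diff borel_measurable_add borel_measurable_matrix_vector_mult mm dm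
          Linf_measurable Linf_feedback B Ri)
  qed
  show ?thesis by (rule ode_on_cong[OF o Eg ms refl]) (use T in simp)
qed

lemmas Linf_m = Linf_ode_on[OF m_ode]

definition phi' :: "real \<Rightarrow> real^'d^'d" where
  "phi' t = - (\<phi> t ** A t + transpose (A t) ** \<phi> t + Q t - (\<phi> t ** B t + transpose (S t)) ** \<Phi> t)"

lemma phi'_ode: "ode_on T \<phi> phi'"
  using phi_ode(1) unfolding phi'_def[abs_def] \<Phi>_def matrix_mul_assoc .

lemma Linf_phi': "Linf T phi'"
  unfolding phi'_def[abs_def] by (intro Linf_matrix_intros Linf_ode A B Q S Linf_feedback)

text \<open>The deterministic part of the adjoint process. For this combination the equations of
  \<open>\<psi>\<close>, \<open>m\<close> and \<open>\<theta>\<close> merge into one linear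
  equation.\<close>

definition eta :: "real \<Rightarrow> real^'d" where "eta t = \<psi> t *v m t + \<theta> t"

definition eta' :: "real \<Rightarrow> real^'d" where
  "eta' t = - (transpose (A t) *v eta t + Qtil t *v m t + q t - (\<phi> t ** B t + transpose (S t)) *v (\<Psi> t *v m t + \<Theta> t))"

lemma Linf_eta: "Linf T eta" "Linf T eta'"
proof -
  show e: "Linf T eta" unfolding eta_def[abs_def] by (intro Linf_matrix_intros Linf_ode Linf_m)
  show "Linf T eta'" unfolding eta'_def[abs_def]
    by (intro Linf_matrix_intros Linf_ode Linf_m A e Qtil q S B Linf_feedback)
qed

text \<open>The product rule for \<open>\<psi> m\<close> yields \<open>\<psi>\<close> applied to the
  drift of \<open>m\<close>. The equation of \<open>\<theta>\<close> contains the same term with the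
  opposite sign, as a pointwise derivative; the two cancel for almost every time.\<close>

lemma eta_ode: "ode_on T eta eta'" "eta T = Htil *v m T"
proof -
  note o = ode_on_add[OF ode_on_bilinear[OF psi_ode(1) m_ode bounded_bilinear_matrix_vector_mult] theta_ode(1)]
  show "ode_on T eta eta'"
  proof (rule ode_on_cong[OF o])
    show "AE t in lebesgue_on {0..T}.
      - (transpose (A t) ** \<psi> t + Qtil t - (\<phi> t ** B t + transpose (S t)) ** Ri t ** transpose (B t) ** \<psi> t) *v m t +
      \<psi> t *v (K t *v m t - B t *v (\<Psi> t *v m t + Ri t *v expectation (\<delta> t))) +
      - (\<psi> t *v vector_derivative m (at t within {0..T}) + transpose (A t) *v \<theta> t + q t -
         ((\<phi> t ** B t + transpose (S t)) ** Ri t) *v (transpose (B t) *v \<theta> t + r t)) = eta' t"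
      using AE_vector_derivative_ode_on[OF m_ode T]
    proof eventually_elim
      case (elim t)
      show ?case
        unfolding elim eta'_def eta_def \<Psi>_def \<Theta>_def
        by (simp add: matrix_vector_mult_diff_rdistrib matrix_vector_mult_add_rdistrib matrix_vector_right_distrib
            matrix_vector_mul_assoc[symmetric] matrix_vector_mult_minus_left matrix_vector_mult_minus_right algebra_simps)
    qed
    show "eta' \<in> borel_measurable (lebesgue_on {0..T})" by (rule Linf_measurable[OF Linf_eta(2)])
  qed (use T in \<open>auto simp: eta_def\<close>)
  show "eta T = Htil *v m T" by (simp add: eta_def psi_ode theta_ode)
qed

text \<open>Built from the version \<open>Z'\<close>, which is progressive for \<open>G1\<close> and
  continuous in every scenario, rather than from \<open>Z\<close>.\<close>

definition Xs :: "real \<Rightarrow> 'w \<Rightarrow> real^'d" where "Xs t \<omega> = xh t + Z' t \<omega>"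

lemma Xs_eq: "AE \<omega> in P. \<forall>t\<in>{0..T}. Xs t \<omega> = xh t + Z t \<omega> \<and> Xs t \<omega> = X t \<omega> + f t \<omega>"
  using Z'(3) xh(1)
proof eventually_elim
  case (elim \<omega>)
  show ?case
  proof
    fix t assume "t \<in> {0..T}"
    then have "xh t = \<mu> t \<omega> + f t \<omega>" using elim(2) by simp
    then show "Xs t \<omega> = xh t + Z t \<omega> \<and> Xs t \<omega> = X t \<omega> + f t \<omega>" using elim(1) by (simp add: Xs_def Z_def)
  qed
qed

lemma Xs_prog: "prog_measurable T G1 Xs"
  unfolding Xs_def
  by (intro prog_measurable_add Z' prog_measurable_deterministic borel_measurable_continuous_on_restrict xh_continuous)

lemma G1_F: "prog_measurable T G1 Y \<Longrightarrow> prog_measurable T F Y"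
  by (rule prog_measurable_mono[OF _ gen_filtration_F]) auto

lemma sq_xh: "sq_process (\<lambda>t \<omega>. xh t)"
  by (intro sq_process_deterministic Linf_sq_integrable Linf_continuous xh_continuous)

lemma sq_Xs: "sq_process Xs"
proof (rule sq_process_cong_AE)
  show "sq_process (\<lambda>t \<omega>. xh t + Z t \<omega>)" by (intro sq_process_add sq_xh sq_Z)
  show "(\<lambda>p. Xs (fst p) (snd p)) \<in> borel_measurable LP" by (rule prog_measurable_LP[OF G1_F[OF Xs_prog]])
  show "AE p in LP. xh (fst p) + Z (fst p) (snd p) = Xs (fst p) (snd p)"
    using AE_LP_snd[OF Xs_eq] AE_space by eventually_elim (auto simp: space_pair_measure)
qed

definition c :: "real \<Rightarrow> real^'k" where "c t = \<Psi> t *v m t + \<Theta> t"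

lemma Linf_c: "Linf T c" unfolding c_def[abs_def] by (intro Linf_matrix_intros Linf_feedback Linf_m)

definition \<Phi>b :: "real \<Rightarrow> real^'d^'k" where
  "\<Phi>b = (SOME g. g \<in> borel_measurable borel \<and> (AE t in lebesgue_on {0..T}. \<Phi> t = g t))"

definition cb :: "real \<Rightarrow> real^'k" where
  "cb = (SOME g. g \<in> borel_measurable borel \<and> (AE t in lebesgue_on {0..T}. c t = g t))"

lemma \<Phi>b: "\<Phi>b \<in> borel_measurable borel" "AE t in lebesgue_on {0..T}. \<Phi> t = \<Phi>b t"
proof -
  have "\<exists>g. g \<in> borel_measurable borel \<and> (AE t in lebesgue_on {0..T}. \<Phi> t = g t)"
    using lebesgue_on_ex_borel[OF Linf_measurable[OF Linf_feedback(1)]] by blast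
  from someI_ex[OF this] show "\<Phi>b \<in> borel_measurable borel" "AE t in lebesgue_on {0..T}. \<Phi> t = \<Phi>b t"
    unfolding \<Phi>b_def[symmetric] by auto
qed

lemma cb: "cb \<in> borel_measurable borel" "AE t in lebesgue_on {0..T}. c t = cb t"
proof -
  have "\<exists>g. g \<in> borel_measurable borel \<and> (AE t in lebesgue_on {0..T}. c t = g t)"
    using lebesgue_on_ex_borel[OF Linf_measurable[OF Linf_c]] by blast
  from someI_ex[OF this] show "cb \<in> borel_measurable borel" "AE t in lebesgue_on {0..T}. c t = cb t"
    unfolding cb_def[symmetric] by auto
qed

text \<open>The optimal deviation; the feedback coefficients are replaced by Borel representatives, since
  progressive measurability refers to Borel sets of times.\<close>

definition bs :: "real \<Rightarrow> 'w \<Rightarrow> real^'k" where "bs t \<omega> = - cb t - \<Phi>b t *v Xs t \<omega>"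

lemma bs_eq: "AE p in LP. bs (fst p) (snd p) = - (\<Phi> (fst p) *v Xs (fst p) (snd p)) - c (fst p)"
  using AE_LP_fst[OF \<Phi>b(2)] AE_LP_fst[OF cb(2)] by eventually_elim (simp add: bs_def)

lemma bs_prog: "prog_measurable T G1 bs"
  unfolding bs_def
  by (intro prog_measurable_diff_fun prog_measurable_matrix \<Phi>b Xs_prog prog_measurable_deterministic
      measurable_restrict_space1 borel_measurable_uminus cb)

lemma sq_bs: "sq_process bs"
proof (rule sq_process_cong_AE)
  show "sq_process (\<lambda>t \<omega>. - (\<Phi> t *v Xs t \<omega>) - c t)"
    by (intro sq_process_diff sq_process_minus sq_process_matrix Linf_feedback sq_Xs sq_process_deterministic
        Linf_sq_integrable Linf_c)
  show "(\<lambda>p. bs (fst p) (snd p)) \<in> borel_measurable LP" by (rule prog_measurable_LP[OF G1_F[OF bs_prog]])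
  show "AE p in LP. - (\<Phi> (fst p) *v Xs (fst p) (snd p)) - c (fst p) = bs (fst p) (snd p)"
    using bs_eq by eventually_elim simp
qed

lemma H2_G1_F: "\<beta> \<in> H2 T P G1 \<Longrightarrow> \<beta> \<in> H2 T P F"
  by (rule H2_mono[OF _ gen_filtration_F]) auto

lemma bs_H2: "bs \<in> H2 T P G1" "bs \<in> H2 T P F"
  using H2I[OF bs_prog sq_bs] H2_G1_F by auto

lemma Xs_continuous: "\<omega> \<in> space P \<Longrightarrow> continuous_on {0..T} (\<lambda>t. Xs t \<omega>)"
  unfolding Xs_def by (intro continuous_on_add xh_continuous Z')

text \<open>Sum of the equations of \<open>X\<close> and \<open>f\<close>: with the feedback form of
  \<open>lam\<close> inserted, the terms in \<open>\<mu>\<close> and \<open>\<delta>\<close> cancel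
  and \<open>- B c\<close> is left, so the control of the summed state is \<open>bs\<close>.\<close>

lemma Xs_ode: "AE \<omega> in P. ode_on T (\<lambda>t. Xs t \<omega> - \<xi> \<omega> - I t \<omega>) (\<lambda>s. A s *v Xs s \<omega> + B s *v bs s \<omega>) \<and>
    Xs 0 \<omega> - \<xi> \<omega> - I 0 \<omega> = 0"
  using I_ode f_ode Xs_eq AE_LP_swap[OF lam_feedback] AE_LP_swap[OF bs_eq] sq_process_section_path[OF sq_Xs] sq_process_section_path[OF sq_bs]
proof eventually_elim
  case (elim \<omega>)
  note o = ode_on_add[OF conjunct1[OF elim(1)] conjunct2[OF elim(2)]]
  have e: "Xs t \<omega> = X t \<omega> + f t \<omega>" if "t \<in> {0..T}" for t using elim(3) that by blast
  have "ode_on T (\<lambda>t. Xs t \<omega> - \<xi> \<omega> - I t \<omega>) (\<lambda>s. A s *v Xs s \<omega> + B s *v bs s \<omega>)"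
  proof (rule ode_on_cong[OF o])
    show "AE s in lebesgue_on {0..T}. A s *v X s \<omega> + B s *v lam s \<omega> +
        ((A s - B s ** \<Phi> s) *v f s \<omega> + B s *v (\<Psi> s *v (\<mu> s \<omega> - m s) + Ri s *v \<delta> s \<omega> - \<Theta> s)) = A s *v Xs s \<omega> + B s *v bs s \<omega>"
      using elim(4,5) AE_space
    proof eventually_elim
      case (elim s)
      have x: "Xs s \<omega> = X s \<omega> + f s \<omega>" using e elim(3) by simp
      show ?case unfolding elim x c_def
        by (simp add: matrix_vector_mult_diff_distrib matrix_vector_mult_diff_rdistrib matrix_vector_right_distrib
            matrix_vector_mul_assoc[symmetric] linear_neg[OF matrix_vector_mul_linear] algebra_simps)
    qed
    show "(\<lambda>s. A s *v Xs s \<omega> + B s *v bs s \<omega>) \<in> borel_measurable (lebesgue_on {0..T})"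
      using elim(6,7)
      by (intro borel_measurable_add borel_measurable_matrix_vector_mult Linf_measurable[OF A] Linf_measurable[OF B]) auto
  qed (use e T in auto)
  moreover have "Xs 0 \<omega> = X 0 \<omega> + f 0 \<omega>" using e T by simp
  ultimately show ?case using elim(1,2) by simp
qed

lemma Xs_state: "is_state bs Xs"
  unfolding state_process_def
proof (intro conjI exI)
  show "prog_measurable T F Xs" by (rule G1_F[OF Xs_prog])
  show "AE \<omega> in P. continuous_on {0..T} (\<lambda>t. Xs t \<omega>)" using AE_space by eventually_elim (rule Xs_continuous)
  show "stoch_integral T P F W \<sigma> I" by (rule I)
  show "AE \<omega> in P. \<forall>t\<in>{0..T}. Xs t \<omega> = \<xi> \<omega> + (LINT s:{0..t}|lebesgue. A s *v Xs s \<omega> + B s *v bs s \<omega>) + I t \<omega>"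
    using Xs_ode
  proof eventually_elim
    case (elim \<omega>)
    show ?case
    proof
      fix t assume t: "t \<in> {0..T}"
      have "Xs t \<omega> - \<xi> \<omega> - I t \<omega> = integral\<^sup>L (lebesgue_on {0..t}) (\<lambda>s. A s *v Xs s \<omega> + B s *v bs s \<omega>)"
        using ode_onD(2)[OF conjunct1[OF elim] t] elim by simp
      then show "Xs t \<omega> = \<xi> \<omega> + (LINT s:{0..t}|lebesgue. A s *v Xs s \<omega> + B s *v bs s \<omega>) + I t \<omega>"
        unfolding set_integral_eq_lebesgue_on by (simp add: algebra_simps)
    qed
  qed
qed

end

section \<open>Optimality of the best deviation\<close>

text \<open>This simp rule turns \<open>transpose A *v x\<close> into \<open>x v* A\<close> and would undo \<open>inner_transpose\<close>.\<close>

declare transpose_matrix_vector [simp del]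

lemma inner_transpose: "(A *v x) \<bullet> y = x \<bullet> (transpose A *v y)" for A :: "real^'n^'m"
proof -
  have "(A *v x) \<bullet> y = (\<Sum>i\<in>UNIV. \<Sum>j\<in>UNIV. A $ i $ j * x $ j * y $ i)"
    by (simp add: inner_vec_def matrix_vector_mult_def sum_distrib_right)
  also have "\<dots> = x \<bullet> (transpose A *v y)"
    by (subst sum.swap) (simp add: inner_vec_def matrix_vector_mult_def transpose_def sum_distrib_left mult_ac)
  finally show ?thesis .
qed

text \<open>The mixed term is at most the square root of \<open>d1 * d2\<close> times the product of
  the norms; by the inequality of arithmetic and geometric means this is at most half the sum of the
  two coercive terms.\<close>

lemma quadratic_cost_nonneg:
  fixes Q :: "real^'d^'d" and R :: "real^'k^'k" and S :: "real^'d^'k"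
  assumes Q: "psd (Q - d1 *\<^sub>R mat 1)" and R: "psd (R - d2 *\<^sub>R mat 1)" and d: "d1 \<ge> 0" "d2 \<ge> 0"
    and S: "(onorm (\<lambda>x. S *v x))\<^sup>2 \<le> d1 * d2"
  shows "0 \<le> 1/2 * ((Q *v x) \<bullet> x) + 1/2 * ((R *v u) \<bullet> u) + (S *v x) \<bullet> u"
proof -
  define a where "a = d1 * (norm x)\<^sup>2"
  define b where "b = d2 * (norm u)\<^sup>2"
  have ab: "a \<ge> 0" "b \<ge> 0" using d by (auto simp: a_def b_def)
  let ?s = "onorm (\<lambda>x. S *v x)"
  have "\<bar>(S *v x) \<bullet> u\<bar> \<le> norm (S *v x) * norm u" by (rule Cauchy_Schwarz_ineq2)
  also have "\<dots> \<le> ?s * norm x * norm u"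
    by (intro mult_right_mono onorm) auto
  finally have 1: "\<bar>(S *v x) \<bullet> u\<bar> \<le> ?s * norm x * norm u" .
  have "(?s * norm x * norm u)\<^sup>2 = ?s\<^sup>2 * ((norm x)\<^sup>2 * (norm u)\<^sup>2)" by (simp add: power_mult_distrib)
  also have "\<dots> \<le> d1 * d2 * ((norm x)\<^sup>2 * (norm u)\<^sup>2)" by (rule mult_right_mono[OF S]) simp
  also have "\<dots> = a * b" by (simp add: a_def b_def)
  also have "\<dots> \<le> ((a + b) / 2)\<^sup>2"
    using sum_squares_bound[of a b] by (simp add: power2_eq_square field_simps)
  finally have "?s * norm x * norm u \<le> (a + b) / 2" by (rule power2_le_imp_le) (use ab in simp)
  then show ?thesis using 1 psd_ge[OF Q, of x] psd_ge[OF R, of u] by (simp add: a_def b_def)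
qed

context noise
begin

lemma uncorrelated_inner:
  fixes U :: "'w \<Rightarrow> real^'m" and Y :: "'w \<Rightarrow> real^'n" and C :: "real^'n^'m"
  assumes U: "sq_integrable P U" and Y: "sq_integrable P Y" and 0: "\<And>i. expectation (\<lambda>\<omega>. U \<omega> $ i *\<^sub>R Y \<omega>) = 0"
  shows "expectation (\<lambda>\<omega>. (C *v Y \<omega>) \<bullet> U \<omega>) = 0"
proof -
  have i: "integrable P (\<lambda>\<omega>. U \<omega> $ i *\<^sub>R Y \<omega>)" for i
    by (intro sq_integrable_imp_scaleR sq_integrable_component U Y)
  have "expectation (\<lambda>\<omega>. (C *v Y \<omega>) \<bullet> U \<omega>) = expectation (\<lambda>\<omega>. \<Sum>i\<in>UNIV. C $ i \<bullet> (U \<omega> $ i *\<^sub>R Y \<omega>))"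
    by (simp add: inner_vec_def[of "C *v Y _"] matrix_vector_mult_component_inner mult.commute)
  also have "\<dots> = (\<Sum>i\<in>UNIV. expectation (\<lambda>\<omega>. C $ i \<bullet> (U \<omega> $ i *\<^sub>R Y \<omega>)))"
    by (rule Bochner_Integration.integral_sum) (rule integrable_inner_right[OF i])
  also have "\<dots> = (\<Sum>i\<in>UNIV. C $ i \<bullet> expectation (\<lambda>\<omega>. U \<omega> $ i *\<^sub>R Y \<omega>))"
    by (intro sum.cong refl integral_inner_right i)
  finally show ?thesis by (simp add: 0)
qed

lemma integral_LP_eq:
  fixes f :: "real \<Rightarrow> 'w \<Rightarrow> real"
  assumes "integrable LP (\<lambda>p. f (fst p) (snd p))"
  shows "expectation (\<lambda>\<omega>. \<integral>t. f t \<omega> \<partial>lebesgue_on {0..T}) = (\<integral>p. f (fst p) (snd p) \<partial>LP)"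
    "(\<integral>t. expectation (f t) \<partial>lebesgue_on {0..T}) = (\<integral>p. f (fst p) (snd p) \<partial>LP)"
  using LP.integral_snd[of f] integral_LP(1)[OF assms] assms by (auto simp: case_prod_beta')

end

context lq_flow
begin

text \<open>The payoff density is separated from the processes, so that the expansion around the
  optimum and the insertion of the feedback become finite-dimensional algebra.\<close>

definition run :: "real \<Rightarrow> real^'d \<Rightarrow> real^'k \<Rightarrow> real^'d \<Rightarrow> real" where
  "run t x u y = L t \<bullet> y - 1/2 * ((Qbar t *v y) \<bullet> y) - 1/2 * ((Q t *v x) \<bullet> x) - (Qtil t *v x) \<bullet> y - q t \<bullet> x
     - 1/2 * ((R t *v u) \<bullet> u) - (S t *v x) \<bullet> u - r t \<bullet> u"

definition fin :: "real^'d \<Rightarrow> real^'d \<Rightarrow> real" where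
  "fin x y = - (1/2 * ((Hbar *v y) \<bullet> y)) - 1/2 * ((H *v x) \<bullet> x) - (Htil *v x) \<bullet> y"

abbreviation pay :: "(real \<Rightarrow> 'w \<Rightarrow> real^'k) \<Rightarrow> real" where
  "pay \<beta> \<equiv> payoff T P F W \<xi> A B \<sigma> L Qbar Q Qtil q R S r Hbar H Htil \<beta> \<mu>"

lemma R_Linf: "Linf T R" by (rule Linf_continuous[OF R])

lemma sq_process_coeff: "Linf T x \<Longrightarrow> sq_process (\<lambda>t \<omega>. x t)"
  by (intro sq_process_deterministic Linf_sq_integrable)

lemma run_integrable:
  assumes "sq_process x" "sq_process u"
  shows "integrable LP (\<lambda>p. run (fst p) (x (fst p) (snd p)) (u (fst p) (snd p)) (\<mu> (fst p) (snd p)))"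
  unfolding run_def
  by (intro Bochner_Integration.integrable_diff integrable_mult_right
      sq_process_inner[OF sq_process_matrix sq_\<mu>(1)] sq_process_inner[OF sq_process_matrix assms(1)]
      sq_process_inner[OF sq_process_matrix assms(2)] sq_process_inner[OF sq_process_coeff sq_\<mu>(1)]
      sq_process_inner[OF sq_process_coeff assms(1)] sq_process_inner[OF sq_process_coeff assms(2)]
      assms sq_\<mu> L q r Q Qbar Qtil S R_Linf)

lemma fin_integrable:
  assumes "sq_integrable P x"
  shows "integrable P (\<lambda>\<omega>. fin (x \<omega>) (\<mu> T \<omega>))"
proof -
  have \<mu>T: "sq_integrable P (\<mu> T)" using sq_\<mu>(2) T by simp
  show ?thesis unfolding fin_def
    by (intro Bochner_Integration.integrable_diff Bochner_Integration.integrable_minus integrable_mult_right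
        sq_integrable_imp_inner sq_integrable_matrix assms \<mu>T)
qed

text \<open>\<open>payoff\<close> refers to the chosen \<open>state\<close>; states being unique up
  to a null set, any state process of the same control gives the same value.\<close>

lemma payoff_eq:
  assumes Y: "is_state \<beta> Y" and \<beta>: "\<beta> \<in> H2 T P F"
  shows "pay \<beta> = (\<integral>p. run (fst p) (Y (fst p) (snd p)) (\<beta> (fst p) (snd p)) (\<mu> (fst p) (snd p)) \<partial>LP)
    + expectation (\<lambda>\<omega>. fin (Y T \<omega>) (\<mu> T \<omega>))"
proof -
  define Y0 where "Y0 = state T P F W \<xi> A B \<sigma> \<beta>"
  have Y0: "is_state \<beta> Y0" unfolding Y0_def by (rule is_state_state[OF X lam_H2 \<beta>])
  note ri = run_integrable[OF is_state_sq(1)[OF Y0 \<beta>] H2_sq_process[OF \<beta>]] run_integrable[OF is_state_sq(1)[OF Y \<beta>] H2_sq_process[OF \<beta>]]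
  have fi: "integrable P (\<lambda>\<omega>. fin (Y T \<omega>) (\<mu> T \<omega>))" "integrable P (\<lambda>\<omega>. fin (Y0 T \<omega>) (\<mu> T \<omega>))"
    using is_state_sq(2)[OF Y \<beta>, of T] is_state_sq(2)[OF Y0 \<beta>, of T] T by (auto intro: fin_integrable)
  note li = integral_LP(3)[OF ri(1)] integral_LP(3)[OF ri(2)]
  have "pay \<beta> = expectation (\<lambda>\<omega>. (\<integral>t. run t (Y0 t \<omega>) (\<beta> t \<omega>) (\<mu> t \<omega>) \<partial>lebesgue_on {0..T}) + fin (Y0 T \<omega>) (\<mu> T \<omega>))"
    unfolding payoff_def Let_def Y0_def[symmetric] set_integral_eq_lebesgue_on run_def fin_def by (simp add: algebra_simps)
  also have "\<dots> = expectation (\<lambda>\<omega>. (\<integral>t. run t (Y t \<omega>) (\<beta> t \<omega>) (\<mu> t \<omega>) \<partial>lebesgue_on {0..T}) + fin (Y T \<omega>) (\<mu> T \<omega>))"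
  proof (rule integral_cong_AE)
    show "AE \<omega> in P. (\<integral>t. run t (Y0 t \<omega>) (\<beta> t \<omega>) (\<mu> t \<omega>) \<partial>lebesgue_on {0..T}) + fin (Y0 T \<omega>) (\<mu> T \<omega>)
      = (\<integral>t. run t (Y t \<omega>) (\<beta> t \<omega>) (\<mu> t \<omega>) \<partial>lebesgue_on {0..T}) + fin (Y T \<omega>) (\<mu> T \<omega>)"
      using is_state_unique[OF Y \<beta> Y0]
    proof eventually_elim
      case (elim \<omega>)
      have "(\<integral>t. run t (Y0 t \<omega>) (\<beta> t \<omega>) (\<mu> t \<omega>) \<partial>lebesgue_on {0..T}) = (\<integral>t. run t (Y t \<omega>) (\<beta> t \<omega>) (\<mu> t \<omega>) \<partial>lebesgue_on {0..T})"
        using elim by (intro Bochner_Integration.integral_cong refl) simp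
      then show ?case using elim T by simp
    qed
  qed (use li fi in auto)
  also have "\<dots> = (\<integral>p. run (fst p) (Y (fst p) (snd p)) (\<beta> (fst p) (snd p)) (\<mu> (fst p) (snd p)) \<partial>LP)
    + expectation (\<lambda>\<omega>. fin (Y T \<omega>) (\<mu> T \<omega>))"
    using li(2) fi(1) integral_LP_eq(1)[OF ri(2)] by simp
  finally show ?thesis .
qed

text \<open>Multiplying the feedback coefficients by \<open>R\<close> removes the inverse of
  \<open>R\<close> inside them; the later algebra uses them only in this form.\<close>

lemma R_feedback:
  assumes t: "t \<in> {0..T}"
  shows "R t *v (\<Phi> t *v x) = transpose (B t) *v (\<phi> t *v x) + S t *v x"
    "R t *v (\<Psi> t *v x) = transpose (B t) *v (\<psi> t *v x)"
    "R t *v \<Theta> t = transpose (B t) *v \<theta> t + r t" "R t *v (Ri t *v u) = u"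
    "(R t *v u) \<bullet> v = u \<bullet> (R t *v v)"
proof -
  have RI: "R t *v (Ri t *v u) = u" for u
    using psd_inverse(1)[OF R_bound[rule_format, OF t] d(2)] by (simp add: matrix_vector_mul_assoc)
  then show "R t *v (Ri t *v u) = u" .
  show "R t *v (\<Phi> t *v x) = transpose (B t) *v (\<phi> t *v x) + S t *v x"
    "R t *v (\<Psi> t *v x) = transpose (B t) *v (\<psi> t *v x)"
    "R t *v \<Theta> t = transpose (B t) *v \<theta> t + r t"
    by (simp_all add: \<Phi>_def \<Psi>_def \<Theta>_def RI matrix_vector_mul_assoc[symmetric] matrix_vector_mult_add_rdistrib)
  show "(R t *v u) \<bullet> v = u \<bullet> (R t *v v)" using R_sym t by (simp add: inner_transpose)
qed

lemma m_centered: "t \<in> {0..T} \<Longrightarrow> sq_integrable P (\<lambda>\<omega>. \<mu> t \<omega> - m t)" "t \<in> {0..T} \<Longrightarrow> expectation (\<lambda>\<omega>. (\<mu> t \<omega> - m t) $ i) = 0"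
proof -
  assume t: "t \<in> {0..T}"
  show sq: "sq_integrable P (\<lambda>\<omega>. \<mu> t \<omega> - m t)" by (intro sq_integrable_diff sq_\<mu> t sq_integrable_const finite_measure_axioms)
  note i = sq_integrable_imp_integrable[OF finite_measure_axioms]
  have "expectation (\<lambda>\<omega>. (\<mu> t \<omega> - m t) $ i) = expectation (\<lambda>\<omega>. \<mu> t \<omega> - m t) $ i"
    by (rule integral_bounded_linear[OF bounded_linear_vec_nth i[OF sq]])
  also have "expectation (\<lambda>\<omega>. \<mu> t \<omega> - m t) = 0" using i[OF sq_\<mu>(2)[OF t]] prob_space by (simp add: m_def)
  finally show "expectation (\<lambda>\<omega>. (\<mu> t \<omega> - m t) $ i) = 0" by simp
qed

end

section \<open>An arbitrary deviation compared with the candidate optimum\<close>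

locale lq_deviation = lq_flow +
  fixes \<beta> Xb
  assumes \<beta>: "\<beta> \<in> H2 T P G1" and Xb: "is_state \<beta> Xb"
begin

lemmas \<beta>_F = H2_G1_F[OF \<beta>]

definition D where "D t \<omega> = Xb t \<omega> - Xs t \<omega>"
definition \<gamma> where "\<gamma> t \<omega> = \<beta> t \<omega> - bs t \<omega>"
definition Dd where "Dd t \<omega> = A t *v D t \<omega> + B t *v \<gamma> t \<omega>"

lemma sq_D: "sq_process D" "\<And>t. t \<in> {0..T} \<Longrightarrow> sq_integrable P (D t)"
  unfolding D_def[abs_def] using is_state_sq[OF Xb \<beta>_F] is_state_sq[OF Xs_state bs_H2(2)]
  by (auto intro: sq_process_diff sq_integrable_diff)

lemma sq_\<gamma>: "sq_process \<gamma>"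
  unfolding \<gamma>_def[abs_def] by (intro sq_process_diff H2_sq_process \<beta>_F bs_H2)

lemma sq_Dd: "sq_process Dd"
  unfolding Dd_def[abs_def] by (intro sq_process_add sq_process_matrix A B sq_D sq_\<gamma>)

lemma D_ode: "AE \<omega> in P. ode_on T (\<lambda>t. D t \<omega>) (\<lambda>t. Dd t \<omega>) \<and> D 0 \<omega> = 0"
  using is_state_diff[OF Xs_state bs_H2(2) Xb \<beta>_F] by (simp add: D_def Dd_def \<gamma>_def)

text \<open>\<open>\<gamma>\<close> is measurable for the filtration of the noise, hence independent
  of \<open>\<mu>\<close>. Being uncorrelated with the centred \<open>\<mu> u\<close> is inherited
  by \<open>D\<close>, which solves a linear equation driven by \<open>\<gamma>\<close>.\<close>

lemma D_\<mu>:
  assumes u: "u \<in> {0..T}" and t: "t \<in> {0..T}"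
  shows "expectation (\<lambda>\<omega>. (\<mu> u \<omega> - m u) $ i *\<^sub>R D t \<omega>) = 0"
proof -
  let ?U = "\<lambda>\<omega>. (\<mu> u \<omega> - m u) $ i"
  have U: "sq_integrable P ?U" by (intro sq_integrable_component m_centered u)
  show ?thesis
  proof (rule weak_gronwall[OF U A sq_D(1), where g="\<lambda>s \<omega>. B s *v \<gamma> s \<omega>" and V="\<lambda>t \<omega>. 0" and ?t0.0=T])
    show "sq_process (\<lambda>s \<omega>. B s *v \<gamma> s \<omega>)" by (intro sq_process_matrix B sq_\<gamma>)
    show "AE \<omega> in P. D t \<omega> = 0 + (\<integral>s. A s *v D s \<omega> + B s *v \<gamma> s \<omega> \<partial>lebesgue_on {0..t})" if "t \<in> {0..T}" for t
      using D_ode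
    proof eventually_elim
      case (elim \<omega>)
      show ?case using ode_onD(2)[OF conjunct1[OF elim] that] elim by (simp add: Dd_def)
    qed
    show "D t \<in> borel_measurable P" if "t \<in> {0..T}" for t using sq_D(2)[OF that] by auto
    show "AE s in lebesgue_on {0..T}. expectation (\<lambda>\<omega>. ?U \<omega> *\<^sub>R (B s *v \<gamma> s \<omega>)) = 0"
      using sq_process_section_time[OF sq_\<gamma>] AE_space
    proof eventually_elim
      case (elim s)
      then have s: "s \<in> {0..T}" by simp
      have "\<gamma> s \<in> borel_measurable (G1 s)"
        unfolding \<gamma>_def[abs_def] using \<beta> bs_H2(1) s by (intro borel_measurable_diff prog_measurable_section) (auto simp: H2_def)
      then have g: "\<gamma> s \<in> borel_measurable (G1 T)"
        using gen_filtration_mono[of s T] s by (auto simp: measurable_def)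
      have Um: "?U \<in> borel_measurable (vimage_algebra (space P) (traj T \<mu>) (C_borel T))"
        by (intro borel_measurable_component borel_measurable_diff \<mu>_traj_measurable u) auto
      note ii = sq_integrable_imp_integrable[OF finite_measure_axioms]
      have j: "integrable P (\<lambda>\<omega>. ?U \<omega> *\<^sub>R \<gamma> s \<omega>)" by (rule sq_integrable_imp_scaleR[OF U elim(1)])
      have "expectation (\<lambda>\<omega>. ?U \<omega> *\<^sub>R \<gamma> s \<omega>) $ j = 0" for j
      proof -
        have "expectation (\<lambda>\<omega>. ?U \<omega> *\<^sub>R \<gamma> s \<omega>) $ j = expectation (\<lambda>\<omega>. ?U \<omega> * \<gamma> s \<omega> $ j)"
          using integral_bounded_linear[OF bounded_linear_vec_nth j, of j] by (simp del: vector_minus_component)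
        also have "\<dots> = expectation ?U * expectation (\<lambda>\<omega>. \<gamma> s \<omega> $ j)"
          by (rule expectation_mult_indep_set[OF indep_gen_filtration[OF \<mu>_traj(2)] _ _ Um borel_measurable_component[OF g]
                ii[OF U] ii[OF sq_integrable_component[OF elim(1)]]]) auto
        finally show ?thesis using m_centered(2)[OF u] by simp
      qed
      then have "expectation (\<lambda>\<omega>. ?U \<omega> *\<^sub>R \<gamma> s \<omega>) = 0" by (simp add: vec_eq_iff)
      then show ?case
        using integral_bounded_linear[OF matrix_vector_mul_bounded_linear j, of "B s"]
        by (simp add: matrix_vector_mult_scaleR del: vector_minus_component)
    qed
  qed (use t T in \<open>auto simp: sq_integrable_def\<close>)
qed

lemma D_\<mu>_inner:
  assumes t: "t \<in> {0..T}"
  shows "expectation (\<lambda>\<omega>. (C *v D t \<omega>) \<bullet> \<mu> t \<omega>) = expectation (\<lambda>\<omega>. (C *v D t \<omega>) \<bullet> m t)"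
proof -
  have "expectation (\<lambda>\<omega>. (C *v D t \<omega>) \<bullet> (\<mu> t \<omega> - m t)) = 0"
    by (intro uncorrelated_inner m_centered sq_D D_\<mu> t)
  moreover have "integrable P (\<lambda>\<omega>. (C *v D t \<omega>) \<bullet> \<mu> t \<omega>)" "integrable P (\<lambda>\<omega>. (C *v D t \<omega>) \<bullet> m t)"
    by (intro sq_integrable_imp_inner sq_integrable_matrix sq_D sq_\<mu> t sq_integrable_const finite_measure_axioms)+
  ultimately show ?thesis by (simp add: inner_diff_right)
qed

text \<open>\<open>V\<close> is the drift of the optimal state, \<open>p\<close> the adjoint process
  and \<open>hh\<close> the drift of \<open>p\<close>; the remaining part of \<open>p\<close> is a
  martingale with integrand \<open>\<phi> \<sigma>\<close>.\<close>

definition V where "V t \<omega> = A t *v Xs t \<omega> + B t *v bs t \<omega>"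
definition p where "p t \<omega> = \<phi> t *v Xs t \<omega> + eta t"
definition hh where "hh t \<omega> = phi' t *v Xs t \<omega> + \<phi> t *v V t \<omega> + eta' t"

lemma sq_V: "sq_process V"
  unfolding V_def[abs_def] by (intro sq_process_add sq_process_matrix A B sq_Xs sq_bs)

lemma sq_p: "sq_process p"
  unfolding p_def[abs_def] by (intro sq_process_add sq_process_matrix Linf_ode sq_Xs sq_process_coeff Linf_eta)

lemma sq_hh: "sq_process hh"
  unfolding hh_def[abs_def] by (intro sq_process_add sq_process_matrix Linf_ode Linf_phi' sq_Xs sq_V sq_process_coeff Linf_eta)

text \<open>No Ito formula is needed for this integration by parts: under the expectation against
  \<open>F\<^sub>s\<close>-measurable factors the martingale part \<open>I\<^sub>s\<close> of the state may be replaced by \<open>I\<^sub>T\<close>, and the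
  remaining processes are absolutely continuous.\<close>

lemma adjoint_duality:
  "expectation (\<lambda>\<omega>. p T \<omega> \<bullet> D T \<omega>) =
    (\<integral>z. hh (fst z) (snd z) \<bullet> D (fst z) (snd z) + p (fst z) (snd z) \<bullet> Dd (fst z) (snd z) \<partial>LP)"
proof -
  obtain Im where Im: "prog_measurable T F Im" "sq_process Im" "\<And>t. t \<in> {0..T} \<Longrightarrow> sq_integrable P (Im t)"
    "AE \<omega> in P. \<forall>t. Im t \<omega> = I t \<omega>"
    using stoch_integral_modification[OF I] by blast
  \<comment> \<open>Derivative of \<open>transpose (\<phi> t) *v D t \<omega>\<close>, which is what
    the martingale part gets paired with once \<open>\<phi>\<close> is moved to the other
    factor.\<close>
  define w where "w t \<omega> = transpose (phi' t) *v D t \<omega> + transpose (\<phi> t) *v Dd t \<omega>" for t \<omega>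
  \<comment> \<open>Derivative of the product of \<open>D\<close> with the adjoint process stripped
    of its term \<open>\<phi> Im\<close>; both factors are absolutely continuous.\<close>
  define g where "g t \<omega> = (phi' t *v (Xs t \<omega> - Im t \<omega>) + \<phi> t *v V t \<omega> + eta' t) \<bullet> D t \<omega> +
    (\<phi> t *v (Xs t \<omega> - Im t \<omega>) + eta t) \<bullet> Dd t \<omega>" for t \<omega>
  have sq_w: "sq_process w"
    unfolding w_def[abs_def] by (intro sq_process_add sq_process_matrix Linf_linear[OF bounded_linear_transpose] Linf_phi' Linf_ode sq_D sq_Dd)
  have TT: "T \<in> {0..T}" using T by simp
  have path: "AE \<omega> in P. p T \<omega> \<bullet> D T \<omega> = (\<integral>t. g t \<omega> \<partial>lebesgue_on {0..T}) + (\<integral>t. Im T \<omega> \<bullet> w t \<omega> \<partial>lebesgue_on {0..T})"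
    using Xs_ode D_ode Im(4)
  proof eventually_elim
    case (elim \<omega>)
    have c: "ode_on T (\<lambda>t. \<xi> \<omega>) (\<lambda>t. 0)" by (rule ode_onI) simp_all
    have "ode_on T (\<lambda>t. Xs t \<omega> - Im t \<omega>) (\<lambda>t. V t \<omega>)"
      using ode_on_add[OF conjunct1[OF elim(1)] c] elim(3) by (simp add: V_def[abs_def])
    note p1 = ode_on_add[OF ode_on_bilinear[OF phi'_ode this bounded_bilinear_matrix_vector_mult] eta_ode(1)]
    have "ode_on T (\<lambda>t. (\<phi> t *v (Xs t \<omega> - Im t \<omega>) + eta t) \<bullet> D t \<omega>) (\<lambda>t. g t \<omega>)"
      using ode_on_bilinear[OF p1 conjunct1[OF elim(2)] bounded_bilinear_inner] by (simp add: g_def)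
    from ode_onD(2)[OF this TT] have 1: "(\<phi> T *v (Xs T \<omega> - Im T \<omega>) + eta T) \<bullet> D T \<omega> = (\<integral>t. g t \<omega> \<partial>lebesgue_on {0..T})"
      using elim(2) by simp
    have "ode_on T (\<lambda>t. transpose (\<phi> t) *v D t \<omega>) (\<lambda>t. w t \<omega>)"
      using ode_on_bilinear[OF ode_on_linear[OF phi'_ode bounded_linear_transpose] conjunct1[OF elim(2)] bounded_bilinear_matrix_vector_mult]
      by (simp add: w_def)
    from ode_onD(1,2)[OF this] TT have 2: "transpose (\<phi> T) *v D T \<omega> = (\<integral>t. w t \<omega> \<partial>lebesgue_on {0..T})"
      "integrable (lebesgue_on {0..T}) (\<lambda>t. w t \<omega>)"
      using elim(2) by auto
    have "p T \<omega> \<bullet> D T \<omega> = (\<phi> T *v (Xs T \<omega> - Im T \<omega>) + eta T) \<bullet> D T \<omega> + Im T \<omega> \<bullet> (transpose (\<phi> T) *v D T \<omega>)"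
      using inner_transpose[of "\<phi> T" "Im T \<omega>" "D T \<omega>"]
      by (simp add: p_def inner_add_left inner_diff_left matrix_vector_mult_diff_distrib)
    also have "Im T \<omega> \<bullet> (transpose (\<phi> T) *v D T \<omega>) = (\<integral>t. Im T \<omega> \<bullet> w t \<omega> \<partial>lebesgue_on {0..T})"
      unfolding 2(1) by (rule integral_inner_right[OF 2(2), symmetric])
    finally show ?case unfolding 1 .
  qed
  have gi: "integrable LP (\<lambda>z. g (fst z) (snd z))"
    unfolding g_def
    by (intro Bochner_Integration.integrable_add sq_process_inner sq_process_add sq_process_diff sq_process_matrix
        sq_process_coeff Linf_phi' Linf_ode Linf_eta sq_Xs sq_V sq_D sq_Dd Im)
  have wT: "integrable LP (\<lambda>z. Im T (snd z) \<bullet> w (fst z) (snd z))"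
    by (rule sq_process_inner[OF sq_process_const[OF Im(3)[OF TT]] sq_w])
  have ws: "integrable LP (\<lambda>z. Im (fst z) (snd z) \<bullet> w (fst z) (snd z))"
    by (rule sq_process_inner[OF Im(2) sq_w])
  have "expectation (\<lambda>\<omega>. p T \<omega> \<bullet> D T \<omega>) =
    expectation (\<lambda>\<omega>. (\<integral>t. g t \<omega> \<partial>lebesgue_on {0..T}) + (\<integral>t. Im T \<omega> \<bullet> w t \<omega> \<partial>lebesgue_on {0..T}))"
  proof (rule integral_cong_AE[OF _ _ path])
    have "p T \<in> borel_measurable P"
      unfolding p_def[abs_def] using sq_integrable_matrix[OF is_state_sq(2)[OF Xs_state bs_H2(2) TT], of "\<phi> T"] by auto
    then show "(\<lambda>\<omega>. p T \<omega> \<bullet> D T \<omega>) \<in> borel_measurable P" using sq_D(2)[OF TT] by (intro borel_measurable_inner) auto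
    show "(\<lambda>\<omega>. (\<integral>t. g t \<omega> \<partial>lebesgue_on {0..T}) + (\<integral>t. Im T \<omega> \<bullet> w t \<omega> \<partial>lebesgue_on {0..T})) \<in> borel_measurable P"
      using integral_LP(3)[OF gi] integral_LP(3)[of "\<lambda>t \<omega>. Im T \<omega> \<bullet> w t \<omega>", OF wT] by (intro borel_measurable_add) auto
  qed
  also have "\<dots> = (\<integral>z. g (fst z) (snd z) \<partial>LP) + (\<integral>t. expectation (\<lambda>\<omega>. Im T \<omega> \<bullet> w t \<omega>) \<partial>lebesgue_on {0..T})"
    using integral_LP(3)[OF gi] integral_LP(3)[of "\<lambda>t \<omega>. Im T \<omega> \<bullet> w t \<omega>", OF wT]
      integral_LP_eq(1)[OF gi] integral_LP(1)[of "\<lambda>t \<omega>. Im T \<omega> \<bullet> w t \<omega>", OF wT] by simp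
  also have "(\<integral>t. expectation (\<lambda>\<omega>. Im T \<omega> \<bullet> w t \<omega>) \<partial>lebesgue_on {0..T}) = (\<integral>t. expectation (\<lambda>\<omega>. Im t \<omega> \<bullet> w t \<omega>) \<partial>lebesgue_on {0..T})"
  proof (rule integral_cong_AE)
    show "(\<lambda>t. expectation (\<lambda>\<omega>. Im T \<omega> \<bullet> w t \<omega>)) \<in> borel_measurable (lebesgue_on {0..T})"
      using integral_LP(2)[of "\<lambda>t \<omega>. Im T \<omega> \<bullet> w t \<omega>", OF wT] by simp
    show "(\<lambda>t. expectation (\<lambda>\<omega>. Im t \<omega> \<bullet> w t \<omega>)) \<in> borel_measurable (lebesgue_on {0..T})"
      using integral_LP(2)[of "\<lambda>t \<omega>. Im t \<omega> \<bullet> w t \<omega>", OF ws] by simp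
    show "AE t in lebesgue_on {0..T}. expectation (\<lambda>\<omega>. Im T \<omega> \<bullet> w t \<omega>) = expectation (\<lambda>\<omega>. Im t \<omega> \<bullet> w t \<omega>)"
      using sq_process_section_time[OF sq_w] AE_space
    proof eventually_elim
      case (elim t)
      then have t: "t \<in> {0..T}" by simp
      have Dt: "D t \<in> borel_measurable (F t)"
        unfolding D_def[abs_def] by (intro borel_measurable_diff prog_measurable_section[OF is_state_prog[OF Xb] t]
            prog_measurable_section[OF is_state_prog[OF Xs_state] t])
      have "\<gamma> t \<in> borel_measurable (F t)"
        unfolding \<gamma>_def[abs_def] using \<beta>_F bs_H2(2) t by (intro borel_measurable_diff prog_measurable_section) (auto simp: H2_def)
      then have wF: "w t \<in> borel_measurable (F t)"
        unfolding w_def[abs_def] Dd_def using Dt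
        by (intro borel_measurable_add borel_measurable_matrix_vector_mult) auto
      have diff: "sq_integrable P (\<lambda>\<omega>. Im T \<omega> - Im t \<omega>)" by (intro sq_integrable_diff Im TT t)
      have int: "integrable P (\<lambda>\<omega>. (Im T \<omega> - Im t \<omega>) $ i * w t \<omega> $ i)" for i
        by (intro sq_integrable_imp_mult sq_integrable_component diff elim)
      have "expectation (\<lambda>\<omega>. (Im T \<omega> - Im t \<omega>) $ i * w t \<omega> $ i) = 0" for i
      proof -
        have "expectation (\<lambda>\<omega>. (Im T \<omega> - Im t \<omega>) $ i * w t \<omega> $ i) = expectation (\<lambda>\<omega>. (I T \<omega> - I t \<omega>) $ i * w t \<omega> $ i)"
        proof (rule integral_cong_AE)
          show "(\<lambda>\<omega>. (Im T \<omega> - Im t \<omega>) $ i * w t \<omega> $ i) \<in> borel_measurable P" using int by blast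
          show "(\<lambda>\<omega>. (I T \<omega> - I t \<omega>) $ i * w t \<omega> $ i) \<in> borel_measurable P"
            using stoch_integral_sq[OF I \<sigma> TT] stoch_integral_sq[OF I \<sigma> t] elim(1)
            by (intro borel_measurable_times borel_measurable_component borel_measurable_diff) auto
        qed (use Im(4) in \<open>auto elim: eventually_mono\<close>)
        also have "\<dots> = 0"
          using t by (intro stoch_integral_martingale[OF I \<sigma>] sq_integrable_component elim borel_measurable_component wF) auto
        finally show ?thesis .
      qed
      then have "expectation (\<lambda>\<omega>. (Im T \<omega> - Im t \<omega>) \<bullet> w t \<omega>) = 0"
        unfolding inner_vec_def inner_real_def using int by (subst Bochner_Integration.integral_sum) auto
      moreover have "integrable P (\<lambda>\<omega>. Im T \<omega> \<bullet> w t \<omega>)" "integrable P (\<lambda>\<omega>. Im t \<omega> \<bullet> w t \<omega>)"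
        by (intro sq_integrable_imp_inner Im TT t elim)+
      ultimately show ?case by (simp add: inner_diff_left)
    qed
  qed
  also have "\<dots> = (\<integral>z. Im (fst z) (snd z) \<bullet> w (fst z) (snd z) \<partial>LP)"
    by (rule integral_LP_eq(2)[OF ws])
  also have "(\<integral>z. g (fst z) (snd z) \<partial>LP) + (\<integral>z. Im (fst z) (snd z) \<bullet> w (fst z) (snd z) \<partial>LP) =
    (\<integral>z. g (fst z) (snd z) + Im (fst z) (snd z) \<bullet> w (fst z) (snd z) \<partial>LP)"
    using gi ws by simp
  also have "\<dots> = (\<integral>z. hh (fst z) (snd z) \<bullet> D (fst z) (snd z) + p (fst z) (snd z) \<bullet> Dd (fst z) (snd z) \<partial>LP)"
  proof (intro Bochner_Integration.integral_cong refl)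
    fix z
    show "g (fst z) (snd z) + Im (fst z) (snd z) \<bullet> w (fst z) (snd z) =
      hh (fst z) (snd z) \<bullet> D (fst z) (snd z) + p (fst z) (snd z) \<bullet> Dd (fst z) (snd z)"
      unfolding g_def w_def hh_def p_def inner_add_right inner_transpose[symmetric]
      by (simp add: inner_add_left inner_diff_left matrix_vector_mult_diff_distrib)
  qed
  finally show ?thesis .
qed

lemma cost_nonneg:
  "AE t in lebesgue_on {0..T}. \<forall>x u. 0 \<le> 1/2 * ((Q t *v x) \<bullet> x) + 1/2 * ((R t *v u) \<bullet> u) + (S t *v x) \<bullet> u"
proof -
  have "AE t in lebesgue_on {0..T}. (onorm (\<lambda>x. S t *v x))\<^sup>2 \<le> d1 * d2"
  proof (cases "d1 = 0")
    case True
    from S_bound(2)[OF True] show ?thesis by eventually_elim (simp add: onorm_zero True)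
  next
    case False
    then obtain c where "c < d1 * d2" "AE t in lebesgue_on {0..T}. (onorm (\<lambda>x. S t *v x))\<^sup>2 \<le> c"
      using S_bound(1) d by auto
    then show ?thesis by (auto elim!: eventually_mono)
  qed
  with Q_bound AE_space show ?thesis
  proof eventually_elim
    case (elim t)
    then show ?case using R_bound d by (intro allI quadratic_cost_nonneg[of _ d1 _ d2]) auto
  qed
qed

text \<open>\<open>lin\<close> and \<open>quad\<close> are the first and second order parts of the
  running cost in the direction of \<open>D\<close> and \<open>\<gamma>\<close>. The coupling of
  \<open>D\<close> with \<open>\<mu>\<close> is kept apart, as it simplifies only under the
  expectation.\<close>

definition lin where
  "lin t \<omega> = (Q t *v Xs t \<omega>) \<bullet> D t \<omega> + q t \<bullet> D t \<omega> + (R t *v bs t \<omega>) \<bullet> \<gamma> t \<omega>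
    + (S t *v Xs t \<omega>) \<bullet> \<gamma> t \<omega> + (S t *v D t \<omega>) \<bullet> bs t \<omega> + r t \<bullet> \<gamma> t \<omega>"

definition quad where
  "quad t \<omega> = 1/2 * ((Q t *v D t \<omega>) \<bullet> D t \<omega>) + 1/2 * ((R t *v \<gamma> t \<omega>) \<bullet> \<gamma> t \<omega>) + (S t *v D t \<omega>) \<bullet> \<gamma> t \<omega>"

lemma lin_quad_integrable:
  "integrable LP (\<lambda>z. lin (fst z) (snd z))" "integrable LP (\<lambda>z. quad (fst z) (snd z))"
  "integrable LP (\<lambda>z. (Qtil (fst z) *v D (fst z) (snd z)) \<bullet> \<mu> (fst z) (snd z))"
  "integrable LP (\<lambda>z. (Qtil (fst z) *v D (fst z) (snd z)) \<bullet> m (fst z))"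
proof -
  show "integrable LP (\<lambda>z. lin (fst z) (snd z))" unfolding lin_def
    by (intro Bochner_Integration.integrable_add sq_process_inner[OF sq_process_matrix sq_D(1)]
        sq_process_inner[OF sq_process_coeff sq_D(1)] sq_process_inner[OF sq_process_matrix sq_\<gamma>]
        sq_process_inner[OF sq_process_matrix sq_bs] sq_process_inner[OF sq_process_coeff sq_\<gamma>]
        sq_Xs sq_bs sq_D Q q R_Linf S r)
  show "integrable LP (\<lambda>z. quad (fst z) (snd z))" unfolding quad_def
    by (intro Bochner_Integration.integrable_add integrable_mult_right sq_process_inner[OF sq_process_matrix sq_D(1)]
        sq_process_inner[OF sq_process_matrix sq_\<gamma>] sq_\<gamma> sq_D Q R_Linf S)
  show "integrable LP (\<lambda>z. (Qtil (fst z) *v D (fst z) (snd z)) \<bullet> \<mu> (fst z) (snd z))"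
    by (intro sq_process_inner sq_process_matrix sq_D sq_\<mu> Qtil)
  show "integrable LP (\<lambda>z. (Qtil (fst z) *v D (fst z) (snd z)) \<bullet> m (fst z))"
    by (intro sq_process_inner[of "\<lambda>t \<omega>. Qtil t *v D t \<omega>" "\<lambda>t \<omega>. m t"] sq_process_matrix sq_D sq_process_coeff Linf_m Qtil)
qed

text \<open>The running payoff is quadratic, so the expansion is exact; symmetry of \<open>Q\<close>
  and \<open>R\<close> merges the two mixed terms of each quadratic form.\<close>

lemma run_expansion:
  "AE z in LP. run (fst z) (Xb (fst z) (snd z)) (\<beta> (fst z) (snd z)) (\<mu> (fst z) (snd z)) =
    run (fst z) (Xs (fst z) (snd z)) (bs (fst z) (snd z)) (\<mu> (fst z) (snd z))
    - lin (fst z) (snd z) - (Qtil (fst z) *v D (fst z) (snd z)) \<bullet> \<mu> (fst z) (snd z) - quad (fst z) (snd z)"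
  using AE_LP_fst[OF Q_sym] AE_space
proof eventually_elim
  case (elim z)
  obtain t \<omega> where z: "z = (t, \<omega>)" by (cases z)
  then have t: "t \<in> {0..T}" using elim(2) by (simp add: space_pair_measure)
  have x: "Xb t \<omega> = Xs t \<omega> + D t \<omega>" and u: "\<beta> t \<omega> = bs t \<omega> + \<gamma> t \<omega>" by (simp_all add: D_def \<gamma>_def)
  have Qs: "(Q t *v D t \<omega>) \<bullet> Xs t \<omega> = (Q t *v Xs t \<omega>) \<bullet> D t \<omega>"
    using elim(1) inner_transpose[of "Q t" "D t \<omega>" "Xs t \<omega>"] by (simp add: z inner_commute)
  have Rs: "(R t *v \<gamma> t \<omega>) \<bullet> bs t \<omega> = (R t *v bs t \<omega>) \<bullet> \<gamma> t \<omega>"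
    using R_feedback(5)[OF t, of "\<gamma> t \<omega>" "bs t \<omega>"] by (simp add: inner_commute)
  show ?case
    by (simp add: z run_def lin_def quad_def x u matrix_vector_right_distrib inner_add_left inner_add_right Qs Rs algebra_simps)
qed

text \<open>Stationarity and the adjoint equation: the feedback gives
  \<open>R bs + S Xs + r = - B^T p\<close>, and the backward equations give
  \<open>hh = - (A^T p + Q Xs + S^T bs + Qtil m + q)\<close>. The adjoint process contains the flow
  only through \<open>m\<close>, hence the coupling term in this form.\<close>

lemma lin_adjoint:
  "AE z in LP. lin (fst z) (snd z) + (Qtil (fst z) *v D (fst z) (snd z)) \<bullet> m (fst z) =
    - (hh (fst z) (snd z) \<bullet> D (fst z) (snd z) + p (fst z) (snd z) \<bullet> Dd (fst z) (snd z))"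
  using AE_LP_fst[OF Qtil_sym] bs_eq AE_space
proof eventually_elim
  case (elim z)
  obtain t \<omega> where z: "z = (t, \<omega>)" by (cases z)
  then have t: "t \<in> {0..T}" using elim(3) by (simp add: space_pair_measure)
  have b: "bs t \<omega> = - (\<Phi> t *v Xs t \<omega>) - c t" using elim(2) by (simp add: z)
  have Qs: "(Qtil t *v D t \<omega>) \<bullet> m t = (Qtil t *v m t) \<bullet> D t \<omega>"
    using elim(1) inner_transpose[of "Qtil t" "D t \<omega>" "m t"] by (simp add: z inner_commute)
  have Rc: "R t *v c t = transpose (B t) *v eta t + r t"
    by (simp add: c_def eta_def matrix_vector_right_distrib R_feedback[OF t])
  have "R t *v bs t \<omega> + S t *v Xs t \<omega> + r t = - (transpose (B t) *v p t \<omega>)"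
    unfolding b p_def by (simp add: matrix_vector_mult_diff_distrib matrix_vector_right_distrib matrix_vector_mult_minus_right R_feedback[OF t] Rc)
  from arg_cong[OF this, of "\<lambda>x. x \<bullet> \<gamma> t \<omega>"]
  have 1: "(R t *v bs t \<omega>) \<bullet> \<gamma> t \<omega> + (S t *v Xs t \<omega>) \<bullet> \<gamma> t \<omega> + r t \<bullet> \<gamma> t \<omega> = - (p t \<omega> \<bullet> (B t *v \<gamma> t \<omega>))"
    using inner_transpose[of "B t" "\<gamma> t \<omega>" "p t \<omega>"]
    by (simp only: inner_add_left inner_minus_left inner_commute[of "p t \<omega>"] inner_commute[of "transpose (B t) *v p t \<omega>"])
  \<comment> \<open>Eliminating \<open>\<Phi> Xs\<close> in favour of \<open>bs\<close> makes the
    terms in \<open>c\<close> and \<open>\<phi> B bs\<close> cancel; the quadratic part of the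
    Riccati equation then leaves only \<open>S^T bs\<close>.\<close>
  have fb: "\<Phi> t *v Xs t \<omega> = - bs t \<omega> - c t" using b by simp
  have "hh t \<omega> = - (transpose (A t) *v p t \<omega> + Q t *v Xs t \<omega> + transpose (S t) *v bs t \<omega> + Qtil t *v m t + q t)"
    unfolding hh_def phi'_def eta'_def V_def p_def c_def[symmetric]
    by (simp add: matrix_vector_mult_minus_left matrix_vector_mult_minus_right matrix_vector_mult_diff_distrib
        matrix_vector_mult_diff_rdistrib matrix_vector_right_distrib matrix_vector_mult_add_rdistrib
        matrix_vector_mul_assoc[symmetric] fb algebra_simps)
  from arg_cong[OF this, of "\<lambda>x. x \<bullet> D t \<omega>"]
  have 2: "hh t \<omega> \<bullet> D t \<omega> = - (p t \<omega> \<bullet> (A t *v D t \<omega>) + (Q t *v Xs t \<omega>) \<bullet> D t \<omega> + bs t \<omega> \<bullet> (S t *v D t \<omega>) + (Qtil t *v m t) \<bullet> D t \<omega> + q t \<bullet> D t \<omega>)"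
    using inner_transpose[of "A t" "D t \<omega>" "p t \<omega>"] inner_transpose[of "S t" "D t \<omega>" "bs t \<omega>"]
    by (simp only: inner_add_left inner_minus_left inner_commute[of "p t \<omega>"] inner_commute[of "transpose (A t) *v p t \<omega>"]
        inner_commute[of "bs t \<omega>"] inner_commute[of "transpose (S t) *v bs t \<omega>"])
  show ?case using 1 2 by (simp add: z lin_def Dd_def Qs inner_add_right inner_commute[of "bs t \<omega>"])
qed

text \<open>Duality turns the first order running term into the expectation of
  \<open>p T \<bullet> D T\<close>, and \<open>p T = H Xs T + Htil m T\<close> is the gradient of
  the terminal cost with the flow averaged, so the two cancel. What remains is a nonnegative second
  order cost.\<close>

theorem optimal: "pay \<beta> \<le> pay bs"
proof -
  have TT: "T \<in> {0..T}" using T by simp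
  note int = lin_quad_integrable
  note XsT = is_state_sq(2)[OF Xs_state bs_H2(2) TT]
  note DT = sq_D(2)[OF TT]
  note \<mu>T = sq_\<mu>(2)[OF TT]
  have rs: "integrable LP (\<lambda>z. run (fst z) (Xs (fst z) (snd z)) (bs (fst z) (snd z)) (\<mu> (fst z) (snd z)))"
    by (rule run_integrable[OF sq_Xs sq_bs])
  have rb: "integrable LP (\<lambda>z. run (fst z) (Xb (fst z) (snd z)) (\<beta> (fst z) (snd z)) (\<mu> (fst z) (snd z)))"
    by (rule run_integrable[OF is_state_sq(1)[OF Xb \<beta>_F] H2_sq_process[OF \<beta>_F]])
  have "(\<integral>z. run (fst z) (Xb (fst z) (snd z)) (\<beta> (fst z) (snd z)) (\<mu> (fst z) (snd z)) \<partial>LP) =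
    (\<integral>z. run (fst z) (Xs (fst z) (snd z)) (bs (fst z) (snd z)) (\<mu> (fst z) (snd z))
    - lin (fst z) (snd z) - (Qtil (fst z) *v D (fst z) (snd z)) \<bullet> \<mu> (fst z) (snd z) - quad (fst z) (snd z) \<partial>LP)"
    using rb rs int run_expansion by (intro integral_cong_AE) auto
  also have "\<dots> = (\<integral>z. run (fst z) (Xs (fst z) (snd z)) (bs (fst z) (snd z)) (\<mu> (fst z) (snd z)) \<partial>LP)
    - (\<integral>z. lin (fst z) (snd z) \<partial>LP) - (\<integral>z. (Qtil (fst z) *v D (fst z) (snd z)) \<bullet> \<mu> (fst z) (snd z) \<partial>LP) - (\<integral>z. quad (fst z) (snd z) \<partial>LP)"
    using rs int by simp
  \<comment> \<open>The integral is taken over scenarios before times, since \<open>\<mu>\<close>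
    may be replaced by \<open>m\<close> only under the expectation at a fixed time.\<close>
  also have "(\<integral>z. (Qtil (fst z) *v D (fst z) (snd z)) \<bullet> \<mu> (fst z) (snd z) \<partial>LP) = (\<integral>z. (Qtil (fst z) *v D (fst z) (snd z)) \<bullet> m (fst z) \<partial>LP)"
    unfolding integral_LP_eq(2)[of "\<lambda>t \<omega>. (Qtil t *v D t \<omega>) \<bullet> \<mu> t \<omega>", OF int(3), symmetric]
      integral_LP_eq(2)[of "\<lambda>t \<omega>. (Qtil t *v D t \<omega>) \<bullet> m t", OF int(4), symmetric]
    by (intro Bochner_Integration.integral_cong refl D_\<mu>_inner) simp
  finally have run_eq: "(\<integral>z. run (fst z) (Xb (fst z) (snd z)) (\<beta> (fst z) (snd z)) (\<mu> (fst z) (snd z)) \<partial>LP) =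
    (\<integral>z. run (fst z) (Xs (fst z) (snd z)) (bs (fst z) (snd z)) (\<mu> (fst z) (snd z)) \<partial>LP)
    - ((\<integral>z. lin (fst z) (snd z) \<partial>LP) + (\<integral>z. (Qtil (fst z) *v D (fst z) (snd z)) \<bullet> m (fst z) \<partial>LP)) - (\<integral>z. quad (fst z) (snd z) \<partial>LP)"
    by simp
  have hi: "integrable LP (\<lambda>z. hh (fst z) (snd z) \<bullet> D (fst z) (snd z) + p (fst z) (snd z) \<bullet> Dd (fst z) (snd z))"
    by (intro Bochner_Integration.integrable_add sq_process_inner sq_hh sq_D sq_p sq_Dd)
  have "(\<integral>z. lin (fst z) (snd z) \<partial>LP) + (\<integral>z. (Qtil (fst z) *v D (fst z) (snd z)) \<bullet> m (fst z) \<partial>LP) =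
    (\<integral>z. lin (fst z) (snd z) + (Qtil (fst z) *v D (fst z) (snd z)) \<bullet> m (fst z) \<partial>LP)"
    using int by simp
  also have "\<dots> = (\<integral>z. - (hh (fst z) (snd z) \<bullet> D (fst z) (snd z) + p (fst z) (snd z) \<bullet> Dd (fst z) (snd z)) \<partial>LP)"
  proof (rule integral_cong_AE[OF _ _ lin_adjoint])
    show "(\<lambda>z. lin (fst z) (snd z) + (Qtil (fst z) *v D (fst z) (snd z)) \<bullet> m (fst z)) \<in> borel_measurable LP"
      using int by (intro borel_measurable_add) auto
    show "(\<lambda>z. - (hh (fst z) (snd z) \<bullet> D (fst z) (snd z) + p (fst z) (snd z) \<bullet> Dd (fst z) (snd z))) \<in> borel_measurable LP"
      using hi by (intro borel_measurable_uminus) auto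
  qed
  also have "\<dots> = - expectation (\<lambda>\<omega>. p T \<omega> \<bullet> D T \<omega>)"
    by (simp only: adjoint_duality integral_minus)
  finally have lin_eq: "(\<integral>z. lin (fst z) (snd z) \<partial>LP) + (\<integral>z. (Qtil (fst z) *v D (fst z) (snd z)) \<bullet> m (fst z) \<partial>LP) =
    - expectation (\<lambda>\<omega>. p T \<omega> \<bullet> D T \<omega>)" .
  have quad0: "(\<integral>z. quad (fst z) (snd z) \<partial>LP) \<ge> 0"
    using AE_LP_fst[OF cost_nonneg] by (intro integral_nonneg_AE) (auto simp: quad_def elim!: eventually_mono)
  have H_sym: "transpose H = H" "transpose Htil = Htil" "\<And>x. 0 \<le> (H *v x) \<bullet> x" using H Htil by (auto simp: psd_def)
  have fin_exp: "fin (Xb T \<omega>) (\<mu> T \<omega>) = fin (Xs T \<omega>) (\<mu> T \<omega>) - (H *v Xs T \<omega>) \<bullet> D T \<omega> - (Htil *v D T \<omega>) \<bullet> \<mu> T \<omega>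
      - 1/2 * ((H *v D T \<omega>) \<bullet> D T \<omega>)" for \<omega>
  proof -
    have x: "Xb T \<omega> = Xs T \<omega> + D T \<omega>" by (simp add: D_def)
    have Hs: "(H *v D T \<omega>) \<bullet> Xs T \<omega> = (H *v Xs T \<omega>) \<bullet> D T \<omega>"
      using inner_transpose[of H "D T \<omega>" "Xs T \<omega>"] H_sym by (simp add: inner_commute)
    show ?thesis by (simp add: fin_def x matrix_vector_right_distrib inner_add_left inner_add_right Hs algebra_simps)
  qed
  have i: "integrable P (\<lambda>\<omega>. fin (Xs T \<omega>) (\<mu> T \<omega>))" "integrable P (\<lambda>\<omega>. (H *v Xs T \<omega>) \<bullet> D T \<omega>)"
    "integrable P (\<lambda>\<omega>. (Htil *v D T \<omega>) \<bullet> \<mu> T \<omega>)" "integrable P (\<lambda>\<omega>. (H *v D T \<omega>) \<bullet> D T \<omega>)"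
    "integrable P (\<lambda>\<omega>. (Htil *v D T \<omega>) \<bullet> m T)"
    by (intro fin_integrable XsT sq_integrable_imp_inner sq_integrable_matrix DT \<mu>T sq_integrable_const finite_measure_axioms)+
  have "expectation (\<lambda>\<omega>. fin (Xb T \<omega>) (\<mu> T \<omega>)) = expectation (\<lambda>\<omega>. fin (Xs T \<omega>) (\<mu> T \<omega>)) -
    expectation (\<lambda>\<omega>. (H *v Xs T \<omega>) \<bullet> D T \<omega>) - expectation (\<lambda>\<omega>. (Htil *v D T \<omega>) \<bullet> m T)
    - 1/2 * expectation (\<lambda>\<omega>. (H *v D T \<omega>) \<bullet> D T \<omega>)"
    unfolding fin_exp D_\<mu>_inner[OF TT, symmetric] using i by simp
  moreover have "expectation (\<lambda>\<omega>. p T \<omega> \<bullet> D T \<omega>) = expectation (\<lambda>\<omega>. (H *v Xs T \<omega>) \<bullet> D T \<omega>) + expectation (\<lambda>\<omega>. (Htil *v D T \<omega>) \<bullet> m T)"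
  proof -
    have "p T \<omega> \<bullet> D T \<omega> = (H *v Xs T \<omega>) \<bullet> D T \<omega> + (Htil *v D T \<omega>) \<bullet> m T" for \<omega>
      using inner_transpose[of Htil "D T \<omega>" "m T"] H_sym
      by (simp add: p_def phi_ode(2) eta_ode(2) inner_add_left inner_commute[of "Htil *v m T"])
    then show ?thesis using i by simp
  qed
  moreover have "expectation (\<lambda>\<omega>. (H *v D T \<omega>) \<bullet> D T \<omega>) \<ge> 0"
    by (intro integral_nonneg_AE AE_I2 H_sym)
  ultimately show ?thesis
    using run_eq lin_eq quad0 unfolding payoff_eq[OF Xb \<beta>_F] payoff_eq[OF Xs_state bs_H2(2)] by linarith
qed

end

section \<open>Comparison of the payoffs\<close>

context noise
begin

text \<open>Quantifying over matrices makes every coupling term of the payoff a direct instance and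
  lets linear maps of \<open>U\<close> pass. Means are not subtracted, because \<open>Y\<close> is
  centred wherever this is applied.\<close>

definition uncorrelated :: "('w \<Rightarrow> real^'m) \<Rightarrow> ('w \<Rightarrow> real^'n) \<Rightarrow> bool" where
  "uncorrelated U Y \<longleftrightarrow> (\<forall>C. expectation (\<lambda>\<omega>. (C *v Y \<omega>) \<bullet> U \<omega>) = 0)"

lemma uncorrelatedI:
  fixes U :: "'w \<Rightarrow> real^'m" and Y :: "'w \<Rightarrow> real^'n"
  shows "sq_integrable P U \<Longrightarrow> sq_integrable P Y \<Longrightarrow> (\<And>i. expectation (\<lambda>\<omega>. U \<omega> $ i *\<^sub>R Y \<omega>) = 0) \<Longrightarrow> uncorrelated U Y"
  unfolding uncorrelated_def by (intro allI uncorrelated_inner)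

lemma uncorrelated_const:
  fixes Y :: "'w \<Rightarrow> real^'n" and u :: "real^'m"
  shows "sq_integrable P Y \<Longrightarrow> expectation Y = 0 \<Longrightarrow> uncorrelated (\<lambda>\<omega>. u) Y"
  by (rule uncorrelatedI[OF sq_integrable_const[OF finite_measure_axioms]]) simp_all

lemma uncorrelated_matrix:
  fixes Y :: "'w \<Rightarrow> real^'n" and U :: "'w \<Rightarrow> real^'m" and M :: "real^'m^'l"
  assumes "uncorrelated U Y"
  shows "uncorrelated (\<lambda>\<omega>. M *v U \<omega>) Y"
proof -
  have "(C *v Y \<omega>) \<bullet> (M *v U \<omega>) = ((transpose M ** C) *v Y \<omega>) \<bullet> U \<omega>" for C \<omega>
    using inner_transpose[of M "U \<omega>" "C *v Y \<omega>"] by (simp add: inner_commute matrix_vector_mul_assoc)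
  then show ?thesis using assms by (simp add: uncorrelated_def)
qed

lemma uncorrelated_add:
  fixes Y :: "'w \<Rightarrow> real^'n" and U V :: "'w \<Rightarrow> real^'m"
  assumes "uncorrelated U Y" "uncorrelated V Y" "sq_integrable P U" "sq_integrable P V" "sq_integrable P Y"
  shows "uncorrelated (\<lambda>\<omega>. U \<omega> + V \<omega>) Y"
  using assms sq_integrable_imp_inner[OF sq_integrable_matrix[OF assms(5)] assms(3)]
    sq_integrable_imp_inner[OF sq_integrable_matrix[OF assms(5)] assms(4)]
  by (simp add: uncorrelated_def inner_add_right)

lemma expectation_inner_const:
  fixes Y :: "'w \<Rightarrow> real^'n" and M :: "real^'n^'m"
  assumes "sq_integrable P Y"
  shows "expectation (\<lambda>\<omega>. (M *v Y \<omega>) \<bullet> v) = (M *v expectation Y) \<bullet> v"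
    "expectation (\<lambda>\<omega>. w \<bullet> Y \<omega>) = w \<bullet> expectation Y"
  using integral_bounded_linear[OF bounded_linear_inner_left sq_integrable_imp_integrable[OF finite_measure_axioms sq_integrable_matrix[OF assms]], of M v]
    integral_bounded_linear[OF bounded_linear_inner_right sq_integrable_imp_integrable[OF finite_measure_axioms assms], of w]
  by (simp_all add: expectation_matrix[OF assms])

text \<open>The two mixed terms merge into one with the matrix \<open>C + transpose C\<close>; this
  form also covers coefficients that are not symmetric, as \<open>cM\<close> may be.\<close>

lemma expectation_quadratic_shift:
  fixes Y Z :: "'w \<Rightarrow> real^'n" and C :: "real^'n^'n"
  assumes Y: "sq_integrable P Y" and Z: "sq_integrable P Z" and 0: "uncorrelated Y Z"
  shows "expectation (\<lambda>\<omega>. (C *v (Y \<omega> + Z \<omega>)) \<bullet> (Y \<omega> + Z \<omega>)) =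
    expectation (\<lambda>\<omega>. (C *v Y \<omega>) \<bullet> Y \<omega>) + expectation (\<lambda>\<omega>. (C *v Z \<omega>) \<bullet> Z \<omega>)"
proof -
  have i: "integrable P (\<lambda>\<omega>. (C *v Y \<omega>) \<bullet> Y \<omega>)" "integrable P (\<lambda>\<omega>. (C *v Z \<omega>) \<bullet> Z \<omega>)"
    "integrable P (\<lambda>\<omega>. ((C + transpose C) *v Z \<omega>) \<bullet> Y \<omega>)"
    by (intro sq_integrable_imp_inner sq_integrable_matrix Y Z)+
  have "(C *v (Y \<omega> + Z \<omega>)) \<bullet> (Y \<omega> + Z \<omega>) = (C *v Y \<omega>) \<bullet> Y \<omega> + (C *v Z \<omega>) \<bullet> Z \<omega> + ((C + transpose C) *v Z \<omega>) \<bullet> Y \<omega>" for \<omega>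
    using inner_transpose[of C "Y \<omega>" "Z \<omega>"]
    by (simp add: matrix_vector_right_distrib matrix_vector_mult_add_rdistrib inner_add_left inner_add_right
        inner_commute[of "Y \<omega>" "transpose C *v Z \<omega>"])
  then show ?thesis using i 0 by (simp add: uncorrelated_def)
qed

text \<open>\<open>Y\<close> is its constant mean shifted by a centred variable, which is
  uncorrelated with every constant.\<close>

lemma expectation_quadratic_centered:
  fixes Y :: "'w \<Rightarrow> real^'n" and C :: "real^'n^'n"
  assumes Y: "sq_integrable P Y"
  shows "expectation (\<lambda>\<omega>. (C *v (Y \<omega> - expectation Y)) \<bullet> (Y \<omega> - expectation Y)) =
    expectation (\<lambda>\<omega>. (C *v Y \<omega>) \<bullet> Y \<omega>) - (C *v expectation Y) \<bullet> expectation Y"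
proof -
  let ?e = "expectation Y"
  have c: "sq_integrable P (\<lambda>\<omega>. Y \<omega> - ?e)" by (intro sq_integrable_diff Y sq_integrable_const finite_measure_axioms)
  have "expectation (\<lambda>\<omega>. Y \<omega> - ?e) = 0"
    using sq_integrable_imp_integrable[OF finite_measure_axioms Y] prob_space by simp
  from expectation_quadratic_shift[OF sq_integrable_const[OF finite_measure_axioms] c uncorrelated_const[OF c this], of C ?e]
  show ?thesis using prob_space by simp
qed

end

context lq_flow
begin

definition cM :: "real \<Rightarrow> real^'d^'d" where
  "cM t = Q t + transpose (\<Phi> t) ** R t ** \<Phi> t - 2 *\<^sub>R (transpose (\<Phi> t) ** S t)"

definition cN :: "real \<Rightarrow> real^'d^'d" where
  "cN t = Qtil t + transpose (\<Psi> t) ** R t ** \<Phi> t - transpose (\<Psi> t) ** S t"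

definition cG :: "real \<Rightarrow> real^'d^'d" where
  "cG t = transpose (\<Psi> t) ** R t ** \<Psi> t"

lemma Linf_cost: "Linf T cM" "Linf T cN" "Linf T cG"
  unfolding cM_def[abs_def] cN_def[abs_def] cG_def[abs_def]
  by (intro Linf_matrix_intros Q Qtil R_Linf S Linf_feedback)+

text \<open>Running cost of the control \<open>- \<Phi> x - u\<close>, without the terms in
  \<open>y\<close> alone. Both \<open>lam\<close> and \<open>bs\<close> are of this form, with
  \<open>u\<close> the part of the control that does not involve the state.\<close>

definition cost :: "real \<Rightarrow> real^'d \<Rightarrow> real^'k \<Rightarrow> real^'d \<Rightarrow> real" where
  "cost t x u y = 1/2 * ((cM t *v x) \<bullet> x) + (Qtil t *v x) \<bullet> y + (q t - transpose (\<Phi> t) *v r t) \<bullet> x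
    + ((transpose (B t) ** \<phi> t) *v x) \<bullet> u + 1/2 * ((R t *v u) \<bullet> u) - r t \<bullet> u"

text \<open>Since \<open>R \<Phi> = B^T \<phi> + S\<close>, the mixed terms in \<open>x\<close> and
  \<open>u\<close> that come from \<open>R\<close> and from \<open>S\<close> combine to
  \<open>B^T \<phi>\<close>.\<close>

lemma run_cost:
  assumes t: "t \<in> {0..T}"
  shows "run t x (- (\<Phi> t *v x) - u) y = L t \<bullet> y - 1/2 * ((Qbar t *v y) \<bullet> y) - cost t x u y"
proof -
  have 1: "(cM t *v x) \<bullet> x = (Q t *v x) \<bullet> x + (R t *v (\<Phi> t *v x)) \<bullet> (\<Phi> t *v x) - 2 * ((S t *v x) \<bullet> (\<Phi> t *v x))"
    using inner_transpose[of "\<Phi> t" x "R t *v (\<Phi> t *v x)"] inner_transpose[of "\<Phi> t" x "S t *v x"]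
    by (simp add: cM_def matrix_vector_mult_diff_rdistrib matrix_vector_mult_add_rdistrib scaleR_matrix_vector_assoc[symmetric]
        matrix_vector_mul_assoc[symmetric] inner_add_right inner_diff_right inner_commute)
  have 2: "(transpose (\<Phi> t) *v r t) \<bullet> x = r t \<bullet> (\<Phi> t *v x)"
    using inner_transpose[of "\<Phi> t" x "r t"] by (simp add: inner_commute)
  have 3: "((transpose (B t) ** \<phi> t) *v x) \<bullet> u = (R t *v (\<Phi> t *v x)) \<bullet> u - (S t *v x) \<bullet> u"
    by (simp add: R_feedback[OF t] matrix_vector_mul_assoc[symmetric] inner_add_left)
  have 4: "(R t *v u) \<bullet> (\<Phi> t *v x) = (R t *v (\<Phi> t *v x)) \<bullet> u"
    using R_feedback(5)[OF t, of u "\<Phi> t *v x"] by (simp add: inner_commute)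
  show ?thesis
    unfolding run_def cost_def inner_diff_left[of "q t"] 1 2 3
    by (simp add: matrix_vector_mult_diff_distrib matrix_vector_mult_minus_right inner_diff_left inner_diff_right 4 algebra_simps)
qed

lemma cost_integrable:
  assumes "sq_integrable P x" "sq_integrable P u" "sq_integrable P y"
  shows "integrable P (\<lambda>\<omega>. cost t (x \<omega>) (u \<omega>) (y \<omega>))"
  unfolding cost_def
  by (intro Bochner_Integration.integrable_add Bochner_Integration.integrable_diff integrable_mult_right
      sq_integrable_imp_inner sq_integrable_matrix assms sq_integrable_const finite_measure_axioms)

lemma expectation_cost:
  assumes x: "sq_integrable P x" and u: "sq_integrable P u" and y: "sq_integrable P y"
  shows "expectation (\<lambda>\<omega>. cost t (x \<omega>) (u \<omega>) (y \<omega>)) =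
    1/2 * expectation (\<lambda>\<omega>. (cM t *v x \<omega>) \<bullet> x \<omega>) + expectation (\<lambda>\<omega>. (Qtil t *v x \<omega>) \<bullet> y \<omega>)
    + (q t - transpose (\<Phi> t) *v r t) \<bullet> expectation x + expectation (\<lambda>\<omega>. ((transpose (B t) ** \<phi> t) *v x \<omega>) \<bullet> u \<omega>)
    + 1/2 * expectation (\<lambda>\<omega>. (R t *v u \<omega>) \<bullet> u \<omega>) - r t \<bullet> expectation u"
proof -
  have i: "integrable P (\<lambda>\<omega>. (cM t *v x \<omega>) \<bullet> x \<omega>)" "integrable P (\<lambda>\<omega>. (Qtil t *v x \<omega>) \<bullet> y \<omega>)"
    "integrable P (\<lambda>\<omega>. ((transpose (B t) ** \<phi> t) *v x \<omega>) \<bullet> u \<omega>)" "integrable P (\<lambda>\<omega>. (R t *v u \<omega>) \<bullet> u \<omega>)"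
    "integrable P (\<lambda>\<omega>. (q t - transpose (\<Phi> t) *v r t) \<bullet> x \<omega>)" "integrable P (\<lambda>\<omega>. r t \<bullet> u \<omega>)"
    by (intro sq_integrable_imp_inner sq_integrable_matrix x u y sq_integrable_const finite_measure_axioms)+
  show ?thesis
    unfolding cost_def expectation_inner_const(2)[OF x, symmetric] expectation_inner_const(2)[OF u, symmetric]
    using i by simp
qed

text \<open>The extra terms depend on \<open>z\<close> and \<open>y\<close> but not on
  \<open>x\<close> or \<open>u\<close>. They are therefore the same for both controls and leave the
  difference of the payoffs.\<close>

lemma expectation_cost_shift:
  assumes x: "sq_integrable P x" and u: "sq_integrable P u" and y: "sq_integrable P y" and z: "sq_integrable P z"
    and 0: "uncorrelated x z" "uncorrelated u z" "expectation z = 0"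
  shows "expectation (\<lambda>\<omega>. cost t (x \<omega> + z \<omega>) (u \<omega>) (y \<omega>)) =
    expectation (\<lambda>\<omega>. cost t (x \<omega>) (u \<omega>) (y \<omega>)) + 1/2 * expectation (\<lambda>\<omega>. (cM t *v z \<omega>) \<bullet> z \<omega>) + expectation (\<lambda>\<omega>. (Qtil t *v z \<omega>) \<bullet> y \<omega>)"
proof -
  have i: "integrable P (\<lambda>\<omega>. (Qtil t *v x \<omega>) \<bullet> y \<omega>)" "integrable P (\<lambda>\<omega>. (Qtil t *v z \<omega>) \<bullet> y \<omega>)"
    "integrable P (\<lambda>\<omega>. ((transpose (B t) ** \<phi> t) *v x \<omega>) \<bullet> u \<omega>)" "integrable P (\<lambda>\<omega>. ((transpose (B t) ** \<phi> t) *v z \<omega>) \<bullet> u \<omega>)"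
    by (intro sq_integrable_imp_inner sq_integrable_matrix x u y z)+
  have "expectation (\<lambda>\<omega>. (Qtil t *v (x \<omega> + z \<omega>)) \<bullet> y \<omega>) = expectation (\<lambda>\<omega>. (Qtil t *v x \<omega>) \<bullet> y \<omega>) + expectation (\<lambda>\<omega>. (Qtil t *v z \<omega>) \<bullet> y \<omega>)"
    "expectation (\<lambda>\<omega>. ((transpose (B t) ** \<phi> t) *v (x \<omega> + z \<omega>)) \<bullet> u \<omega>) = expectation (\<lambda>\<omega>. ((transpose (B t) ** \<phi> t) *v x \<omega>) \<bullet> u \<omega>)"
    "expectation (\<lambda>\<omega>. x \<omega> + z \<omega>) = expectation x"
    using i 0 sq_integrable_imp_integrable[OF finite_measure_axioms x] sq_integrable_imp_integrable[OF finite_measure_axioms z]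
    by (simp_all add: matrix_vector_right_distrib inner_add_left uncorrelated_def)
  then show ?thesis
    unfolding expectation_cost[OF sq_integrable_add[OF x z] u y] expectation_cost[OF x u y] expectation_quadratic_shift[OF x z 0(1)]
    by simp
qed

lemma cN_inner:
  assumes t: "t \<in> {0..T}"
  shows "(cN t *v x) \<bullet> y = (Qtil t *v x) \<bullet> y + ((transpose (B t) ** \<phi> t) *v x) \<bullet> (\<Psi> t *v y)"
    "(cG t *v x) \<bullet> y = (R t *v (\<Psi> t *v x)) \<bullet> (\<Psi> t *v y)"
proof -
  have "(cN t *v x) \<bullet> y = (Qtil t *v x) \<bullet> y + (R t *v (\<Phi> t *v x)) \<bullet> (\<Psi> t *v y) - (S t *v x) \<bullet> (\<Psi> t *v y)"
    using inner_transpose[of "\<Psi> t" y "R t *v (\<Phi> t *v x)"] inner_transpose[of "\<Psi> t" y "S t *v x"]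
    by (simp add: cN_def matrix_vector_mult_diff_rdistrib matrix_vector_mult_add_rdistrib
        matrix_vector_mul_assoc[symmetric] inner_add_right inner_diff_right inner_commute)
  then show "(cN t *v x) \<bullet> y = (Qtil t *v x) \<bullet> y + ((transpose (B t) ** \<phi> t) *v x) \<bullet> (\<Psi> t *v y)"
    by (simp add: R_feedback[OF t] matrix_vector_mul_assoc[symmetric] inner_add_left)
  show "(cG t *v x) \<bullet> y = (R t *v (\<Psi> t *v x)) \<bullet> (\<Psi> t *v y)"
    using inner_transpose[of "\<Psi> t" y "R t *v (\<Psi> t *v x)"]
    by (simp add: cG_def matrix_vector_mul_assoc[symmetric] inner_commute)
qed

text \<open>Pairing \<open>B^T \<phi> y\<close> with \<open>\<Psi> y\<close> completes
  \<open>Qtil\<close> to \<open>cN\<close>. Pairing it with \<open>Ri e\<close>, together with the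
  mixed term of the control cost, where \<open>R \<Psi> = B^T \<psi>\<close>, produces
  \<open>B^T (\<phi> + \<psi>)\<close>.\<close>

lemma cost_own:
  assumes t: "t \<in> {0..T}"
  shows "cost t y (\<Psi> t *v y + Ri t *v e) y = 1/2 * ((cM t *v y) \<bullet> y) + (cN t *v y) \<bullet> y + 1/2 * ((cG t *v y) \<bullet> y)
    + ((transpose (B t) ** (\<phi> t + \<psi> t)) *v y) \<bullet> (Ri t *v e) + 1/2 * ((Ri t *v e) \<bullet> e)
    + (q t - transpose (\<Phi> t) *v r t) \<bullet> y - r t \<bullet> (\<Psi> t *v y) - r t \<bullet> (Ri t *v e)"
proof -
  have 1: "(R t *v (\<Psi> t *v y)) \<bullet> (Ri t *v e) = (transpose (B t) *v (\<psi> t *v y)) \<bullet> (Ri t *v e)"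
    by (simp add: R_feedback[OF t])
  have 2: "e \<bullet> (\<Psi> t *v y) = (R t *v (\<Psi> t *v y)) \<bullet> (Ri t *v e)"
    using R_feedback(4,5)[OF t, of e] R_feedback(5)[OF t, of "\<Psi> t *v y" "Ri t *v e"] by (simp add: inner_commute)
  show ?thesis
    unfolding cost_def cN_inner[OF t]
    by (simp add: matrix_vector_right_distrib matrix_add_ldistrib matrix_vector_mult_add_rdistrib inner_add_left inner_add_right
        R_feedback(4)[OF t] 2 1 matrix_vector_mul_assoc[symmetric] inner_commute[of e "Ri t *v e"])
qed

text \<open>The counterpart for \<open>u = \<Psi> m + \<Theta>\<close>. Here the state
  \<open>x\<close> and the flow argument differ, so the \<open>\<phi>\<close> part and the
  \<open>\<psi>\<close> part of the pairing with \<open>\<Theta>\<close> stay separate.\<close>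

lemma cost_deviation:
  assumes t: "t \<in> {0..T}"
  shows "cost t x (c t) (m t) = 1/2 * ((cM t *v x) \<bullet> x) + (cN t *v x) \<bullet> m t + ((transpose (B t) ** \<phi> t) *v x) \<bullet> \<Theta> t
    + 1/2 * ((cG t *v m t) \<bullet> m t) + ((transpose (B t) ** \<psi> t) *v m t) \<bullet> \<Theta> t + 1/2 * ((R t *v \<Theta> t) \<bullet> \<Theta> t)
    + (q t - transpose (\<Phi> t) *v r t) \<bullet> x - r t \<bullet> (\<Psi> t *v m t) - r t \<bullet> \<Theta> t"
proof -
  have 1: "(R t *v (\<Psi> t *v m t)) \<bullet> \<Theta> t = (transpose (B t) *v (\<psi> t *v m t)) \<bullet> \<Theta> t"
    by (simp add: R_feedback[OF t])
  have 2: "(R t *v \<Theta> t) \<bullet> (\<Psi> t *v m t) = (R t *v (\<Psi> t *v m t)) \<bullet> \<Theta> t"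
    using R_feedback(5)[OF t, of "\<Theta> t" "\<Psi> t *v m t"] by (simp add: inner_commute)
  show ?thesis
    unfolding cost_def cN_inner[OF t] c_def
    by (simp only: matrix_vector_right_distrib inner_add_left inner_add_right 2 1 matrix_vector_mul_assoc[symmetric])
      (simp add: algebra_simps)
qed

definition lhs :: "real \<Rightarrow> real" where
  "lhs t = expectation (\<lambda>\<omega>. (cN t *v (\<mu> t \<omega> - m t)) \<bullet> (\<mu> t \<omega> - m t))
    + 1/2 * (expectation (\<lambda>\<omega>. (cG t *v \<mu> t \<omega>) \<bullet> \<mu> t \<omega>) - (cG t *v m t) \<bullet> m t)
    + 1/2 * expectation (\<lambda>\<omega>. (Ri t *v \<delta> t \<omega>) \<bullet> \<delta> t \<omega>) - 1/2 * ((R t *v \<Theta> t) \<bullet> \<Theta> t)"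

text \<open>The integrand of the right-hand side after \<open>\<mu> + f\<close> and the mean of
  \<open>f\<close> have been expressed through the deterministic \<open>xh\<close>.\<close>

definition rhs :: "real \<Rightarrow> real" where
  "rhs t = 1/2 * ((cM t *v xh t) \<bullet> xh t - expectation (\<lambda>\<omega>. (cM t *v \<mu> t \<omega>) \<bullet> \<mu> t \<omega>))
    + (cN t *v (xh t - m t)) \<bullet> m t + (q t - transpose (\<Phi> t) *v r t) \<bullet> (xh t - m t)
    + ((transpose (B t) ** (\<phi> t + \<psi> t)) *v m t) \<bullet> \<Theta> t
    - expectation (\<lambda>\<omega>. ((transpose (B t) ** (\<phi> t + \<psi> t)) *v \<mu> t \<omega>) \<bullet> (Ri t *v \<delta> t \<omega>))
    + ((transpose (B t) ** \<phi> t) *v (xh t - m t)) \<bullet> \<Theta> t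
    - expectation (\<lambda>\<omega>. r t \<bullet> (\<Theta> t - Ri t *v \<delta> t \<omega>))"

lemma expectation_cost_difference:
  assumes t: "t \<in> {0..T}" and \<delta>t: "sq_integrable P (\<delta> t)"
  shows "expectation (\<lambda>\<omega>. cost t (xh t) (c t) (\<mu> t \<omega>)) -
    expectation (\<lambda>\<omega>. cost t (\<mu> t \<omega>) (\<Psi> t *v \<mu> t \<omega> + Ri t *v \<delta> t \<omega>) (\<mu> t \<omega>)) = rhs t - lhs t"
proof -
  note \<mu>t = sq_\<mu>(2)[OF t]
  have E\<mu>: "expectation (\<mu> t) = m t" by (simp add: m_def)
  \<comment> \<open>For deterministic state and control the cost is affine in the flow argument, so
    averaging just replaces \<open>\<mu> t\<close> by \<open>m t\<close>.\<close>
  have "expectation (\<lambda>\<omega>. cost t (xh t) (c t) (\<mu> t \<omega>)) = cost t (xh t) (c t) (m t)"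
    unfolding expectation_cost[OF sq_integrable_const[OF finite_measure_axioms] sq_integrable_const[OF finite_measure_axioms] \<mu>t]
      expectation_inner_const(2)[OF \<mu>t]
    using prob_space by (simp add: cost_def E\<mu>)
  moreover
  have i: "integrable P (\<lambda>\<omega>. (cM t *v \<mu> t \<omega>) \<bullet> \<mu> t \<omega>)" "integrable P (\<lambda>\<omega>. (cN t *v \<mu> t \<omega>) \<bullet> \<mu> t \<omega>)"
    "integrable P (\<lambda>\<omega>. (cG t *v \<mu> t \<omega>) \<bullet> \<mu> t \<omega>)" "integrable P (\<lambda>\<omega>. (Ri t *v \<delta> t \<omega>) \<bullet> \<delta> t \<omega>)"
    "integrable P (\<lambda>\<omega>. ((transpose (B t) ** (\<phi> t + \<psi> t)) *v \<mu> t \<omega>) \<bullet> (Ri t *v \<delta> t \<omega>))"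
    "integrable P (\<lambda>\<omega>. (q t - transpose (\<Phi> t) *v r t) \<bullet> \<mu> t \<omega>)" "integrable P (\<lambda>\<omega>. r t \<bullet> (\<Psi> t *v \<mu> t \<omega>))"
    "integrable P (\<lambda>\<omega>. r t \<bullet> (Ri t *v \<delta> t \<omega>))"
    by (intro sq_integrable_imp_inner sq_integrable_matrix \<mu>t \<delta>t sq_integrable_const finite_measure_axioms)+
  have r: "expectation (\<lambda>\<omega>. r t \<bullet> (\<Psi> t *v \<mu> t \<omega>)) = r t \<bullet> (\<Psi> t *v m t)"
    unfolding expectation_inner_const(2)[OF sq_integrable_matrix[OF \<mu>t]] expectation_matrix[OF \<mu>t] E\<mu> ..
  have "expectation (\<lambda>\<omega>. cost t (\<mu> t \<omega>) (\<Psi> t *v \<mu> t \<omega> + Ri t *v \<delta> t \<omega>) (\<mu> t \<omega>)) =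
    1/2 * expectation (\<lambda>\<omega>. (cM t *v \<mu> t \<omega>) \<bullet> \<mu> t \<omega>) + expectation (\<lambda>\<omega>. (cN t *v \<mu> t \<omega>) \<bullet> \<mu> t \<omega>)
    + 1/2 * expectation (\<lambda>\<omega>. (cG t *v \<mu> t \<omega>) \<bullet> \<mu> t \<omega>)
    + expectation (\<lambda>\<omega>. ((transpose (B t) ** (\<phi> t + \<psi> t)) *v \<mu> t \<omega>) \<bullet> (Ri t *v \<delta> t \<omega>))
    + 1/2 * expectation (\<lambda>\<omega>. (Ri t *v \<delta> t \<omega>) \<bullet> \<delta> t \<omega>)
    + (q t - transpose (\<Phi> t) *v r t) \<bullet> m t - r t \<bullet> (\<Psi> t *v m t) - expectation (\<lambda>\<omega>. r t \<bullet> (Ri t *v \<delta> t \<omega>))"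
    unfolding cost_own[OF t] using i r expectation_inner_const(2)[OF \<mu>t, of "q t - transpose (\<Phi> t) *v r t"] by (simp add: E\<mu>)
  moreover have "expectation (\<lambda>\<omega>. r t \<bullet> (\<Theta> t - Ri t *v \<delta> t \<omega>)) = r t \<bullet> \<Theta> t - expectation (\<lambda>\<omega>. r t \<bullet> (Ri t *v \<delta> t \<omega>))"
    using i(8) prob_space by (simp add: inner_diff_right)
  ultimately show ?thesis
    unfolding lhs_def rhs_def cost_deviation[OF t] expectation_quadratic_centered[OF \<mu>t, unfolded E\<mu>]
    by (simp add: matrix_vector_mult_diff_distrib matrix_add_ldistrib matrix_vector_mult_add_rdistrib inner_diff_left inner_diff_right
        inner_add_left algebra_simps)
qed

text \<open>At a fixed time both payoffs are a common function of \<open>\<mu>\<close> minus a cost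
  whose state argument is shifted by \<open>Z t\<close>; the shift contributes equally to both. The
  feedback identities restrict this to almost every time.\<close>

lemma expectation_run_difference:
  "AE t in lebesgue_on {0..T}. expectation (\<lambda>\<omega>. run t (X t \<omega>) (lam t \<omega>) (\<mu> t \<omega>)) -
    expectation (\<lambda>\<omega>. run t (Xs t \<omega>) (bs t \<omega>) (\<mu> t \<omega>)) = rhs t - lhs t"
  using LP.AE_pair[OF lam_feedback] LP.AE_pair[OF bs_eq] sq_process_section_time[OF sq_\<delta>] Z_\<delta>
    sq_process_section_time[OF H2_sq_process[OF lam_H2]] sq_process_section_time[OF sq_bs] AE_space
proof eventually_elim
  case (elim t)
  then have t: "t \<in> {0..T}" by simp
  note \<mu>t = sq_\<mu>(2)[OF t] and \<delta>t = elim(3) and Zt = sq_Z(2)[OF t]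
  note const = sq_integrable_const[OF finite_measure_axioms]
  define u where "u \<omega> = \<Psi> t *v \<mu> t \<omega> + Ri t *v \<delta> t \<omega>" for \<omega>
  have u: "sq_integrable P u" unfolding u_def[abs_def] by (intro sq_integrable_add sq_integrable_matrix \<mu>t \<delta>t)
  have \<mu>Z: "uncorrelated (\<mu> t) (Z t)" by (intro uncorrelatedI \<mu>t Zt Z_\<mu> t)
  have \<delta>Z: "uncorrelated (\<delta> t) (Z t)" using elim(4) t by (intro uncorrelatedI \<delta>t Zt) simp
  have uZ: "uncorrelated u (Z t)"
    unfolding u_def[abs_def] by (intro uncorrelated_add uncorrelated_matrix \<mu>Z \<delta>Z sq_integrable_matrix \<mu>t \<delta>t Zt)
  define G where "G \<omega> = L t \<bullet> \<mu> t \<omega> - 1/2 * ((Qbar t *v \<mu> t \<omega>) \<bullet> \<mu> t \<omega>)" for \<omega>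
  have G: "integrable P G" unfolding G_def
    by (intro Bochner_Integration.integrable_diff integrable_mult_right sq_integrable_imp_inner sq_integrable_matrix \<mu>t const)
  have ri: "(\<lambda>\<omega>. run t (x \<omega>) (v \<omega>) (\<mu> t \<omega>)) \<in> borel_measurable P"
    if x: "sq_integrable P x" and v: "sq_integrable P v" for x v
    unfolding run_def
    by (intro borel_measurable_integrable Bochner_Integration.integrable_diff integrable_mult_right
        sq_integrable_imp_inner sq_integrable_matrix \<mu>t x v const)
  have 1: "expectation (\<lambda>\<omega>. run t (X t \<omega>) (lam t \<omega>) (\<mu> t \<omega>)) = expectation (\<lambda>\<omega>. G \<omega> - cost t (\<mu> t \<omega> + Z t \<omega>) (u \<omega>) (\<mu> t \<omega>))"
  proof (rule integral_cong_AE)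
    show "AE \<omega> in P. run t (X t \<omega>) (lam t \<omega>) (\<mu> t \<omega>) = G \<omega> - cost t (\<mu> t \<omega> + Z t \<omega>) (u \<omega>) (\<mu> t \<omega>)"
      using elim(1)
    proof eventually_elim
      case (elim \<omega>)
      have l: "lam t \<omega> = - (\<Phi> t *v X t \<omega>) - u \<omega>" using elim by (simp add: u_def)
      have x: "\<mu> t \<omega> + Z t \<omega> = X t \<omega>" by (simp add: Z_def)
      show ?case unfolding l x run_cost[OF t] G_def ..
    qed
    show "(\<lambda>\<omega>. run t (X t \<omega>) (lam t \<omega>) (\<mu> t \<omega>)) \<in> borel_measurable P" by (rule ri[OF sq_X(2)[OF t] elim(5)])
    show "(\<lambda>\<omega>. G \<omega> - cost t (\<mu> t \<omega> + Z t \<omega>) (u \<omega>) (\<mu> t \<omega>)) \<in> borel_measurable P"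
      by (intro borel_measurable_integrable Bochner_Integration.integrable_diff G cost_integrable sq_integrable_add \<mu>t Zt u)
  qed
  have 2: "expectation (\<lambda>\<omega>. run t (Xs t \<omega>) (bs t \<omega>) (\<mu> t \<omega>)) = expectation (\<lambda>\<omega>. G \<omega> - cost t (xh t + Z t \<omega>) (c t) (\<mu> t \<omega>))"
  proof (rule integral_cong_AE)
    show "AE \<omega> in P. run t (Xs t \<omega>) (bs t \<omega>) (\<mu> t \<omega>) = G \<omega> - cost t (xh t + Z t \<omega>) (c t) (\<mu> t \<omega>)"
      using elim(2) Xs_eq
    proof eventually_elim
      case (elim \<omega>)
      have l: "bs t \<omega> = - (\<Phi> t *v Xs t \<omega>) - c t" using elim(1) by simp
      have x: "xh t + Z t \<omega> = Xs t \<omega>" using elim(2) t by simp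
      show ?case unfolding l x run_cost[OF t] G_def ..
    qed
    show "(\<lambda>\<omega>. run t (Xs t \<omega>) (bs t \<omega>) (\<mu> t \<omega>)) \<in> borel_measurable P"
      by (rule ri[OF is_state_sq(2)[OF Xs_state bs_H2(2) t] elim(6)])
    show "(\<lambda>\<omega>. G \<omega> - cost t (xh t + Z t \<omega>) (c t) (\<mu> t \<omega>)) \<in> borel_measurable P"
      by (intro borel_measurable_integrable Bochner_Integration.integrable_diff G cost_integrable sq_integrable_add \<mu>t Zt const)
  qed
  have 3: "integrable P (\<lambda>\<omega>. cost t (\<mu> t \<omega> + Z t \<omega>) (u \<omega>) (\<mu> t \<omega>))" "integrable P (\<lambda>\<omega>. cost t (xh t + Z t \<omega>) (c t) (\<mu> t \<omega>))"
    by (intro cost_integrable sq_integrable_add \<mu>t Zt u const)+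
  note sh = expectation_cost_shift[OF \<mu>t u \<mu>t Zt \<mu>Z uZ Z_mean[OF t], of t]
    expectation_cost_shift[OF const const \<mu>t Zt uncorrelated_const[OF Zt Z_mean[OF t]] uncorrelated_const[OF Zt Z_mean[OF t]] Z_mean[OF t], of t "xh t" "c t"]
  show ?case
    unfolding 1 2 using expectation_cost_difference[OF t \<delta>t] G 3 sh by (simp add: u_def[abs_def])
qed

lemma lhs_integrable: "integrable (lebesgue_on {0..T}) lhs"
proof -
  have c: "sq_process (\<lambda>t \<omega>. \<mu> t \<omega> - m t)" by (intro sq_process_diff sq_\<mu> sq_process_coeff Linf_m)
  have "integrable LP (\<lambda>z. (cN (fst z) *v (\<mu> (fst z) (snd z) - m (fst z))) \<bullet> (\<mu> (fst z) (snd z) - m (fst z)))"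
    by (rule sq_process_inner[OF sq_process_matrix[OF c Linf_cost(2)] c])
  note 1 = integral_LP(2)[of "\<lambda>t \<omega>. (cN t *v (\<mu> t \<omega> - m t)) \<bullet> (\<mu> t \<omega> - m t)", OF this]
  note 2 = integral_LP(2)[of "\<lambda>t \<omega>. (cG t *v \<mu> t \<omega>) \<bullet> \<mu> t \<omega>", OF sq_process_inner[OF sq_process_matrix[OF sq_\<mu>(1) Linf_cost(3)] sq_\<mu>(1)]]
  note 3 = integral_LP(2)[of "\<lambda>t \<omega>. (Ri t *v \<delta> t \<omega>) \<bullet> \<delta> t \<omega>", OF sq_process_inner[OF sq_process_matrix[OF sq_\<delta> Ri(2)] sq_\<delta>]]
  show ?thesis unfolding lhs_def[abs_def]
    by (intro Bochner_Integration.integrable_add Bochner_Integration.integrable_diff integrable_mult_right 1 2 3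
        Linf_integrable Linf_bilinear[OF bounded_bilinear_inner] Linf_matrix_intros Linf_cost Linf_m R_Linf Linf_feedback)
qed

lemma rhs_integrable: "integrable (lebesgue_on {0..T}) rhs"
proof -
  have b: "Linf T (\<lambda>t. transpose (B t) ** (\<phi> t + \<psi> t))" by (intro Linf_matrix_intros B Linf_ode)
  have x: "Linf T xh" by (rule Linf_continuous[OF xh_continuous])
  have d: "sq_process (\<lambda>t \<omega>. Ri t *v \<delta> t \<omega>)" by (rule sq_process_matrix[OF sq_\<delta> Ri(2)])
  note 1 = integral_LP(2)[of "\<lambda>t \<omega>. (cM t *v \<mu> t \<omega>) \<bullet> \<mu> t \<omega>", OF sq_process_inner[OF sq_process_matrix[OF sq_\<mu>(1) Linf_cost(1)] sq_\<mu>(1)]]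
  note 2 = integral_LP(2)[of "\<lambda>t \<omega>. ((transpose (B t) ** (\<phi> t + \<psi> t)) *v \<mu> t \<omega>) \<bullet> (Ri t *v \<delta> t \<omega>)",
      OF sq_process_inner[OF sq_process_matrix[OF sq_\<mu>(1) b] d]]
  note 3 = integral_LP(2)[of "\<lambda>t \<omega>. r t \<bullet> (\<Theta> t - Ri t *v \<delta> t \<omega>)",
      OF sq_process_inner[OF sq_process_coeff[OF r] sq_process_diff[OF sq_process_coeff[OF Linf_feedback(3)] d]]]
  show ?thesis unfolding rhs_def[abs_def]
    by (intro Bochner_Integration.integrable_add Bochner_Integration.integrable_diff integrable_mult_right 1 2 3
        Linf_integrable Linf_bilinear[OF bounded_bilinear_inner] Linf_matrix_intros Linf_cost Linf_m R_Linf Linf_feedback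
        b x B Linf_ode q r)
qed

lemma payoff_difference:
  "pay lam - pay bs =
    (\<integral>t. rhs t \<partial>lebesgue_on {0..T}) - (\<integral>t. lhs t \<partial>lebesgue_on {0..T})
    + 1/2 * ((H *v xh T) \<bullet> xh T - expectation (\<lambda>\<omega>. (H *v \<mu> T \<omega>) \<bullet> \<mu> T \<omega>)) + (Htil *v (xh T - m T)) \<bullet> m T
    - expectation (\<lambda>\<omega>. (Htil *v (\<mu> T \<omega> - m T)) \<bullet> (\<mu> T \<omega> - m T))"
proof -
  note i1 = run_integrable[OF sq_X(1) H2_sq_process[OF lam_H2]]
  note i2 = run_integrable[OF sq_Xs sq_bs]
  note e1 = integral_LP_eq(2)[of "\<lambda>t \<omega>. run t (X t \<omega>) (lam t \<omega>) (\<mu> t \<omega>)", OF i1]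
  note e2 = integral_LP_eq(2)[of "\<lambda>t \<omega>. run t (Xs t \<omega>) (bs t \<omega>) (\<mu> t \<omega>)", OF i2]
  note j1 = integral_LP(2)[of "\<lambda>t \<omega>. run t (X t \<omega>) (lam t \<omega>) (\<mu> t \<omega>)", OF i1]
  note j2 = integral_LP(2)[of "\<lambda>t \<omega>. run t (Xs t \<omega>) (bs t \<omega>) (\<mu> t \<omega>)", OF i2]
  have TT: "T \<in> {0..T}" using T by simp
  note \<mu>T = sq_\<mu>(2)[OF TT] and ZT = sq_Z(2)[OF TT]
  note const = sq_integrable_const[OF finite_measure_axioms]
  have run: "(\<integral>t. expectation (\<lambda>\<omega>. run t (X t \<omega>) (lam t \<omega>) (\<mu> t \<omega>)) \<partial>lebesgue_on {0..T}) -
      (\<integral>t. expectation (\<lambda>\<omega>. run t (Xs t \<omega>) (bs t \<omega>) (\<mu> t \<omega>)) \<partial>lebesgue_on {0..T}) =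
    (\<integral>t. rhs t \<partial>lebesgue_on {0..T}) - (\<integral>t. lhs t \<partial>lebesgue_on {0..T})"
    unfolding Bochner_Integration.integral_diff[OF j1 j2, symmetric]
      Bochner_Integration.integral_diff[OF rhs_integrable lhs_integrable, symmetric]
    using expectation_run_difference j1 j2 rhs_integrable lhs_integrable
    by (intro integral_cong_AE borel_measurable_diff) auto
  \<comment> \<open>The terminal payoff at \<open>x + Z T\<close> for \<open>x\<close> uncorrelated
    with \<open>Z T\<close>. It is applied with \<open>\<mu> T\<close> and with \<open>xh T\<close>,
    and the terms in \<open>Z T\<close> agree.\<close>
  have fin: "expectation (\<lambda>\<omega>. fin (x \<omega> + Z T \<omega>) (\<mu> T \<omega>)) =
      expectation (\<lambda>\<omega>. - (1/2 * ((Hbar *v \<mu> T \<omega>) \<bullet> \<mu> T \<omega>))) - 1/2 * expectation (\<lambda>\<omega>. (H *v x \<omega>) \<bullet> x \<omega>)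
      - 1/2 * expectation (\<lambda>\<omega>. (H *v Z T \<omega>) \<bullet> Z T \<omega>) - expectation (\<lambda>\<omega>. (Htil *v x \<omega>) \<bullet> \<mu> T \<omega>)
      - expectation (\<lambda>\<omega>. (Htil *v Z T \<omega>) \<bullet> \<mu> T \<omega>)"
    if x: "sq_integrable P x" and 0: "uncorrelated x (Z T)" for x
  proof -
    have i: "integrable P (\<lambda>\<omega>. - (1/2 * ((Hbar *v \<mu> T \<omega>) \<bullet> \<mu> T \<omega>)))"
      "integrable P (\<lambda>\<omega>. (H *v (x \<omega> + Z T \<omega>)) \<bullet> (x \<omega> + Z T \<omega>))"
      "integrable P (\<lambda>\<omega>. (Htil *v x \<omega>) \<bullet> \<mu> T \<omega>)" "integrable P (\<lambda>\<omega>. (Htil *v Z T \<omega>) \<bullet> \<mu> T \<omega>)"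
      by (intro Bochner_Integration.integrable_minus integrable_mult_right sq_integrable_imp_inner sq_integrable_matrix
          sq_integrable_add \<mu>T x ZT)+
    have e: "fin (x \<omega> + Z T \<omega>) (\<mu> T \<omega>) = - (1/2 * ((Hbar *v \<mu> T \<omega>) \<bullet> \<mu> T \<omega>)) - 1/2 * ((H *v (x \<omega> + Z T \<omega>)) \<bullet> (x \<omega> + Z T \<omega>))
      - (Htil *v x \<omega>) \<bullet> \<mu> T \<omega> - (Htil *v Z T \<omega>) \<bullet> \<mu> T \<omega>" for \<omega>
      by (simp add: fin_def matrix_vector_right_distrib[of Htil] inner_add_left)
    have "expectation (\<lambda>\<omega>. fin (x \<omega> + Z T \<omega>) (\<mu> T \<omega>)) = expectation (\<lambda>\<omega>. - (1/2 * ((Hbar *v \<mu> T \<omega>) \<bullet> \<mu> T \<omega>)))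
      - 1/2 * expectation (\<lambda>\<omega>. (H *v (x \<omega> + Z T \<omega>)) \<bullet> (x \<omega> + Z T \<omega>))
      - expectation (\<lambda>\<omega>. (Htil *v x \<omega>) \<bullet> \<mu> T \<omega>) - expectation (\<lambda>\<omega>. (Htil *v Z T \<omega>) \<bullet> \<mu> T \<omega>)"
      unfolding e using i by simp
    then show ?thesis unfolding expectation_quadratic_shift[OF x ZT 0] by (simp add: add_divide_distrib)
  qed
  have "X T = (\<lambda>\<omega>. \<mu> T \<omega> + Z T \<omega>)" by (simp add: Z_def)
  then have f1: "expectation (\<lambda>\<omega>. fin (X T \<omega>) (\<mu> T \<omega>)) = expectation (\<lambda>\<omega>. fin (\<mu> T \<omega> + Z T \<omega>) (\<mu> T \<omega>))" by simp
  have f2: "expectation (\<lambda>\<omega>. fin (Xs T \<omega>) (\<mu> T \<omega>)) = expectation (\<lambda>\<omega>. fin (xh T + Z T \<omega>) (\<mu> T \<omega>))"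
  proof (rule integral_cong_AE)
    show "AE \<omega> in P. fin (Xs T \<omega>) (\<mu> T \<omega>) = fin (xh T + Z T \<omega>) (\<mu> T \<omega>)"
      using Xs_eq by eventually_elim (use TT in auto)
  qed (intro borel_measurable_integrable fin_integrable is_state_sq(2)[OF Xs_state bs_H2(2) TT] sq_integrable_add ZT const)+
  have "expectation (\<lambda>\<omega>. (Htil *v xh T) \<bullet> \<mu> T \<omega>) = (Htil *v xh T) \<bullet> m T"
    using expectation_inner_const(2)[OF \<mu>T] by (simp add: m_def)
  then show ?thesis
    using run e1 e2 fin[OF \<mu>T uncorrelatedI[OF \<mu>T ZT Z_\<mu>[OF TT TT]]] fin[OF const uncorrelated_const[OF ZT Z_mean[OF TT]], of "xh T"]
      expectation_quadratic_centered[OF \<mu>T, of Htil] prob_space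
    unfolding payoff_eq[OF X lam_H2] payoff_eq[OF Xs_state bs_H2(2)] f1 f2 m_def[of T, symmetric]
    by (simp add: matrix_vector_mult_diff_distrib inner_diff_left algebra_simps)
qed

section \<open>Consistency, the reduction to one deviation, and the final form of the
  inequality\<close>

lemma consistency:
  assumes t: "t \<in> {0..T}"
  shows "AE \<omega> in P. \<mu> t \<omega> $ i = real_cond_exp P (vimage_algebra (space P) (traj T \<mu>) (C_borel T))
          (\<lambda>\<omega>. state T P F W \<xi> A B \<sigma> lam t \<omega> $ i) \<omega>"
proof -
  let ?V = "vimage_algebra (space P) (traj T \<mu>) (C_borel T)"
  let ?X = "state T P F W \<xi> A B \<sigma> lam"
  have X0: "is_state lam ?X" by (rule is_state_state[OF X lam_H2 lam_H2])
  have "traj T \<mu> \<in> measurable P (C_borel T)" by (rule indep_of_noiseD(5)[OF \<mu>_traj(2)])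
  then have "sets ?V \<subseteq> sets P" by (intro sets_image_in_sets) auto
  then interpret V: finite_measure_subalgebra P ?V by unfold_locales (simp add: subalgebra_def)
  note X0t = is_state_sq(2)[OF X0 lam_H2 t]
  note ii = sq_integrable_imp_integrable[OF finite_measure_axioms]
  have eq: "AE \<omega> in P. ?X t \<omega> = \<mu> t \<omega> + Z t \<omega>"
    using is_state_unique[OF X lam_H2 X0] by eventually_elim (use t in \<open>simp add: Z_def\<close>)
  have "AE \<omega> in P. real_cond_exp P ?V (\<lambda>\<omega>. ?X t \<omega> $ i) \<omega> = \<mu> t \<omega> $ i"
  proof (rule V.real_cond_exp_charact)
    fix E assume E: "E \<in> sets ?V"
    then have EP: "E \<in> sets P" using \<open>sets ?V \<subseteq> sets P\<close> by auto
    \<comment> \<open>The indicator of an event determined by the path of \<open>\<mu>\<close> is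
      independent of the noise, hence orthogonal to \<open>Z t\<close>; tested against it, the state
      and \<open>\<mu> t\<close> have the same integral.\<close>
    let ?U = "indicator E :: 'w \<Rightarrow> real"
    have U: "sq_integrable P ?U"
      by (rule sq_integrable_bound[OF sq_integrable_const[OF finite_measure_axioms, of "1::real"], where C=1])
        (use EP in \<open>auto simp: indicator_def\<close>)
    have UV: "?U \<in> borel_measurable ?V" using E by simp
    note i = sq_integrable_imp_scaleR[OF U sq_Z(2)[OF t]]
    have "expectation (\<lambda>\<omega>. ?U \<omega> * Z t \<omega> $ i) = expectation (\<lambda>\<omega>. ?U \<omega> *\<^sub>R Z t \<omega>) $ i"
      using integral_bounded_linear[OF bounded_linear_vec_nth i, of i] by simp
    also have "\<dots> = 0" using Z_orth_indep[OF \<mu>_traj(2) U UV t] by simp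
    finally have 0: "expectation (\<lambda>\<omega>. ?U \<omega> * Z t \<omega> $ i) = 0" .
    have "expectation (\<lambda>\<omega>. ?U \<omega> * ?X t \<omega> $ i) = expectation (\<lambda>\<omega>. ?U \<omega> * \<mu> t \<omega> $ i + ?U \<omega> * Z t \<omega> $ i)"
    proof (rule integral_cong_AE)
      show "AE \<omega> in P. ?U \<omega> * ?X t \<omega> $ i = ?U \<omega> * \<mu> t \<omega> $ i + ?U \<omega> * Z t \<omega> $ i"
        using eq by eventually_elim (simp add: distrib_left)
    qed (intro borel_measurable_integrable Bochner_Integration.integrable_add sq_integrable_imp_mult U
        sq_integrable_component X0t sq_\<mu> sq_Z t)+
    also have "\<dots> = expectation (\<lambda>\<omega>. ?U \<omega> * \<mu> t \<omega> $ i)"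
      using sq_integrable_imp_mult[OF U sq_integrable_component[OF sq_\<mu>(2)[OF t]]]
        sq_integrable_imp_mult[OF U sq_integrable_component[OF sq_Z(2)[OF t]]] 0 by simp
    finally show "(LINT \<omega>:E|P. ?X t \<omega> $ i) = (LINT \<omega>:E|P. \<mu> t \<omega> $ i)"
      by (simp add: set_lebesgue_integral_def)
  next
    show "integrable P (\<lambda>\<omega>. ?X t \<omega> $ i)" "integrable P (\<lambda>\<omega>. \<mu> t \<omega> $ i)"
      by (intro ii sq_integrable_component X0t sq_\<mu> t)+
    show "(\<lambda>\<omega>. \<mu> t \<omega> $ i) \<in> borel_measurable ?V" by (intro borel_measurable_component \<mu>_traj_measurable t)
  qed
  then show ?thesis by eventually_elim simp
qed

text \<open>One direction is specialisation, since \<open>bs\<close> is itself admissible; the other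
  is its optimality among all admissible deviations, consistency being automatic for the
  class.\<close>

lemma cce_iff:
  "mean_field_cce T P F W \<xi> A B \<sigma> L Qbar Q Qtil q R S r Hbar H Htil lam \<mu> \<longleftrightarrow> pay bs \<le> pay lam"
proof
  assume "mean_field_cce T P F W \<xi> A B \<sigma> L Qbar Q Qtil q R S r Hbar H Htil lam \<mu>"
  then show "pay bs \<le> pay lam" using bs_H2(1) by (simp add: mean_field_cce_def)
next
  assume le: "pay bs \<le> pay lam"
  have "pay \<beta> \<le> pay lam" if \<beta>: "\<beta> \<in> H2 T P G1" for \<beta>
  proof -
    interpret lq_deviation P T F W \<xi> A B \<sigma> Q Qbar Qtil R S L q r H Hbar Htil d1 d2 \<phi> \<psi> \<theta> \<delta> lam \<mu> X f m \<Phi> \<Psi> \<Theta> \<beta> "state T P F W \<xi> A B \<sigma> \<beta>"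
      by unfold_locales (rule \<beta>, rule is_state_state[OF X lam_H2 H2_G1_F[OF \<beta>]])
    show ?thesis using optimal le by simp
  qed
  then show "mean_field_cce T P F W \<xi> A B \<sigma> L Qbar Q Qtil q R S r Hbar H Htil lam \<mu>"
    using flow consistency by (simp add: mean_field_cce_def)
qed

text \<open>\<open>f\<close> is given only through its equation in almost every scenario. Its
  measurability and integrability are recovered from \<open>xh t - \<mu> t\<close>, with which it
  agrees almost surely, by completeness.\<close>

lemma f_eq:
  assumes t: "t \<in> {0..T}"
  shows "AE \<omega> in P. \<mu> t \<omega> + f t \<omega> = xh t" "expectation (f t) = xh t - m t" "sq_integrable P (f t)"
proof -
  show x: "AE \<omega> in P. \<mu> t \<omega> + f t \<omega> = xh t" using xh(1) by eventually_elim (use t in auto)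
  have s: "sq_integrable P (\<lambda>\<omega>. xh t - \<mu> t \<omega>)" by (intro sq_integrable_diff sq_\<mu> t sq_integrable_const finite_measure_axioms)
  from x have e: "AE \<omega> in P. xh t - \<mu> t \<omega> = f t \<omega>" by eventually_elim (metis add_diff_cancel_left')
  have fm: "f t \<in> borel_measurable P"
    using s by (intro measurable_AE_cong_null[OF _ refl _ e]) auto
  show "sq_integrable P (f t)" by (rule sq_integrable_cong_AE[OF s fm e])
  have "expectation (f t) = expectation (\<lambda>\<omega>. xh t - \<mu> t \<omega>)"
    using e s fm by (intro integral_cong_AE) (auto elim!: eventually_mono)
  also have "\<dots> = xh t - m t"
    using sq_integrable_imp_integrable[OF finite_measure_axioms sq_\<mu>(2)[OF t]] prob_space by (simp add: m_def)
  finally show "expectation (f t) = xh t - m t" .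
qed

lemma expectation_f:
  assumes t: "t \<in> {0..T}"
  shows "expectation (\<lambda>\<omega>. (C *v (\<mu> t \<omega> + f t \<omega>)) \<bullet> (\<mu> t \<omega> + f t \<omega>)) = (C *v xh t) \<bullet> xh t"
proof -
  have "expectation (\<lambda>\<omega>. (C *v (\<mu> t \<omega> + f t \<omega>)) \<bullet> (\<mu> t \<omega> + f t \<omega>)) = expectation (\<lambda>\<omega>. (C *v xh t) \<bullet> xh t)"
  proof (rule integral_cong_AE)
    show "(\<lambda>\<omega>. (C *v (\<mu> t \<omega> + f t \<omega>)) \<bullet> (\<mu> t \<omega> + f t \<omega>)) \<in> borel_measurable P"
      by (intro borel_measurable_integrable sq_integrable_imp_inner sq_integrable_matrix sq_integrable_add sq_\<mu> f_eq t)
    show "AE \<omega> in P. (C *v (\<mu> t \<omega> + f t \<omega>)) \<bullet> (\<mu> t \<omega> + f t \<omega>) = (C *v xh t) \<bullet> xh t"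
      using f_eq(1)[OF t] by eventually_elim simp
  qed simp
  then show ?thesis using prob_space by simp
qed

theorem characterization:
  "mean_field_cce T P F W \<xi> A B \<sigma> L Qbar Q Qtil q R S r Hbar H Htil lam \<mu> \<longleftrightarrow>
    (LINT t:{0..T}|lebesgue.
        expectation (\<lambda>\<omega>. (cN t *v (\<mu> t \<omega> - m t)) \<bullet> (\<mu> t \<omega> - m t))
        + 1/2 * (expectation (\<lambda>\<omega>. (cG t *v \<mu> t \<omega>) \<bullet> \<mu> t \<omega>) - (cG t *v m t) \<bullet> m t)
        + 1/2 * expectation (\<lambda>\<omega>. (Ri t *v \<delta> t \<omega>) \<bullet> \<delta> t \<omega>)
        - 1/2 * ((R t *v \<Theta> t) \<bullet> \<Theta> t))
    + expectation (\<lambda>\<omega>. (Htil *v (\<mu> T \<omega> - m T)) \<bullet> (\<mu> T \<omega> - m T))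
    \<le>
    (LINT t:{0..T}|lebesgue.
        1/2 * (expectation (\<lambda>\<omega>. (cM t *v (\<mu> t \<omega> + f t \<omega>)) \<bullet> (\<mu> t \<omega> + f t \<omega>))
               - expectation (\<lambda>\<omega>. (cM t *v \<mu> t \<omega>) \<bullet> \<mu> t \<omega>))
        + expectation (\<lambda>\<omega>. (cN t *v f t \<omega>) \<bullet> m t)
        + (q t - transpose (\<Phi> t) *v r t) \<bullet> expectation (f t)
        + ((transpose (B t) ** (\<phi> t + \<psi> t)) *v m t) \<bullet> \<Theta> t
        - expectation (\<lambda>\<omega>. ((transpose (B t) ** (\<phi> t + \<psi> t)) *v \<mu> t \<omega>) \<bullet> (Ri t *v \<delta> t \<omega>))
        + expectation (\<lambda>\<omega>. ((transpose (B t) ** \<phi> t) *v f t \<omega>) \<bullet> \<Theta> t)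
        - expectation (\<lambda>\<omega>. r t \<bullet> (\<Theta> t - Ri t *v \<delta> t \<omega>)))
    + 1/2 * (expectation (\<lambda>\<omega>. (H *v (\<mu> T \<omega> + f T \<omega>)) \<bullet> (\<mu> T \<omega> + f T \<omega>))
             - expectation (\<lambda>\<omega>. (H *v \<mu> T \<omega>) \<bullet> \<mu> T \<omega>))
    + (Htil *v expectation (f T)) \<bullet> m T"
proof -
  have TT: "T \<in> {0..T}" using T by simp
  have r: "1/2 * (expectation (\<lambda>\<omega>. (cM t *v (\<mu> t \<omega> + f t \<omega>)) \<bullet> (\<mu> t \<omega> + f t \<omega>)) - expectation (\<lambda>\<omega>. (cM t *v \<mu> t \<omega>) \<bullet> \<mu> t \<omega>))
        + expectation (\<lambda>\<omega>. (cN t *v f t \<omega>) \<bullet> m t)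
        + (q t - transpose (\<Phi> t) *v r t) \<bullet> expectation (f t)
        + ((transpose (B t) ** (\<phi> t + \<psi> t)) *v m t) \<bullet> \<Theta> t
        - expectation (\<lambda>\<omega>. ((transpose (B t) ** (\<phi> t + \<psi> t)) *v \<mu> t \<omega>) \<bullet> (Ri t *v \<delta> t \<omega>))
        + expectation (\<lambda>\<omega>. ((transpose (B t) ** \<phi> t) *v f t \<omega>) \<bullet> \<Theta> t)
        - expectation (\<lambda>\<omega>. r t \<bullet> (\<Theta> t - Ri t *v \<delta> t \<omega>)) = rhs t" if t: "t \<in> {0..T}" for t
    unfolding rhs_def expectation_f[OF t] expectation_inner_const(1)[OF f_eq(3)[OF t]] f_eq(2)[OF t] ..
  have "(\<integral>t. 1/2 * (expectation (\<lambda>\<omega>. (cM t *v (\<mu> t \<omega> + f t \<omega>)) \<bullet> (\<mu> t \<omega> + f t \<omega>)) - expectation (\<lambda>\<omega>. (cM t *v \<mu> t \<omega>) \<bullet> \<mu> t \<omega>))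
        + expectation (\<lambda>\<omega>. (cN t *v f t \<omega>) \<bullet> m t)
        + (q t - transpose (\<Phi> t) *v r t) \<bullet> expectation (f t)
        + ((transpose (B t) ** (\<phi> t + \<psi> t)) *v m t) \<bullet> \<Theta> t
        - expectation (\<lambda>\<omega>. ((transpose (B t) ** (\<phi> t + \<psi> t)) *v \<mu> t \<omega>) \<bullet> (Ri t *v \<delta> t \<omega>))
        + expectation (\<lambda>\<omega>. ((transpose (B t) ** \<phi> t) *v f t \<omega>) \<bullet> \<Theta> t)
        - expectation (\<lambda>\<omega>. r t \<bullet> (\<Theta> t - Ri t *v \<delta> t \<omega>)) \<partial>lebesgue_on {0..T}) = (\<integral>t. rhs t \<partial>lebesgue_on {0..T})"
    by (intro Bochner_Integration.integral_cong refl r) simp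
  then show ?thesis
    unfolding cce_iff set_integral_eq_lebesgue_on lhs_def[symmetric] expectation_f[OF TT] f_eq(2)[OF TT]
    using payoff_difference by linarith
qed

end

theorem theorem3p3:
  fixes T :: real and P :: "'w measure" and F :: "real \<Rightarrow> 'w measure"
    and W :: "real \<Rightarrow> 'w \<Rightarrow> real^'d" and \<xi> :: "'w \<Rightarrow> real^'d" and U :: "'w \<Rightarrow> real"
    and A \<sigma> Q Qbar Qtil :: "real \<Rightarrow> real^'d^'d" and B :: "real \<Rightarrow> real^'k^'d"
    and R :: "real \<Rightarrow> real^'k^'k" and S :: "real \<Rightarrow> real^'d^'k"
    and L q :: "real \<Rightarrow> real^'d" and r :: "real \<Rightarrow> real^'k"
    and H Hbar Htil :: "real^'d^'d" and d1 d2 :: real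
    and \<phi> \<psi> :: "real \<Rightarrow> real^'d^'d" and \<theta> :: "real \<Rightarrow> real^'d"
    and \<delta> lam :: "real \<Rightarrow> 'w \<Rightarrow> real^'k" and \<mu> f :: "real \<Rightarrow> 'w \<Rightarrow> real^'d"
    and m :: "real \<Rightarrow> real^'d"
    and \<Phi> \<Psi> :: "real \<Rightarrow> real^'d^'k" and \<Theta> :: "real \<Rightarrow> real^'k"
    and M N G :: "real \<Rightarrow> real^'d^'d"
  defines "m \<equiv> (\<lambda>t. \<integral>\<omega>. \<mu> t \<omega> \<partial>P)"
    and "\<Phi> \<equiv> (\<lambda>t. matrix_inv (R t) ** (transpose (B t) ** \<phi> t + S t))"
    and "\<Psi> \<equiv> (\<lambda>t. matrix_inv (R t) ** (transpose (B t) ** \<psi> t))"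
    and "\<Theta> \<equiv> (\<lambda>t. matrix_inv (R t) *v (transpose (B t) *v \<theta> t + r t))"
    and "M \<equiv> (\<lambda>t. Q t + transpose (\<Phi> t) ** R t ** \<Phi> t - 2 *\<^sub>R (transpose (\<Phi> t) ** S t))"
    and "N \<equiv> (\<lambda>t. Qtil t + transpose (\<Psi> t) ** R t ** \<Phi> t - transpose (\<Psi> t) ** S t)"
    and "G \<equiv> (\<lambda>t. transpose (\<Psi> t) ** R t ** \<Psi> t)"
  assumes T: "T > 0"
    and coeffs: "Linf T A" "Linf T \<sigma>" "Linf T B" "Linf T Q" "Linf T Qbar" "Linf T Qtil"
      "continuous_on {0..T} R" "Linf T S" "Linf T L" "Linf T q" "Linf T r"
    and symmetric: "AE t in lebesgue_on {0..T}. transpose (Q t) = Q t"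
      "AE t in lebesgue_on {0..T}. transpose (Qbar t) = Qbar t"
      "AE t in lebesgue_on {0..T}. transpose (Qtil t) = Qtil t"
      "\<forall>t\<in>{0..T}. transpose (R t) = R t"
    and terminal: "psd H" "psd Hbar" "psd Htil"
    and d: "d1 \<ge> 0" "d2 > 0"
    and Q_bound: "AE t in lebesgue_on {0..T}. psd (Q t - d1 *\<^sub>R mat 1)"
    and R_bound: "\<forall>t\<in>{0..T}. psd (R t - d2 *\<^sub>R mat 1)"
    and S_bound: "d1 > 0 \<Longrightarrow>
        \<exists>c<d1 * d2. AE t in lebesgue_on {0..T}. (onorm (\<lambda>x. S t *v x))\<^sup>2 \<le> c"
      "d1 = 0 \<Longrightarrow> AE t in lebesgue_on {0..T}. S t = 0"
    and space: "usual_conditions T P F"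
    and W: "brownian_motion T P F W"
    and \<xi>: "\<xi> \<in> borel_measurable (F 0)" "indep_rv P borel \<xi> (path_algebra T) (traj T W)"
      "integrable P (\<lambda>\<omega>. (norm (\<xi> \<omega>))\<^sup>2)"
    and U: "U \<in> borel_measurable (F 0)" "distr P borel U = uniform_measure lborel {0..1}"
      "indep_of_noise T P W \<xi> borel U"
    and phi: "solves_phi T A B Q R S H \<phi>"
    and psi: "solves_psi T A B Qtil R S Htil \<phi> \<psi>"
    and theta: "solves_theta T A B q R S r \<phi> \<psi> m \<theta>"
    and flow: "class_G T P F W \<xi> A B \<sigma> R S \<phi> \<psi> \<delta> lam \<mu>"
    and f: "AE \<omega> in P. f 0 \<omega> = 0 \<and>
        ode_on T (\<lambda>t. f t \<omega>) (\<lambda>t. (A t - B t ** \<Phi> t) *v f t \<omega>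
          + B t *v (\<Psi> t *v (\<mu> t \<omega> - m t) + matrix_inv (R t) *v \<delta> t \<omega> - \<Theta> t))"
  shows "mean_field_cce T P F W \<xi> A B \<sigma> L Qbar Q Qtil q R S r Hbar H Htil lam \<mu> \<longleftrightarrow>
    (LINT t:{0..T}|lebesgue.
        (\<integral>\<omega>. inner (N t *v (\<mu> t \<omega> - m t)) (\<mu> t \<omega> - m t) \<partial>P)
        + 1/2 * ((\<integral>\<omega>. inner (G t *v \<mu> t \<omega>) (\<mu> t \<omega>) \<partial>P) - inner (G t *v m t) (m t))
        + 1/2 * (\<integral>\<omega>. inner (matrix_inv (R t) *v \<delta> t \<omega>) (\<delta> t \<omega>) \<partial>P)
        - 1/2 * inner (R t *v \<Theta> t) (\<Theta> t))
    + (\<integral>\<omega>. inner (Htil *v (\<mu> T \<omega> - m T)) (\<mu> T \<omega> - m T) \<partial>P)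
    \<le>
    (LINT t:{0..T}|lebesgue.
        1/2 * ((\<integral>\<omega>. inner (M t *v (\<mu> t \<omega> + f t \<omega>)) (\<mu> t \<omega> + f t \<omega>) \<partial>P)
               - (\<integral>\<omega>. inner (M t *v \<mu> t \<omega>) (\<mu> t \<omega>) \<partial>P))
        + (\<integral>\<omega>. inner (N t *v f t \<omega>) (m t) \<partial>P)
        + inner (q t - transpose (\<Phi> t) *v r t) (\<integral>\<omega>. f t \<omega> \<partial>P)
        + inner ((transpose (B t) ** (\<phi> t + \<psi> t)) *v m t) (\<Theta> t)
        - (\<integral>\<omega>. inner ((transpose (B t) ** (\<phi> t + \<psi> t)) *v \<mu> t \<omega>) (matrix_inv (R t) *v \<delta> t \<omega>) \<partial>P)
        + (\<integral>\<omega>. inner ((transpose (B t) ** \<phi> t) *v f t \<omega>) (\<Theta> t) \<partial>P)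
        - (\<integral>\<omega>. inner (r t) (\<Theta> t - matrix_inv (R t) *v \<delta> t \<omega>) \<partial>P))
    + 1/2 * ((\<integral>\<omega>. inner (H *v (\<mu> T \<omega> + f T \<omega>)) (\<mu> T \<omega> + f T \<omega>) \<partial>P)
             - (\<integral>\<omega>. inner (H *v \<mu> T \<omega>) (\<mu> T \<omega>) \<partial>P))
    + inner (Htil *v (\<integral>\<omega>. f T \<omega> \<partial>P)) (m T)"
proof -
  note fl = flow[unfolded class_G_def]
  \<comment> \<open>The state supplied by the class need not be the one that \<open>state\<close>
    selects; uniqueness up to a null set identifies the two where the payoff and the consistency
    condition are evaluated.\<close>
  from fl obtain X where X: "state_process T P F W \<xi> A B \<sigma> lam X"
    "AE (t, \<omega>) in lebesgue_on {0..T} \<Otimes>\<^sub>M P. lam t \<omega> =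
       - (matrix_inv (R t) *v ((transpose (B t) ** \<phi> t + S t) *v X t \<omega>
            + (transpose (B t) ** \<psi> t) *v \<mu> t \<omega> + \<delta> t \<omega>))" by blast
  have flow': "correlated_flow T P F W \<xi> lam \<mu>" "\<delta> \<in> H2 T P (\<lambda>_. F 0)"
    "indep_of_noise T P W \<xi> (path_algebra T) (traj T \<delta>)"
    and ode: "AE \<omega> in P. \<mu> 0 \<omega> = (\<integral>\<omega>. \<xi> \<omega> \<partial>P) \<and>
        ode_on T (\<lambda>t. \<mu> t \<omega>) (\<lambda>t.
          (A t - B t ** matrix_inv (R t) ** (transpose (B t) ** \<phi> t + S t + transpose (B t) ** \<psi> t))
             *v \<mu> t \<omega> - (B t ** matrix_inv (R t)) *v \<delta> t \<omega>)"
    using fl by blast+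
  interpret prob_space P using space by (simp add: usual_conditions_def)
  interpret lq_flow P T F W \<xi> A B \<sigma> Q Qbar Qtil R S L q r H Hbar Htil d1 d2 \<phi> \<psi> \<theta> \<delta> lam \<mu> X f m \<Phi> \<Psi> \<Theta>
    by unfold_locales (fact T space W \<xi> coeffs symmetric terminal d Q_bound R_bound S_bound phi psi theta flow' X ode f
      | simp add: m_def \<Phi>_def \<Psi>_def \<Theta>_def; fail)+
  show ?thesis
    using characterization unfolding cM_def cN_def cG_def M_def N_def G_def .
qed

end
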